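(* Let $M$ be a unital algebra with differential calculus $\Omega^1(M)=\Omega^1M/N_M$, let $H$ be a Hopf algebra with bicovariant calculus $\Omega^1(H)=\Omega^1H/N_H$ (with associated right ideal $Q_H$), and let $P=M\otimes H$ be the tensor product algebra with right coaction $\Delta_R=\mathrm{id}\otimes\Delta:P\to P\otimes H$. Identify $P\otimes P$ with $M\otimes M\otimes H\otimes H$ and put $$N_P=N_M\otimes H\otimes H+M\otimes M\otimes N_H+\Omega^1M\otimes\Omega^1H\subset\Omega^1P,\qquad \Omega^1(P)=\Omega^1P/N_P .$$ Then $(P,\Omega^1(P),\Delta_R)$ is a quantum principal bundle with nonuniversal calculus over $(M,\Omega^1(M))$, with structure quantum group $(H,\Omega^1(H))$. Moreover, inside $\Omega^1(P)$ the subspaces $\Omega^1(M)P$, $P\Omega^1(M)P$ and $P\Omega^1(M)$ coincide, and are identified as right $H$-comodules with $\Omega^1(M)\otimes H$ (coaction $\mathrm{id}\otimes\Delta$) by $\alpha\otimes h\mapsto \alpha h$.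
   Context: Everything is over a field $k$. $H$ is a Hopf algebra with coproduct $\Delta h=h_{(1)}\otimes h_{(2)}$, counit $\epsilon$ and invertible antipode $S$. For a unital algebra $M$, the universal calculus is $\Omega^1M=\ker(M\otimes M\to M)$ (kernel of multiplication) with $\mathrm d m=1\otimes m-m\otimes 1$. A differential calculus on $M$ is a quotient $\Omega^1(M)=\Omega^1M/N_M$ by a sub-bimodule $N_M$. A bicovariant calculus on $H$ is given by a right ideal $Q_H\subset\ker\epsilon$ stable under the right adjoint coaction $\mathrm{Ad}(h)=h_{(2)}\otimes (Sh_{(1)})h_{(3)}$; then $N_H\subset\Omega^1H$ is the subspace corresponding to $H\otimes Q_H$ under the isomorphism $\Omega^1H\to H\otimes\ker\epsilon$, $h\otimes g\mapsto hg_{(1)}\otimes g_{(2)}$, and $\Omega_0=\ker\epsilon/Q_H$. A quantum principal bundle with universal calculus over $M$ is $(P,H,\Delta_R)$ with $P$ an algebra, $\Delta_R:P\to P\otimes H$ a right coaction that is an algebra map, $M=P^H=\{p:\Delta_R p=p\otimes 1\}$, $P$ flat as an $M$-bimodule (flat as a left and as a right $M$-module), and the sequence $0\to P(\Omega^1M)P\to\Omega^1P\xrightarrow{\mathrm{ver}}P\otimes\ker\epsilon\to 0$ exact, where $\mathrm{ver}(p\otimes p')=p\Delta_R(p')$. A quantum principal bundle with nonuniversal calculus over $(M,\Omega^1(M))$ is such a $(P,H,\Delta_R)$ together with calculi $\Omega^1(P)=\Omega^1P/N_P$ and a bicovariant $\Omega^1(H)$ such that $\Delta_R N_P\subset N_P\otimes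 H$ (for the tensor product coaction on $P\otimes P$), $N_M=N_P\cap\Omega^1M$ and $\mathrm{ver}(N_P)=P\otimes Q_H$. Then $\Omega^1(M)$ is a subspace of $\Omega^1(P)$, and $\Omega^1(M)P$, etc., denote the subspaces spanned by products in the $P$-bimodule $\Omega^1(P)$. *)

theory Defs
  imports "HOL-Algebra.Module" "HOL-Algebra.QuotRing" "HOL-Algebra.Generated_Groups"
    "HOL-Algebra.Free_Abelian_Groups"
begin

section \<open>Vector spaces and algebras over a field\<close>

text \<open>
  Vector spaces and (not necessarily commutative) unital algebras over a field \<open>K\<close> are both
  represented by \<open>module\<close> records. For a mere vector space the fields \<open>mult\<close> and \<open>one\<close> of the
  record carry no meaning and are never used. A subspace \<open>U\<close> of \<open>V\<close>, viewed as a vector space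
  itself, is the record \<open>V\<lparr>carrier := U\<rparr>\<close>.
\<close>

locale k_algebra = field K + module K A + A?: ring A
  for K (structure) and A (structure) +
  assumes smult_mult_left:
      "\<lbrakk>c \<in> carrier K; x \<in> carrier A; y \<in> carrier A\<rbrakk>
       \<Longrightarrow> (c \<odot>\<^bsub>A\<^esub> x) \<otimes>\<^bsub>A\<^esub> y = c \<odot>\<^bsub>A\<^esub> (x \<otimes>\<^bsub>A\<^esub> y)"
    and smult_mult_right:
      "\<lbrakk>c \<in> carrier K; x \<in> carrier A; y \<in> carrier A\<rbrakk>
       \<Longrightarrow> x \<otimes>\<^bsub>A\<^esub> (c \<odot>\<^bsub>A\<^esub> y) = c \<odot>\<^bsub>A\<^esub> (x \<otimes>\<^bsub>A\<^esub> y)"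

definition lin_map ::
  "('k, _) ring_scheme \<Rightarrow> ('k, 'v, _) module_scheme \<Rightarrow> ('k, 'w, _) module_scheme
    \<Rightarrow> ('v \<Rightarrow> 'w) \<Rightarrow> bool"
  where "lin_map K V W f \<longleftrightarrow>
    f \<in> carrier V \<rightarrow> carrier W \<and>
    (\<forall>x\<in>carrier V. \<forall>y\<in>carrier V. f (x \<oplus>\<^bsub>V\<^esub> y) = f x \<oplus>\<^bsub>W\<^esub> f y) \<and>
    (\<forall>c\<in>carrier K. \<forall>x\<in>carrier V. f (c \<odot>\<^bsub>V\<^esub> x) = c \<odot>\<^bsub>W\<^esub> f x)"

definition alg_hom ::
  "('k, _) ring_scheme \<Rightarrow> ('k, 'a, _) module_scheme \<Rightarrow> ('k, 'b, _) module_scheme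
    \<Rightarrow> ('a \<Rightarrow> 'b) \<Rightarrow> bool"
  where "alg_hom K A B f \<longleftrightarrow> f \<in> ring_hom A B \<and> lin_map K A B f"

definition kspan ::
  "('k, _) ring_scheme \<Rightarrow> ('k, 'v, _) module_scheme \<Rightarrow> 'v set \<Rightarrow> 'v set"
  where "kspan K V S = \<Inter>{U. submodule U K V \<and> S \<subseteq> U}"

text \<open>
  The quotient \<open>V / N\<close> by a subspace. Only the vector space structure is meaningful; \<open>mult\<close> and
  \<open>one\<close> are filled in as for the library's quotient rings.
\<close>

definition quot_space ::
  "('k, 'v, _) module_scheme \<Rightarrow> 'v set \<Rightarrow> ('k, 'v set) module"
  where "quot_space V N =
    \<lparr>carrier = a_rcosets\<^bsub>V\<^esub> N, mult = rcoset_mult V N, one = N +>\<^bsub>V\<^esub> \<one>\<^bsub>V\<^esub>,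
     ring.zero = N, ring.add = set_add V,
     smult = (\<lambda>c X. set_add V N ((\<lambda>x. c \<odot>\<^bsub>V\<^esub> x) ` X))\<rparr>"


section \<open>Tensor products\<close>

text \<open>
  The tensor product over a (possibly noncommutative) ring \<open>R\<close> of a right module \<open>A\<close>, with action
  \<open>ra\<close>, and a left module \<open>B\<close>, with action \<open>lb\<close>: the free abelian group on the pairs, modulo the
  subgroup generated by biadditivity and balancedness. Only the additive structure of the records
  \<open>A\<close> and \<open>B\<close> is used.
\<close>

definition tensor_rel ::
  "('r, _) ring_scheme \<Rightarrow> ('a, _) ring_scheme \<Rightarrow> ('a \<Rightarrow> 'r \<Rightarrow> 'a)
    \<Rightarrow> ('b, _) ring_scheme \<Rightarrow> ('r \<Rightarrow> 'b \<Rightarrow> 'b) \<Rightarrow> ('a \<times> 'b \<Rightarrow>\<^sub>0 int) set"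
  where "tensor_rel R A ra B lb =
    generate (free_Abelian_group (carrier A \<times> carrier B))
     ({frag_of (a \<oplus>\<^bsub>A\<^esub> a', b) - frag_of (a, b) - frag_of (a', b) | a a' b.
         a \<in> carrier A \<and> a' \<in> carrier A \<and> b \<in> carrier B} \<union>
      {frag_of (a, b \<oplus>\<^bsub>B\<^esub> b') - frag_of (a, b) - frag_of (a, b') | a b b'.
         a \<in> carrier A \<and> b \<in> carrier B \<and> b' \<in> carrier B} \<union>
      {frag_of (ra a r, b) - frag_of (a, lb r b) | a r b.
         a \<in> carrier A \<and> r \<in> carrier R \<and> b \<in> carrier B})"

definition tensor_group ::
  "('r, _) ring_scheme \<Rightarrow> ('a, _) ring_scheme \<Rightarrow> ('a \<Rightarrow> 'r \<Rightarrow> 'a)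
    \<Rightarrow> ('b, _) ring_scheme \<Rightarrow> ('r \<Rightarrow> 'b \<Rightarrow> 'b) \<Rightarrow> ('a \<times> 'b \<Rightarrow>\<^sub>0 int) set monoid"
  where "tensor_group R A ra B lb =
    free_Abelian_group (carrier A \<times> carrier B) Mod tensor_rel R A ra B lb"

type_synonym ('a, 'b) tens = "('a \<times> 'b \<Rightarrow>\<^sub>0 int) set"

definition tens ::
  "('k, _) ring_scheme \<Rightarrow> ('k, 'v, _) module_scheme \<Rightarrow> ('k, 'w, _) module_scheme
    \<Rightarrow> 'v \<Rightarrow> 'w \<Rightarrow> ('v, 'w) tens"
  where "tens K V W v w =
    tensor_rel K V (\<lambda>v c. c \<odot>\<^bsub>V\<^esub> v) W (\<lambda>c w. c \<odot>\<^bsub>W\<^esub> w)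
      #>\<^bsub>free_Abelian_group (carrier V \<times> carrier W)\<^esub> frag_of (v, w)"

definition tensor_add ::
  "('k, _) ring_scheme \<Rightarrow> ('k, 'v, _) module_scheme \<Rightarrow> ('k, 'w, _) module_scheme
    \<Rightarrow> ('v, 'w) tens ring"
  where "tensor_add K V W =
    (let G = tensor_group K V (\<lambda>v c. c \<odot>\<^bsub>V\<^esub> v) W (\<lambda>c w. c \<odot>\<^bsub>W\<^esub> w)
     in \<lparr>carrier = carrier G, mult = (\<lambda>_ _. undefined), one = undefined,
         ring.zero = \<one>\<^bsub>G\<^esub>, ring.add = (\<lambda>x y. x \<otimes>\<^bsub>G\<^esub> y)\<rparr>)"

text \<open>
  The map \<open>V \<otimes> W \<rightarrow> U\<close> induced by a \<open>K\<close>-bilinear \<open>\<beta>\<close>, sending \<open>v \<otimes> w\<close> to \<open>\<beta> v w\<close>. It is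
  evaluated on an arbitrary representative of the coset, the value being independent of it.
\<close>

definition tlift :: "('u, _) ring_scheme \<Rightarrow> ('v \<Rightarrow> 'w \<Rightarrow> 'u) \<Rightarrow> ('v, 'w) tens \<Rightarrow> 'u"
  where "tlift U \<beta> X =
    (let x = (SOME x. x \<in> X)
     in finsum U (\<lambda>p. [Poly_Mapping.lookup x p] \<cdot>\<^bsub>U\<^esub> \<beta> (fst p) (snd p)) (Poly_Mapping.keys x))"

text \<open>
  The multiplication is that of the tensor product algebra,
  \<open>(a \<otimes> b) (a' \<otimes> b') = a a' \<otimes> b b'\<close>; it is meaningful only if both factors are algebras.
\<close>

definition tensor ::
  "('k, _) ring_scheme \<Rightarrow> ('k, 'v, _) module_scheme \<Rightarrow> ('k, 'w, _) module_scheme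
    \<Rightarrow> ('k, ('v, 'w) tens) module"
  where "tensor K V W =
    \<lparr>carrier = carrier (tensor_add K V W),
     mult = (\<lambda>X Y. tlift (tensor_add K V W) (\<lambda>a b. tlift (tensor_add K V W)
               (\<lambda>a' b'. tens K V W (a \<otimes>\<^bsub>V\<^esub> a') (b \<otimes>\<^bsub>W\<^esub> b')) Y) X),
     one = tens K V W \<one>\<^bsub>V\<^esub> \<one>\<^bsub>W\<^esub>,
     ring.zero = ring.zero (tensor_add K V W),
     ring.add = ring.add (tensor_add K V W),
     smult = (\<lambda>c. tlift (tensor_add K V W) (\<lambda>v w. tens K V W (c \<odot>\<^bsub>V\<^esub> v) w))\<rparr>"

definition tmap ::
  "('k, _) ring_scheme \<Rightarrow> ('k, 'v, _) module_scheme \<Rightarrow> ('k, 'w, _) module_scheme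
    \<Rightarrow> ('u \<Rightarrow> 'v) \<Rightarrow> ('x \<Rightarrow> 'w) \<Rightarrow> ('u, 'x) tens \<Rightarrow> ('v, 'w) tens"
  where "tmap K V W f g = tlift (tensor K V W) (\<lambda>u x. tens K V W (f u) (g x))"

text \<open>The canonical isomorphism \<open>U \<otimes> (V \<otimes> W) \<rightarrow> (U \<otimes> V) \<otimes> W\<close>.\<close>

definition assoc_iso ::
  "('k, _) ring_scheme \<Rightarrow> ('k, 'u, _) module_scheme \<Rightarrow> ('k, 'v, _) module_scheme
    \<Rightarrow> ('k, 'w, _) module_scheme \<Rightarrow> ('u, ('v, 'w) tens) tens \<Rightarrow> (('u, 'v) tens, 'w) tens"
  where "assoc_iso K U V W =
    tlift (tensor K (tensor K U V) W)
      (\<lambda>u. tlift (tensor K (tensor K U V) W)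
        (\<lambda>v w. tens K (tensor K U V) W (tens K U V u v) w))"

text \<open>For subspaces \<open>A\<close> of \<open>V\<close> and \<open>B\<close> of \<open>W\<close>: \<open>A \<otimes> B\<close> as a subspace of \<open>V \<otimes> W\<close>.\<close>

definition tsub ::
  "('k, _) ring_scheme \<Rightarrow> ('k, 'v, _) module_scheme \<Rightarrow> ('k, 'w, _) module_scheme
    \<Rightarrow> 'v set \<Rightarrow> 'w set \<Rightarrow> ('v, 'w) tens set"
  where "tsub K V W A B = kspan K (tensor K V W) {tens K V W a b | a b. a \<in> A \<and> b \<in> B}"


section \<open>Flat modules over a noncommutative ring\<close>

definition right_module ::
  "('r, _) ring_scheme \<Rightarrow> ('a, _) ring_scheme \<Rightarrow> ('a \<Rightarrow> 'r \<Rightarrow> 'a) \<Rightarrow> bool"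
  where "right_module R A ra \<longleftrightarrow>
    ring R \<and> abelian_group A \<and>
    (\<forall>a\<in>carrier A. \<forall>r\<in>carrier R. ra a r \<in> carrier A) \<and>
    (\<forall>a\<in>carrier A. \<forall>a'\<in>carrier A. \<forall>r\<in>carrier R. ra (a \<oplus>\<^bsub>A\<^esub> a') r = ra a r \<oplus>\<^bsub>A\<^esub> ra a' r) \<and>
    (\<forall>a\<in>carrier A. \<forall>r\<in>carrier R. \<forall>s\<in>carrier R. ra a (r \<oplus>\<^bsub>R\<^esub> s) = ra a r \<oplus>\<^bsub>A\<^esub> ra a s) \<and>
    (\<forall>a\<in>carrier A. \<forall>r\<in>carrier R. \<forall>s\<in>carrier R. ra a (r \<otimes>\<^bsub>R\<^esub> s) = ra (ra a r) s) \<and>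
    (\<forall>a\<in>carrier A. ra a \<one>\<^bsub>R\<^esub> = a)"

definition left_module ::
  "('r, _) ring_scheme \<Rightarrow> ('a, _) ring_scheme \<Rightarrow> ('r \<Rightarrow> 'a \<Rightarrow> 'a) \<Rightarrow> bool"
  where "left_module R A la \<longleftrightarrow>
    ring R \<and> abelian_group A \<and>
    (\<forall>a\<in>carrier A. \<forall>r\<in>carrier R. la r a \<in> carrier A) \<and>
    (\<forall>a\<in>carrier A. \<forall>a'\<in>carrier A. \<forall>r\<in>carrier R. la r (a \<oplus>\<^bsub>A\<^esub> a') = la r a \<oplus>\<^bsub>A\<^esub> la r a') \<and>
    (\<forall>a\<in>carrier A. \<forall>r\<in>carrier R. \<forall>s\<in>carrier R. la (r \<oplus>\<^bsub>R\<^esub> s) a = la r a \<oplus>\<^bsub>A\<^esub> la s a) \<and>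
    (\<forall>a\<in>carrier A. \<forall>r\<in>carrier R. \<forall>s\<in>carrier R. la (r \<otimes>\<^bsub>R\<^esub> s) a = la r (la s a)) \<and>
    (\<forall>a\<in>carrier A. la \<one>\<^bsub>R\<^esub> a = a)"

text \<open>
  Flatness: tensoring with the module preserves injectivity of module maps \<open>f : A \<rightarrow> A'\<close>. HOL
  cannot quantify over types inside a formula, so the types \<open>'x\<close>, \<open>'y\<close> of the elements of \<open>A\<close> and
  \<open>A'\<close> are passed as a parameter; a theorem asserting flatness with \<open>'x\<close>, \<open>'y\<close> type variables
  covers all modules.
\<close>

definition flat_left ::
  "('x \<times> 'y) itself \<Rightarrow> ('r, _) ring_scheme \<Rightarrow> ('b, _) ring_scheme \<Rightarrow> ('r \<Rightarrow> 'b \<Rightarrow> 'b) \<Rightarrow> bool"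
  where "flat_left t R B lb \<longleftrightarrow>
    left_module R B lb \<and>
    (\<forall>(A :: 'x ring) ra (A' :: 'y ring) ra' f.
      right_module R A ra \<and> right_module R A' ra' \<and>
      f \<in> hom (add_monoid A) (add_monoid A') \<and>
      (\<forall>a\<in>carrier A. \<forall>r\<in>carrier R. f (ra a r) = ra' (f a) r) \<and>
      inj_on f (carrier A) \<longrightarrow>
      inj_on
        (\<lambda>X. tensor_rel R A' ra' B lb
           <#>\<^bsub>free_Abelian_group (carrier A' \<times> carrier B)\<^esub>
           (frag_extend (\<lambda>(a, b). frag_of (f a, b)) ` X))
        (carrier (tensor_group R A ra B lb)))"

definition flat_right ::
  "('x \<times> 'y) itself \<Rightarrow> ('r, _) ring_scheme \<Rightarrow> ('b, _) ring_scheme \<Rightarrow> ('b \<Rightarrow> 'r \<Rightarrow> 'b) \<Rightarrow> bool"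
  where "flat_right t R B rb \<longleftrightarrow>
    right_module R B rb \<and>
    (\<forall>(A :: 'x ring) la (A' :: 'y ring) la' f.
      left_module R A la \<and> left_module R A' la' \<and>
      f \<in> hom (add_monoid A) (add_monoid A') \<and>
      (\<forall>a\<in>carrier A. \<forall>r\<in>carrier R. f (la r a) = la' r (f a)) \<and>
      inj_on f (carrier A) \<longrightarrow>
      inj_on
        (\<lambda>X. tensor_rel R B rb A' la'
           <#>\<^bsub>free_Abelian_group (carrier B \<times> carrier A')\<^esub>
           (frag_extend (\<lambda>(b, a). frag_of (b, f a)) ` X))
        (carrier (tensor_group R B rb A la)))"


section \<open>Hopf algebras and comodules\<close>

record ('k, 'h) hopf_alg = "('k, 'h) module" +
  comult :: "'h \<Rightarrow> ('h, 'h) tens"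
  counit :: "'h \<Rightarrow> 'k"
  antipode :: "'h \<Rightarrow> 'h"

locale hopf_algebra = k_algebra K H
  for K (structure) and H :: "('k, 'h, 'z) hopf_alg_scheme" (structure) +
  assumes comult_hom: "alg_hom K H (tensor K H H) (comult H)"
    and counit_hom: "counit H \<in> ring_hom H K"
    and counit_smult:
      "\<lbrakk>c \<in> carrier K; h \<in> carrier H\<rbrakk> \<Longrightarrow> counit H (c \<odot>\<^bsub>H\<^esub> h) = c \<otimes>\<^bsub>K\<^esub> counit H h"
    and antipode_lin: "lin_map K H H (antipode H)"
    and coassoc: "h \<in> carrier H \<Longrightarrow>
      tmap K (tensor K H H) H (comult H) (\<lambda>h. h) (comult H h) =
      assoc_iso K H H H (tmap K H (tensor K H H) (\<lambda>h. h) (comult H) (comult H h))"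
    and counit_left: "h \<in> carrier H \<Longrightarrow> tlift H (\<lambda>a b. counit H a \<odot>\<^bsub>H\<^esub> b) (comult H h) = h"
    and counit_right: "h \<in> carrier H \<Longrightarrow> tlift H (\<lambda>a b. counit H b \<odot>\<^bsub>H\<^esub> a) (comult H h) = h"
    and antipode_left: "h \<in> carrier H \<Longrightarrow>
      tlift H (\<lambda>a b. antipode H a \<otimes>\<^bsub>H\<^esub> b) (comult H h) = counit H h \<odot>\<^bsub>H\<^esub> \<one>\<^bsub>H\<^esub>"
    and antipode_right: "h \<in> carrier H \<Longrightarrow>
      tlift H (\<lambda>a b. a \<otimes>\<^bsub>H\<^esub> antipode H b) (comult H h) = counit H h \<odot>\<^bsub>H\<^esub> \<one>\<^bsub>H\<^esub>"
    and antipode_bij: "bij_betw (antipode H) (carrier H) (carrier H)"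

definition right_comodule ::
  "('k, _) ring_scheme \<Rightarrow> ('k, 'h, _) hopf_alg_scheme \<Rightarrow> ('k, 'v, _) module_scheme
    \<Rightarrow> ('v \<Rightarrow> ('v, 'h) tens) \<Rightarrow> bool"
  where "right_comodule K H V \<delta> \<longleftrightarrow>
    module K V \<and> lin_map K V (tensor K V H) \<delta> \<and>
    (\<forall>v\<in>carrier V.
      tmap K (tensor K V H) H \<delta> (\<lambda>h. h) (\<delta> v) =
      assoc_iso K V H H (tmap K V (tensor K H H) (\<lambda>v. v) (comult H) (\<delta> v))) \<and>
    (\<forall>v\<in>carrier V. tlift V (\<lambda>x h. counit H h \<odot>\<^bsub>V\<^esub> x) (\<delta> v) = v)"

definition comodule_iso ::
  "('k, _) ring_scheme \<Rightarrow> ('k, 'h, _) hopf_alg_scheme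
    \<Rightarrow> ('k, 'v, _) module_scheme \<Rightarrow> ('v \<Rightarrow> ('v, 'h) tens)
    \<Rightarrow> ('k, 'w, _) module_scheme \<Rightarrow> ('w \<Rightarrow> ('w, 'h) tens) \<Rightarrow> ('v \<Rightarrow> 'w) \<Rightarrow> bool"
  where "comodule_iso K H V \<delta> W \<delta>' f \<longleftrightarrow>
    right_comodule K H V \<delta> \<and> right_comodule K H W \<delta>' \<and>
    lin_map K V W f \<and> bij_betw f (carrier V) (carrier W) \<and>
    (\<forall>v\<in>carrier V. \<delta>' (f v) = tmap K W H f (\<lambda>h. h) (\<delta> v))"

text \<open>The coaction \<open>id \<otimes> \<Delta>\<close> on \<open>V \<otimes> H\<close>.\<close>

definition free_coact ::
  "('k, _) ring_scheme \<Rightarrow> ('k, 'h, _) hopf_alg_scheme \<Rightarrow> ('k, 'v, _) module_scheme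
    \<Rightarrow> ('v, 'h) tens \<Rightarrow> (('v, 'h) tens, 'h) tens"
  where "free_coact K H V x =
    assoc_iso K V H H (tmap K V (tensor K H H) (\<lambda>v. v) (comult H) x)"

text \<open>
  The tensor product coaction \<open>v \<otimes> w \<mapsto> v\<^sub>0 \<otimes> w\<^sub>0 \<otimes> v\<^sub>1 w\<^sub>1\<close> on \<open>V \<otimes> W\<close>.
\<close>

definition tensor_coact ::
  "('k, _) ring_scheme \<Rightarrow> ('k, 'h, _) hopf_alg_scheme
    \<Rightarrow> ('k, 'v, _) module_scheme \<Rightarrow> ('v \<Rightarrow> ('v, 'h) tens)
    \<Rightarrow> ('k, 'w, _) module_scheme \<Rightarrow> ('w \<Rightarrow> ('w, 'h) tens)
    \<Rightarrow> ('v, 'w) tens \<Rightarrow> (('v, 'w) tens, 'h) tens"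
  where "tensor_coact K H V \<delta> W \<delta>' =
    (let T = tensor K (tensor K V W) H in
     tlift T (\<lambda>v w.
       tlift T (\<lambda>v0 v1.
         tlift T (\<lambda>w0 w1. tens K (tensor K V W) H (tens K V W v0 w0) (v1 \<otimes>\<^bsub>H\<^esub> w1)) (\<delta>' w)) (\<delta> v)))"

text \<open>
  The restriction of a coaction to a subcomodule \<open>U\<close> of \<open>V\<close>, with values in \<open>U \<otimes> H\<close> rather than in
  \<open>V \<otimes> H\<close>; over a field, the map \<open>U \<otimes> H \<rightarrow> V \<otimes> H\<close> induced by the inclusion is injective.
\<close>

definition sub_coact ::
  "('k, _) ring_scheme \<Rightarrow> ('k, 'h, _) hopf_alg_scheme \<Rightarrow> ('k, 'v, _) module_scheme
    \<Rightarrow> ('v \<Rightarrow> ('v, 'h) tens) \<Rightarrow> 'v set \<Rightarrow> 'v \<Rightarrow> ('v, 'h) tens"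
  where "sub_coact K H V \<delta> U u =
    (THE y. y \<in> carrier (tensor K (V\<lparr>carrier := U\<rparr>) H) \<and> tmap K V H (\<lambda>v. v) (\<lambda>h. h) y = \<delta> u)"

text \<open>The coaction induced on the quotient of \<open>V\<close> by a subcomodule \<open>N\<close>.\<close>

definition quot_coact ::
  "('k, _) ring_scheme \<Rightarrow> ('k, 'h, _) hopf_alg_scheme \<Rightarrow> ('k, 'v, _) module_scheme
    \<Rightarrow> ('v \<Rightarrow> ('v, 'h) tens) \<Rightarrow> 'v set \<Rightarrow> 'v set \<Rightarrow> ('v set, 'h) tens"
  where "quot_coact K H V \<delta> N X =
    tmap K (quot_space V N) H (\<lambda>v. N +>\<^bsub>V\<^esub> v) (\<lambda>h. h) (\<delta> (SOME x. x \<in> X))"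


section \<open>Differential calculi\<close>

text \<open>
  The universal calculus \<open>ker (A \<otimes> A \<rightarrow> A)\<close>, and the \<open>A\<close>-bimodule structure of \<open>A \<otimes> A\<close>. A
  differential calculus on \<open>A\<close> is given by the sub-bimodule \<open>N\<close> of the universal calculus by which
  one divides.
\<close>

definition univ_calc ::
  "('k, _) ring_scheme \<Rightarrow> ('k, 'a, _) module_scheme \<Rightarrow> ('a, 'a) tens set"
  where "univ_calc K A =
    {x \<in> carrier (tensor K A A). tlift A (\<lambda>a b. a \<otimes>\<^bsub>A\<^esub> b) x = \<zero>\<^bsub>A\<^esub>}"

definition lact ::
  "('k, _) ring_scheme \<Rightarrow> ('k, 'a, _) module_scheme \<Rightarrow> 'a \<Rightarrow> ('a, 'a) tens \<Rightarrow> ('a, 'a) tens"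
  where "lact K A a = tmap K A A (\<lambda>x. a \<otimes>\<^bsub>A\<^esub> x) (\<lambda>y. y)"

definition ract ::
  "('k, _) ring_scheme \<Rightarrow> ('k, 'a, _) module_scheme \<Rightarrow> ('a, 'a) tens \<Rightarrow> 'a \<Rightarrow> ('a, 'a) tens"
  where "ract K A \<omega> a = tmap K A A (\<lambda>x. x) (\<lambda>y. y \<otimes>\<^bsub>A\<^esub> a) \<omega>"

definition diff_calculus ::
  "('k, _) ring_scheme \<Rightarrow> ('k, 'a, _) module_scheme \<Rightarrow> ('a, 'a) tens set \<Rightarrow> bool"
  where "diff_calculus K A N \<longleftrightarrow>
    N \<subseteq> univ_calc K A \<and> submodule N K (tensor K A A) \<and>
    (\<forall>a\<in>carrier A. \<forall>\<omega>\<in>N. lact K A a \<omega> \<in> N \<and> ract K A \<omega> a \<in> N)"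

text \<open>The space of 1-forms \<open>\<Omega>\<^sup>1(A)\<close> of the calculus given by \<open>N\<close>, and its bimodule structure.\<close>

definition univ_forms ::
  "('k, _) ring_scheme \<Rightarrow> ('k, 'a, _) module_scheme \<Rightarrow> ('k, ('a, 'a) tens) module"
  where "univ_forms K A = (tensor K A A)\<lparr>carrier := univ_calc K A\<rparr>"

definition forms ::
  "('k, _) ring_scheme \<Rightarrow> ('k, 'a, _) module_scheme \<Rightarrow> ('a, 'a) tens set
    \<Rightarrow> ('k, ('a, 'a) tens set) module"
  where "forms K A N = quot_space (univ_forms K A) N"

definition forms_lact ::
  "('k, _) ring_scheme \<Rightarrow> ('k, 'a, _) module_scheme \<Rightarrow> ('a, 'a) tens set
    \<Rightarrow> 'a \<Rightarrow> ('a, 'a) tens set \<Rightarrow> ('a, 'a) tens set"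
  where "forms_lact K A N a X = set_add (univ_forms K A) N (lact K A a ` X)"

definition forms_ract ::
  "('k, _) ring_scheme \<Rightarrow> ('k, 'a, _) module_scheme \<Rightarrow> ('a, 'a) tens set
    \<Rightarrow> ('a, 'a) tens set \<Rightarrow> 'a \<Rightarrow> ('a, 'a) tens set"
  where "forms_ract K A N X a = set_add (univ_forms K A) N ((\<lambda>\<omega>. ract K A \<omega> a) ` X)"

text \<open>
  The right adjoint coaction \<open>Ad(h) = h\<^sub>2 \<otimes> (S h\<^sub>1) h\<^sub>3\<close>, computed from
  \<open>(\<Delta> \<otimes> id) (\<Delta> h) = (h\<^sub>1 \<otimes> h\<^sub>2) \<otimes> h\<^sub>3\<close>.
\<close>

definition Ad_coact ::
  "('k, _) ring_scheme \<Rightarrow> ('k, 'h, _) hopf_alg_scheme \<Rightarrow> 'h \<Rightarrow> ('h, 'h) tens"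
  where "Ad_coact K H h =
    tlift (tensor K H H)
      (\<lambda>x h3. tlift (tensor K H H) (\<lambda>h1 h2. tens K H H h2 (antipode H h1 \<otimes>\<^bsub>H\<^esub> h3)) x)
      (tmap K (tensor K H H) H (comult H) (\<lambda>h. h) (comult H h))"

definition ker_counit :: "('k, _) ring_scheme \<Rightarrow> ('k, 'h, _) hopf_alg_scheme \<Rightarrow> 'h set"
  where "ker_counit K H = {h \<in> carrier H. counit H h = \<zero>\<^bsub>K\<^esub>}"

text \<open>
  The data \<open>Q\<close> of a bicovariant calculus on \<open>H\<close>, and the subspace \<open>N\<^sub>H\<close> of the universal calculus
  which corresponds to \<open>H \<otimes> Q\<close> under \<open>h \<otimes> g \<mapsto> h g\<^sub>1 \<otimes> g\<^sub>2\<close>.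
\<close>

definition bicovariant ::
  "('k, _) ring_scheme \<Rightarrow> ('k, 'h, _) hopf_alg_scheme \<Rightarrow> 'h set \<Rightarrow> bool"
  where "bicovariant K H Q \<longleftrightarrow>
    Q \<subseteq> ker_counit K H \<and> submodule Q K H \<and>
    (\<forall>q\<in>Q. \<forall>h\<in>carrier H. q \<otimes>\<^bsub>H\<^esub> h \<in> Q) \<and>
    Ad_coact K H ` Q \<subseteq> tsub K H H Q (carrier H)"

definition bicov_N ::
  "('k, _) ring_scheme \<Rightarrow> ('k, 'h, _) hopf_alg_scheme \<Rightarrow> 'h set \<Rightarrow> ('h, 'h) tens set"
  where "bicov_N K H Q =
    {x \<in> univ_calc K H.
      tlift (tensor K H H)
        (\<lambda>h g. tmap K H H (\<lambda>g1. h \<otimes>\<^bsub>H\<^esub> g1) (\<lambda>g2. g2) (comult H g)) x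
      \<in> tsub K H H (carrier H) Q}"


section \<open>Quantum principal bundles\<close>

definition coinvariants ::
  "('k, _) ring_scheme \<Rightarrow> ('k, 'h, _) hopf_alg_scheme \<Rightarrow> ('k, 'p, _) module_scheme
    \<Rightarrow> ('p \<Rightarrow> ('p, 'h) tens) \<Rightarrow> 'p set"
  where "coinvariants K H P \<Delta> = {p \<in> carrier P. \<Delta> p = tens K P H p \<one>\<^bsub>H\<^esub>}"

text \<open>\<open>ver(p \<otimes> p') = p \<Delta>(p')\<close>\<close>

definition ver ::
  "('k, _) ring_scheme \<Rightarrow> ('k, 'h, _) hopf_alg_scheme \<Rightarrow> ('k, 'p, _) module_scheme
    \<Rightarrow> ('p \<Rightarrow> ('p, 'h) tens) \<Rightarrow> ('p, 'p) tens \<Rightarrow> ('p, 'h) tens"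
  where "ver K H P \<Delta> =
    tlift (tensor K P H) (\<lambda>p p'. tmap K P H (\<lambda>p0. p \<otimes>\<^bsub>P\<^esub> p0) (\<lambda>h. h) (\<Delta> p'))"

text \<open>
  The base algebra \<open>M\<close> is identified with the coinvariants by an injective algebra map
  \<open>\<iota> : M \<rightarrow> P\<close>; the universal calculus of \<open>M\<close> is identified with a subspace of that of \<open>P\<close> by
  \<open>\<iota> \<otimes> \<iota>\<close>.
\<close>

definition base_forms ::
  "('k, _) ring_scheme \<Rightarrow> ('k, 'p, _) module_scheme \<Rightarrow> ('m \<Rightarrow> 'p)
    \<Rightarrow> ('m, 'm) tens set \<Rightarrow> ('p, 'p) tens set"
  where "base_forms K P \<iota> N = tmap K P P \<iota> \<iota> ` N"

text \<open>
  In the last two conjuncts, the sequence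
  \<open>0 \<rightarrow> P (\<Omega>\<^sup>1 M) P \<rightarrow> \<Omega>\<^sup>1 P \<rightarrow> P \<otimes> ker \<epsilon> \<rightarrow> 0\<close> is exact.
\<close>

definition qpb_universal ::
  "('x \<times> 'y) itself \<Rightarrow> ('k, _) ring_scheme \<Rightarrow> ('k, 'm, _) module_scheme \<Rightarrow> ('m \<Rightarrow> 'p)
    \<Rightarrow> ('k, 'p, _) module_scheme \<Rightarrow> ('k, 'h, _) hopf_alg_scheme
    \<Rightarrow> ('p \<Rightarrow> ('p, 'h) tens) \<Rightarrow> bool"
  where "qpb_universal t K M \<iota> P H \<Delta> \<longleftrightarrow>
    hopf_algebra K H \<and> k_algebra K P \<and>
    right_comodule K H P \<Delta> \<and> alg_hom K P (tensor K P H) \<Delta> \<and>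
    k_algebra K M \<and> alg_hom K M P \<iota> \<and>
    bij_betw \<iota> (carrier M) (coinvariants K H P \<Delta>) \<and>
    flat_left t M P (\<lambda>m p. \<iota> m \<otimes>\<^bsub>P\<^esub> p) \<and> flat_right t M P (\<lambda>p m. p \<otimes>\<^bsub>P\<^esub> \<iota> m) \<and>
    kspan K (tensor K P P)
      {ract K P (lact K P p \<omega>) p' | p \<omega> p'.
         p \<in> carrier P \<and> \<omega> \<in> base_forms K P \<iota> (univ_calc K M) \<and> p' \<in> carrier P} =
      {x \<in> univ_calc K P. ver K H P \<Delta> x = \<zero>\<^bsub>tensor K P H\<^esub>} \<and>
    ver K H P \<Delta> ` univ_calc K P = tsub K P H (carrier P) (ker_counit K H)"

text \<open>
  A bundle with calculi \<open>N\<^sub>M\<close> on the base, \<open>N\<^sub>P\<close> on the total space and \<open>Q\<close> on the structure group.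
\<close>

definition qpb_nonuniversal ::
  "('x \<times> 'y) itself \<Rightarrow> ('k, _) ring_scheme
    \<Rightarrow> ('k, 'm, _) module_scheme \<Rightarrow> ('m, 'm) tens set \<Rightarrow> ('m \<Rightarrow> 'p)
    \<Rightarrow> ('k, 'p, _) module_scheme \<Rightarrow> ('p, 'p) tens set
    \<Rightarrow> ('k, 'h, _) hopf_alg_scheme \<Rightarrow> 'h set
    \<Rightarrow> ('p \<Rightarrow> ('p, 'h) tens) \<Rightarrow> bool"
  where "qpb_nonuniversal t K M N\<^sub>M \<iota> P N\<^sub>P H Q \<Delta> \<longleftrightarrow>
    qpb_universal t K M \<iota> P H \<Delta> \<and>
    diff_calculus K M N\<^sub>M \<and> diff_calculus K P N\<^sub>P \<and> bicovariant K H Q \<and>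
    tensor_coact K H P \<Delta> P \<Delta> ` N\<^sub>P \<subseteq> tsub K (tensor K P P) H N\<^sub>P (carrier H) \<and>
    base_forms K P \<iota> N\<^sub>M = N\<^sub>P \<inter> base_forms K P \<iota> (univ_calc K M) \<and>
    ver K H P \<Delta> ` N\<^sub>P = tsub K P H (carrier P) Q"

text \<open>
  The inclusion of \<open>\<Omega>\<^sup>1(M)\<close> in \<open>\<Omega>\<^sup>1(P)\<close>, and the coaction on \<open>\<Omega>\<^sup>1(P)\<close>.
\<close>

definition forms_incl ::
  "('k, _) ring_scheme \<Rightarrow> ('k, 'p, _) module_scheme \<Rightarrow> ('p, 'p) tens set \<Rightarrow> ('m \<Rightarrow> 'p)
    \<Rightarrow> ('m, 'm) tens set \<Rightarrow> ('p, 'p) tens set"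
  where "forms_incl K P N\<^sub>P \<iota> X = set_add (univ_forms K P) N\<^sub>P (base_forms K P \<iota> X)"

definition forms_coact ::
  "('k, _) ring_scheme \<Rightarrow> ('k, 'h, _) hopf_alg_scheme \<Rightarrow> ('k, 'p, _) module_scheme
    \<Rightarrow> ('p, 'p) tens set \<Rightarrow> ('p \<Rightarrow> ('p, 'h) tens)
    \<Rightarrow> ('p, 'p) tens set \<Rightarrow> (('p, 'p) tens set, 'h) tens"
  where "forms_coact K H P N\<^sub>P \<Delta> =
    quot_coact K H (univ_forms K P)
      (sub_coact K H (tensor K P P) (tensor_coact K H P \<Delta> P \<Delta>) (univ_calc K P)) N\<^sub>P"

text \<open>The subspaces \<open>\<Omega>\<^sup>1(M) P\<close>, \<open>P \<Omega>\<^sup>1(M) P\<close> and \<open>P \<Omega>\<^sup>1(M)\<close> of \<open>\<Omega>\<^sup>1(P)\<close>.\<close>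

definition forms_MP ::
  "('k, _) ring_scheme \<Rightarrow> ('k, 'm, _) module_scheme \<Rightarrow> ('m, 'm) tens set \<Rightarrow> ('m \<Rightarrow> 'p)
    \<Rightarrow> ('k, 'p, _) module_scheme \<Rightarrow> ('p, 'p) tens set \<Rightarrow> ('p, 'p) tens set set"
  where "forms_MP K M N\<^sub>M \<iota> P N\<^sub>P =
    kspan K (forms K P N\<^sub>P)
      {forms_ract K P N\<^sub>P (forms_incl K P N\<^sub>P \<iota> \<alpha>) p | \<alpha> p.
         \<alpha> \<in> carrier (forms K M N\<^sub>M) \<and> p \<in> carrier P}"

definition forms_PMP ::
  "('k, _) ring_scheme \<Rightarrow> ('k, 'm, _) module_scheme \<Rightarrow> ('m, 'm) tens set \<Rightarrow> ('m \<Rightarrow> 'p)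
    \<Rightarrow> ('k, 'p, _) module_scheme \<Rightarrow> ('p, 'p) tens set \<Rightarrow> ('p, 'p) tens set set"
  where "forms_PMP K M N\<^sub>M \<iota> P N\<^sub>P =
    kspan K (forms K P N\<^sub>P)
      {forms_ract K P N\<^sub>P (forms_lact K P N\<^sub>P p (forms_incl K P N\<^sub>P \<iota> \<alpha>)) p' | p \<alpha> p'.
         p \<in> carrier P \<and> \<alpha> \<in> carrier (forms K M N\<^sub>M) \<and> p' \<in> carrier P}"

definition forms_PM ::
  "('k, _) ring_scheme \<Rightarrow> ('k, 'm, _) module_scheme \<Rightarrow> ('m, 'm) tens set \<Rightarrow> ('m \<Rightarrow> 'p)
    \<Rightarrow> ('k, 'p, _) module_scheme \<Rightarrow> ('p, 'p) tens set \<Rightarrow> ('p, 'p) tens set set"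
  where "forms_PM K M N\<^sub>M \<iota> P N\<^sub>P =
    kspan K (forms K P N\<^sub>P)
      {forms_lact K P N\<^sub>P p (forms_incl K P N\<^sub>P \<iota> \<alpha>) | p \<alpha>.
         p \<in> carrier P \<and> \<alpha> \<in> carrier (forms K M N\<^sub>M)}"


section \<open>The calculus on a tensor product bundle\<close>

text \<open>
  The identification of \<open>M \<otimes> M \<otimes> H \<otimes> H\<close>, bracketed as \<open>(M \<otimes> M) \<otimes> (H \<otimes> H)\<close>, with
  \<open>P \<otimes> P\<close> for \<open>P = M \<otimes> H\<close>: \<open>(m \<otimes> m') \<otimes> (h \<otimes> h') \<mapsto> (m \<otimes> h) \<otimes> (m' \<otimes> h')\<close>.
\<close>

definition shuffle ::
  "('k, _) ring_scheme \<Rightarrow> ('k, 'm, _) module_scheme \<Rightarrow> ('k, 'h, _) module_scheme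
    \<Rightarrow> (('m, 'm) tens, ('h, 'h) tens) tens \<Rightarrow> (('m, 'h) tens, ('m, 'h) tens) tens"
  where "shuffle K M H =
    (let P = tensor K M H; T = tensor K P P in
     tlift T (\<lambda>x y.
       tlift T (\<lambda>m m'.
         tlift T (\<lambda>h h'. tens K P P (tens K M H m h) (tens K M H m' h')) y) x))"

definition product_N ::
  "('k, _) ring_scheme \<Rightarrow> ('k, 'm, _) module_scheme \<Rightarrow> ('m, 'm) tens set
    \<Rightarrow> ('k, 'h, _) hopf_alg_scheme \<Rightarrow> ('h, 'h) tens set
    \<Rightarrow> (('m, 'h) tens, ('m, 'h) tens) tens set"
  where "product_N K M N\<^sub>M H N\<^sub>H =
    (let MM = tensor K M M; HH = tensor K H H; T = tensor K MM HH in
     shuffle K M H `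
       (set_add T (set_add T (tsub K MM HH N\<^sub>M (carrier HH)) (tsub K MM HH (carrier MM) N\<^sub>H))
          (tsub K MM HH (univ_calc K M) (univ_calc K H))))"

end

theory Submission
  imports Defs
begin

text \<open>
  Write \<open>P \<otimes> P\<close> as \<open>(M \<otimes> M) \<otimes> (H \<otimes> H)\<close>. There \<open>ver\<close> becomes \<open>\<mu>\<^sub>M \<otimes> \<theta>\<close>, where \<open>\<mu>\<^sub>M\<close> is the
  multiplication of \<open>M\<close> and \<open>\<theta>(h \<otimes> g) = h g\<^sub>1 \<otimes> g\<^sub>2\<close> is bijective by the antipode. Since
  \<open>\<theta>(N\<^sub>H) = H \<otimes> Q\<^sub>H\<close> and \<open>(id \<otimes> \<epsilon>) \<theta>\<close> is the multiplication of \<open>H\<close>, this gives both the exactness of the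
  universal sequence and \<open>ver(N\<^sub>P) = P \<otimes> Q\<^sub>H\<close>. The coaction preserves \<open>N\<^sub>H\<close> because \<open>\<theta>\<close> turns it into
  \<open>\<Delta> \<otimes> Ad\<close>. Kernels of multiplication maps are split off by \<open>x \<mapsto> x - \<mu>(x) \<otimes> 1\<close>, so that tensoring
  with them needs no exactness argument; complements of arbitrary subspaces enter only in flatness and in
  the uniqueness behind \<^const>\<open>sub_coact\<close>.

  In \<open>\<Omega>\<^sup>1(P)\<close> the summand \<open>\<Omega>\<^sup>1M \<otimes> \<Omega>\<^sup>1H\<close> of \<open>N\<^sub>P\<close> lets one move both factors in \<open>H\<close> of a form
  \<open>\<omega> \<otimes> h \<otimes> g\<close> to one side, so the three subspaces agree. The map \<open>\<alpha> \<otimes> h \<mapsto> \<alpha> h\<close> is inverted by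
  \<open>x \<otimes> y \<mapsto> [x - \<mu>\<^sub>M(x) \<otimes> 1] \<otimes> \<mu>\<^sub>H(y)\<close>, which annihilates \<open>N\<^sub>P\<close>.
\<close>

section \<open>Balanced tensor products\<close>

text \<open>Elements of \<open>tensor\<close> are cosets in a free abelian group, and
  \<open>tlift\<close> evaluates them on a chosen representative. Cosets are handled directly only
  until the universal property is available; afterwards an identity is checked on pure tensors, at
  the price of a linearity proof for each side, which the rule set \<open>lin\<close> makes
  mechanical. Sweedler sums become iterated \<open>tlift\<close> over \<open>comult\<close>, with
  one rewriting rule for each Hopf algebra axiom. Exactness of the universal sequence comes from
  explicit preimages, since the inverse of \<open>\<theta>\<close> and the splitting of each
  multiplication are given by formulas. The third summand of \<open>N\<^sub>P\<close> is what the
  last claim rests on: without it \<open>h \<omega>\<close> and \<open>\<omega> h\<close> would in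
  general be different forms. It does no harm elsewhere: in \<open>ver\<close> its left factor is
  killed by \<open>\<mu>\<^sub>M\<close>, and in the comparison with the base its right factor is
  killed by \<open>\<mu>\<^sub>H\<close>. Definitions through \<open>SOME\<close> and
  \<open>THE\<close> are replaced as early as possible by linear formulas, built from
  \<open>univ_proj\<close> or from a retraction.\<close>

text \<open>One locale covers both tensor products of the development: the one over the field behind
  \<open>tensor\<close>, and the one over the algebra \<open>M\<close> in the definition of
  flatness. The assumptions are exactly what places the generating relations inside the free
  group.\<close>

locale tensor_pair = A: abelian_group A + B: abelian_group B
  for R :: "('r, 'z) ring_scheme" and A :: "('a, 'm) ring_scheme" and ra and B :: "('b, 'n) ring_scheme" and lb +
  assumes ra_closed: "\<lbrakk>a \<in> carrier A; r \<in> carrier R\<rbrakk> \<Longrightarrow> ra a r \<in> carrier A"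
    and lb_closed: "\<lbrakk>b \<in> carrier B; r \<in> carrier R\<rbrakk> \<Longrightarrow> lb r b \<in> carrier B"
begin

abbreviation F where "F \<equiv> free_Abelian_group (carrier A \<times> carrier B)"
abbreviation N where "N \<equiv> tensor_rel R A ra B lb"
abbreviation G where "G \<equiv> tensor_group R A ra B lb"

definition balanced where
  "balanced U \<beta> \<longleftrightarrow>
    (\<forall>a\<in>carrier A. \<forall>b\<in>carrier B. \<beta> a b \<in> carrier U) \<and>
    (\<forall>a\<in>carrier A. \<forall>a'\<in>carrier A. \<forall>b\<in>carrier B. \<beta> (a \<oplus>\<^bsub>A\<^esub> a') b = \<beta> a b \<oplus>\<^bsub>U\<^esub> \<beta> a' b) \<and>
    (\<forall>a\<in>carrier A. \<forall>b\<in>carrier B. \<forall>b'\<in>carrier B. \<beta> a (b \<oplus>\<^bsub>B\<^esub> b') = \<beta> a b \<oplus>\<^bsub>U\<^esub> \<beta> a b') \<and>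
    (\<forall>a\<in>carrier A. \<forall>r\<in>carrier R. \<forall>b\<in>carrier B. \<beta> (ra a r) b = \<beta> a (lb r b))"

definition pure where "pure a b = N #>\<^bsub>F\<^esub> frag_of (a, b)"

sublocale F: comm_group F by (rule abelian_free_Abelian_group)

lemma rel_gens_subset:
  "{frag_of (a \<oplus>\<^bsub>A\<^esub> a', b) - frag_of (a, b) - frag_of (a', b) | a a' b.
         a \<in> carrier A \<and> a' \<in> carrier A \<and> b \<in> carrier B} \<union>
      {frag_of (a, b \<oplus>\<^bsub>B\<^esub> b') - frag_of (a, b) - frag_of (a, b') | a b b'.
         a \<in> carrier A \<and> b \<in> carrier B \<and> b' \<in> carrier B} \<union>
      {frag_of (ra a r, b) - frag_of (a, lb r b) | a r b.
         a \<in> carrier A \<and> r \<in> carrier R \<and> b \<in> carrier B} \<subseteq> carrier F"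
  by (auto simp: ra_closed lb_closed dest!: subsetD[OF keys_diff])

lemma rel_subgroup: "subgroup N F"
  unfolding tensor_rel_def by (rule F.generate_is_subgroup[OF rel_gens_subset])

lemma rel_normal: "N \<lhd> F"
  using rel_subgroup F.subgroup_imp_normal by blast

lemma G_comm_group: "comm_group G"
  unfolding tensor_group_def by (rule F.abelian_FactGroup[OF rel_subgroup])

sublocale G: comm_group G by (rule G_comm_group)

lemma G_carrier: "carrier G = (\<lambda>x. N #>\<^bsub>F\<^esub> x) ` carrier F"
  by (simp add: tensor_group_def carrier_FactGroup)

lemma G_one: "\<one>\<^bsub>G\<^esub> = N" by (simp add: tensor_group_def)

lemma G_mult: "x \<in> carrier F \<Longrightarrow> y \<in> carrier F \<Longrightarrow>
    (N #>\<^bsub>F\<^esub> x) \<otimes>\<^bsub>G\<^esub> (N #>\<^bsub>F\<^esub> y) = N #>\<^bsub>F\<^esub> (x + y)"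
  using normal.rcos_sum[OF rel_normal, of x y] by (simp add: tensor_group_def)

lemma G_inv: "x \<in> carrier F \<Longrightarrow> inv\<^bsub>G\<^esub> (N #>\<^bsub>F\<^esub> x) = N #>\<^bsub>F\<^esub> (- x)"
proof -
  assume x: "x \<in> carrier F"
  have "N #>\<^bsub>F\<^esub> 0 = N"
    using F.coset_mult_one[of N] subgroup.subset[OF rel_subgroup] by simp
  then show ?thesis using x
    by (intro G.inv_equality) (auto simp: G_mult G_one G_carrier)
qed

lemma coset_eq: "x \<in> N \<Longrightarrow> y \<in> carrier F \<Longrightarrow> N #>\<^bsub>F\<^esub> (x + y) = N #>\<^bsub>F\<^esub> y"
proof -
  assume x: "x \<in> N" and y: "y \<in> carrier F"
  have "x \<in> carrier F" using x subgroup.subset[OF rel_subgroup] by blast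
  moreover have "N #>\<^bsub>F\<^esub> x = N"
    using x rel_subgroup F.coset_join2 \<open>x \<in> carrier F\<close> by blast
  ultimately show ?thesis using y G_mult[of x y] G_one G.l_one[of "N #>\<^bsub>F\<^esub> y"] by (simp add: G_carrier)
qed

lemma coset_eq': "x - y \<in> N \<Longrightarrow> y \<in> carrier F \<Longrightarrow> N #>\<^bsub>F\<^esub> x = N #>\<^bsub>F\<^esub> y"
  using coset_eq[of "x - y" y] by simp

lemma frag_F: "a \<in> carrier A \<Longrightarrow> b \<in> carrier B \<Longrightarrow> frag_of (a, b) \<in> carrier F"
  by simp

lemma pure_closed: "a \<in> carrier A \<Longrightarrow> b \<in> carrier B \<Longrightarrow> pure a b \<in> carrier G"
  by (auto simp: pure_def G_carrier)

lemma add_F: "x \<in> carrier F \<Longrightarrow> y \<in> carrier F \<Longrightarrow> x + y \<in> carrier F"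
  using F.m_closed[of x y] by simp

lemma pure_add_left:
  assumes "a \<in> carrier A" "a' \<in> carrier A" "b \<in> carrier B"
  shows "pure (a \<oplus>\<^bsub>A\<^esub> a') b = pure a b \<otimes>\<^bsub>G\<^esub> pure a' b"
proof -
  have "frag_of (a \<oplus>\<^bsub>A\<^esub> a', b) - (frag_of (a, b) + frag_of (a', b)) \<in> N"
    unfolding tensor_rel_def diff_diff_eq[symmetric]
    by (rule generate.incl) (use assms in blast)
  from coset_eq'[OF this add_F] show ?thesis
    using assms by (simp add: pure_def G_mult)
qed

lemma pure_add_right:
  assumes "a \<in> carrier A" "b \<in> carrier B" "b' \<in> carrier B"
  shows "pure a (b \<oplus>\<^bsub>B\<^esub> b') = pure a b \<otimes>\<^bsub>G\<^esub> pure a b'"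
proof -
  have "frag_of (a, b \<oplus>\<^bsub>B\<^esub> b') - (frag_of (a, b) + frag_of (a, b')) \<in> N"
    unfolding tensor_rel_def diff_diff_eq[symmetric]
    by (rule generate.incl) (use assms in blast)
  from coset_eq'[OF this add_F] show ?thesis
    using assms by (simp add: pure_def G_mult)
qed

lemma pure_balanced:
  assumes "a \<in> carrier A" "r \<in> carrier R" "b \<in> carrier B"
  shows "pure (ra a r) b = pure a (lb r b)"
proof -
  have "frag_of (ra a r, b) - frag_of (a, lb r b) \<in> N"
    unfolding tensor_rel_def by (rule generate.incl) (use assms in blast)
  from coset_eq'[OF this] show ?thesis
    using assms by (simp add: pure_def lb_closed)
qed

lemma pure_neg: "a \<in> carrier A \<Longrightarrow> b \<in> carrier B \<Longrightarrow> inv\<^bsub>G\<^esub> (pure a b) = pure (\<ominus>\<^bsub>A\<^esub> a) b"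
proof -
  assume a: "a \<in> carrier A" and b: "b \<in> carrier B"
  have z: "pure \<zero>\<^bsub>A\<^esub> b \<otimes>\<^bsub>G\<^esub> pure \<zero>\<^bsub>A\<^esub> b = pure \<zero>\<^bsub>A\<^esub> b"
    using pure_add_left[of "\<zero>\<^bsub>A\<^esub>" "\<zero>\<^bsub>A\<^esub>" b] b by simp
  have "pure \<zero>\<^bsub>A\<^esub> b = \<one>\<^bsub>G\<^esub>"
    using z G.l_cancel_one[OF pure_closed pure_closed, of "\<zero>\<^bsub>A\<^esub>" b "\<zero>\<^bsub>A\<^esub>" b] b by simp
  moreover have "pure (\<ominus>\<^bsub>A\<^esub> a) b \<otimes>\<^bsub>G\<^esub> pure a b = pure \<zero>\<^bsub>A\<^esub> b"
    using pure_add_left[of "\<ominus>\<^bsub>A\<^esub> a" a b] a b by (simp add: A.l_neg)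
  ultimately show ?thesis using a b by (intro G.inv_equality) (auto intro: pure_closed)
qed

text \<open>Negatives of pure tensors are pure by \<open>pure_neg\<close>, so sums alone exhaust the
  group; this is why there is no case for inverses.\<close>

lemma G_induct [consumes 1, case_names one pure mult]:
  assumes X: "X \<in> carrier G" and one: "P \<one>\<^bsub>G\<^esub>"
    and pure: "\<And>a b. a \<in> carrier A \<Longrightarrow> b \<in> carrier B \<Longrightarrow> P (pure a b)"
    and mult: "\<And>x y. x \<in> carrier G \<Longrightarrow> y \<in> carrier G \<Longrightarrow> P x \<Longrightarrow> P y \<Longrightarrow> P (x \<otimes>\<^bsub>G\<^esub> y)"
  shows "P X"
proof -
  obtain x where x: "x \<in> carrier F" "X = N #>\<^bsub>F\<^esub> x" using X by (auto simp: G_carrier)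
  have "Poly_Mapping.keys x \<subseteq> carrier A \<times> carrier B" using x by simp
  \<comment> \<open>Induction on the free group proceeds by differences, while \<open>mult\<close>
    speaks of sums. Carrying the claim for the inverse class as well bridges the two.\<close>
  then have "P (N #>\<^bsub>F\<^esub> x) \<and> P (inv\<^bsub>G\<^esub> (N #>\<^bsub>F\<^esub> x))"
  proof (induction x rule: free_Abelian_group_induct[consumes 1, case_names zero diff one])
    case zero
    have "N #>\<^bsub>F\<^esub> 0 = \<one>\<^bsub>G\<^esub>"
      using F.coset_mult_one[of N] subgroup.subset[OF rel_subgroup] by (simp add: G_one)
    then show ?case using one by simp
  next
    case (diff x y)
    have c: "N #>\<^bsub>F\<^esub> x \<in> carrier G" "N #>\<^bsub>F\<^esub> y \<in> carrier G" using diff by (auto simp: G_carrier)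
    have e: "N #>\<^bsub>F\<^esub> (x - y) = (N #>\<^bsub>F\<^esub> x) \<otimes>\<^bsub>G\<^esub> inv\<^bsub>G\<^esub> (N #>\<^bsub>F\<^esub> y)"
      using diff by (simp add: G_inv G_mult)
    have "inv\<^bsub>G\<^esub> (N #>\<^bsub>F\<^esub> (x - y)) = inv\<^bsub>G\<^esub> (N #>\<^bsub>F\<^esub> x) \<otimes>\<^bsub>G\<^esub> (N #>\<^bsub>F\<^esub> y)"
      using c by (simp add: e G.inv_mult)
    then show ?case using e diff mult c by simp
  next
    case (one p)
    then obtain a b where p: "p = (a, b)" "a \<in> carrier A" "b \<in> carrier B" by auto
    then show ?case using pure[of a b] pure[of "\<ominus>\<^bsub>A\<^esub> a" b] pure_neg[of a b] by (simp add: pure_def)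
  qed
  then show ?thesis using x by simp
qed

text \<open>Evaluating a formal sum is additive although its support is not: \<open>ext\<close>
  enlarges the index set to a common finite one, where the additional terms have coefficient
  zero.\<close>

lemma finsum_lookup_hom:
  assumes U: "abelian_group U" and f: "f \<in> carrier A \<times> carrier B \<rightarrow> carrier U"
  shows "(\<lambda>x. finsum U (\<lambda>p. [Poly_Mapping.lookup x p] \<cdot>\<^bsub>U\<^esub> f p) (Poly_Mapping.keys x))
    \<in> hom F (add_monoid U)"
proof -
  interpret U: abelian_group U by (rule U)
  let ?g = "\<lambda>(x :: 'a \<times> 'b \<Rightarrow>\<^sub>0 int) p. [Poly_Mapping.lookup x p] \<cdot>\<^bsub>U\<^esub> f p"
  have cl: "?g x p \<in> carrier U" if "Poly_Mapping.keys x \<subseteq> carrier A \<times> carrier B" "p \<in> carrier A \<times> carrier B"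
    for x p using group.int_pow_closed[OF U.a_group, of "f p"] funcset_mem[OF f that(2)] by (simp add: add_pow_def)
  have ext: "finsum U (?g x) (Poly_Mapping.keys x) = finsum U (?g x) T"
    if "finite T" "Poly_Mapping.keys x \<subseteq> T" "T \<subseteq> carrier A \<times> carrier B" for x T
  proof (rule U.add.finprod_mono_neutral_cong_left[OF that(1,2)])
    show "?g x p = \<zero>\<^bsub>U\<^esub>" if "p \<in> T - Poly_Mapping.keys x" for p
      using that by (simp add: in_keys_iff add_pow_def)
  qed (use cl[of x] that in blast)+
  show ?thesis
  proof (rule homI)
    fix x assume "x \<in> carrier F"
    then show "finsum U (?g x) (Poly_Mapping.keys x) \<in> carrier (add_monoid U)"
      using cl[of x] by (auto intro!: U.finsum_closed)
  next
    fix x y assume x: "x \<in> carrier F" and y: "y \<in> carrier F"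
    let ?T = "Poly_Mapping.keys x \<union> Poly_Mapping.keys y"
    have T: "finite ?T" "?T \<subseteq> carrier A \<times> carrier B" using x y by auto
    have fT: "f p \<in> carrier U" if "p \<in> ?T" for p using that T f by auto
    have "finsum U (?g (x + y)) (Poly_Mapping.keys (x + y)) = finsum U (?g (x + y)) ?T"
      using ext[of ?T "x + y"] T keys_add[of x y] by blast
    also have "\<dots> = finsum U (\<lambda>p. ?g x p \<oplus>\<^bsub>U\<^esub> ?g y p) ?T"
      using fT using group.int_pow_mult[OF U.a_group] by (intro U.add.finprod_cong') (auto simp: Poly_Mapping.lookup_add add_pow_def group.int_pow_closed[OF U.a_group, simplified])
    also have "\<dots> = finsum U (?g x) ?T \<oplus>\<^bsub>U\<^esub> finsum U (?g y) ?T"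
      using fT by (intro U.finsum_addf) auto
    also have "\<dots> = finsum U (?g x) (Poly_Mapping.keys x) \<oplus>\<^bsub>U\<^esub> finsum U (?g y) (Poly_Mapping.keys y)"
      using ext[of ?T x] ext[of ?T y] T by simp
    finally show "finsum U (?g (x \<otimes>\<^bsub>F\<^esub> y)) (Poly_Mapping.keys (x \<otimes>\<^bsub>F\<^esub> y)) =
      finsum U (?g x) (Poly_Mapping.keys x) \<otimes>\<^bsub>add_monoid U\<^esub> finsum U (?g y) (Poly_Mapping.keys y)" by simp
  qed
qed

text \<open>The evaluation homomorphism \<open>h\<close> kills the generating relations because
  \<open>\<beta>\<close> is balanced, hence all of \<open>N\<close>. The representative chosen by
  \<open>SOME\<close> in \<open>tlift\<close> differs from \<open>x\<close> by an element of
  \<open>N\<close>.\<close>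

lemma tlift_coset:
  assumes U: "abelian_group U" and b: "balanced U \<beta>" and x: "x \<in> carrier F"
  shows "tlift U \<beta> (N #>\<^bsub>F\<^esub> x) =
    finsum U (\<lambda>p. [Poly_Mapping.lookup x p] \<cdot>\<^bsub>U\<^esub> \<beta> (fst p) (snd p)) (Poly_Mapping.keys x)"
proof -
  interpret U: abelian_group U by (rule U)
  define h where "h x = finsum U (\<lambda>p. [Poly_Mapping.lookup x p] \<cdot>\<^bsub>U\<^esub> \<beta> (fst p) (snd p)) (Poly_Mapping.keys x)"
    for x :: "'a \<times> 'b \<Rightarrow>\<^sub>0 int"
  have hom: "h \<in> hom F (add_monoid U)"
    unfolding h_def using b by (intro finsum_lookup_hom[OF U, of "\<lambda>p. \<beta> (fst p) (snd p)"]) (auto simp: balanced_def)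
  interpret h: group_hom F "add_monoid U" h
    using hom U.a_group by (simp add: group_hom_def group_hom_axioms_def)
  have h_frag: "h (frag_of (a, c)) = \<beta> a c" if "a \<in> carrier A" "c \<in> carrier B" for a c
    using that b by (simp add: h_def balanced_def)
  have h_diff: "h (x - y) = h x \<ominus>\<^bsub>U\<^esub> h y" if "x \<in> carrier F" "y \<in> carrier F" for x y
  proof -
    have "h (x \<otimes>\<^bsub>F\<^esub> inv\<^bsub>F\<^esub> y) = h x \<oplus>\<^bsub>U\<^esub> (\<ominus>\<^bsub>U\<^esub> h y)"
      using that h.hom_mult[of x "inv\<^bsub>F\<^esub> y"] h.hom_inv[of y] by (simp add: a_inv_def)
    then show ?thesis using that by (simp add: U.minus_eq)
  qed
  have diffF: "x - y \<in> carrier F" if "x \<in> carrier F" "y \<in> carrier F" for x y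
    using that keys_diff[of x y] by auto
  have gens: "h r = \<zero>\<^bsub>U\<^esub>"
    if "r \<in> {frag_of (a \<oplus>\<^bsub>A\<^esub> a', b) - frag_of (a, b) - frag_of (a', b) | a a' b.
         a \<in> carrier A \<and> a' \<in> carrier A \<and> b \<in> carrier B} \<union>
      {frag_of (a, b \<oplus>\<^bsub>B\<^esub> b') - frag_of (a, b) - frag_of (a, b') | a b b'.
         a \<in> carrier A \<and> b \<in> carrier B \<and> b' \<in> carrier B} \<union>
      {frag_of (ra a r, b) - frag_of (a, lb r b) | a r b.
         a \<in> carrier A \<and> r \<in> carrier R \<and> b \<in> carrier B}" for r
  proof -
    have b': "\<And>a b. a \<in> carrier A \<Longrightarrow> b \<in> carrier B \<Longrightarrow> \<beta> a b \<in> carrier U"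
      using b by (auto simp: balanced_def)
    have m2: "u \<oplus>\<^bsub>U\<^esub> v \<ominus>\<^bsub>U\<^esub> u \<ominus>\<^bsub>U\<^esub> v = \<zero>\<^bsub>U\<^esub>" if "u \<in> carrier U" "v \<in> carrier U" for u v
      
    proof -
      have "u \<oplus>\<^bsub>U\<^esub> v \<ominus>\<^bsub>U\<^esub> u \<ominus>\<^bsub>U\<^esub> v = (u \<oplus>\<^bsub>U\<^esub> v) \<oplus>\<^bsub>U\<^esub> (\<ominus>\<^bsub>U\<^esub> u \<oplus>\<^bsub>U\<^esub> \<ominus>\<^bsub>U\<^esub> v)"
        using that by (simp only: U.minus_eq U.a_assoc U.a_closed U.a_inv_closed)
      also have "\<dots> = (u \<oplus>\<^bsub>U\<^esub> v) \<oplus>\<^bsub>U\<^esub> \<ominus>\<^bsub>U\<^esub> (u \<oplus>\<^bsub>U\<^esub> v)"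
        using that by (simp only: U.minus_add)
      also have "\<dots> = \<zero>\<^bsub>U\<^esub>"
        using that by (simp only: U.r_neg U.a_closed)
      finally show ?thesis .
    qed
    from that consider
      a a' c where "r = frag_of (a \<oplus>\<^bsub>A\<^esub> a', c) - frag_of (a, c) - frag_of (a', c)"
         "a \<in> carrier A" "a' \<in> carrier A" "c \<in> carrier B"
      | a c c' where "r = frag_of (a, c \<oplus>\<^bsub>B\<^esub> c') - frag_of (a, c) - frag_of (a, c')"
         "a \<in> carrier A" "c \<in> carrier B" "c' \<in> carrier B"
      | a s c where "r = frag_of (ra a s, c) - frag_of (a, lb s c)"
         "a \<in> carrier A" "s \<in> carrier R" "c \<in> carrier B" by blast
    then show ?thesis
    proof cases
      case 1
      then have "h r = h (frag_of (a \<oplus>\<^bsub>A\<^esub> a', c)) \<ominus>\<^bsub>U\<^esub> h (frag_of (a, c)) \<ominus>\<^bsub>U\<^esub> h (frag_of (a', c))"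
        by (simp only: h_diff diffF frag_F A.a_closed)
      also have "\<dots> = \<beta> a c \<oplus>\<^bsub>U\<^esub> \<beta> a' c \<ominus>\<^bsub>U\<^esub> \<beta> a c \<ominus>\<^bsub>U\<^esub> \<beta> a' c"
        using 1 b unfolding balanced_def by (simp only: h_frag A.a_closed)
      finally show ?thesis using m2[of "\<beta> a c" "\<beta> a' c"] b' 1 by simp
    next
      case 2
      then have "h r = h (frag_of (a, c \<oplus>\<^bsub>B\<^esub> c')) \<ominus>\<^bsub>U\<^esub> h (frag_of (a, c)) \<ominus>\<^bsub>U\<^esub> h (frag_of (a, c'))"
        by (simp only: h_diff diffF frag_F B.a_closed)
      also have "\<dots> = \<beta> a c \<oplus>\<^bsub>U\<^esub> \<beta> a c' \<ominus>\<^bsub>U\<^esub> \<beta> a c \<ominus>\<^bsub>U\<^esub> \<beta> a c'"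
        using 2 b unfolding balanced_def by (simp only: h_frag B.a_closed)
      finally show ?thesis using m2[of "\<beta> a c" "\<beta> a c'"] b' 2 by simp
    next
      case 3
      then have "h r = \<beta> (ra a s) c \<ominus>\<^bsub>U\<^esub> \<beta> a (lb s c)"
        by (simp only: h_diff h_frag frag_F ra_closed lb_closed)
      also have "\<beta> (ra a s) c = \<beta> a (lb s c)" using 3 b unfolding balanced_def by blast
      finally show ?thesis using b' 3 lb_closed by (simp add: U.minus_eq U.r_neg)
    qed
  qed
  have "N \<subseteq> kernel F (add_monoid U) h"
    unfolding tensor_rel_def
  proof (rule F.generate_subgroup_incl[OF subsetI h.subgroup_kernel])
    fix r
    assume r: "r \<in> {frag_of (a \<oplus>\<^bsub>A\<^esub> a', b) - frag_of (a, b) - frag_of (a', b) | a a' b.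
         a \<in> carrier A \<and> a' \<in> carrier A \<and> b \<in> carrier B} \<union>
      {frag_of (a, b \<oplus>\<^bsub>B\<^esub> b') - frag_of (a, b) - frag_of (a, b') | a b b'.
         a \<in> carrier A \<and> b \<in> carrier B \<and> b' \<in> carrier B} \<union>
      {frag_of (ra a r, b) - frag_of (a, lb r b) | a r b.
         a \<in> carrier A \<and> r \<in> carrier R \<and> b \<in> carrier B}"
    show "r \<in> kernel F (add_monoid U) h"
      unfolding kernel_def using gens[OF r] subsetD[OF rel_gens_subset r]
      by (simp only: mem_Collect_eq monoid.simps simp_thms)
  qed
  then have rel: "h r = \<zero>\<^bsub>U\<^esub>" if "r \<in> N" for r
    using that by (auto simp: kernel_def)
  have "N #>\<^bsub>F\<^esub> x \<noteq> {}" using F.rcos_self[OF x rel_subgroup] by blast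
  then have s: "(SOME y. y \<in> N #>\<^bsub>F\<^esub> x) \<in> N #>\<^bsub>F\<^esub> x" by (simp add: some_in_eq)
  then obtain r where r: "r \<in> N" "(SOME y. y \<in> N #>\<^bsub>F\<^esub> x) = r + x" by (auto simp: r_coset_def)
  have "r \<in> carrier F" using r subgroup.subset[OF rel_subgroup] by blast
  then have "h (r + x) = h r \<oplus>\<^bsub>U\<^esub> h x" using h.hom_mult[of r x] x by simp
  then have "h (r + x) = h x" using rel[OF r(1)] h.hom_closed[OF x] by simp
  then show ?thesis unfolding tlift_def Let_def r(2) h_def .
qed

lemma tlift_hom:
  assumes U: "abelian_group U" and b: "balanced U \<beta>"
  shows "tlift U \<beta> \<in> hom G (add_monoid U)"
proof -
  have h: "(\<lambda>x. finsum U (\<lambda>p. [Poly_Mapping.lookup x p] \<cdot>\<^bsub>U\<^esub> \<beta> (fst p) (snd p)) (Poly_Mapping.keys x))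
     \<in> hom F (add_monoid U)"
    using b by (intro finsum_lookup_hom[OF U, of "\<lambda>p. \<beta> (fst p) (snd p)"]) (auto simp: balanced_def)
  show ?thesis
  proof (rule homI)
    fix X assume "X \<in> carrier G"
    then show "tlift U \<beta> X \<in> carrier (add_monoid U)"
      using h unfolding G_carrier hom_def by (auto simp: tlift_coset[OF U b] simp del: carrier_free_Abelian_group_iff)
  next
    fix X Y assume "X \<in> carrier G" "Y \<in> carrier G"
    then obtain x y where "x \<in> carrier F" "y \<in> carrier F" "X = N #>\<^bsub>F\<^esub> x" "Y = N #>\<^bsub>F\<^esub> y"
      by (auto simp: G_carrier simp del: carrier_free_Abelian_group_iff)
    then show "tlift U \<beta> (X \<otimes>\<^bsub>G\<^esub> Y) = tlift U \<beta> X \<otimes>\<^bsub>add_monoid U\<^esub> tlift U \<beta> Y"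
      using hom_mult[OF h, of x y] add_F[of x y]
      by (simp add: G_mult tlift_coset[OF U b] del: carrier_free_Abelian_group_iff)
  qed
qed

lemma tlift_pure:
  assumes U: "abelian_group U" and b: "balanced U \<beta>" and "a \<in> carrier A" "c \<in> carrier B"
  shows "tlift U \<beta> (pure a c) = \<beta> a c"
proof -
  interpret U: abelian_group U by (rule U)
  have "\<beta> a c \<in> carrier U" using assms by (auto simp: balanced_def)
  then show ?thesis
    unfolding pure_def using assms by (subst tlift_coset[OF U b]) simp_all
qed

end

section \<open>Linear and bilinear maps\<close>

named_theorems lin "typing rules for elements, modules, linear and bilinear maps, applied as backward search"

lemma module_abelian_group: "module K V \<Longrightarrow> abelian_group V"
  by (simp add: module_def)

lemma k_algebra_module: "k_algebra K A \<Longrightarrow> module K A"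
  by (simp add: k_algebra_def)

lemma k_algebra_ring: "k_algebra K A \<Longrightarrow> ring A"
  by (simp add: k_algebra_def)

lemma lin_mapI:
  "(\<And>x. x \<in> carrier V \<Longrightarrow> f x \<in> carrier W) \<Longrightarrow>
   (\<And>x y. x \<in> carrier V \<Longrightarrow> y \<in> carrier V \<Longrightarrow> f (x \<oplus>\<^bsub>V\<^esub> y) = f x \<oplus>\<^bsub>W\<^esub> f y) \<Longrightarrow>
   (\<And>c x. c \<in> carrier K \<Longrightarrow> x \<in> carrier V \<Longrightarrow> f (c \<odot>\<^bsub>V\<^esub> x) = c \<odot>\<^bsub>W\<^esub> f x) \<Longrightarrow> lin_map K V W f"
  by (auto simp: lin_map_def)

lemma lin_map_closed: "lin_map K V W f \<Longrightarrow> x \<in> carrier V \<Longrightarrow> f x \<in> carrier W"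
  by (auto simp: lin_map_def)

lemma lin_map_add: "lin_map K V W f \<Longrightarrow> x \<in> carrier V \<Longrightarrow> y \<in> carrier V \<Longrightarrow> f (x \<oplus>\<^bsub>V\<^esub> y) = f x \<oplus>\<^bsub>W\<^esub> f y"
  by (auto simp: lin_map_def)

lemma lin_map_smult: "lin_map K V W f \<Longrightarrow> c \<in> carrier K \<Longrightarrow> x \<in> carrier V \<Longrightarrow> f (c \<odot>\<^bsub>V\<^esub> x) = c \<odot>\<^bsub>W\<^esub> f x"
  by (auto simp: lin_map_def)

lemma lin_map_zero:
  assumes "module K V" "module K W" "lin_map K V W f"
  shows "f \<zero>\<^bsub>V\<^esub> = \<zero>\<^bsub>W\<^esub>"
proof -
  interpret V: module K V by fact
  interpret W: module K W by fact
  have "f \<zero>\<^bsub>V\<^esub> = f (\<zero>\<^bsub>K\<^esub> \<odot>\<^bsub>V\<^esub> \<zero>\<^bsub>V\<^esub>)" by simp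
  also have "\<dots> = \<zero>\<^bsub>K\<^esub> \<odot>\<^bsub>W\<^esub> f \<zero>\<^bsub>V\<^esub>"
    by (rule lin_map_smult[OF assms(3)]) simp_all
  finally show ?thesis using lin_map_closed[OF assms(3) V.zero_closed] by simp
qed

lemma module_neg: "module K V \<Longrightarrow> x \<in> carrier V \<Longrightarrow> \<ominus>\<^bsub>V\<^esub> x = (\<ominus>\<^bsub>K\<^esub> \<one>\<^bsub>K\<^esub>) \<odot>\<^bsub>V\<^esub> x"
proof -
  assume "module K V" and x: "x \<in> carrier V"
  then interpret V: module K V by simp
  show ?thesis using V.smult_l_minus[of "\<one>\<^bsub>K\<^esub>" x] x by simp
qed

lemma lin_map_neg:
  assumes "module K V" "module K W" "lin_map K V W f" "x \<in> carrier V"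
  shows "f (\<ominus>\<^bsub>V\<^esub> x) = \<ominus>\<^bsub>W\<^esub> f x"
proof -
  interpret V: module K V by fact
  show ?thesis
    using assms lin_map_closed[OF assms(3,4)] by (simp add: module_neg lin_map_smult)
qed

lemma lin_map_minus:
  assumes "module K V" "module K W" "lin_map K V W f" "x \<in> carrier V" "y \<in> carrier V"
  shows "f (x \<ominus>\<^bsub>V\<^esub> y) = f x \<ominus>\<^bsub>W\<^esub> f y"
proof -
  interpret V: module K V by fact
  show ?thesis
    using assms by (simp add: a_minus_def lin_map_add[OF assms(3)] lin_map_neg[OF assms(1-3)])
qed

lemma lin_map_cong: "module K V \<Longrightarrow> lin_map K V W f \<Longrightarrow> (\<And>x. x \<in> carrier V \<Longrightarrow> f x = g x) \<Longrightarrow> lin_map K V W g"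
proof -
  assume "module K V" and f: "lin_map K V W f" and e: "\<And>x. x \<in> carrier V \<Longrightarrow> f x = g x"
  then interpret V: module K V by simp
  show ?thesis using f by (auto simp: lin_map_def e[symmetric] Pi_iff)
qed

lemma lin_map_ident [lin]: "lin_map K V V (\<lambda>x. x)"
  by (auto simp: lin_map_def)

lemma lin_map_comp: "lin_map K V W g \<Longrightarrow> lin_map K X V f \<Longrightarrow> lin_map K X W (\<lambda>x. g (f x))"
  by (auto simp: lin_map_def Pi_iff)

lemma lin_map_sum [lin]:
  assumes "module K W" "lin_map K V W f" "lin_map K V W g"
  shows "lin_map K V W (\<lambda>x. f x \<oplus>\<^bsub>W\<^esub> g x)"
proof -
  interpret W: module K W by fact
  show ?thesis
    using assms by (intro lin_mapI) (simp_all add: lin_map_closed[of K V W] lin_map_add[of K V W]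
      lin_map_smult[of K V W] W.smult_r_distr W.a_ac)
qed

lemma lin_map_scale [lin]:
  assumes "module K W" "c \<in> carrier K" "lin_map K V W f"
  shows "lin_map K V W (\<lambda>x. c \<odot>\<^bsub>W\<^esub> f x)"
proof -
  interpret W: module K W by fact
  show ?thesis
    using assms by (intro lin_mapI) (simp_all add: lin_map_closed[of K V W] lin_map_add[of K V W]
      lin_map_smult[of K V W] W.smult_r_distr W.smult_assoc1[symmetric] W.R.m_comm)
qed

lemma lin_map_diff [lin]:
  assumes "module K W" "lin_map K V W f" "lin_map K V W g"
  shows "lin_map K V W (\<lambda>x. f x \<ominus>\<^bsub>W\<^esub> g x)"
proof -
  interpret W: module K W by fact
  show ?thesis
    using assms by (intro lin_mapI) (simp_all add: lin_map_closed[of K V W] lin_map_add[of K V W]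
      lin_map_smult[of K V W] W.smult_r_distr W.smult_r_minus W.a_ac W.minus_add a_minus_def)
qed

definition bilin where
  "bilin K V W U \<beta> \<longleftrightarrow> (\<forall>w\<in>carrier W. lin_map K V U (\<lambda>v. \<beta> v w)) \<and> (\<forall>v\<in>carrier V. lin_map K W U (\<beta> v))"

lemma bilinI [lin]:
  "(\<And>w. w \<in> carrier W \<Longrightarrow> lin_map K V U (\<lambda>v. \<beta> v w)) \<Longrightarrow> (\<And>v. v \<in> carrier V \<Longrightarrow> lin_map K W U (\<beta> v)) \<Longrightarrow>
   bilin K V W U \<beta>"
  by (simp add: bilin_def)


lemma bilin_comp: "lin_map K U U' f \<Longrightarrow> bilin K V W U \<beta> \<Longrightarrow> bilin K V W U' (\<lambda>v w. f (\<beta> v w))"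
  unfolding bilin_def by (auto intro: lin_map_comp)


section \<open>Tensor products of vector spaces\<close>

text \<open>\<open>tensor\<close> defines its multiplication and scalars by \<open>tlift\<close>
  into \<open>tensor_add\<close>, a record that holds only the group. The last three equations
  identify the additive structures of the two records, so that the group lemmas apply to
  both.\<close>

lemma tensor_sel:
  "carrier (tensor K V W) = carrier (tensor_group K V (\<lambda>v c. c \<odot>\<^bsub>V\<^esub> v) W (\<lambda>c w. c \<odot>\<^bsub>W\<^esub> w))"
  "\<zero>\<^bsub>tensor K V W\<^esub> = \<one>\<^bsub>tensor_group K V (\<lambda>v c. c \<odot>\<^bsub>V\<^esub> v) W (\<lambda>c w. c \<odot>\<^bsub>W\<^esub> w)\<^esub>"
  "x \<oplus>\<^bsub>tensor K V W\<^esub> y = x \<otimes>\<^bsub>tensor_group K V (\<lambda>v c. c \<odot>\<^bsub>V\<^esub> v) W (\<lambda>c w. c \<odot>\<^bsub>W\<^esub> w)\<^esub> y"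
  "carrier (tensor_add K V W) = carrier (tensor K V W)"
  "\<zero>\<^bsub>tensor_add K V W\<^esub> = \<zero>\<^bsub>tensor K V W\<^esub>"
  "x \<oplus>\<^bsub>tensor_add K V W\<^esub> y = x \<oplus>\<^bsub>tensor K V W\<^esub> y"
  by (simp_all add: tensor_def tensor_add_def Let_def)

locale two_modules = V: module K V + W: module K W
  for K :: "('k, 'c) ring_scheme" and V :: "('k, 'v, 'y) module_scheme" and W :: "('k, 'w, 'z) module_scheme"
begin

sublocale tensor_pair K V "\<lambda>v c. c \<odot>\<^bsub>V\<^esub> v" W "\<lambda>c w. c \<odot>\<^bsub>W\<^esub> w"
  by unfold_locales auto

abbreviation T where "T \<equiv> tensor K V W"

lemma tens_eq_pure: "tens K V W v w = pure v w"
  by (simp add: tens_def pure_def)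

lemma tens_closed: "v \<in> carrier V \<Longrightarrow> w \<in> carrier W \<Longrightarrow> tens K V W v w \<in> carrier T"
  by (simp add: tens_eq_pure pure_closed tensor_sel)

lemma tensor_abelian_group: "abelian_group T"
proof (rule comm_group_abelian_groupI, rule comm_groupI)
  fix x assume "x \<in> carrier (add_monoid T)"
  then show "\<exists>y\<in>carrier (add_monoid T). y \<otimes>\<^bsub>add_monoid T\<^esub> x = \<one>\<^bsub>add_monoid T\<^esub>"
    using G.l_inv_ex by (auto simp: tensor_sel)
qed (simp_all add: tensor_sel G.m_ac)

lemma tensor_add_abelian_group: "abelian_group (tensor_add K V W)"
proof (rule comm_group_abelian_groupI, rule comm_groupI)
  fix x assume "x \<in> carrier (add_monoid (tensor_add K V W))"
  then show "\<exists>y\<in>carrier (add_monoid (tensor_add K V W)).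
      y \<otimes>\<^bsub>add_monoid (tensor_add K V W)\<^esub> x = \<one>\<^bsub>add_monoid (tensor_add K V W)\<^esub>"
    using G.l_inv_ex by (auto simp: tensor_sel)
qed (simp_all add: tensor_sel G.m_ac)

lemma tens_add_left: "v \<in> carrier V \<Longrightarrow> v' \<in> carrier V \<Longrightarrow> w \<in> carrier W \<Longrightarrow>
    tens K V W (v \<oplus>\<^bsub>V\<^esub> v') w = tens K V W v w \<oplus>\<^bsub>T\<^esub> tens K V W v' w"
  by (simp add: tens_eq_pure pure_add_left tensor_sel)

lemma tens_add_right: "v \<in> carrier V \<Longrightarrow> w \<in> carrier W \<Longrightarrow> w' \<in> carrier W \<Longrightarrow>
    tens K V W v (w \<oplus>\<^bsub>W\<^esub> w') = tens K V W v w \<oplus>\<^bsub>T\<^esub> tens K V W v w'"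
  by (simp add: tens_eq_pure pure_add_right tensor_sel)

lemma tens_balanced: "c \<in> carrier K \<Longrightarrow> v \<in> carrier V \<Longrightarrow> w \<in> carrier W \<Longrightarrow>
    tens K V W (c \<odot>\<^bsub>V\<^esub> v) w = tens K V W v (c \<odot>\<^bsub>W\<^esub> w)"
  by (simp add: tens_eq_pure pure_balanced)

lemma induct_tens [consumes 1, case_names zero tens add]:
  assumes X: "X \<in> carrier T" and "P \<zero>\<^bsub>T\<^esub>"
    and "\<And>v w. v \<in> carrier V \<Longrightarrow> w \<in> carrier W \<Longrightarrow> P (tens K V W v w)"
    and "\<And>x y. x \<in> carrier T \<Longrightarrow> y \<in> carrier T \<Longrightarrow> P x \<Longrightarrow> P y \<Longrightarrow> P (x \<oplus>\<^bsub>T\<^esub> y)"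
  shows "P X"
  using X unfolding tensor_sel(1)
proof (induction X rule: G_induct)
  case one then show ?case using assms(2) by (simp add: tensor_sel)
next
  case (pure a b) then show ?case using assms(3) by (simp add: tens_eq_pure)
next
  case (mult x y) then show ?case using assms(4)[of x y] by (simp add: tensor_sel)
qed

text \<open>Scaling descends to the quotient because \<open>K\<close> is commutative:
  \<open>c\<close> has to pass the scalar that is moved across the tensor sign.\<close>

lemma smult_balanced: "c \<in> carrier K \<Longrightarrow> balanced (tensor_add K V W) (\<lambda>v w. tens K V W (c \<odot>\<^bsub>V\<^esub> v) w)"
  unfolding balanced_def
  by (simp add: tensor_sel(4-6) tens_closed tens_add_left tens_add_right V.smult_r_distr
      tens_balanced[symmetric] V.smult_assoc1[symmetric] V.R.m_comm)

lemma smult_def': "c \<odot>\<^bsub>T\<^esub> x = tlift (tensor_add K V W) (\<lambda>v w. tens K V W (c \<odot>\<^bsub>V\<^esub> v) w) x"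
  by (simp add: tensor_def)

lemma smult_hom: "c \<in> carrier K \<Longrightarrow> (\<lambda>x. c \<odot>\<^bsub>T\<^esub> x) \<in> hom G (add_monoid (tensor_add K V W))"
  unfolding smult_def' by (rule tlift_hom[OF tensor_add_abelian_group smult_balanced])

lemma smult_closed': "c \<in> carrier K \<Longrightarrow> x \<in> carrier T \<Longrightarrow> c \<odot>\<^bsub>T\<^esub> x \<in> carrier T"
  using smult_hom[of c] by (auto simp: hom_def tensor_sel)

lemma smult_add': "c \<in> carrier K \<Longrightarrow> x \<in> carrier T \<Longrightarrow> y \<in> carrier T \<Longrightarrow>
    c \<odot>\<^bsub>T\<^esub> (x \<oplus>\<^bsub>T\<^esub> y) = c \<odot>\<^bsub>T\<^esub> x \<oplus>\<^bsub>T\<^esub> c \<odot>\<^bsub>T\<^esub> y"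
  using smult_hom[of c] by (auto simp: hom_def tensor_sel)

lemma smult_tens: "c \<in> carrier K \<Longrightarrow> v \<in> carrier V \<Longrightarrow> w \<in> carrier W \<Longrightarrow>
    c \<odot>\<^bsub>T\<^esub> tens K V W v w = tens K V W (c \<odot>\<^bsub>V\<^esub> v) w"
  unfolding smult_def' tens_eq_pure
  by (subst tlift_pure[OF tensor_add_abelian_group smult_balanced, unfolded tens_eq_pure]) auto

lemma smult_zero': "c \<in> carrier K \<Longrightarrow> c \<odot>\<^bsub>T\<^esub> \<zero>\<^bsub>T\<^esub> = \<zero>\<^bsub>T\<^esub>"
proof -
  interpret T: abelian_group T by (rule tensor_abelian_group)
  assume c: "c \<in> carrier K"
  have "c \<odot>\<^bsub>T\<^esub> \<zero>\<^bsub>T\<^esub> \<oplus>\<^bsub>T\<^esub> c \<odot>\<^bsub>T\<^esub> \<zero>\<^bsub>T\<^esub> = c \<odot>\<^bsub>T\<^esub> \<zero>\<^bsub>T\<^esub>"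
    using smult_add'[OF c T.zero_closed T.zero_closed] by simp
  then show ?thesis
    using T.add.l_cancel_one[of "c \<odot>\<^bsub>T\<^esub> \<zero>\<^bsub>T\<^esub>" "c \<odot>\<^bsub>T\<^esub> \<zero>\<^bsub>T\<^esub>"] smult_closed'[OF c T.zero_closed] by simp
qed

lemma tensor_module: "module K T"
proof (rule moduleI)
  interpret T: abelian_group T by (rule tensor_abelian_group)
  show "cring K" by (rule V.R.is_cring)
  show "abelian_group T" by (rule tensor_abelian_group)
  show "a \<odot>\<^bsub>T\<^esub> x \<in> carrier T" if "a \<in> carrier K" "x \<in> carrier T" for a x
    using that by (rule smult_closed')
  show "a \<odot>\<^bsub>T\<^esub> (x \<oplus>\<^bsub>T\<^esub> y) = a \<odot>\<^bsub>T\<^esub> x \<oplus>\<^bsub>T\<^esub> a \<odot>\<^bsub>T\<^esub> y"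
    if "a \<in> carrier K" "x \<in> carrier T" "y \<in> carrier T" for a x y
    using that by (rule smult_add')
  show "(a \<oplus>\<^bsub>K\<^esub> b) \<odot>\<^bsub>T\<^esub> x = a \<odot>\<^bsub>T\<^esub> x \<oplus>\<^bsub>T\<^esub> b \<odot>\<^bsub>T\<^esub> x"
    if a: "a \<in> carrier K" and b: "b \<in> carrier K" and x: "x \<in> carrier T" for a b x
    using x
  proof (induction x rule: induct_tens)
    case zero then show ?case using a b by (simp add: smult_zero')
  next
    case (tens v w)
    then show ?case using a b by (simp add: smult_tens V.smult_l_distr tens_add_left)
  next
    case (add x y)
    then show ?case using a b by (simp add: smult_add' smult_closed' T.a_ac)
  qed
  show "(a \<otimes>\<^bsub>K\<^esub> b) \<odot>\<^bsub>T\<^esub> x = a \<odot>\<^bsub>T\<^esub> (b \<odot>\<^bsub>T\<^esub> x)"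
    if a: "a \<in> carrier K" and b: "b \<in> carrier K" and x: "x \<in> carrier T" for a b x
    using x
  proof (induction x rule: induct_tens)
    case zero then show ?case using a b by (simp add: smult_zero')
  next
    case (tens v w)
    then show ?case using a b by (simp add: smult_tens V.smult_assoc1)
  next
    case (add x y)
    then show ?case using a b by (simp add: smult_add' smult_closed')
  qed
  show "\<one>\<^bsub>K\<^esub> \<odot>\<^bsub>T\<^esub> x = x" if x: "x \<in> carrier T" for x
    using x
  proof (induction x rule: induct_tens)
    case zero then show ?case by (simp add: smult_zero')
  next
    case (tens v w)
    then show ?case by (simp add: smult_tens)
  next
    case (add x y)
    then show ?case by (simp add: smult_add' smult_closed')
  qed
qed

lemma bilin_balanced: "module K U \<Longrightarrow> bilin K V W U \<beta> \<Longrightarrow> balanced U \<beta>"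
  unfolding bilin_def balanced_def by (auto simp: lin_map_def Pi_iff)

lemma tlift_tens: "module K U \<Longrightarrow> bilin K V W U \<beta> \<Longrightarrow> v \<in> carrier V \<Longrightarrow> w \<in> carrier W \<Longrightarrow>
    tlift U \<beta> (tens K V W v w) = \<beta> v w"
  unfolding tens_eq_pure by (rule tlift_pure) (auto intro: bilin_balanced module_abelian_group)

lemma lin_map_tlift: 
  assumes U: "module K U" and b: "bilin K V W U \<beta>"
  shows "lin_map K T U (tlift U \<beta>)"
proof -
  interpret U: module K U by fact
  interpret T: module K T by (rule tensor_module)
  have hom: "tlift U \<beta> \<in> hom G (add_monoid U)"
    by (rule tlift_hom[OF U.abelian_group_axioms bilin_balanced[OF U b]])
  have cl: "tlift U \<beta> x \<in> carrier U" if "x \<in> carrier T" for x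
    using hom that by (auto simp: hom_def tensor_sel)
  have ad: "tlift U \<beta> (x \<oplus>\<^bsub>T\<^esub> y) = tlift U \<beta> x \<oplus>\<^bsub>U\<^esub> tlift U \<beta> y" if "x \<in> carrier T" "y \<in> carrier T" for x y
    using hom that by (auto simp: hom_def tensor_sel)
  have z: "tlift U \<beta> \<zero>\<^bsub>T\<^esub> = \<zero>\<^bsub>U\<^esub>"
    using ad[of "\<zero>\<^bsub>T\<^esub>" "\<zero>\<^bsub>T\<^esub>"] cl[of "\<zero>\<^bsub>T\<^esub>"] U.add.l_cancel_one[of "tlift U \<beta> \<zero>\<^bsub>T\<^esub>" "tlift U \<beta> \<zero>\<^bsub>T\<^esub>"] by simp
  have "tlift U \<beta> (c \<odot>\<^bsub>T\<^esub> x) = c \<odot>\<^bsub>U\<^esub> tlift U \<beta> x" if c: "c \<in> carrier K" and x: "x \<in> carrier T" for c x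
    using x
  proof (induction x rule: induct_tens)
    case zero then show ?case using c z by simp
  next
    case (tens v w)
    then show ?case using c b unfolding bilin_def
      by (simp add: smult_tens tlift_tens[OF U b] lin_map_smult[of K V U "\<lambda>v. \<beta> v w"])
  next
    case (add x y)
    then show ?case using c by (simp add: T.smult_r_distr ad cl U.smult_r_distr)
  qed
  then show ?thesis using cl ad by (intro lin_mapI)
qed

end

lemma module_tensor [lin]: "module K V \<Longrightarrow> module K W \<Longrightarrow> module K (tensor K V W)"
  by (rule two_modules.tensor_module) (simp add: two_modules_def)

lemma tens_closed [lin]:
  "module K V \<Longrightarrow> module K W \<Longrightarrow> v \<in> carrier V \<Longrightarrow> w \<in> carrier W \<Longrightarrow> tens K V W v w \<in> carrier (tensor K V W)"
  by (rule two_modules.tens_closed) (simp add: two_modules_def)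

lemma tensor_induct [consumes 3, case_names zero tens add]:
  assumes "module K V" "module K W"
    and X: "X \<in> carrier (tensor K V W)" and "P \<zero>\<^bsub>tensor K V W\<^esub>"
    and "\<And>v w. v \<in> carrier V \<Longrightarrow> w \<in> carrier W \<Longrightarrow> P (tens K V W v w)"
    and "\<And>x y. x \<in> carrier (tensor K V W) \<Longrightarrow> y \<in> carrier (tensor K V W) \<Longrightarrow> P x \<Longrightarrow> P y \<Longrightarrow>
      P (x \<oplus>\<^bsub>tensor K V W\<^esub> y)"
  shows "P X"
  by (rule two_modules.induct_tens[of K V W]) (use assms in \<open>simp_all add: two_modules_def\<close>)

lemma tlift_tens:
  "module K V \<Longrightarrow> module K W \<Longrightarrow> module K U \<Longrightarrow> bilin K V W U \<beta> \<Longrightarrow> v \<in> carrier V \<Longrightarrow> w \<in> carrier W \<Longrightarrow>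
    tlift U \<beta> (tens K V W v w) = \<beta> v w"
  by (rule two_modules.tlift_tens) (simp_all add: two_modules_def)

text \<open>The inner linear map \<open>f\<close> gives the rule the shape shared by the rules for
  maps in \<open>lin\<close>: the method \<open>(assumption | rule lin)+\<close> can then peel a
  composite expression from the outside.\<close>

lemma lin_map_tlift [lin]:
  assumes "lin_map K X (tensor K V W) f" "module K V" "module K W" "module K U" "bilin K V W U \<beta>"
  shows "lin_map K X U (\<lambda>x. tlift U \<beta> (f x))"
  by (rule lin_map_comp[OF two_modules.lin_map_tlift]) (use assms in \<open>simp_all add: two_modules_def\<close>)

lemma lin_map_tlift': "module K V \<Longrightarrow> module K W \<Longrightarrow> module K U \<Longrightarrow> bilin K V W U \<beta> \<Longrightarrow>
    lin_map K (tensor K V W) U (tlift U \<beta>)"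
  using lin_map_tlift[OF lin_map_ident] .

lemma tlift_closed [lin]:
  "x \<in> carrier (tensor K V W) \<Longrightarrow> module K V \<Longrightarrow> module K W \<Longrightarrow> module K U \<Longrightarrow> bilin K V W U \<beta> \<Longrightarrow> tlift U \<beta> x \<in> carrier U"
  by (rule lin_map_closed[OF lin_map_tlift'])

lemma lin_map_tens_left [lin]:
  assumes "module K V" "module K W" "w \<in> carrier W" "lin_map K X V f"
  shows "lin_map K X (tensor K V W) (\<lambda>x. tens K V W (f x) w)"
proof (rule lin_map_comp[OF _ assms(4)])
  interpret two_modules K V W using assms by (simp add: two_modules_def)
  show "lin_map K V (tensor K V W) (\<lambda>v. tens K V W v w)"
    by (rule lin_mapI) (simp_all add: tens_closed tens_add_left smult_tens assms)
qed

lemma lin_map_tens_right [lin]: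
  assumes "module K V" "module K W" "v \<in> carrier V" "lin_map K X W f"
  shows "lin_map K X (tensor K V W) (\<lambda>x. tens K V W v (f x))"
proof (rule lin_map_comp[OF _ assms(4)])
  interpret two_modules K V W using assms by (simp add: two_modules_def)
  show "lin_map K W (tensor K V W) (tens K V W v)"
    by (rule lin_mapI) (simp_all add: tens_closed tens_add_right smult_tens tens_balanced assms)
qed

text \<open>Pure tensors generate additively, so linear maps agreeing on them agree. Almost every
  identity below is proved by this rule, with the linearity of both sides as the side
  conditions.\<close>

lemma tensor_eqI:
  assumes "lin_map K (tensor K V W) U f" "lin_map K (tensor K V W) U g"
    and "module K V" "module K W" "module K U"
    and "\<And>v w. v \<in> carrier V \<Longrightarrow> w \<in> carrier W \<Longrightarrow> f (tens K V W v w) = g (tens K V W v w)"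
    and "X \<in> carrier (tensor K V W)"
  shows "f X = g X"
  using assms(3,4,7)
proof (induction X rule: tensor_induct)
  case zero
  then show ?case
    using lin_map_zero[OF module_tensor[OF assms(3,4)] assms(5) assms(1)]
      lin_map_zero[OF module_tensor[OF assms(3,4)] assms(5) assms(2)] by simp
next
  case (tens v w)
  then show ?case by (rule assms)
next
  case (add x y)
  then show ?case by (simp add: lin_map_add[OF assms(1)] lin_map_add[OF assms(2)])
qed

lemma tlift_cong:
  assumes "X \<in> carrier (tensor K V W)" "module K V" "module K W" "module K U" "bilin K V W U \<beta>" "bilin K V W U \<beta>'"
    "\<And>v w. v \<in> carrier V \<Longrightarrow> w \<in> carrier W \<Longrightarrow> \<beta> v w = \<beta>' v w"
  shows "tlift U \<beta> X = tlift U \<beta>' X"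
  by (rule tensor_eqI[of K V W U "tlift U \<beta>" "tlift U \<beta>'"])
    (use assms in \<open>simp_all add: tlift_tens lin_map_tlift'\<close>)

lemma lin_map_tlift_apply:
  assumes "lin_map K U U' f" "X \<in> carrier (tensor K V W)" "module K V" "module K W" "module K U" "module K U'" "bilin K V W U \<beta>"
  shows "f (tlift U \<beta> X) = tlift U' (\<lambda>v w. f (\<beta> v w)) X"
proof -
  have b: "bilin K V W U' (\<lambda>v w. f (\<beta> v w))"
    using assms(7) unfolding bilin_def by (auto intro: lin_map_comp[OF assms(1)])
  show ?thesis
    by (rule tensor_eqI[of K V W U' "\<lambda>X. f (tlift U \<beta> X)" "tlift U' (\<lambda>v w. f (\<beta> v w))"])
     (use assms b in \<open>simp_all add: tlift_tens lin_map_tlift' lin_map_comp[OF assms(1)]\<close>)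
qed

text \<open>The tensor is fixed and the bilinear map varies, complementing
  \<open>lin_map_tlift\<close>. Both are needed for nested Sweedler sums, whose inner integrands
  depend on the outer variables.\<close>

lemma lin_map_tlift_param [lin]:
  assumes "X \<in> carrier (tensor K V W)" "module K V" "module K W" "module K U" "module K Y"
    and "\<And>v w. v \<in> carrier V \<Longrightarrow> w \<in> carrier W \<Longrightarrow> lin_map K Y U (\<lambda>y. \<beta> y v w)"
    and b: "\<And>y. y \<in> carrier Y \<Longrightarrow> bilin K V W U (\<beta> y)"
  shows "lin_map K Y U (\<lambda>y. tlift U (\<beta> y) X)"
proof (rule lin_mapI)
  interpret U: module K U by fact
  interpret Y: module K Y by fact
  fix x assume "x \<in> carrier Y"
  then show "tlift U (\<beta> x) X \<in> carrier U" using assms(1-4) b by (intro tlift_closed)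
next
  interpret U: module K U by fact
  interpret Y: module K Y by fact
  fix x y assume x: "x \<in> carrier Y" and y: "y \<in> carrier Y"
  then have xy: "x \<oplus>\<^bsub>Y\<^esub> y \<in> carrier Y" by simp
  show "tlift U (\<beta> (x \<oplus>\<^bsub>Y\<^esub> y)) X = tlift U (\<beta> x) X \<oplus>\<^bsub>U\<^esub> tlift U (\<beta> y) X"
    by (rule tensor_eqI[of K V W U "tlift U (\<beta> (x \<oplus>\<^bsub>Y\<^esub> y))" "\<lambda>X. tlift U (\<beta> x) X \<oplus>\<^bsub>U\<^esub> tlift U (\<beta> y) X"])
      (use assms x y xy in \<open>auto simp: tlift_tens lin_map_tlift' lin_map_sum lin_map_add[OF assms(6)]\<close>)
next
  interpret U: module K U by fact
  interpret Y: module K Y by fact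
  fix c x assume c: "c \<in> carrier K" and x: "x \<in> carrier Y"
  then have cx: "c \<odot>\<^bsub>Y\<^esub> x \<in> carrier Y" by simp
  show "tlift U (\<beta> (c \<odot>\<^bsub>Y\<^esub> x)) X = c \<odot>\<^bsub>U\<^esub> tlift U (\<beta> x) X"
    by (rule tensor_eqI[of K V W U "tlift U (\<beta> (c \<odot>\<^bsub>Y\<^esub> x))" "\<lambda>X. c \<odot>\<^bsub>U\<^esub> tlift U (\<beta> x) X"])
      (use assms c x cx in \<open>auto simp: tlift_tens lin_map_tlift' lin_map_scale lin_map_smult[OF assms(6)]\<close>)
qed

lemma bilin_tens_comp:
  "lin_map K A V f \<Longrightarrow> lin_map K B W g \<Longrightarrow> module K V \<Longrightarrow> module K W \<Longrightarrow>
    bilin K A B (tensor K V W) (\<lambda>a b. tens K V W (f a) (g b))"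
  by (rule bilinI) (auto intro!: lin_map_tens_left lin_map_tens_right dest: lin_map_closed)

lemma lin_map_tmap [lin]:
  "lin_map K X (tensor K A B) h \<Longrightarrow> lin_map K A V f \<Longrightarrow> lin_map K B W g \<Longrightarrow>
    module K A \<Longrightarrow> module K B \<Longrightarrow> module K V \<Longrightarrow> module K W \<Longrightarrow>
    lin_map K X (tensor K V W) (\<lambda>x. tmap K V W f g (h x))"
  unfolding tmap_def by (intro lin_map_tlift bilin_tens_comp module_tensor)

lemma lin_map_tmap_left [lin]:
  assumes "Z \<in> carrier (tensor K A B)" "lin_map K B W g" "module K A" "module K B" "module K V" "module K W" "module K X"
    "\<And>a. a \<in> carrier A \<Longrightarrow> lin_map K X V (\<lambda>x. f x a)" "\<And>x. x \<in> carrier X \<Longrightarrow> lin_map K A V (f x)"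
  shows "lin_map K X (tensor K V W) (\<lambda>x. tmap K V W (f x) g Z)"
  unfolding tmap_def
  by (rule lin_map_tlift_param[OF assms(1)])
    (use assms in \<open>auto intro!: bilin_tens_comp module_tensor lin_map_tens_left dest: lin_map_closed\<close>)

lemma lin_map_tmap_right [lin]:
  assumes "Z \<in> carrier (tensor K A B)" "lin_map K A V f" "module K A" "module K B" "module K V" "module K W" "module K X"
    "\<And>b. b \<in> carrier B \<Longrightarrow> lin_map K X W (\<lambda>x. g x b)" "\<And>x. x \<in> carrier X \<Longrightarrow> lin_map K B W (g x)"
  shows "lin_map K X (tensor K V W) (\<lambda>x. tmap K V W f (g x) Z)"
  unfolding tmap_def
  by (rule lin_map_tlift_param[OF assms(1)])
    (use assms in \<open>auto intro!: bilin_tens_comp module_tensor lin_map_tens_right dest: lin_map_closed\<close>)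

lemma tmap_closed [lin]:
  "Z \<in> carrier (tensor K A B) \<Longrightarrow> lin_map K A V f \<Longrightarrow> lin_map K B W g \<Longrightarrow>
    module K A \<Longrightarrow> module K B \<Longrightarrow> module K V \<Longrightarrow> module K W \<Longrightarrow>
    tmap K V W f g Z \<in> carrier (tensor K V W)"
  by (rule lin_map_closed[OF lin_map_tmap[OF lin_map_ident]])

lemma tmap_tens:
  "lin_map K A V f \<Longrightarrow> lin_map K B W g \<Longrightarrow> module K A \<Longrightarrow> module K B \<Longrightarrow> module K V \<Longrightarrow> module K W \<Longrightarrow>
    a \<in> carrier A \<Longrightarrow> b \<in> carrier B \<Longrightarrow> tmap K V W f g (tens K A B a b) = tens K V W (f a) (g b)"
  unfolding tmap_def by (subst tlift_tens[where U="tensor K V W"]) (auto intro!: bilin_tens_comp module_tensor)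

lemma tmap_tmap:
  assumes "Z \<in> carrier (tensor K X Y)" "lin_map K X A f'" "lin_map K Y B g'" "lin_map K A V f" "lin_map K B W g"
    "module K X" "module K Y" "module K A" "module K B" "module K V" "module K W"
  shows "tmap K V W f g (tmap K A B f' g' Z) = tmap K V W (\<lambda>x. f (f' x)) (\<lambda>y. g (g' y)) Z"
  by (rule tensor_eqI[of K X Y "tensor K V W" "\<lambda>Z. tmap K V W f g (tmap K A B f' g' Z)"])
    (use assms lin_map_comp[OF assms(4,2)] lin_map_comp[OF assms(5,3)] in
      \<open>auto intro!: lin_map_tmap module_tensor lin_map_ident simp: tmap_tens lin_map_closed\<close>)

lemma tmap_cong:
  assumes "Z \<in> carrier (tensor K A B)" "lin_map K A V f" "lin_map K B W g"
    "module K A" "module K B" "module K V" "module K W"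
    "\<And>a. a \<in> carrier A \<Longrightarrow> f a = f' a" "\<And>b. b \<in> carrier B \<Longrightarrow> g b = g' b"
  shows "tmap K V W f g Z = tmap K V W f' g' Z"
proof -
  have "lin_map K A V f'" "lin_map K B W g'"
    using lin_map_cong[OF assms(4,2,8)] lin_map_cong[OF assms(5,3,9)] by auto
  then show ?thesis
    by (intro tensor_eqI[of K A B "tensor K V W" "tmap K V W f g" "tmap K V W f' g'" Z])
      (use assms in \<open>auto intro!: lin_map_tmap[OF lin_map_ident] module_tensor simp: tmap_tens\<close>)
qed

lemma tmap_ident:
  assumes "Z \<in> carrier (tensor K V W)" "module K V" "module K W"
  shows "tmap K V W (\<lambda>v. v) (\<lambda>w. w) Z = Z"
  by (rule tensor_eqI[of K V W "tensor K V W" "tmap K V W (\<lambda>v. v) (\<lambda>w. w)" "\<lambda>x. x" Z])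
    (use assms in \<open>auto intro!: lin_map_tmap[OF lin_map_ident] module_tensor lin_map_ident simp: tmap_tens lin_map_ident\<close>)

lemma tensor_eqI3_right:
  assumes "lin_map K (tensor K A (tensor K B C)) U f" "lin_map K (tensor K A (tensor K B C)) U g"
    and m: "module K A" "module K B" "module K C" "module K U"
    and e: "\<And>a b c. a \<in> carrier A \<Longrightarrow> b \<in> carrier B \<Longrightarrow> c \<in> carrier C \<Longrightarrow>
      f (tens K A (tensor K B C) a (tens K B C b c)) = g (tens K A (tensor K B C) a (tens K B C b c))"
    and "X \<in> carrier (tensor K A (tensor K B C))"
  shows "f X = g X"
proof (rule tensor_eqI[OF assms(1,2)])
  fix a y assume a: "a \<in> carrier A" and y: "y \<in> carrier (tensor K B C)"
  show "f (tens K A (tensor K B C) a y) = g (tens K A (tensor K B C) a y)"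
    by (rule tensor_eqI[OF _ _ m(2,3,4) _ y]) (use a e in \<open>auto intro!: lin_map_comp[OF assms(1)]
      lin_map_comp[OF assms(2)] lin_map_tens_right[OF _ _ _ lin_map_ident] m module_tensor\<close>)
qed (use assms in \<open>auto intro: module_tensor\<close>)

lemma tensor_eqI3_left:
  assumes "lin_map K (tensor K (tensor K A B) C) U f" "lin_map K (tensor K (tensor K A B) C) U g"
    and m: "module K A" "module K B" "module K C" "module K U"
    and e: "\<And>a b c. a \<in> carrier A \<Longrightarrow> b \<in> carrier B \<Longrightarrow> c \<in> carrier C \<Longrightarrow>
      f (tens K (tensor K A B) C (tens K A B a b) c) = g (tens K (tensor K A B) C (tens K A B a b) c)"
    and "X \<in> carrier (tensor K (tensor K A B) C)"
  shows "f X = g X"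
proof (rule tensor_eqI[OF assms(1,2)])
  fix x c assume x: "x \<in> carrier (tensor K A B)" and c: "c \<in> carrier C"
  have 1: "lin_map K (tensor K A B) U (\<lambda>x. f (tens K (tensor K A B) C x c))"
    by (rule lin_map_comp[OF assms(1)]) (use c m in \<open>auto intro!: lin_map_tens_left lin_map_ident module_tensor\<close>)
  have 2: "lin_map K (tensor K A B) U (\<lambda>x. g (tens K (tensor K A B) C x c))"
    by (rule lin_map_comp[OF assms(2)]) (use c m in \<open>auto intro!: lin_map_tens_left lin_map_ident module_tensor\<close>)
  show "f (tens K (tensor K A B) C x c) = g (tens K (tensor K A B) C x c)"
    by (rule tensor_eqI[OF 1 2 m(1,2,4) _ x]) (use c e in auto)
qed (use assms in \<open>auto intro: module_tensor\<close>)

lemma tensor_eqI4: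
  assumes "lin_map K (tensor K (tensor K A B) (tensor K C D)) U f"
    "lin_map K (tensor K (tensor K A B) (tensor K C D)) U g"
    and m: "module K A" "module K B" "module K C" "module K D" "module K U"
    and e: "\<And>a b c d. a \<in> carrier A \<Longrightarrow> b \<in> carrier B \<Longrightarrow> c \<in> carrier C \<Longrightarrow> d \<in> carrier D \<Longrightarrow>
      f (tens K (tensor K A B) (tensor K C D) (tens K A B a b) (tens K C D c d)) =
      g (tens K (tensor K A B) (tensor K C D) (tens K A B a b) (tens K C D c d))"
    and "X \<in> carrier (tensor K (tensor K A B) (tensor K C D))"
  shows "f X = g X"
proof (rule tensor_eqI3_left[OF assms(1,2)])
  fix a b y assume a: "a \<in> carrier A" "b \<in> carrier B" and y: "y \<in> carrier (tensor K C D)"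
  let ?t = "tens K (tensor K A B) (tensor K C D) (tens K A B a b)"
  have 1: "lin_map K (tensor K C D) U (\<lambda>x. f (?t x))"
    by (rule lin_map_comp[OF assms(1)]) (use a m in \<open>auto intro!: lin_map_tens_right[OF _ _ _ lin_map_ident] module_tensor tens_closed\<close>)
  have 2: "lin_map K (tensor K C D) U (\<lambda>x. g (?t x))"
    by (rule lin_map_comp[OF assms(2)]) (use a m in \<open>auto intro!: lin_map_tens_right[OF _ _ _ lin_map_ident] module_tensor tens_closed\<close>)
  show "f (?t y) = g (?t y)"
    by (rule tensor_eqI[OF 1 2 m(3,4,5) _ y]) (use a e in auto)
qed (use assms in \<open>auto intro: module_tensor\<close>)

section \<open>Rebracketing and interchange of tensor factors\<close>

lemma bilin_assoc_iso:
  assumes m: "module K U" "module K V" "module K W"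
  shows "bilin K U (tensor K V W) (tensor K (tensor K U V) W)
      (\<lambda>u. tlift (tensor K (tensor K U V) W)
        (\<lambda>v w. tens K (tensor K U V) W (tens K U V u v) w))"
  using m by (intro bilinI) (assumption | rule lin)+

lemma lin_map_assoc_iso:
  assumes m: "module K U" "module K V" "module K W"
  shows "lin_map K (tensor K U (tensor K V W)) (tensor K (tensor K U V) W) (assoc_iso K U V W)"
  unfolding assoc_iso_def using m by (intro lin_map_tlift' module_tensor bilin_assoc_iso)

lemmas lin_map_assoc_iso_comp [lin] = lin_map_comp[OF lin_map_assoc_iso]

lemma assoc_iso_tens:
  assumes m: "module K U" "module K V" "module K W" and u: "u \<in> carrier U" "v \<in> carrier V" "w \<in> carrier W"
  shows "assoc_iso K U V W (tens K U (tensor K V W) u (tens K V W v w)) = tens K (tensor K U V) W (tens K U V u v) w"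
proof -
  have b: "bilin K V W (tensor K (tensor K U V) W) (\<lambda>v w. tens K (tensor K U V) W (tens K U V u v) w)"
    using m u by (intro bilinI) (assumption | rule lin)+
  show ?thesis
    unfolding assoc_iso_def using m u b
    by (simp add: tlift_tens[where U="tensor K (tensor K U V) W"] bilin_assoc_iso module_tensor tens_closed)
qed

definition assoc_inv where
  "assoc_inv K U V W =
    tlift (tensor K U (tensor K V W))
      (\<lambda>x w. tlift (tensor K U (tensor K V W))
        (\<lambda>u v. tens K U (tensor K V W) u (tens K V W v w)) x)"

lemma bilin_assoc_inv:
  assumes m: "module K U" "module K V" "module K W"
  shows "bilin K (tensor K U V) W (tensor K U (tensor K V W))
      (\<lambda>x w. tlift (tensor K U (tensor K V W))
        (\<lambda>u v. tens K U (tensor K V W) u (tens K V W v w)) x)"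
  using m by (intro bilinI) (assumption | rule lin)+

lemma lin_map_assoc_inv:
  assumes m: "module K U" "module K V" "module K W"
  shows "lin_map K (tensor K (tensor K U V) W) (tensor K U (tensor K V W)) (assoc_inv K U V W)"
  unfolding assoc_inv_def using m by (intro lin_map_tlift' module_tensor bilin_assoc_inv)

lemmas lin_map_assoc_inv_comp [lin] = lin_map_comp[OF lin_map_assoc_inv]

lemma assoc_inv_tens:
  assumes m: "module K U" "module K V" "module K W" and u: "u \<in> carrier U" "v \<in> carrier V" "w \<in> carrier W"
  shows "assoc_inv K U V W (tens K (tensor K U V) W (tens K U V u v) w) = tens K U (tensor K V W) u (tens K V W v w)"
proof -
  have b: "bilin K U V (tensor K U (tensor K V W)) (\<lambda>u v. tens K U (tensor K V W) u (tens K V W v w))"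
    using m u by (intro bilinI) (assumption | rule lin)+
  show ?thesis
    unfolding assoc_inv_def using m u b
    by (simp add: tlift_tens[where U="tensor K U (tensor K V W)"] bilin_assoc_inv module_tensor tens_closed)
qed

lemma assoc_inv_assoc_iso:
  assumes m: "module K U" "module K V" "module K W" and x: "x \<in> carrier (tensor K U (tensor K V W))"
  shows "assoc_inv K U V W (assoc_iso K U V W x) = x"
proof (rule tensor_eqI3_right[OF _ _ m _ _ x])
  show "lin_map K (tensor K U (tensor K V W)) (tensor K U (tensor K V W)) (\<lambda>x. assoc_inv K U V W (assoc_iso K U V W x))"
    using m by - (assumption | rule lin)+
qed (use m in \<open>auto simp: assoc_iso_tens assoc_inv_tens intro: module_tensor lin_map_ident\<close>)

text \<open>This is \<open>shuffle\<close> with four independent spaces. The inverse is then another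
  instance, with \<open>B\<close> and \<open>C\<close> exchanged, and one set of lemmas serves both
  directions.\<close>

definition interchange where
  "interchange K A B C D =
    (let T = tensor K (tensor K A C) (tensor K B D) in
     tlift T (\<lambda>x y.
       tlift T (\<lambda>a b.
         tlift T (\<lambda>c d. tens K (tensor K A C) (tensor K B D) (tens K A C a c) (tens K B D b d)) y) x))"

lemma bilin_interchange1:
  assumes m: "module K A" "module K B" "module K C" "module K D" and a: "a \<in> carrier A" "b \<in> carrier B"
  shows "bilin K C D (tensor K (tensor K A C) (tensor K B D))
    (\<lambda>c d. tens K (tensor K A C) (tensor K B D) (tens K A C a c) (tens K B D b d))"
  using m a by (intro bilinI) (assumption | rule lin)+

lemma bilin_interchange2:
  assumes m: "module K A" "module K B" "module K C" "module K D" and y: "y \<in> carrier (tensor K C D)"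
  shows "bilin K A B (tensor K (tensor K A C) (tensor K B D))
    (\<lambda>a b. tlift (tensor K (tensor K A C) (tensor K B D))
      (\<lambda>c d. tens K (tensor K A C) (tensor K B D) (tens K A C a c) (tens K B D b d)) y)"
  using m y by (intro bilinI) (assumption | rule lin)+

lemma bilin_interchange3:
  assumes m: "module K A" "module K B" "module K C" "module K D"
  shows "bilin K (tensor K A B) (tensor K C D) (tensor K (tensor K A C) (tensor K B D))
    (\<lambda>x y. tlift (tensor K (tensor K A C) (tensor K B D)) (\<lambda>a b. tlift (tensor K (tensor K A C) (tensor K B D))
      (\<lambda>c d. tens K (tensor K A C) (tensor K B D) (tens K A C a c) (tens K B D b d)) y) x)"
  using m by (intro bilinI) (assumption | rule lin)+

lemma lin_map_interchange:
  assumes m: "module K A" "module K B" "module K C" "module K D"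
  shows "lin_map K (tensor K (tensor K A B) (tensor K C D)) (tensor K (tensor K A C) (tensor K B D)) (interchange K A B C D)"
  unfolding interchange_def Let_def using m by (intro lin_map_tlift' module_tensor bilin_interchange3)

lemmas lin_map_interchange_comp [lin] = lin_map_comp[OF lin_map_interchange]

lemma interchange_tens:
  assumes m: "module K A" "module K B" "module K C" "module K D"
    and u: "a \<in> carrier A" "b \<in> carrier B" "c \<in> carrier C" "d \<in> carrier D"
  shows "interchange K A B C D (tens K (tensor K A B) (tensor K C D) (tens K A B a b) (tens K C D c d)) =
    tens K (tensor K A C) (tensor K B D) (tens K A C a c) (tens K B D b d)"
  unfolding interchange_def Let_def using m u
  by (simp add: tlift_tens[where U="tensor K (tensor K A C) (tensor K B D)"] bilin_interchange1
      bilin_interchange2 bilin_interchange3 module_tensor tens_closed)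

lemma interchange_interchange:
  assumes m: "module K A" "module K B" "module K C" "module K D"
    and x: "x \<in> carrier (tensor K (tensor K A B) (tensor K C D))"
  shows "interchange K A C B D (interchange K A B C D x) = x"
proof (rule tensor_eqI4[OF _ _ m _ _ x])
  show "lin_map K (tensor K (tensor K A B) (tensor K C D)) (tensor K (tensor K A B) (tensor K C D))
      (\<lambda>x. interchange K A C B D (interchange K A B C D x))"
    using m by - (assumption | rule lin)+
qed (use m in \<open>auto simp: interchange_tens intro: module_tensor lin_map_ident\<close>)

lemma shuffle_interchange: "shuffle K M H = interchange K M M H H"
  unfolding shuffle_def interchange_def Let_def ..


section \<open>The tensor product algebra\<close>

text \<open>\<open>tlift\<close> depends only on the carrier, zero and addition of its target, and
  there the two records coincide. The multiplication of \<open>tensor\<close> can thus be treated as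
  a lift into a genuine module.\<close>

lemma tlift_tensor_add: "tlift (tensor_add K V W) = tlift (tensor K V W)"
proof -
  have "carrier (tensor_add K V W) = carrier (tensor K V W)" "ring.zero (tensor_add K V W) = ring.zero (tensor K V W)"
    "ring.add (tensor_add K V W) = ring.add (tensor K V W)"
    by (simp_all add: tensor_def)
  then show ?thesis
    unfolding tlift_def finsum_def finprod_def add_pow_def int_pow_def nat_pow_def m_inv_def Let_def
    by (simp only: monoid.simps partial_object.simps)
qed

lemma tensor_mult_def:
  "X \<otimes>\<^bsub>tensor K A B\<^esub> Y = tlift (tensor K A B) (\<lambda>a b. tlift (tensor K A B)
      (\<lambda>a' b'. tens K A B (a \<otimes>\<^bsub>A\<^esub> a') (b \<otimes>\<^bsub>B\<^esub> b')) Y) X"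
  unfolding tlift_tensor_add[symmetric] by (simp add: tensor_def)

lemma one_tensor: "\<one>\<^bsub>tensor K A B\<^esub> = tens K A B \<one>\<^bsub>A\<^esub> \<one>\<^bsub>B\<^esub>"
  by (simp add: tensor_def)

lemma alg_mult_closed [lin]: "k_algebra K A \<Longrightarrow> x \<in> carrier A \<Longrightarrow> y \<in> carrier A \<Longrightarrow> x \<otimes>\<^bsub>A\<^esub> y \<in> carrier A"
  using ring.ring_simprules(5) k_algebra_ring by metis

lemma alg_one_closed [lin]: "k_algebra K A \<Longrightarrow> \<one>\<^bsub>A\<^esub> \<in> carrier A"
  using ring.ring_simprules(6) k_algebra_ring by metis

lemma lin_map_mult_left [lin]:
  assumes "k_algebra K A" "a \<in> carrier A" "lin_map K X A f"
  shows "lin_map K X A (\<lambda>x. f x \<otimes>\<^bsub>A\<^esub> a)"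
proof -
  interpret A: k_algebra K A by fact
  show ?thesis
    by (rule lin_map_comp[OF _ assms(3)], rule lin_mapI)
      (use assms(2) in \<open>auto simp: A.l_distr A.smult_mult_left\<close>)
qed

lemma lin_map_mult_right [lin]:
  assumes "k_algebra K A" "a \<in> carrier A" "lin_map K X A f"
  shows "lin_map K X A (\<lambda>x. a \<otimes>\<^bsub>A\<^esub> f x)"
proof -
  interpret A: k_algebra K A by fact
  show ?thesis
    by (rule lin_map_comp[OF _ assms(3)], rule lin_mapI)
      (use assms(2) in \<open>auto simp: A.r_distr A.smult_mult_right\<close>)
qed

lemma bilin_mult: "k_algebra K A \<Longrightarrow> bilin K A A A (\<lambda>a b. a \<otimes>\<^bsub>A\<^esub> b)"
  by (rule bilinI) (auto intro: lin)

context
  fixes K :: "('k, 'c) ring_scheme" and A :: "('k, 'a, 'y) module_scheme" and B :: "('k, 'b, 'z) module_scheme"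
  assumes A: "k_algebra K A" and B: "k_algebra K B"
begin

interpretation A: k_algebra K A by (rule A)
interpretation B: k_algebra K B by (rule B)

private lemmas mods = k_algebra_module[OF A] k_algebra_module[OF B]

lemma bilin_tensor_mult1: "a \<in> carrier A \<Longrightarrow> b \<in> carrier B \<Longrightarrow>
    bilin K A B (tensor K A B) (\<lambda>a' b'. tens K A B (a \<otimes>\<^bsub>A\<^esub> a') (b \<otimes>\<^bsub>B\<^esub> b'))"
  using A B mods by (intro bilinI) (assumption | rule lin)+

lemma bilin_tensor_mult2: "Y \<in> carrier (tensor K A B) \<Longrightarrow>
    bilin K A B (tensor K A B) (\<lambda>a b. tlift (tensor K A B) (\<lambda>a' b'. tens K A B (a \<otimes>\<^bsub>A\<^esub> a') (b \<otimes>\<^bsub>B\<^esub> b')) Y)"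
  using A B mods by (intro bilinI) (assumption | rule lin)+

lemma tensor_mult_tens:
  "a \<in> carrier A \<Longrightarrow> b \<in> carrier B \<Longrightarrow> a' \<in> carrier A \<Longrightarrow> b' \<in> carrier B \<Longrightarrow>
    tens K A B a b \<otimes>\<^bsub>tensor K A B\<^esub> tens K A B a' b' = tens K A B (a \<otimes>\<^bsub>A\<^esub> a') (b \<otimes>\<^bsub>B\<^esub> b')"
  unfolding tensor_mult_def using mods
  by (simp add: tlift_tens[where U="tensor K A B"] bilin_tensor_mult1 bilin_tensor_mult2 module_tensor tens_closed)

lemma lin_map_tensor_mult_left:
  "Y \<in> carrier (tensor K A B) \<Longrightarrow> lin_map K (tensor K A B) (tensor K A B) (\<lambda>X. X \<otimes>\<^bsub>tensor K A B\<^esub> Y)"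
  unfolding tensor_mult_def using mods by (intro lin_map_tlift' module_tensor bilin_tensor_mult2)

lemma lin_map_tensor_mult_right:
  assumes "X \<in> carrier (tensor K A B)"
  shows "lin_map K (tensor K A B) (tensor K A B) (\<lambda>Y. X \<otimes>\<^bsub>tensor K A B\<^esub> Y)"
  unfolding tensor_mult_def using assms mods A B by - (assumption | rule lin)+

text \<open>Each ring axiom is an identity between maps linear in every variable, so it reduces to
  pure tensors one variable at a time.\<close>

lemma k_algebra_tensor: "k_algebra K (tensor K A B)"
proof -
  let ?T = "tensor K A B"
  interpret T: module K ?T using mods by (rule module_tensor)
  have cl: "x \<otimes>\<^bsub>?T\<^esub> y \<in> carrier ?T" if "x \<in> carrier ?T" "y \<in> carrier ?T" for x y
    using lin_map_closed[OF lin_map_tensor_mult_left] that by blast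
  have tc: "tens K A B a b \<in> carrier ?T" if "a \<in> carrier A" "b \<in> carrier B" for a b
    using that mods by (intro tens_closed)
  have one: "\<one>\<^bsub>?T\<^esub> \<in> carrier ?T" by (simp add: one_tensor tc)
  have assoc: "x \<otimes>\<^bsub>?T\<^esub> y \<otimes>\<^bsub>?T\<^esub> z = x \<otimes>\<^bsub>?T\<^esub> (y \<otimes>\<^bsub>?T\<^esub> z)"
    if x: "x \<in> carrier ?T" and y: "y \<in> carrier ?T" and z: "z \<in> carrier ?T" for x y z
  proof (rule tensor_eqI[OF _ _ mods T.module_axioms _ x])
    show "lin_map K ?T ?T (\<lambda>x. x \<otimes>\<^bsub>?T\<^esub> y \<otimes>\<^bsub>?T\<^esub> z)"
      by (rule lin_map_comp[OF lin_map_tensor_mult_left lin_map_tensor_mult_left]) (use y z in auto)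
    show "lin_map K ?T ?T (\<lambda>x. x \<otimes>\<^bsub>?T\<^esub> (y \<otimes>\<^bsub>?T\<^esub> z))"
      by (rule lin_map_tensor_mult_left) (use y z cl in auto)
    fix a b assume a: "a \<in> carrier A" "b \<in> carrier B"
    show "tens K A B a b \<otimes>\<^bsub>?T\<^esub> y \<otimes>\<^bsub>?T\<^esub> z = tens K A B a b \<otimes>\<^bsub>?T\<^esub> (y \<otimes>\<^bsub>?T\<^esub> z)"
    proof (rule tensor_eqI[OF _ _ mods T.module_axioms _ y])
      show "lin_map K ?T ?T (\<lambda>y. tens K A B a b \<otimes>\<^bsub>?T\<^esub> y \<otimes>\<^bsub>?T\<^esub> z)"
        by (rule lin_map_comp[OF lin_map_tensor_mult_left lin_map_tensor_mult_right]) (use tc a z in auto)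
      show "lin_map K ?T ?T (\<lambda>y. tens K A B a b \<otimes>\<^bsub>?T\<^esub> (y \<otimes>\<^bsub>?T\<^esub> z))"
        by (rule lin_map_comp[OF lin_map_tensor_mult_right lin_map_tensor_mult_left]) (use tc a z in auto)
      fix a' b' assume a': "a' \<in> carrier A" "b' \<in> carrier B"
      show "tens K A B a b \<otimes>\<^bsub>?T\<^esub> tens K A B a' b' \<otimes>\<^bsub>?T\<^esub> z = tens K A B a b \<otimes>\<^bsub>?T\<^esub> (tens K A B a' b' \<otimes>\<^bsub>?T\<^esub> z)"
      proof (rule tensor_eqI[OF _ _ mods T.module_axioms _ z])
        show "lin_map K ?T ?T (\<lambda>z. tens K A B a b \<otimes>\<^bsub>?T\<^esub> tens K A B a' b' \<otimes>\<^bsub>?T\<^esub> z)"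
          by (rule lin_map_tensor_mult_right) (use tc cl a a' in auto)
        show "lin_map K ?T ?T (\<lambda>z. tens K A B a b \<otimes>\<^bsub>?T\<^esub> (tens K A B a' b' \<otimes>\<^bsub>?T\<^esub> z))"
          by (rule lin_map_comp[OF lin_map_tensor_mult_right lin_map_tensor_mult_right]) (use tc a a' in auto)
      qed (use a a' in \<open>simp add: tensor_mult_tens A.m_assoc B.m_assoc\<close>)
    qed
  qed
  have l1: "\<one>\<^bsub>?T\<^esub> \<otimes>\<^bsub>?T\<^esub> x = x" if x: "x \<in> carrier ?T" for x
    by (rule tensor_eqI[OF lin_map_tensor_mult_right[OF one] lin_map_ident mods T.module_axioms _ x])
      (simp add: one_tensor tensor_mult_tens)
  have r1: "x \<otimes>\<^bsub>?T\<^esub> \<one>\<^bsub>?T\<^esub> = x" if x: "x \<in> carrier ?T" for x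
    by (rule tensor_eqI[OF lin_map_tensor_mult_left[OF one] lin_map_ident mods T.module_axioms _ x])
      (simp add: one_tensor tensor_mult_tens)
  have ring: "ring ?T"
  proof (rule ringI)
    show "monoid ?T" by (rule monoidI) (use cl one assoc l1 r1 in auto)
  qed (use lin_map_add[OF lin_map_tensor_mult_left] lin_map_add[OF lin_map_tensor_mult_right] T.abelian_group_axioms in auto)
  have "k_algebra_axioms K ?T"
    by (rule k_algebra_axioms.intro)
     (use lin_map_smult[OF lin_map_tensor_mult_left] lin_map_smult[OF lin_map_tensor_mult_right] in auto)
  then show ?thesis
    using ring T.module_axioms A.field_axioms by (simp add: k_algebra_def)
qed

end

section \<open>Subspaces and quotients\<close>

lemma submodule_subset: "module K V \<Longrightarrow> submodule U K V \<Longrightarrow> U \<subseteq> carrier V"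
  using module.submoduleE(1) by metis

lemma submodule_zero: "module K V \<Longrightarrow> submodule U K V \<Longrightarrow> \<zero>\<^bsub>V\<^esub> \<in> U"
  using subgroup.one_closed[OF submodule.axioms(1)] by fastforce

lemma submodule_add: "module K V \<Longrightarrow> submodule U K V \<Longrightarrow> x \<in> U \<Longrightarrow> y \<in> U \<Longrightarrow> x \<oplus>\<^bsub>V\<^esub> y \<in> U"
  using module.submoduleE(5) by metis

lemma submodule_smult: "submodule U K V \<Longrightarrow> c \<in> carrier K \<Longrightarrow> x \<in> U \<Longrightarrow> c \<odot>\<^bsub>V\<^esub> x \<in> U"
  by (rule submodule.smult_closed)

lemma submodule_neg: "module K V \<Longrightarrow> submodule U K V \<Longrightarrow> x \<in> U \<Longrightarrow> \<ominus>\<^bsub>V\<^esub> x \<in> U"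
  using module.submoduleE(3) by metis

lemma submodule_minus: "module K V \<Longrightarrow> submodule U K V \<Longrightarrow> x \<in> U \<Longrightarrow> y \<in> U \<Longrightarrow> x \<ominus>\<^bsub>V\<^esub> y \<in> U"
  unfolding a_minus_def by (intro submodule_add submodule_neg)

lemma submoduleI':
  assumes "module K V" "U \<subseteq> carrier V" "\<zero>\<^bsub>V\<^esub> \<in> U"
    "\<And>x y. x \<in> U \<Longrightarrow> y \<in> U \<Longrightarrow> x \<oplus>\<^bsub>V\<^esub> y \<in> U" "\<And>c x. c \<in> carrier K \<Longrightarrow> x \<in> U \<Longrightarrow> c \<odot>\<^bsub>V\<^esub> x \<in> U"
  shows "submodule U K V"
proof (rule module.submoduleI[OF assms(1-3) _ assms(4,5)])
  fix a assume a: "a \<in> U"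
  interpret V: module K V by fact
  show "\<ominus>\<^bsub>V\<^esub> a \<in> U" using assms(5)[OF _ a] a assms(2) by (subst module_neg[OF assms(1)]) auto
qed

lemma submodule_carrier: "module K V \<Longrightarrow> submodule (carrier V) K V"
  by (rule module.carrier_is_submodule)

lemma module_sub [lin]: "module K V \<Longrightarrow> submodule U K V \<Longrightarrow> module K (V\<lparr>carrier := U\<rparr>)"
  by (rule submodule.submodule_is_module)

lemma lin_map_restrict_dom: "U \<subseteq> carrier V \<Longrightarrow> lin_map K V W f \<Longrightarrow> lin_map K (V\<lparr>carrier := U\<rparr>) W f"
  by (auto simp: lin_map_def Pi_iff subset_iff)

lemma lin_map_restrict_cod:
  "lin_map K V W f \<Longrightarrow> (\<And>v. v \<in> carrier V \<Longrightarrow> f v \<in> U) \<Longrightarrow> lin_map K V (W\<lparr>carrier := U\<rparr>) f"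
  by (auto simp: lin_map_def)

lemma submodule_vimage:
  assumes "module K V" "module K W" "lin_map K V W f" "submodule U K W"
  shows "submodule {v \<in> carrier V. f v \<in> U} K V"
proof -
  interpret V: module K V by fact
  show ?thesis
    by (rule submoduleI') (use assms in \<open>auto simp: lin_map_zero[OF assms(1-3)] lin_map_add[OF assms(3)]
      lin_map_smult[OF assms(3)] submodule_zero submodule_add submodule_smult\<close>)
qed

lemma submodule_image:
  assumes "module K V" "module K W" "lin_map K V W f" "submodule U K V"
  shows "submodule (f ` U) K W"
proof (rule submoduleI')
  have s: "U \<subseteq> carrier V" by (rule submodule_subset[OF assms(1,4)])
  show "f ` U \<subseteq> carrier W" using s lin_map_closed[OF assms(3)] by blast
  show "\<zero>\<^bsub>W\<^esub> \<in> f ` U"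
    using lin_map_zero[OF assms(1-3)] submodule_zero[OF assms(1,4)] by (metis imageI)
  show "x \<oplus>\<^bsub>W\<^esub> y \<in> f ` U" if "x \<in> f ` U" "y \<in> f ` U" for x y
  proof -
    from that obtain a b where "x = f a" "y = f b" "a \<in> U" "b \<in> U" by blast
    then show ?thesis using lin_map_add[OF assms(3), of a b] submodule_add[OF assms(1,4), of a b] s by (metis imageI subsetD)
  qed
  show "c \<odot>\<^bsub>W\<^esub> x \<in> f ` U" if "c \<in> carrier K" "x \<in> f ` U" for c x
  proof -
    from that obtain a where "x = f a" "a \<in> U" by blast
    then show ?thesis using lin_map_smult[OF assms(3), of c a] submodule_smult[OF assms(4), of c a] s that by (metis imageI subsetD)
  qed
qed fact

lemma submodule_ker:
  assumes "module K V" "module K W" "lin_map K V W f"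
  shows "submodule {v \<in> carrier V. f v = \<zero>\<^bsub>W\<^esub>} K V"
proof -
  interpret W: module K W by fact
  have "submodule {\<zero>\<^bsub>W\<^esub>} K W" by (rule submoduleI'[OF assms(2)]) auto
  from submodule_vimage[OF assms this] show ?thesis by simp
qed

lemma kspan_submodule:
  assumes "module K V" "S \<subseteq> carrier V"
  shows "submodule (kspan K V S) K V"
  unfolding kspan_def
  by (rule submoduleI'[OF assms(1)])
    (use submodule_carrier[OF assms(1)] assms in \<open>auto simp: submodule_zero submodule_add submodule_smult\<close>)

lemma kspan_incl: "x \<in> S \<Longrightarrow> x \<in> kspan K V S"
  by (auto simp: kspan_def)

lemma kspan_least: "submodule U K V \<Longrightarrow> S \<subseteq> U \<Longrightarrow> kspan K V S \<subseteq> U"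
  by (auto simp: kspan_def)

lemma tsub_gens_subset:
  assumes "module K V" "module K W" "A \<subseteq> carrier V" "B \<subseteq> carrier W"
  shows "{tens K V W a b | a b. a \<in> A \<and> b \<in> B} \<subseteq> carrier (tensor K V W)"
  using assms by (auto intro!: tens_closed)

lemma tsub_submodule:
  "module K V \<Longrightarrow> module K W \<Longrightarrow> A \<subseteq> carrier V \<Longrightarrow> B \<subseteq> carrier W \<Longrightarrow> submodule (tsub K V W A B) K (tensor K V W)"
  unfolding tsub_def by (intro kspan_submodule module_tensor tsub_gens_subset)

lemma tsub_subset:
  "module K V \<Longrightarrow> module K W \<Longrightarrow> A \<subseteq> carrier V \<Longrightarrow> B \<subseteq> carrier W \<Longrightarrow> tsub K V W A B \<subseteq> carrier (tensor K V W)"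
  by (rule submodule_subset[OF module_tensor tsub_submodule])

lemma tsub_tens: "a \<in> A \<Longrightarrow> b \<in> B \<Longrightarrow> tens K V W a b \<in> tsub K V W A B"
  unfolding tsub_def by (rule kspan_incl) blast

lemma tsub_least:
  "submodule U K (tensor K V W) \<Longrightarrow> (\<And>a b. a \<in> A \<Longrightarrow> b \<in> B \<Longrightarrow> tens K V W a b \<in> U) \<Longrightarrow> tsub K V W A B \<subseteq> U"
  unfolding tsub_def by (rule kspan_least) auto

text \<open>The preimage of \<open>U\<close> under \<open>f\<close> is a subspace, and it contains
  the span once it contains the generators. This is the working rule for all statements that a map
  sends one \<open>tsub\<close> into a given subspace.\<close>

lemma lin_map_tsub:
  assumes x: "x \<in> tsub K V W A B" and f: "lin_map K (tensor K V W) X f"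
    and m: "module K V" "module K W" "module K X" and U: "submodule U K X"
    and s: "A \<subseteq> carrier V" "B \<subseteq> carrier W"
    and g: "\<And>a b. a \<in> A \<Longrightarrow> b \<in> B \<Longrightarrow> f (tens K V W a b) \<in> U"
  shows "f x \<in> U"
proof -
  have "tsub K V W A B \<subseteq> {x \<in> carrier (tensor K V W). f x \<in> U}"
    by (rule tsub_least[OF submodule_vimage[OF module_tensor[OF m(1,2)] m(3) f U]])
      (use m s g in \<open>auto intro!: tens_closed\<close>)
  then show ?thesis using x by blast
qed

lemma tmap_tsub:
  assumes "x \<in> tsub K A B A' B'" "A' \<subseteq> carrier A" "B' \<subseteq> carrier B"
    "lin_map K A V f" "lin_map K B W g" "module K A" "module K B" "module K V" "module K W"
    "V' \<subseteq> carrier V" "W' \<subseteq> carrier W"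
    "\<And>a. a \<in> A' \<Longrightarrow> f a \<in> V'" "\<And>b. b \<in> B' \<Longrightarrow> g b \<in> W'"
  shows "tmap K V W f g x \<in> tsub K V W V' W'"
  by (rule lin_map_tsub[OF assms(1) lin_map_tmap[OF lin_map_ident]])
    (use assms in \<open>auto simp: tmap_tens subset_iff intro!: tsub_submodule tsub_tens module_tensor\<close>)

lemma tsub_full:
  assumes "module K V" "module K W"
  shows "tsub K V W (carrier V) (carrier W) = carrier (tensor K V W)"
proof
  show "tsub K V W (carrier V) (carrier W) \<subseteq> carrier (tensor K V W)"
    using assms by (intro tsub_subset) auto
  show "carrier (tensor K V W) \<subseteq> tsub K V W (carrier V) (carrier W)"
  proof
    fix x assume x: "x \<in> carrier (tensor K V W)"
    have s: "submodule (tsub K V W (carrier V) (carrier W)) K (tensor K V W)"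
      using assms by (intro tsub_submodule) auto
    show "x \<in> tsub K V W (carrier V) (carrier W)"
      using assms x
      by (induction x rule: tensor_induct)
        (use submodule_zero[OF module_tensor[OF assms] s] submodule_add[OF module_tensor[OF assms] s] in
          \<open>auto intro: tsub_tens\<close>)
  qed
qed

lemma tmap_in_tsub:
  assumes "x \<in> carrier (tensor K A B)"
    "lin_map K A V f" "lin_map K B W g" "module K A" "module K B" "module K V" "module K W"
    "V' \<subseteq> carrier V" "W' \<subseteq> carrier W"
    "\<And>a. a \<in> carrier A \<Longrightarrow> f a \<in> V'" "\<And>b. b \<in> carrier B \<Longrightarrow> g b \<in> W'"
  shows "tmap K V W f g x \<in> tsub K V W V' W'"
  by (rule tmap_tsub[where A'="carrier A" and B'="carrier B"]) (use assms in \<open>auto simp: tsub_full\<close>)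

lemma tsub_mono:
  assumes "module K V" "module K W" "A' \<subseteq> carrier V" "B' \<subseteq> carrier W" "A \<subseteq> A'" "B \<subseteq> B'"
  shows "tsub K V W A B \<subseteq> tsub K V W A' B'"
  using assms by (intro tsub_least tsub_submodule) (auto intro: tsub_tens)

text \<open>The retraction is the projection along a complement of \<open>U\<close>, which Zorn's
  lemma provides in any dimension as a maximal subspace meeting \<open>U\<close> only in
  zero.\<close>

lemma exists_retraction:
  assumes K: "field K" and V: "module K V" and U: "submodule U K V"
  obtains r where "lin_map K V (V\<lparr>carrier := U\<rparr>) r" "\<And>u. u \<in> U \<Longrightarrow> r u = u"
proof -
  interpret K: field K by fact
  interpret V: module K V by fact
  note Usub = submodule_subset[OF V U]
  define CC where "CC = {C. submodule C K V \<and> C \<inter> U = {\<zero>\<^bsub>V\<^esub>}}"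
  have "\<exists>C\<in>CC. \<forall>X\<in>CC. C \<subseteq> X \<longrightarrow> X = C"
  proof (rule subset_Zorn_nonempty)
    have "submodule {\<zero>\<^bsub>V\<^esub>} K V" by (rule submoduleI'[OF V]) auto
    moreover have "{\<zero>\<^bsub>V\<^esub>} \<inter> U = {\<zero>\<^bsub>V\<^esub>}" using submodule_zero[OF V U] by simp
    ultimately have "{\<zero>\<^bsub>V\<^esub>} \<in> CC" unfolding CC_def by simp
    then show "CC \<noteq> {}" by (metis empty_iff)
    fix \<C> assume ne: "\<C> \<noteq> {}" and ch: "subset.chain CC \<C>"
    have sub: "\<C> \<subseteq> CC" and tot: "\<And>C D. C \<in> \<C> \<Longrightarrow> D \<in> \<C> \<Longrightarrow> C \<subseteq> D \<or> D \<subseteq> C"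
      using ch by (simp_all add: subset_chain_def)
    have c: "submodule C K V" "C \<inter> U = {\<zero>\<^bsub>V\<^esub>}" if "C \<in> \<C>" for C
      using subsetD[OF sub that] by (simp_all add: CC_def)
    obtain C0 where C0: "C0 \<in> \<C>" using ne by fast
    have "submodule (\<Union>\<C>) K V"
    proof (rule submoduleI'[OF V])
      show "\<Union>\<C> \<subseteq> carrier V" by (rule Union_least) (rule submodule_subset[OF V c(1)])
      show "\<zero>\<^bsub>V\<^esub> \<in> \<Union>\<C>" by (rule UnionI[OF C0 submodule_zero[OF V c(1)[OF C0]]])
      fix x y assume "x \<in> \<Union>\<C>" "y \<in> \<Union>\<C>"
      then obtain C D where CD: "x \<in> C" "C \<in> \<C>" "y \<in> D" "D \<in> \<C>" by (meson UnionE)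
      from tot[OF CD(2,4)] show "x \<oplus>\<^bsub>V\<^esub> y \<in> \<Union>\<C>"
      proof
        assume "C \<subseteq> D"
        then show ?thesis
          by (intro UnionI[OF CD(4)] submodule_add[OF V c(1)[OF CD(4)]] CD subsetD[OF _ CD(1)])
      next
        assume "D \<subseteq> C"
        then show ?thesis
          by (intro UnionI[OF CD(2)] submodule_add[OF V c(1)[OF CD(2)]] CD subsetD[OF _ CD(3)])
      qed
    next
      fix k x assume k: "k \<in> carrier K" and "x \<in> \<Union>\<C>"
      then obtain C where CD: "x \<in> C" "C \<in> \<C>" by (meson UnionE)
      show "k \<odot>\<^bsub>V\<^esub> x \<in> \<Union>\<C>"
        by (rule UnionI[OF CD(2) submodule_smult[OF c(1)[OF CD(2)] k CD(1)]])
    qed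
    moreover have "\<Union>\<C> \<inter> U = {\<zero>\<^bsub>V\<^esub>}"
    proof (rule equalityI)
      show "\<Union>\<C> \<inter> U \<subseteq> {\<zero>\<^bsub>V\<^esub>}" 
      proof
        fix x assume "x \<in> \<Union>\<C> \<inter> U"
        then obtain C where "C \<in> \<C>" "x \<in> C \<inter> U" by (meson IntE IntI UnionE)
        then show "x \<in> {\<zero>\<^bsub>V\<^esub>}" using c(2) by simp
      qed
      show "{\<zero>\<^bsub>V\<^esub>} \<subseteq> \<Union>\<C> \<inter> U" using c(2)[OF C0] C0 by auto
    qed
    ultimately show "\<Union>\<C> \<in> CC" unfolding CC_def by simp
  qed
  then obtain C where "C \<in> CC" and max': "\<And>X. X \<in> CC \<Longrightarrow> C \<subseteq> X \<Longrightarrow> X = C" by meson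
  then have C: "submodule C K V" and CU: "C \<inter> U = {\<zero>\<^bsub>V\<^esub>}" by (simp_all add: CC_def)
  have max: "X = C" if "submodule X K V" "X \<inter> U = {\<zero>\<^bsub>V\<^esub>}" "C \<subseteq> X" for X
    by (rule max') (use that in \<open>simp_all add: CC_def\<close>)
  note Csub = submodule_subset[OF V C]
  \<comment> \<open>If \<open>x\<close> were outside \<open>U + C\<close>, then adjoining
    \<open>x\<close> to \<open>C\<close> would give a larger subspace still meeting \<open>U\<close>
    trivially, against maximality.\<close>
  have ex: "\<exists>u\<in>U. \<exists>c\<in>C. x = u \<oplus>\<^bsub>V\<^esub> c" if x: "x \<in> carrier V" for x
  proof (rule ccontr)
    assume no: "\<not> ?thesis"
    let ?X = "{c \<oplus>\<^bsub>V\<^esub> k \<odot>\<^bsub>V\<^esub> x | c k. c \<in> C \<and> k \<in> carrier K}"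
    have "submodule ?X K V"
    proof (rule submoduleI'[OF V])
      show "?X \<subseteq> carrier V" using Csub x by auto
      show "\<zero>\<^bsub>V\<^esub> \<in> ?X"
        using submodule_zero[OF V C] x by (auto intro!: exI[of _ "\<zero>\<^bsub>V\<^esub>"] exI[of _ "\<zero>\<^bsub>K\<^esub>"])
      fix a b assume "a \<in> ?X" "b \<in> ?X"
      then obtain c k d l where *: "a = c \<oplus>\<^bsub>V\<^esub> k \<odot>\<^bsub>V\<^esub> x" "b = d \<oplus>\<^bsub>V\<^esub> l \<odot>\<^bsub>V\<^esub> x" "c \<in> C" "d \<in> C" "k \<in> carrier K" "l \<in> carrier K"
        by blast
      then have "a \<oplus>\<^bsub>V\<^esub> b = (c \<oplus>\<^bsub>V\<^esub> d) \<oplus>\<^bsub>V\<^esub> (k \<oplus>\<^bsub>K\<^esub> l) \<odot>\<^bsub>V\<^esub> x"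
        using Csub x by (simp add: subset_iff V.smult_l_distr V.a_ac)
      then show "a \<oplus>\<^bsub>V\<^esub> b \<in> ?X" using * submodule_add[OF V C] by blast
    next
      fix l a assume l: "l \<in> carrier K" and "a \<in> ?X"
      then obtain c k where *: "a = c \<oplus>\<^bsub>V\<^esub> k \<odot>\<^bsub>V\<^esub> x" "c \<in> C" "k \<in> carrier K" by blast
      then have "l \<odot>\<^bsub>V\<^esub> a = l \<odot>\<^bsub>V\<^esub> c \<oplus>\<^bsub>V\<^esub> (l \<otimes>\<^bsub>K\<^esub> k) \<odot>\<^bsub>V\<^esub> x"
        using Csub x l by (simp add: subset_iff V.smult_r_distr V.smult_assoc1)
      then show "l \<odot>\<^bsub>V\<^esub> a \<in> ?X" using * l submodule_smult[OF C] by blast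
    qed
    moreover have CX: "C \<subseteq> ?X"
    proof
      fix c assume c: "c \<in> C"
      then have "c = c \<oplus>\<^bsub>V\<^esub> \<zero>\<^bsub>K\<^esub> \<odot>\<^bsub>V\<^esub> x" using Csub x by (simp add: subset_iff)
      then show "c \<in> ?X" using c by blast
    qed
    moreover have "?X \<inter> U = {\<zero>\<^bsub>V\<^esub>}"
    proof -
      have "y = \<zero>\<^bsub>V\<^esub>" if y: "y \<in> ?X" "y \<in> U" for y
      proof -
        from y obtain c k where *: "y = c \<oplus>\<^bsub>V\<^esub> k \<odot>\<^bsub>V\<^esub> x" "c \<in> C" "k \<in> carrier K" by blast
        have cV: "c \<in> carrier V" using * Csub by blast
        have yV: "y \<in> carrier V" using y Usub by blast
        show ?thesis
        proof (cases "k = \<zero>\<^bsub>K\<^esub>")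
          case True
          then have "y = c" using * cV x by simp
          then show ?thesis using * y CU by blast
        next
          case False
          \<comment> \<open>Over a field the nonzero \<open>k\<close> can be inverted, so that
            \<open>y \<in> U\<close> expresses \<open>x\<close> itself as an element of
            \<open>U + C\<close>, contradicting \<open>no\<close>.\<close>
          then have k: "inv\<^bsub>K\<^esub> k \<in> carrier K" "inv\<^bsub>K\<^esub> k \<otimes>\<^bsub>K\<^esub> k = \<one>\<^bsub>K\<^esub>"
            using * K.field_Units by (auto intro: K.Units_l_inv)
          have "k \<odot>\<^bsub>V\<^esub> x = \<ominus>\<^bsub>V\<^esub> c \<oplus>\<^bsub>V\<^esub> y"
            unfolding *(1) using * cV x by (simp only: V.r_neg1 V.smult_closed)
          also have "\<dots> = y \<oplus>\<^bsub>V\<^esub> \<ominus>\<^bsub>V\<^esub> c"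
            using cV yV by (intro V.a_comm) auto
          finally have "inv\<^bsub>K\<^esub> k \<odot>\<^bsub>V\<^esub> (k \<odot>\<^bsub>V\<^esub> x) = inv\<^bsub>K\<^esub> k \<odot>\<^bsub>V\<^esub> y \<oplus>\<^bsub>V\<^esub> inv\<^bsub>K\<^esub> k \<odot>\<^bsub>V\<^esub> (\<ominus>\<^bsub>V\<^esub> c)"
            using k(1) yV cV by (simp only: V.smult_r_distr V.a_inv_closed)
          moreover have "inv\<^bsub>K\<^esub> k \<odot>\<^bsub>V\<^esub> (k \<odot>\<^bsub>V\<^esub> x) = x"
            using V.smult_assoc1[OF k(1) *(3) x] V.smult_one[OF x] k(2) by simp
          moreover have "inv\<^bsub>K\<^esub> k \<odot>\<^bsub>V\<^esub> y \<in> U" "inv\<^bsub>K\<^esub> k \<odot>\<^bsub>V\<^esub> (\<ominus>\<^bsub>V\<^esub> c) \<in> C"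
            using k y * submodule_smult[OF U] submodule_smult[OF C] submodule_neg[OF V C] by auto
          ultimately have "\<exists>u\<in>U. \<exists>c\<in>C. x = u \<oplus>\<^bsub>V\<^esub> c" by auto
          then show ?thesis using no by blast
        qed
      qed
      moreover have "\<zero>\<^bsub>V\<^esub> \<in> ?X" using CX submodule_zero[OF V C] by blast
      ultimately show ?thesis using submodule_zero[OF V U] by blast
    qed
    ultimately have "?X = C" using max by simp
    moreover have "\<zero>\<^bsub>V\<^esub> \<oplus>\<^bsub>V\<^esub> \<one>\<^bsub>K\<^esub> \<odot>\<^bsub>V\<^esub> x \<in> ?X" using submodule_zero[OF V C] by blast
    ultimately have "x \<in> C" using x by simp
    moreover have "x = \<zero>\<^bsub>V\<^esub> \<oplus>\<^bsub>V\<^esub> x" using x by simp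
    ultimately show False using no submodule_zero[OF V U] by blast
  qed
  have uniq: "u = u'" if "u \<in> U" "u' \<in> U" "c \<in> C" "c' \<in> C" "u \<oplus>\<^bsub>V\<^esub> c = u' \<oplus>\<^bsub>V\<^esub> c'" for u u' c c'
  proof -
    have i: "u \<in> carrier V" "u' \<in> carrier V" "c \<in> carrier V" "c' \<in> carrier V" using that Usub Csub by auto
    have "(u \<ominus>\<^bsub>V\<^esub> u') \<oplus>\<^bsub>V\<^esub> (c \<ominus>\<^bsub>V\<^esub> c') = (u \<oplus>\<^bsub>V\<^esub> c) \<ominus>\<^bsub>V\<^esub> (u' \<oplus>\<^bsub>V\<^esub> c')"
      using i by (simp add: V.minus_eq V.minus_add V.a_ac)
    also have "\<dots> = \<zero>\<^bsub>V\<^esub>"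
      unfolding that(5) using i by (simp add: V.minus_eq V.r_neg)
    finally have "\<ominus>\<^bsub>V\<^esub> (c \<ominus>\<^bsub>V\<^esub> c') = u \<ominus>\<^bsub>V\<^esub> u'"
      using i by (intro V.minus_equality) auto
    then have "u \<ominus>\<^bsub>V\<^esub> u' \<in> C \<inter> U"
      using submodule_minus[OF V U that(1,2)] submodule_neg[OF V C submodule_minus[OF V C that(3,4)]] by auto
    then have "u \<ominus>\<^bsub>V\<^esub> u' = \<zero>\<^bsub>V\<^esub>" using CU by blast
    then show ?thesis using i V.minus_equality[of u "\<ominus>\<^bsub>V\<^esub> u'"] by (simp add: V.minus_eq)
  qed
  define r where "r x = (SOME u. u \<in> U \<and> (\<exists>c\<in>C. x = u \<oplus>\<^bsub>V\<^esub> c))" for x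
  have r: "r x \<in> U \<and> (\<exists>c\<in>C. x = r x \<oplus>\<^bsub>V\<^esub> c)" if "x \<in> carrier V" for x
    unfolding r_def by (rule someI_ex) (use ex[OF that] in blast)
  have rI: "r x = u" if "u \<in> U" "c \<in> C" "x = u \<oplus>\<^bsub>V\<^esub> c" for x u c
  proof -
    have "x \<in> carrier V" using that Usub Csub by auto
    then obtain c' where "r x \<in> U" "c' \<in> C" "x = r x \<oplus>\<^bsub>V\<^esub> c'" using r by blast
    then show ?thesis using uniq[of "r x" u c' c] that by auto
  qed
  have "lin_map K V (V\<lparr>carrier := U\<rparr>) r"
  proof (rule lin_mapI)
    fix x assume x: "x \<in> carrier V"
    then show "r x \<in> carrier (V\<lparr>carrier := U\<rparr>)" using r by simp
    obtain c where c: "c \<in> C" "x = r x \<oplus>\<^bsub>V\<^esub> c" using r[OF x] by blast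
    have rx: "r x \<in> U" "r x \<in> carrier V" "c \<in> carrier V" using r[OF x] Usub Csub c by auto
    {
      fix k assume k: "k \<in> carrier K"
      have "r (k \<odot>\<^bsub>V\<^esub> x) = k \<odot>\<^bsub>V\<^esub> r x"
      proof (rule rI[of _ "k \<odot>\<^bsub>V\<^esub> c"])
        show "k \<odot>\<^bsub>V\<^esub> x = k \<odot>\<^bsub>V\<^esub> r x \<oplus>\<^bsub>V\<^esub> k \<odot>\<^bsub>V\<^esub> c" using k rx by (subst c(2)) (simp add: V.smult_r_distr)
      qed (use k c rx in \<open>auto intro: submodule_smult[OF U] submodule_smult[OF C]\<close>)
      then show "r (k \<odot>\<^bsub>V\<^esub> x) = k \<odot>\<^bsub>V\<lparr>carrier := U\<rparr>\<^esub> r x" by simp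
    }
    fix y assume y: "y \<in> carrier V"
    obtain d where d: "d \<in> C" "y = r y \<oplus>\<^bsub>V\<^esub> d" using r[OF y] by blast
    have ry: "r y \<in> U" "r y \<in> carrier V" "d \<in> carrier V" using r[OF y] Usub Csub d by auto
    have "r (x \<oplus>\<^bsub>V\<^esub> y) = r x \<oplus>\<^bsub>V\<^esub> r y"
    proof (rule rI[of _ "c \<oplus>\<^bsub>V\<^esub> d"])
      have "x \<oplus>\<^bsub>V\<^esub> y = (r x \<oplus>\<^bsub>V\<^esub> c) \<oplus>\<^bsub>V\<^esub> (r y \<oplus>\<^bsub>V\<^esub> d)" using c d by simp
      also have "\<dots> = r x \<oplus>\<^bsub>V\<^esub> r y \<oplus>\<^bsub>V\<^esub> (c \<oplus>\<^bsub>V\<^esub> d)" using rx ry by (simp add: V.a_ac)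
      finally show "x \<oplus>\<^bsub>V\<^esub> y = r x \<oplus>\<^bsub>V\<^esub> r y \<oplus>\<^bsub>V\<^esub> (c \<oplus>\<^bsub>V\<^esub> d)" .
    qed (use c d rx ry submodule_add[OF V U] submodule_add[OF V C] in auto)
    then show "r (x \<oplus>\<^bsub>V\<^esub> y) = r x \<oplus>\<^bsub>V\<lparr>carrier := U\<rparr>\<^esub> r y" by simp
  qed
  moreover have "r u = u" if "u \<in> U" for u
    by (rule rI[of _ "\<zero>\<^bsub>V\<^esub>"]) (use that Usub submodule_zero[OF V C] in auto)
  ultimately show ?thesis by (rule that)
qed

section \<open>Quotients by a subspace and maps induced on them\<close>

locale quotient = module K V for K :: "('k, 'c) ring_scheme" and V :: "('k, 'v, 'y) module_scheme" (structure) +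
  fixes N assumes N: "submodule N K V"
begin

lemma N_subset: "N \<subseteq> carrier V" by (rule submodule_subset[OF module_axioms N])

lemma N_subgroup: "additive_subgroup N V"
  using N by (simp add: additive_subgroup_def submodule_def)

lemma N_abelian_subgroup: "abelian_subgroup N V"
  by (rule abelian_subgroupI3[OF N_subgroup abelian_group_axioms])

lemma mem_coset_iff: "v \<in> carrier V \<Longrightarrow> x \<in> N +> v \<longleftrightarrow> (\<exists>n\<in>N. x = n \<oplus> v)"
  by (auto simp: a_r_coset_def')

lemma coset_eq_iff:
  assumes "v \<in> carrier V" "w \<in> carrier V"
  shows "N +> v = N +> w \<longleftrightarrow> v \<ominus> w \<in> N"
proof -
  interpret N: abelian_subgroup N V by (rule N_abelian_subgroup)
  have "N +> v = N +> w \<longleftrightarrow> v \<in> N +> w"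
    using N.a_repr_independence'[of v w] N.a_rcos_self[of v] assms by auto
  also have "\<dots> \<longleftrightarrow> v \<ominus> w \<in> N"
  proof
    assume "v \<in> N +> w"
    then obtain n where n: "n \<in> N" "v = n \<oplus> w" using assms by (auto simp: mem_coset_iff)
    then have "v \<ominus> w = n" using assms N_subset by (auto simp: minus_eq a_assoc r_neg)
    then show "v \<ominus> w \<in> N" using n by simp
  next
    assume "v \<ominus> w \<in> N"
    moreover have "v = (v \<ominus> w) \<oplus> w" using assms by (simp add: minus_eq a_assoc l_neg)
    ultimately show "v \<in> N +> w" using assms unfolding mem_coset_iff[OF assms(2)] by blast
  qed
  finally show ?thesis .
qed

lemma quot_carrier: "carrier (quot_space V N) = (\<lambda>v. N +> v) ` carrier V"
  by (auto simp: quot_space_def A_RCOSETS_def')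

lemma quot_add: "v \<in> carrier V \<Longrightarrow> w \<in> carrier V \<Longrightarrow> (N +> v) \<oplus>\<^bsub>quot_space V N\<^esub> (N +> w) = N +> (v \<oplus> w)"
  using abelian_subgroup.a_rcos_sum[OF N_abelian_subgroup] by (simp add: quot_space_def)

end

text \<open>The definitions of scalar multiplication on \<open>quot_space\<close>, of
  \<open>forms_incl\<close> and of both actions on \<open>forms\<close> all have the shape
  \<open>N + f(X)\<close>. Whenever \<open>f\<close> maps \<open>N'\<close> into \<open>N\<close>,
  this is the map induced on the quotients.\<close>

lemma set_add_image_coset:
  assumes V: "quotient K V N" and V': "quotient K V' N'"
    and f: "lin_map K V' V f" "\<And>n. n \<in> N' \<Longrightarrow> f n \<in> N" and v: "v \<in> carrier V'"
  shows "set_add V N (f ` (N' +>\<^bsub>V'\<^esub> v)) = N +>\<^bsub>V\<^esub> f v"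
proof
  interpret V: quotient K V N by fact
  interpret V': quotient K V' N' by fact
  have fv: "f v \<in> carrier V" using f v by (auto dest: lin_map_closed)
  show "set_add V N (f ` (N' +>\<^bsub>V'\<^esub> v)) \<subseteq> N +>\<^bsub>V\<^esub> f v"
  proof
    fix x assume "x \<in> set_add V N (f ` (N' +>\<^bsub>V'\<^esub> v))"
    then obtain n m where nm: "n \<in> N" "m \<in> N'" "x = n \<oplus>\<^bsub>V\<^esub> f (m \<oplus>\<^bsub>V'\<^esub> v)"
      using v by (auto simp: set_add_def' V'.mem_coset_iff)
    have "n \<oplus>\<^bsub>V\<^esub> f m \<in> N" using nm f(2) submodule_add[OF V.module_axioms V.N] by blast
    moreover have "x = (n \<oplus>\<^bsub>V\<^esub> f m) \<oplus>\<^bsub>V\<^esub> f v"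
      using nm v fv V.N_subset V'.N_subset f(2) by (auto simp: lin_map_add[OF f(1)] subset_iff V.a_assoc)
    ultimately show "x \<in> N +>\<^bsub>V\<^esub> f v" using fv by (auto simp: V.mem_coset_iff)
  qed
  show "N +>\<^bsub>V\<^esub> f v \<subseteq> set_add V N (f ` (N' +>\<^bsub>V'\<^esub> v))"
  proof
    fix x assume "x \<in> N +>\<^bsub>V\<^esub> f v"
    then obtain n where n: "n \<in> N" "x = n \<oplus>\<^bsub>V\<^esub> f v" using fv by (auto simp: V.mem_coset_iff)
    have "v = \<zero>\<^bsub>V'\<^esub> \<oplus>\<^bsub>V'\<^esub> v" using v by simp
    then have "v \<in> N' +>\<^bsub>V'\<^esub> v" using submodule_zero[OF V'.module_axioms V'.N] v unfolding V'.mem_coset_iff[OF v] by blast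
    then show "x \<in> set_add V N (f ` (N' +>\<^bsub>V'\<^esub> v))" using n unfolding set_add_def' by blast
  qed
qed

context quotient
begin

lemma quot_smult: "c \<in> carrier K \<Longrightarrow> v \<in> carrier V \<Longrightarrow> c \<odot>\<^bsub>quot_space V N\<^esub> (N +> v) = N +> (c \<odot> v)"
  using set_add_image_coset[OF quotient_axioms quotient_axioms lin_map_scale[OF module_axioms _ lin_map_ident], of c v] submodule_smult[OF N]
  by (simp add: quot_space_def)

lemma quot_zero: "\<zero>\<^bsub>quot_space V N\<^esub> = N +> \<zero>"
  using a_coset_add_zero[OF N_subset] by (simp add: quot_space_def)

lemma quot_module: "module K (quot_space V N)"
proof (rule moduleI)
  show "abelian_group (quot_space V N)"
  proof (rule abelian_groupI)
    fix x assume "x \<in> carrier (quot_space V N)"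
    then obtain v where "v \<in> carrier V" "x = N +> v" by (auto simp: quot_carrier)
    then show "\<exists>y\<in>carrier (quot_space V N). y \<oplus>\<^bsub>quot_space V N\<^esub> x = \<zero>\<^bsub>quot_space V N\<^esub>"
      by (intro bexI[of _ "N +> (\<ominus> v)"]) (auto simp: quot_carrier quot_add quot_zero l_neg)
  qed (auto simp: quot_carrier quot_add quot_zero a_ac)
qed (auto simp: quot_carrier quot_add quot_smult smult_l_distr smult_r_distr smult_assoc1 intro: R.is_cring)

lemma lin_map_proj: "lin_map K V (quot_space V N) (\<lambda>v. N +> v)"
  by (rule lin_mapI) (auto simp: quot_carrier quot_add quot_smult)

lemma proj_zero_iff: "v \<in> carrier V \<Longrightarrow> N +> v = \<zero>\<^bsub>quot_space V N\<^esub> \<longleftrightarrow> v \<in> N"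
proof -
  assume v: "v \<in> carrier V"
  have "\<ominus>\<^bsub>V\<^esub> \<zero>\<^bsub>V\<^esub> = \<zero>\<^bsub>V\<^esub>"
    by (rule abelian_group.minus_equality[OF module_abelian_group[OF module_axioms]]) simp_all
  then have "v \<ominus>\<^bsub>V\<^esub> \<zero>\<^bsub>V\<^esub> = v" using v by (simp add: a_minus_def)
  then show ?thesis using v by (simp add: quot_zero coset_eq_iff)
qed

lemma some_coset:
  assumes v: "v \<in> carrier V"
  obtains n where "n \<in> N" "(SOME x. x \<in> N +> v) = n \<oplus> v"
proof -
  have "v = \<zero> \<oplus> v" using v by simp
  then have "v \<in> N +> v" using submodule_zero[OF module_axioms N] v unfolding mem_coset_iff[OF v] by blast
  then have "(SOME x. x \<in> N +> v) \<in> N +> v" by (rule someI)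
  then show ?thesis using that v by (auto simp: mem_coset_iff)
qed

text \<open>The chosen representative differs from \<open>v\<close> by an element of
  \<open>N\<close>, which \<open>f\<close> kills. This evaluates definitions such as
  \<open>quot_coact\<close>, where a representative is picked by \<open>SOME\<close>.\<close>

lemma some_lift:
  assumes "module K W" and f: "lin_map K V W f" "\<And>n. n \<in> N \<Longrightarrow> f n = \<zero>\<^bsub>W\<^esub>" and v: "v \<in> carrier V"
  shows "f (SOME x. x \<in> N +> v) = f v"
proof -
  interpret W: module K W by fact
  obtain n where n: "n \<in> N" "(SOME x. x \<in> N +> v) = n \<oplus> v" by (rule some_coset[OF v])
  then show ?thesis using lin_map_add[OF f(1), of n v] f(2) v N_subset lin_map_closed[OF f(1)] by auto
qed

lemma lin_map_some_lift:
  assumes "module K W" and f: "lin_map K V W f" "\<And>n. n \<in> N \<Longrightarrow> f n = \<zero>\<^bsub>W\<^esub>"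
  shows "lin_map K (quot_space V N) W (\<lambda>X. f (SOME x. x \<in> X))"
  by (rule lin_mapI) (auto simp: quot_carrier quot_add quot_smult some_lift[OF assms] lin_map_closed[OF f(1)]
    lin_map_add[OF f(1)] lin_map_smult[OF f(1)])

end

section \<open>Universal calculi\<close>

lemma tlift_mem:
  assumes "X \<in> carrier (tensor K V W)" and b: "bilin K V W U \<beta>" and m: "module K V" "module K W" "module K U"
    and U: "submodule U' K U" and g: "\<And>v w. v \<in> carrier V \<Longrightarrow> w \<in> carrier W \<Longrightarrow> \<beta> v w \<in> U'"
  shows "tlift U \<beta> X \<in> U'"
  by (rule lin_map_tsub[of X K V W "carrier V" "carrier W" U])
    (use assms in \<open>auto simp: tsub_full tlift_tens lin_map_tlift'\<close>)

lemma tlift_tsub_mem: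
  assumes "X \<in> tsub K V W A B" and b: "bilin K V W U \<beta>" and m: "module K V" "module K W" "module K U"
    and U: "submodule U' K U" and s: "A \<subseteq> carrier V" "B \<subseteq> carrier W"
    and g: "\<And>v w. v \<in> A \<Longrightarrow> w \<in> B \<Longrightarrow> \<beta> v w \<in> U'"
  shows "tlift U \<beta> X \<in> U'"
  by (rule lin_map_tsub[of X K V W A B U])
    (use assms in \<open>auto simp: tlift_tens lin_map_tlift' subset_iff\<close>)

lemma module_diff_self: "module K V \<Longrightarrow> x \<in> carrier V \<Longrightarrow> x \<ominus>\<^bsub>V\<^esub> x = \<zero>\<^bsub>V\<^esub>"
  by (simp add: a_minus_def abelian_group.r_neg[OF module_abelian_group])

lemma module_neg_zero: "module K V \<Longrightarrow> \<ominus>\<^bsub>V\<^esub> \<zero>\<^bsub>V\<^esub> = \<zero>\<^bsub>V\<^esub>"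
proof -
  assume V: "module K V"
  then have "\<zero>\<^bsub>V\<^esub> \<in> carrier V" "\<zero>\<^bsub>V\<^esub> \<oplus>\<^bsub>V\<^esub> \<zero>\<^bsub>V\<^esub> = \<zero>\<^bsub>V\<^esub>"
    by (simp_all add: module_def abelian_group_def abelian_monoid.zero_closed abelian_monoid.l_zero)
  then show ?thesis by (intro abelian_group.minus_equality[OF module_abelian_group[OF V]])
qed

definition mu where "mu K A = tlift A (\<lambda>a b. a \<otimes>\<^bsub>A\<^esub> b)"

text \<open>Subtracting \<open>\<mu>(x) \<otimes> 1\<close> removes the product of \<open>x\<close>,
  because \<open>\<mu>(a \<otimes> 1) = a\<close>. The result is an explicit linear projection of
  \<open>A \<otimes> A\<close> onto its universal calculus.\<close>

definition univ_proj where "univ_proj K A x = x \<ominus>\<^bsub>tensor K A A\<^esub> tens K A A (mu K A x) \<one>\<^bsub>A\<^esub>"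

lemma univ_calc_mu: "univ_calc K A = {x \<in> carrier (tensor K A A). mu K A x = \<zero>\<^bsub>A\<^esub>}"
  by (simp add: univ_calc_def mu_def)

context k_algebra
begin

lemma alg [lin]: "k_algebra K A" by (rule k_algebra_axioms)
lemma mod [lin]: "module K A" by (rule module_axioms)
lemma tmod [lin]: "module K (tensor K A A)" by (rule module_tensor[OF mod mod])

lemma lin_map_mu: "lin_map K (tensor K A A) A (mu K A)"
  unfolding mu_def by (rule lin_map_tlift'[OF mod mod mod bilin_mult[OF alg]])

lemmas lin_map_mu_comp [lin] = lin_map_comp[OF lin_map_mu]
lemmas mu_closed [lin] = lin_map_closed[OF lin_map_mu]

lemma mu_tens: "a \<in> carrier A \<Longrightarrow> b \<in> carrier A \<Longrightarrow> mu K A (tens K A A a b) = a \<otimes>\<^bsub>A\<^esub> b"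
  unfolding mu_def by (rule tlift_tens[OF mod mod mod bilin_mult[OF alg]])

lemma univ_submodule: "submodule (univ_calc K A) K (tensor K A A)"
  unfolding univ_calc_mu by (rule submodule_ker[OF tmod mod lin_map_mu])

lemma univ_subset: "univ_calc K A \<subseteq> carrier (tensor K A A)"
  by (auto simp: univ_calc_def)

lemma lin_map_univ_proj: "lin_map K (tensor K A A) (tensor K A A) (univ_proj K A)"
  unfolding univ_proj_def by (assumption | rule lin)+

lemma univ_proj_univ: "x \<in> carrier (tensor K A A) \<Longrightarrow> univ_proj K A x \<in> univ_calc K A"
proof -
  assume x: "x \<in> carrier (tensor K A A)"
  have m: "mu K A x \<in> carrier A" by (rule mu_closed[OF x])
  have t: "tens K A A (mu K A x) \<one>\<^bsub>A\<^esub> \<in> carrier (tensor K A A)"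
    by (rule tens_closed[OF mod mod m alg_one_closed[OF alg]])
  have "mu K A (univ_proj K A x) = mu K A x \<ominus>\<^bsub>A\<^esub> mu K A x"
    unfolding univ_proj_def lin_map_minus[OF tmod mod lin_map_mu x t] using m by (simp add: mu_tens)
  also have "\<dots> = \<zero>\<^bsub>A\<^esub>" using m by (rule module_diff_self[OF mod])
  finally show ?thesis using lin_map_closed[OF lin_map_univ_proj x] by (simp add: univ_calc_mu)
qed

lemma univ_proj_ident: "x \<in> univ_calc K A \<Longrightarrow> univ_proj K A x = x"
proof -
  assume "x \<in> univ_calc K A"
  then have x: "x \<in> carrier (tensor K A A)" "mu K A x = \<zero>\<^bsub>A\<^esub>" by (auto simp: univ_calc_mu)
  interpret T: module K "tensor K A A" by (rule tmod)
  have "tens K A A \<zero>\<^bsub>A\<^esub> \<one>\<^bsub>A\<^esub> = \<zero>\<^bsub>tensor K A A\<^esub>"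
    by (rule lin_map_zero[OF mod tmod lin_map_tens_left[OF mod mod alg_one_closed[OF alg] lin_map_ident]])
  moreover have "\<ominus>\<^bsub>tensor K A A\<^esub> \<zero>\<^bsub>tensor K A A\<^esub> = \<zero>\<^bsub>tensor K A A\<^esub>"
    by (rule module_neg_zero[OF T.module_axioms])
  ultimately show ?thesis using x by (simp add: univ_proj_def a_minus_def)
qed

text \<open>\<open>univ_proj \<otimes> id\<close> differs from the identity by a map that factors
  through \<open>mu \<otimes> id\<close>; it therefore fixes \<open>y\<close>, while its values lie
  in the required span.\<close>

lemma univ_tsub:
  assumes W: "module K W" and y: "y \<in> carrier (tensor K (tensor K A A) W)"
    and z: "tmap K A W (mu K A) (\<lambda>w. w) y = \<zero>\<^bsub>tensor K A W\<^esub>"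
  shows "y \<in> tsub K (tensor K A A) W (univ_calc K A) (carrier W)"
proof -
  let ?AA = "tensor K A A" let ?T = "tensor K ?AA W"
  let ?s = "\<lambda>a. tens K A A a \<one>\<^bsub>A\<^esub>"
  interpret T: module K ?T by (rule module_tensor[OF tmod W])
  have ls: "lin_map K A ?AA ?s" by (assumption | rule lin)+
  have p: "tmap K ?AA W (univ_proj K A) (\<lambda>w. w) y = y \<ominus>\<^bsub>?T\<^esub> tmap K ?AA W ?s (\<lambda>w. w) (tmap K A W (mu K A) (\<lambda>w. w) y)"
  proof (rule tensor_eqI[OF _ _ tmod W T.module_axioms _ y])
    show "lin_map K ?T ?T (tmap K ?AA W (univ_proj K A) (\<lambda>w. w))"
      by (rule lin_map_tmap[OF lin_map_ident lin_map_univ_proj lin_map_ident tmod W tmod W])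
    show "lin_map K ?T ?T (\<lambda>y. y \<ominus>\<^bsub>?T\<^esub> tmap K ?AA W ?s (\<lambda>w. w) (tmap K A W (mu K A) (\<lambda>w. w) y))"
      using W by - (assumption | rule lin)+
    fix x w assume x: "x \<in> carrier ?AA" and w: "w \<in> carrier W"
    have m: "mu K A x \<in> carrier A" by (rule mu_closed[OF x])
    have sm: "?s (mu K A x) \<in> carrier ?AA" by (rule lin_map_closed[OF ls m])
    have lw: "lin_map K ?AA ?T (\<lambda>x. tens K ?AA W x w)"
      by (rule lin_map_tens_left[OF tmod W w lin_map_ident])
    have e: "tmap K ?AA W ?s (\<lambda>w. w) (tmap K A W (mu K A) (\<lambda>w. w) (tens K ?AA W x w)) = tens K ?AA W (?s (mu K A x)) w"
      by (simp add: tmap_tens[OF lin_map_mu lin_map_ident tmod W mod W x w]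
          tmap_tens[OF ls lin_map_ident mod W tmod W m w])
    show "tmap K ?AA W (univ_proj K A) (\<lambda>w. w) (tens K ?AA W x w) = tens K ?AA W x w \<ominus>\<^bsub>?T\<^esub>
        tmap K ?AA W ?s (\<lambda>w. w) (tmap K A W (mu K A) (\<lambda>w. w) (tens K ?AA W x w))"
      unfolding e tmap_tens[OF lin_map_univ_proj lin_map_ident tmod W tmod W x w]
      unfolding univ_proj_def by (rule lin_map_minus[OF tmod T.module_axioms lw x sm])
  qed
  have "tmap K ?AA W ?s (\<lambda>w. w) \<zero>\<^bsub>tensor K A W\<^esub> = \<zero>\<^bsub>?T\<^esub>"
    by (rule lin_map_zero[OF module_tensor[OF mod W] T.module_axioms lin_map_tmap[OF lin_map_ident ls lin_map_ident mod W tmod W]])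
  moreover have "\<ominus>\<^bsub>?T\<^esub> \<zero>\<^bsub>?T\<^esub> = \<zero>\<^bsub>?T\<^esub>" by (rule module_neg_zero[OF T.module_axioms])
  ultimately have "tmap K ?AA W (univ_proj K A) (\<lambda>w. w) y = y" using p z y by (simp add: a_minus_def)
  moreover have "tmap K ?AA W (univ_proj K A) (\<lambda>w. w) y \<in> tsub K ?AA W (univ_calc K A) (carrier W)"
    by (rule tmap_in_tsub[OF y lin_map_univ_proj lin_map_ident tmod W tmod W univ_subset])
      (auto intro: univ_proj_univ)
  ultimately show ?thesis by simp
qed

end


section \<open>Sweedler calculus\<close>

lemma alg_hom_lin_map: "alg_hom K A B f \<Longrightarrow> lin_map K A B f"
  by (simp add: alg_hom_def)

context hopf_algebra
begin

abbreviation HH where "HH \<equiv> tensor K H H"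

lemma lin_map_comult: "lin_map K H HH (comult H)"
  by (rule alg_hom_lin_map[OF comult_hom])

lemma lin_map_antipode: "lin_map K H H (antipode H)"
  by (rule antipode_lin)

lemmas lin_map_comult_comp [lin] = lin_map_comp[OF lin_map_comult]
lemmas comult_closed [lin] = lin_map_closed[OF lin_map_comult]
lemmas lin_map_antipode_comp [lin] = lin_map_comp[OF lin_map_antipode]
lemmas antipode_closed [lin] = lin_map_closed[OF lin_map_antipode]

lemma counit_closed [lin]: "h \<in> carrier H \<Longrightarrow> counit H h \<in> carrier K"
  using counit_hom by (auto simp: ring_hom_def)

text \<open>The counit takes values in the field, which is not a \<open>module\<close> record. Its
  linearity is therefore expressed after letting the value scale a vector.\<close>

lemma lin_map_counit_smult [lin]:
  assumes "module K W" "w \<in> carrier W" "lin_map K X H f"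
  shows "lin_map K X W (\<lambda>x. counit H (f x) \<odot>\<^bsub>W\<^esub> w)"
proof (rule lin_map_comp[OF _ assms(3)], rule lin_mapI)
  interpret W: module K W by fact
  fix x y assume "x \<in> carrier H" "y \<in> carrier H"
  then show "counit H (x \<oplus>\<^bsub>H\<^esub> y) \<odot>\<^bsub>W\<^esub> w = counit H x \<odot>\<^bsub>W\<^esub> w \<oplus>\<^bsub>W\<^esub> counit H y \<odot>\<^bsub>W\<^esub> w"
    using assms(2) counit_hom by (simp add: ring_hom_add W.smult_l_distr counit_closed)
next
  interpret W: module K W by fact
  show "counit H x \<odot>\<^bsub>W\<^esub> w \<in> carrier W" if "x \<in> carrier H" for x
    using assms(2) that by (simp add: counit_closed)
  fix c x assume "c \<in> carrier K" "x \<in> carrier H"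
  then show "counit H (c \<odot>\<^bsub>H\<^esub> x) \<odot>\<^bsub>W\<^esub> w = c \<odot>\<^bsub>W\<^esub> (counit H x \<odot>\<^bsub>W\<^esub> w)"
    using assms(2) by (simp add: counit_smult W.smult_assoc1 counit_closed)
qed

lemma counit_one: "counit H \<one>\<^bsub>H\<^esub> = \<one>\<^bsub>K\<^esub>"
  using counit_hom by (rule ring_hom_one)

lemma comult_mult: "x \<in> carrier H \<Longrightarrow> y \<in> carrier H \<Longrightarrow> comult H (x \<otimes>\<^bsub>H\<^esub> y) = comult H x \<otimes>\<^bsub>HH\<^esub> comult H y"
  using comult_hom by (auto simp: alg_hom_def ring_hom_def)

lemma comult_one: "comult H \<one>\<^bsub>H\<^esub> = tens K H H \<one>\<^bsub>H\<^esub> \<one>\<^bsub>H\<^esub>"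
  using comult_hom by (auto simp: alg_hom_def ring_hom_def one_tensor)

text \<open>\<open>tlift U \<beta> (comult H h)\<close> is the Sweedler sum of
  \<open>\<beta>(h\<^sub>1, h\<^sub>2)\<close>. This rule rewrites under the summation sign, where
  equality of the integrands is known on the carrier only.\<close>

lemma sw_cong:
  assumes h: "h \<in> carrier H" and U: "module K U" and b: "bilin K H H U \<beta>"
    and e: "\<And>a b. a \<in> carrier H \<Longrightarrow> b \<in> carrier H \<Longrightarrow> \<beta> a b = \<beta>' a b"
  shows "tlift U \<beta> (comult H h) = tlift U \<beta>' (comult H h)"
proof (rule tlift_cong[OF comult_closed[OF h] mod mod U b _ e])
  show "bilin K H H U \<beta>'"
    using b e unfolding bilin_def by (auto intro: lin_map_cong[OF mod])
qed

lemma sw_apply: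
  assumes "lin_map K U U' f" "h \<in> carrier H" "module K U" "module K U'" "bilin K H H U \<beta>"
  shows "f (tlift U \<beta> (comult H h)) = tlift U' (\<lambda>v w. f (\<beta> v w)) (comult H h)"
  by (rule lin_map_tlift_apply[OF assms(1) comult_closed[OF assms(2)] mod mod assms(3,4,5)])

text \<open>The axiom \<open>coassoc\<close> compares two elements of
  \<open>(H \<otimes> H) \<otimes> H\<close>. Applying to both the linear map \<open>t\<close>
  induced by the trilinear \<open>\<gamma>\<close> turns it into an identity of iterated
  sums.\<close>

lemma sw_coassoc:
  assumes h: "h \<in> carrier H" and U: "module K U"
    and l: "\<And>a b. a \<in> carrier H \<Longrightarrow> b \<in> carrier H \<Longrightarrow> lin_map K H U (\<gamma> a b)"
      "\<And>a c. a \<in> carrier H \<Longrightarrow> c \<in> carrier H \<Longrightarrow> lin_map K H U (\<lambda>b. \<gamma> a b c)"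
      "\<And>b c. b \<in> carrier H \<Longrightarrow> c \<in> carrier H \<Longrightarrow> lin_map K H U (\<lambda>a. \<gamma> a b c)"
  shows "tlift U (\<lambda>a c. tlift U (\<lambda>a1 a2. \<gamma> a1 a2 c) (comult H a)) (comult H h) =
    tlift U (\<lambda>a b. tlift U (\<gamma> a) (comult H b)) (comult H h)"
proof -
  define t where "t x = tlift U (\<lambda>x c. tlift U (\<lambda>a b. \<gamma> a b c) x) x" for x
  have b1: "bilin K H H U (\<lambda>a b. \<gamma> a b c)" if "c \<in> carrier H" for c
    using that l by (intro bilinI) auto
  have b2: "bilin K HH H U (\<lambda>x c. tlift U (\<lambda>a b. \<gamma> a b c) x)"
    using U l b1 by - (assumption | rule lin)+
  have b3: "bilin K H H U (\<gamma> a)" if "a \<in> carrier H" for a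
    using that l by (intro bilinI) auto
  have lt: "lin_map K (tensor K HH H) U t"
    unfolding t_def by (rule lin_map_tlift'[OF tmod mod U b2])
  have t: "t (tens K HH H x c) = tlift U (\<lambda>a b. \<gamma> a b c) x" if "x \<in> carrier HH" "c \<in> carrier H" for x c
    unfolding t_def using that by (intro tlift_tens[OF tmod mod U b2])
  have m3: "module K (tensor K HH H)" "module K (tensor K H HH)" by (assumption | rule lin)+
  have "t (tmap K HH H (comult H) (\<lambda>h. h) (comult H h)) = tlift U (\<lambda>a c. t (tens K HH H (comult H a) c)) (comult H h)"
    unfolding tmap_def by (rule sw_apply[OF lt h m3(1) U]) (assumption | rule lin)+
  also have "\<dots> = tlift U (\<lambda>a c. tlift U (\<lambda>a1 a2. \<gamma> a1 a2 c) (comult H a)) (comult H h)"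
  proof (rule sw_cong[OF h U])
    show "bilin K H H U (\<lambda>a c. t (tens K HH H (comult H a) c))"
      by (rule bilinI; rule lin_map_comp[OF lt]) (assumption | rule lin)+
    fix a b assume a: "a \<in> carrier H" "b \<in> carrier H"
    then show "t (tens K HH H (comult H a) b) = tlift U (\<lambda>a1 a2. \<gamma> a1 a2 b) (comult H a)"
      by (intro t comult_closed)
  qed
  finally have L: "t (tmap K HH H (comult H) (\<lambda>h. h) (comult H h)) = tlift U (\<lambda>a c. tlift U (\<lambda>a1 a2. \<gamma> a1 a2 c) (comult H a)) (comult H h)" .
  let ?ta = "\<lambda>x. t (assoc_iso K H H H x)"
  have lta: "lin_map K (tensor K H HH) U ?ta"
    by (rule lin_map_comp[OF lt lin_map_assoc_iso[OF mod mod mod]])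
  have ta: "?ta (tens K H HH a y) = tlift U (\<gamma> a) y" if a: "a \<in> carrier H" and y: "y \<in> carrier HH" for a y
  proof (rule tensor_eqI[OF _ _ mod mod U _ y])
    show "lin_map K HH U (\<lambda>y. ?ta (tens K H HH a y))"
      by (rule lin_map_comp[OF lta]) (insert a, (assumption | rule lin)+)
    show "lin_map K HH U (tlift U (\<gamma> a))" by (rule lin_map_tlift'[OF mod mod U b3[OF a]])
    fix b c assume bc: "b \<in> carrier H" "c \<in> carrier H"
    have "?ta (tens K H HH a (tens K H H b c)) = t (tens K HH H (tens K H H a b) c)"
      using a bc by (simp add: assoc_iso_tens[OF mod mod mod])
    also have "\<dots> = tlift U (\<lambda>a b. \<gamma> a b c) (tens K H H a b)"
      using a bc by (intro t tens_closed[OF mod mod])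
    also have "\<dots> = \<gamma> a b c" using a bc by (intro tlift_tens[OF mod mod U b1])
    also have "\<dots> = tlift U (\<gamma> a) (tens K H H b c)" using a bc tlift_tens[OF mod mod U b3] by simp
    finally show "?ta (tens K H HH a (tens K H H b c)) = tlift U (\<gamma> a) (tens K H H b c)" .
  qed
  have "?ta (tmap K H HH (\<lambda>h. h) (comult H) (comult H h)) = tlift U (\<lambda>a b. ?ta (tens K H HH a (comult H b))) (comult H h)"
    unfolding tmap_def by (rule sw_apply[OF lta h m3(2) U]) (assumption | rule lin)+
  also have "\<dots> = tlift U (\<lambda>a b. tlift U (\<gamma> a) (comult H b)) (comult H h)"
  proof (rule sw_cong[OF h U])
    show "bilin K H H U (\<lambda>a b. ?ta (tens K H HH a (comult H b)))"
      by (rule bilinI; rule lin_map_comp[OF lta]) (assumption | rule lin)+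
    fix a b assume a: "a \<in> carrier H" "b \<in> carrier H"
    then show "?ta (tens K H HH a (comult H b)) = tlift U (\<gamma> a) (comult H b)"
      by (intro ta comult_closed)
  qed
  finally show ?thesis using L coassoc[OF h] by simp
qed

text \<open>The linear \<open>f\<close> stands for an arbitrary expression in the surviving leg, so
  that the counit law can be used inside larger sums. The three lemmas that follow have the same
  form for the same reason.\<close>

lemma sw_counit_left:
  assumes h: "h \<in> carrier H" and U: "module K U" and f: "lin_map K H U f"
  shows "tlift U (\<lambda>a b. counit H a \<odot>\<^bsub>U\<^esub> f b) (comult H h) = f h"
proof -
  have "f (tlift H (\<lambda>a b. counit H a \<odot>\<^bsub>H\<^esub> b) (comult H h)) = tlift U (\<lambda>a b. f (counit H a \<odot>\<^bsub>H\<^esub> b)) (comult H h)"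
    by (rule sw_apply[OF f h mod U]) (assumption | rule lin)+
  also have "\<dots> = tlift U (\<lambda>a b. counit H a \<odot>\<^bsub>U\<^esub> f b) (comult H h)"
  proof (rule sw_cong[OF h U])
    show "bilin K H H U (\<lambda>a b. f (counit H a \<odot>\<^bsub>H\<^esub> b))"
      by (rule bilinI; rule lin_map_comp[OF f]) (assumption | rule lin)+
  qed (use lin_map_smult[OF f] counit_closed in auto)
  finally show ?thesis using counit_left[OF h] by simp
qed

lemma sw_counit_right:
  assumes h: "h \<in> carrier H" and U: "module K U" and f: "lin_map K H U f"
  shows "tlift U (\<lambda>a b. counit H b \<odot>\<^bsub>U\<^esub> f a) (comult H h) = f h"
proof -
  have "f (tlift H (\<lambda>a b. counit H b \<odot>\<^bsub>H\<^esub> a) (comult H h)) = tlift U (\<lambda>a b. f (counit H b \<odot>\<^bsub>H\<^esub> a)) (comult H h)"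
    by (rule sw_apply[OF f h mod U]) (assumption | rule lin)+
  also have "\<dots> = tlift U (\<lambda>a b. counit H b \<odot>\<^bsub>U\<^esub> f a) (comult H h)"
  proof (rule sw_cong[OF h U])
    show "bilin K H H U (\<lambda>a b. f (counit H b \<odot>\<^bsub>H\<^esub> a))"
      by (rule bilinI; rule lin_map_comp[OF f]) (assumption | rule lin)+
  qed (use lin_map_smult[OF f] counit_closed in auto)
  finally show ?thesis using counit_right[OF h] by simp
qed

lemma sw_antipode_left:
  assumes h: "h \<in> carrier H" and U: "module K U" and f: "lin_map K H U f"
  shows "tlift U (\<lambda>a b. f (antipode H a \<otimes>\<^bsub>H\<^esub> b)) (comult H h) = counit H h \<odot>\<^bsub>U\<^esub> f \<one>\<^bsub>H\<^esub>"
proof -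
  have "f (tlift H (\<lambda>a b. antipode H a \<otimes>\<^bsub>H\<^esub> b) (comult H h)) = tlift U (\<lambda>a b. f (antipode H a \<otimes>\<^bsub>H\<^esub> b)) (comult H h)"
    by (rule sw_apply[OF f h mod U]) (assumption | rule lin)+
  then show ?thesis
    using antipode_left[OF h] lin_map_smult[OF f counit_closed[OF h] alg_one_closed[OF alg]] by simp
qed

lemma sw_antipode_right:
  assumes h: "h \<in> carrier H" and U: "module K U" and f: "lin_map K H U f"
  shows "tlift U (\<lambda>a b. f (a \<otimes>\<^bsub>H\<^esub> antipode H b)) (comult H h) = counit H h \<odot>\<^bsub>U\<^esub> f \<one>\<^bsub>H\<^esub>"
proof -
  have "f (tlift H (\<lambda>a b. a \<otimes>\<^bsub>H\<^esub> antipode H b) (comult H h)) = tlift U (\<lambda>a b. f (a \<otimes>\<^bsub>H\<^esub> antipode H b)) (comult H h)"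
    by (rule sw_apply[OF f h mod U]) (assumption | rule lin)+
  then show ?thesis
    using antipode_right[OF h] lin_map_smult[OF f counit_closed[OF h] alg_one_closed[OF alg]] by simp
qed

text \<open>Multiplicativity of \<open>\<Delta>\<close>, with the product of
  \<open>H \<otimes> H\<close> written out as a double sum over the legs of \<open>x\<close> and of
  \<open>y\<close>.\<close>

lemma sw_mult:
  assumes x: "x \<in> carrier H" and y: "y \<in> carrier H" and U: "module K U" and b: "bilin K H H U \<beta>"
  shows "tlift U \<beta> (comult H (x \<otimes>\<^bsub>H\<^esub> y)) =
    tlift U (\<lambda>a b. tlift U (\<lambda>c d. \<beta> (a \<otimes>\<^bsub>H\<^esub> c) (b \<otimes>\<^bsub>H\<^esub> d)) (comult H y)) (comult H x)"
proof -
  have lb: "lin_map K HH U (tlift U \<beta>)" by (rule lin_map_tlift'[OF mod mod U b])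
  have "tlift U \<beta> (comult H (x \<otimes>\<^bsub>H\<^esub> y)) =
     tlift U (\<lambda>a b. tlift U \<beta> (tlift HH (\<lambda>a' b'. tens K H H (a \<otimes>\<^bsub>H\<^esub> a') (b \<otimes>\<^bsub>H\<^esub> b')) (comult H y))) (comult H x)"
    unfolding comult_mult[OF x y] tensor_mult_def
    by (rule sw_apply[OF lb x tmod U bilin_tensor_mult2[OF alg alg comult_closed[OF y]]])
  also have "\<dots> = tlift U (\<lambda>a b. tlift U (\<lambda>c d. \<beta> (a \<otimes>\<^bsub>H\<^esub> c) (b \<otimes>\<^bsub>H\<^esub> d)) (comult H y)) (comult H x)"
  proof (rule sw_cong[OF x U])
    show "bilin K H H U (\<lambda>a b. tlift U \<beta> (tlift HH (\<lambda>a' b'. tens K H H (a \<otimes>\<^bsub>H\<^esub> a') (b \<otimes>\<^bsub>H\<^esub> b')) (comult H y)))"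
      by (rule bilinI; rule lin_map_comp[OF lb]) (insert y, (assumption | rule lin)+)
    fix a b' assume a: "a \<in> carrier H" and b': "b' \<in> carrier H"
    have "tlift U \<beta> (tlift HH (\<lambda>c d. tens K H H (a \<otimes>\<^bsub>H\<^esub> c) (b' \<otimes>\<^bsub>H\<^esub> d)) (comult H y)) =
       tlift U (\<lambda>c d. tlift U \<beta> (tens K H H (a \<otimes>\<^bsub>H\<^esub> c) (b' \<otimes>\<^bsub>H\<^esub> d))) (comult H y)"
      by (rule sw_apply[OF lb y tmod U bilin_tensor_mult1[OF alg alg a b']])
    also have "\<dots> = tlift U (\<lambda>c d. \<beta> (a \<otimes>\<^bsub>H\<^esub> c) (b' \<otimes>\<^bsub>H\<^esub> d)) (comult H y)"
    proof (rule sw_cong[OF y U])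
      show "bilin K H H U (\<lambda>c d. tlift U \<beta> (tens K H H (a \<otimes>\<^bsub>H\<^esub> c) (b' \<otimes>\<^bsub>H\<^esub> d)))"
        by (rule bilinI; rule lin_map_comp[OF lb]) (insert a b', (assumption | rule lin)+)
    qed (use a b' in \<open>auto intro!: tlift_tens[OF mod mod U b]\<close>)
    finally show "tlift U \<beta> (tlift HH (\<lambda>c d. tens K H H (a \<otimes>\<^bsub>H\<^esub> c) (b' \<otimes>\<^bsub>H\<^esub> d)) (comult H y)) =
       tlift U (\<lambda>c d. \<beta> (a \<otimes>\<^bsub>H\<^esub> c) (b' \<otimes>\<^bsub>H\<^esub> d)) (comult H y)" .
  qed
  finally show ?thesis .
qed

text \<open>A Fubini rule. With \<open>comult H x\<close> replaced by an arbitrary tensor both sides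
  are linear in that tensor, and on a pure tensor the outer sum disappears.\<close>

lemma sw_swap:
  assumes x: "x \<in> carrier H" and y: "y \<in> carrier H" and U: "module K U"
    and b1: "\<And>a b. a \<in> carrier H \<Longrightarrow> b \<in> carrier H \<Longrightarrow> bilin K H H U (\<delta> a b)"
    and b2: "\<And>c d. c \<in> carrier H \<Longrightarrow> d \<in> carrier H \<Longrightarrow> bilin K H H U (\<lambda>a b. \<delta> a b c d)"
  shows "tlift U (\<lambda>a b. tlift U (\<delta> a b) (comult H y)) (comult H x) =
    tlift U (\<lambda>c d. tlift U (\<lambda>a b. \<delta> a b c d) (comult H x)) (comult H y)"
proof -
  have l: "lin_map K H U (\<lambda>a. \<delta> a b c d)" "lin_map K H U (\<lambda>b. \<delta> a b c d)"
    "lin_map K H U (\<lambda>c. \<delta> a b c d)" "lin_map K H U (\<lambda>d. \<delta> a b c d)"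
    if "a \<in> carrier H" "b \<in> carrier H" "c \<in> carrier H" "d \<in> carrier H" for a b c d
    using b1[OF that(1,2)] b2[OF that(3,4)] that unfolding bilin_def by auto
  have bA: "bilin K H H U (\<lambda>a b. tlift U (\<delta> a b) Y)" if "Y \<in> carrier HH" for Y
    using that U b1 l by - (assumption | rule lin)+
  have bB: "bilin K H H U (\<lambda>c d. tlift U (\<lambda>a b. \<delta> a b c d) X)" if "X \<in> carrier HH" for X
    using that U b2 l by - (assumption | rule lin)+
  show ?thesis
  proof (rule tensor_eqI[OF _ _ mod mod U _ comult_closed[OF x]])
    show "lin_map K HH U (tlift U (\<lambda>a b. tlift U (\<delta> a b) (comult H y)))"
      using y by (intro lin_map_tlift'[OF mod mod U] bA comult_closed)
    show "lin_map K HH U (\<lambda>X. tlift U (\<lambda>c d. tlift U (\<lambda>a b. \<delta> a b c d) X) (comult H y))"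
      by (rule lin_map_tlift_param[OF comult_closed[OF y] mod mod U tmod])
        (use U b2 bB in \<open>auto intro!: lin_map_tlift'[OF mod mod U]\<close>)
    fix a b assume a: "a \<in> carrier H" "b \<in> carrier H"
    have "tlift U (\<lambda>a b. tlift U (\<delta> a b) (comult H y)) (tens K H H a b) = tlift U (\<delta> a b) (comult H y)"
      using a y by (intro tlift_tens[OF mod mod U] bA comult_closed)
    also have "\<dots> = tlift U (\<lambda>c d. tlift U (\<lambda>a b. \<delta> a b c d) (tens K H H a b)) (comult H y)"
      using a by (intro sw_cong[OF y U b1]) (auto simp: tlift_tens[OF mod mod U b2])
    finally show "tlift U (\<lambda>a b. tlift U (\<delta> a b) (comult H y)) (tens K H H a b) = \<dots>" .
  qed
qed

end

section \<open>Tensor product coactions\<close>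

context hopf_algebra
begin

text \<open>Here \<open>\<delta>\<close> and \<open>\<delta>'\<close> are merely linear maps. The
  formula of \<open>tensor_coact\<close> can then be used for the pair \<open>\<Delta>\<close>,
  \<open>Ad\<close> on \<open>H \<otimes> H\<close> without first showing that \<open>Ad\<close>
  satisfies the comodule axioms.\<close>

context
  fixes V :: "('k, 'v, 'p) module_scheme" and W :: "('k, 'w, 'q) module_scheme" and \<delta> \<delta>'
  assumes V: "module K V" and W: "module K W"
    and d: "lin_map K V (tensor K V H) \<delta>" and d': "lin_map K W (tensor K W H) \<delta>'"
begin

private lemmas coact_lin = V W lin_map_comp[OF d] lin_map_comp[OF d'] lin_map_closed[OF d] lin_map_closed[OF d']

private abbreviation T where "T \<equiv> tensor K (tensor K V W) H"

lemma bilin_coact1: "v0 \<in> carrier V \<Longrightarrow> v1 \<in> carrier H \<Longrightarrow>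
    bilin K W H T (\<lambda>w0 w1. tens K (tensor K V W) H (tens K V W v0 w0) (v1 \<otimes>\<^bsub>H\<^esub> w1))"
  by (assumption | rule lin coact_lin)+

lemma bilin_coact2: "y \<in> carrier (tensor K W H) \<Longrightarrow>
    bilin K V H T (\<lambda>v0 v1. tlift T (\<lambda>w0 w1. tens K (tensor K V W) H (tens K V W v0 w0) (v1 \<otimes>\<^bsub>H\<^esub> w1)) y)"
  by (assumption | rule lin coact_lin)+

lemma bilin_coact3: "bilin K V W T (\<lambda>v w. tlift T (\<lambda>v0 v1.
     tlift T (\<lambda>w0 w1. tens K (tensor K V W) H (tens K V W v0 w0) (v1 \<otimes>\<^bsub>H\<^esub> w1)) (\<delta>' w)) (\<delta> v))"
  by (assumption | rule lin coact_lin)+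

lemma module_T: "module K T" by (assumption | rule lin coact_lin)+

lemma lin_map_tensor_coact: "lin_map K (tensor K V W) T (tensor_coact K H V \<delta> W \<delta>')"
  unfolding tensor_coact_def Let_def by (rule lin_map_tlift'[OF V W module_T bilin_coact3])

lemma tensor_coact_tens: "v \<in> carrier V \<Longrightarrow> w \<in> carrier W \<Longrightarrow>
   tensor_coact K H V \<delta> W \<delta>' (tens K V W v w) = tlift T (\<lambda>v0 v1.
     tlift T (\<lambda>w0 w1. tens K (tensor K V W) H (tens K V W v0 w0) (v1 \<otimes>\<^bsub>H\<^esub> w1)) (\<delta>' w)) (\<delta> v)"
  unfolding tensor_coact_def Let_def by (rule tlift_tens[OF V W module_T bilin_coact3])

lemma tensor_coact_tsub:
  assumes x: "x \<in> tsub K V W A B" and s: "A \<subseteq> carrier V" "B \<subseteq> carrier W"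
    and A: "\<And>a. a \<in> A \<Longrightarrow> \<delta> a \<in> tsub K V H A (carrier H)"
    and B: "\<And>b. b \<in> B \<Longrightarrow> \<delta>' b \<in> tsub K W H B (carrier H)"
  shows "tensor_coact K H V \<delta> W \<delta>' x \<in> tsub K (tensor K V W) H (tsub K V W A B) (carrier H)"
proof -
  have sub: "submodule (tsub K (tensor K V W) H (tsub K V W A B) (carrier H)) K T"
    by (rule tsub_submodule[OF module_tensor[OF V W] mod tsub_subset[OF V W s] subset_refl])
  show ?thesis
  proof (rule lin_map_tsub[OF x lin_map_tensor_coact V W module_T sub s])
    fix a b assume a: "a \<in> A" and b: "b \<in> B"
    then have aV: "a \<in> carrier V" "b \<in> carrier W" using s by auto
    show "tensor_coact K H V \<delta> W \<delta>' (tens K V W a b) \<in> tsub K (tensor K V W) H (tsub K V W A B) (carrier H)"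
      unfolding tensor_coact_tens[OF aV]
    proof (rule tlift_tsub_mem[OF A[OF a] bilin_coact2 V mod module_T sub s(1) subset_refl])
      show "\<delta>' b \<in> carrier (tensor K W H)" by (rule lin_map_closed[OF d' aV(2)])
      fix v0 v1 assume v: "v0 \<in> A" "v1 \<in> carrier H"
      then have vV: "v0 \<in> carrier V" using s by auto
      show "tlift T (\<lambda>w0 w1. tens K (tensor K V W) H (tens K V W v0 w0) (v1 \<otimes>\<^bsub>H\<^esub> w1)) (\<delta>' b)
          \<in> tsub K (tensor K V W) H (tsub K V W A B) (carrier H)"
        by (rule tlift_tsub_mem[OF B[OF b] bilin_coact1[OF vV v(2)] W mod module_T sub s(2) subset_refl])
          (use v in \<open>auto intro!: tsub_tens alg_mult_closed[OF alg]\<close>)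
    qed
  qed
qed

end

text \<open>The multiplication of a comodule algebra is colinear because \<open>\<delta>\<close> is
  multiplicative: on \<open>p \<otimes> q\<close> both sides equal the product of
  \<open>\<delta> p\<close> and \<open>\<delta> q\<close>.\<close>

lemma mu_tensor_coact:
  assumes P: "k_algebra K P" and d: "alg_hom K P (tensor K P H) \<delta>" and x: "x \<in> carrier (tensor K P P)"
  shows "tmap K P H (mu K P) (\<lambda>h. h) (tensor_coact K H P \<delta> P \<delta> x) = \<delta> (mu K P x)"
proof -
  interpret P: k_algebra K P by fact
  note m = P.mod
  note dl = alg_hom_lin_map[OF d]
  let ?PH = "tensor K P H" let ?T = "tensor K (tensor K P P) H"
  have mPH: "module K ?PH" and mT: "module K ?T" by (rule module_tensor[OF m mod], rule module_tensor[OF P.tmod mod])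
  have lt: "lin_map K ?T ?PH (tmap K P H (mu K P) (\<lambda>h. h))"
    by (rule lin_map_tmap[OF lin_map_ident P.lin_map_mu lin_map_ident P.tmod mod m mod])
  show ?thesis
  proof (rule tensor_eqI[OF lin_map_comp[OF lt lin_map_tensor_coact[OF m m dl dl]] lin_map_comp[OF dl P.lin_map_mu] m m mPH _ x])
    fix p q assume p: "p \<in> carrier P" and q: "q \<in> carrier P"
    have dp: "\<delta> p \<in> carrier ?PH" "\<delta> q \<in> carrier ?PH" using dl p q by (auto intro: lin_map_closed)
    have inner: "tmap K P H (mu K P) (\<lambda>h. h) (tlift ?T (\<lambda>w0 w1. tens K (tensor K P P) H (tens K P P v0 w0) (v1 \<otimes>\<^bsub>H\<^esub> w1)) (\<delta> q))
       = tlift ?PH (\<lambda>w0 w1. tens K P H (v0 \<otimes>\<^bsub>P\<^esub> w0) (v1 \<otimes>\<^bsub>H\<^esub> w1)) (\<delta> q)"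
      if v: "v0 \<in> carrier P" "v1 \<in> carrier H" for v0 v1
    proof -
      have e: "tmap K P H (mu K P) (\<lambda>h. h) (tens K (tensor K P P) H (tens K P P v0 w0) (v1 \<otimes>\<^bsub>H\<^esub> w1)) = tens K P H (v0 \<otimes>\<^bsub>P\<^esub> w0) (v1 \<otimes>\<^bsub>H\<^esub> w1)"
        if w: "w0 \<in> carrier P" "w1 \<in> carrier H" for w0 w1
        using v w by (subst tmap_tens[OF P.lin_map_mu lin_map_ident P.tmod mod m mod])
          (auto simp: P.mu_tens intro!: tens_closed[OF m m])
      have b1: "bilin K P H ?PH (\<lambda>w0 w1. tmap K P H (mu K P) (\<lambda>h. h) (tens K (tensor K P P) H (tens K P P v0 w0) (v1 \<otimes>\<^bsub>H\<^esub> w1)))"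
        by (rule bilin_comp[OF lt bilin_coact1[OF m m dl dl v]])
      show ?thesis
        unfolding lin_map_tlift_apply[OF lt dp(2) m mod mT mPH bilin_coact1[OF m m dl dl v]]
        by (rule tlift_cong[OF dp(2) m mod mPH b1 bilin_tensor_mult1[OF P alg v] e])
    qed
    have b2: "bilin K P H ?PH (\<lambda>v0 v1. tmap K P H (mu K P) (\<lambda>h. h) (tlift ?T (\<lambda>w0 w1. tens K (tensor K P P) H (tens K P P v0 w0) (v1 \<otimes>\<^bsub>H\<^esub> w1)) (\<delta> q)))"
      by (rule bilin_comp[OF lt bilin_coact2[OF m m dl dl dp(2)]])
    have "tmap K P H (mu K P) (\<lambda>h. h) (tensor_coact K H P \<delta> P \<delta> (tens K P P p q)) = \<delta> p \<otimes>\<^bsub>?PH\<^esub> \<delta> q"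
      unfolding tensor_coact_tens[OF m m dl dl p q] tensor_mult_def
        lin_map_tlift_apply[OF lt dp(1) m mod mT mPH bilin_coact2[OF m m dl dl dp(2)]]
      by (rule tlift_cong[OF dp(1) m mod mPH b2 bilin_tensor_mult2[OF P alg dp(2)] inner])
    also have "\<dots> = \<delta> (p \<otimes>\<^bsub>P\<^esub> q)" using d ring_hom_mult[OF _ p q, of \<delta> ?PH] by (simp add: alg_hom_def)
    finally show "tmap K P H (mu K P) (\<lambda>h. h) (tensor_coact K H P \<delta> P \<delta> (tens K P P p q)) = \<delta> (mu K P (tens K P P p q))"
      using p q by (simp add: P.mu_tens)
  qed
qed

text \<open>By \<open>mu_tensor_coact\<close> the map \<open>mu \<otimes> id\<close> kills the
  coaction of a universal form, and \<open>univ_tsub\<close> then locates it. Both \<open>H\<close>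
  and the bundle algebra are instances.\<close>

lemma tensor_coact_univ:
  assumes P: "k_algebra K P" and d: "alg_hom K P (tensor K P H) \<delta>" and x: "x \<in> univ_calc K P"
  shows "tensor_coact K H P \<delta> P \<delta> x \<in> tsub K (tensor K P P) H (univ_calc K P) (carrier H)"
proof -
  interpret P: k_algebra K P by fact
  note dl = alg_hom_lin_map[OF d]
  have x': "x \<in> carrier (tensor K P P)" "mu K P x = \<zero>\<^bsub>P\<^esub>" using x by (auto simp: univ_calc_mu)
  show ?thesis
    by (rule P.univ_tsub[OF mod lin_map_closed[OF lin_map_tensor_coact[OF P.mod P.mod dl dl] x'(1)]])
      (simp add: mu_tensor_coact[OF P d x'(1)] x'(2) lin_map_zero[OF P.mod module_tensor[OF P.mod mod] dl])
qed


section \<open>The canonical map of a Hopf algebra\<close>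

text \<open>
  \<open>theta\<close> is the isomorphism \<open>h \<otimes> g \<mapsto> h g\<^sub>1 \<otimes> g\<^sub>2\<close> by which \<^const>\<open>bicov_N\<close> is defined; its inverse
  is \<open>h \<otimes> g \<mapsto> h S(g\<^sub>1) \<otimes> g\<^sub>2\<close>.
\<close>

definition theta where
  "theta = tlift HH (\<lambda>h g. tmap K H H (\<lambda>g1. h \<otimes>\<^bsub>H\<^esub> g1) (\<lambda>g2. g2) (comult H g))"

definition theta_inv where
  "theta_inv = tlift HH (\<lambda>h g. tmap K H H (\<lambda>g1. h \<otimes>\<^bsub>H\<^esub> antipode H g1) (\<lambda>g2. g2) (comult H g))"

lemma bilin_theta: "bilin K H H HH (\<lambda>h g. tmap K H H (\<lambda>g1. h \<otimes>\<^bsub>H\<^esub> g1) (\<lambda>g2. g2) (comult H g))"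
  by (assumption | rule lin)+

lemma bilin_theta_inv: "bilin K H H HH (\<lambda>h g. tmap K H H (\<lambda>g1. h \<otimes>\<^bsub>H\<^esub> antipode H g1) (\<lambda>g2. g2) (comult H g))"
  by (assumption | rule lin)+

lemma lin_map_theta: "lin_map K HH HH theta"
  unfolding theta_def by (rule lin_map_tlift'[OF mod mod tmod bilin_theta])

lemma lin_map_theta_inv: "lin_map K HH HH theta_inv"
  unfolding theta_inv_def by (rule lin_map_tlift'[OF mod mod tmod bilin_theta_inv])

lemmas lin_map_theta_comp [lin] = lin_map_comp[OF lin_map_theta]
lemmas theta_closed [lin] = lin_map_closed[OF lin_map_theta]
lemmas lin_map_theta_inv_comp [lin] = lin_map_comp[OF lin_map_theta_inv]
lemmas theta_inv_closed [lin] = lin_map_closed[OF lin_map_theta_inv]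

lemma theta_tens: "h \<in> carrier H \<Longrightarrow> g \<in> carrier H \<Longrightarrow>
    theta (tens K H H h g) = tlift HH (\<lambda>a b. tens K H H (h \<otimes>\<^bsub>H\<^esub> a) b) (comult H g)"
  unfolding theta_def by (subst tlift_tens[OF mod mod tmod bilin_theta]) (simp_all add: tmap_def)

lemma theta_inv_tens: "h \<in> carrier H \<Longrightarrow> g \<in> carrier H \<Longrightarrow>
    theta_inv (tens K H H h g) = tlift HH (\<lambda>a b. tens K H H (h \<otimes>\<^bsub>H\<^esub> antipode H a) b) (comult H g)"
  unfolding theta_inv_def by (subst tlift_tens[OF mod mod tmod bilin_theta_inv]) (simp_all add: tmap_def)

lemma theta_theta_inv:
  assumes x: "x \<in> carrier HH" shows "theta (theta_inv x) = x"
proof (rule tensor_eqI[OF _ _ mod mod tmod _ x])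
  show "lin_map K HH HH (\<lambda>x. theta (theta_inv x))" "lin_map K HH HH (\<lambda>x. x)" by (assumption | rule lin)+
  fix h g assume h: "h \<in> carrier H" and g: "g \<in> carrier H"
  have "theta (theta_inv (tens K H H h g)) = tlift HH (\<lambda>a b. theta (tens K H H (h \<otimes>\<^bsub>H\<^esub> antipode H a) b)) (comult H g)"
    unfolding theta_inv_tens[OF h g] by (rule sw_apply[OF lin_map_theta g tmod tmod]) (insert h, (assumption | rule lin)+)
  also have "\<dots> = tlift HH (\<lambda>a b. tlift HH (\<lambda>c d. tens K H H (h \<otimes>\<^bsub>H\<^esub> (antipode H a \<otimes>\<^bsub>H\<^esub> c)) d) (comult H b)) (comult H g)"
  proof (rule sw_cong[OF g tmod])
    show "bilin K H H HH (\<lambda>a b. theta (tens K H H (h \<otimes>\<^bsub>H\<^esub> antipode H a) b))" using h by - (assumption | rule lin)+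
    fix a b assume a: "a \<in> carrier H" and b: "b \<in> carrier H"
    show "theta (tens K H H (h \<otimes>\<^bsub>H\<^esub> antipode H a) b) = tlift HH (\<lambda>c d. tens K H H (h \<otimes>\<^bsub>H\<^esub> (antipode H a \<otimes>\<^bsub>H\<^esub> c)) d) (comult H b)"
      unfolding theta_tens[OF alg_mult_closed[OF alg h antipode_closed[OF a]] b]
    proof (rule sw_cong[OF b tmod])
      show "bilin K H H HH (\<lambda>c d. tens K H H (h \<otimes>\<^bsub>H\<^esub> antipode H a \<otimes>\<^bsub>H\<^esub> c) d)"
        using h a by - (assumption | rule lin)+
    qed (use h antipode_closed[OF a] in \<open>simp add: m_assoc\<close>)
  qed
  \<comment> \<open>Coassociativity gathers the factors \<open>S(g\<^sub>1) g\<^sub>2\<close> into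
    one inner sum, which the antipode axiom collapses to a counit.\<close>
  also have "\<dots> = tlift HH (\<lambda>x d. tlift HH (\<lambda>a c. tens K H H (h \<otimes>\<^bsub>H\<^esub> (antipode H a \<otimes>\<^bsub>H\<^esub> c)) d) (comult H x)) (comult H g)"
    by (rule sw_coassoc[OF g tmod, symmetric]) (insert h, (assumption | rule lin)+)
  also have "\<dots> = tlift HH (\<lambda>x d. counit H x \<odot>\<^bsub>HH\<^esub> tens K H H h d) (comult H g)"
  proof (rule sw_cong[OF g tmod])
    show "bilin K H H HH (\<lambda>x d. tlift HH (\<lambda>a c. tens K H H (h \<otimes>\<^bsub>H\<^esub> (antipode H a \<otimes>\<^bsub>H\<^esub> c)) d) (comult H x))"
      using h by - (assumption | rule lin)+
    fix a b assume a: "a \<in> carrier H" and b: "b \<in> carrier H"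
    have l: "lin_map K H HH (\<lambda>y. tens K H H (h \<otimes>\<^bsub>H\<^esub> y) b)" using h b by - (assumption | rule lin)+
    show "tlift HH (\<lambda>a c. tens K H H (h \<otimes>\<^bsub>H\<^esub> (antipode H a \<otimes>\<^bsub>H\<^esub> c)) b) (comult H a) = counit H a \<odot>\<^bsub>HH\<^esub> tens K H H h b"
      using sw_antipode_left[OF a tmod l] h by simp
  qed
  also have "\<dots> = tens K H H h g"
    by (rule sw_counit_left[OF g tmod]) (insert h, (assumption | rule lin)+)
  finally show "theta (theta_inv (tens K H H h g)) = tens K H H h g" .
qed

lemma theta_inv_theta:
  assumes x: "x \<in> carrier HH" shows "theta_inv (theta x) = x"
proof (rule tensor_eqI[OF _ _ mod mod tmod _ x])
  show "lin_map K HH HH (\<lambda>x. theta_inv (theta x))" "lin_map K HH HH (\<lambda>x. x)" by (assumption | rule lin)+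
  fix h g assume h: "h \<in> carrier H" and g: "g \<in> carrier H"
  have "theta_inv (theta (tens K H H h g)) = tlift HH (\<lambda>a b. theta_inv (tens K H H (h \<otimes>\<^bsub>H\<^esub> a) b)) (comult H g)"
    unfolding theta_tens[OF h g] by (rule sw_apply[OF lin_map_theta_inv g tmod tmod]) (insert h, (assumption | rule lin)+)
  also have "\<dots> = tlift HH (\<lambda>a b. tlift HH (\<lambda>c d. tens K H H (h \<otimes>\<^bsub>H\<^esub> (a \<otimes>\<^bsub>H\<^esub> antipode H c)) d) (comult H b)) (comult H g)"
  proof (rule sw_cong[OF g tmod])
    show "bilin K H H HH (\<lambda>a b. theta_inv (tens K H H (h \<otimes>\<^bsub>H\<^esub> a) b))" using h by - (assumption | rule lin)+
    fix a b assume a: "a \<in> carrier H" and b: "b \<in> carrier H"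
    show "theta_inv (tens K H H (h \<otimes>\<^bsub>H\<^esub> a) b) = tlift HH (\<lambda>c d. tens K H H (h \<otimes>\<^bsub>H\<^esub> (a \<otimes>\<^bsub>H\<^esub> antipode H c)) d) (comult H b)"
      unfolding theta_inv_tens[OF alg_mult_closed[OF alg h a] b]
    proof (rule sw_cong[OF b tmod])
      show "bilin K H H HH (\<lambda>c d. tens K H H (h \<otimes>\<^bsub>H\<^esub> a \<otimes>\<^bsub>H\<^esub> antipode H c) d)"
        using h a by - (assumption | rule lin)+
    qed (use h a antipode_closed in \<open>simp add: m_assoc\<close>)
  qed
  \<comment> \<open>In this order the gathered factors are \<open>g\<^sub>1 S(g\<^sub>2)\<close>, so
    the other antipode axiom is the one that applies.\<close>
  also have "\<dots> = tlift HH (\<lambda>x d. tlift HH (\<lambda>a c. tens K H H (h \<otimes>\<^bsub>H\<^esub> (a \<otimes>\<^bsub>H\<^esub> antipode H c)) d) (comult H x)) (comult H g)"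
    by (rule sw_coassoc[OF g tmod, symmetric]) (insert h, (assumption | rule lin)+)
  also have "\<dots> = tlift HH (\<lambda>x d. counit H x \<odot>\<^bsub>HH\<^esub> tens K H H h d) (comult H g)"
  proof (rule sw_cong[OF g tmod])
    show "bilin K H H HH (\<lambda>x d. tlift HH (\<lambda>a c. tens K H H (h \<otimes>\<^bsub>H\<^esub> (a \<otimes>\<^bsub>H\<^esub> antipode H c)) d) (comult H x))"
      using h by - (assumption | rule lin)+
    fix a b assume a: "a \<in> carrier H" and b: "b \<in> carrier H"
    have l: "lin_map K H HH (\<lambda>y. tens K H H (h \<otimes>\<^bsub>H\<^esub> y) b)" using h b by - (assumption | rule lin)+
    show "tlift HH (\<lambda>a c. tens K H H (h \<otimes>\<^bsub>H\<^esub> (a \<otimes>\<^bsub>H\<^esub> antipode H c)) b) (comult H a) = counit H a \<odot>\<^bsub>HH\<^esub> tens K H H h b"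
      using sw_antipode_right[OF a tmod l] h by simp
  qed
  also have "\<dots> = tens K H H h g"
    by (rule sw_counit_left[OF g tmod]) (insert h, (assumption | rule lin)+)
  finally show "theta_inv (theta (tens K H H h g)) = tens K H H h g" .
qed

abbreviation eps_right where "eps_right V \<equiv> tlift V (\<lambda>v h. counit H h \<odot>\<^bsub>V\<^esub> v)"

lemma bilin_eps_right: "module K V \<Longrightarrow> bilin K V H V (\<lambda>v h. counit H h \<odot>\<^bsub>V\<^esub> v)"
  by (assumption | rule lin)+

lemma lin_map_eps_right: "module K V \<Longrightarrow> lin_map K (tensor K V H) V (eps_right V)"
  by (rule lin_map_tlift'[OF _ mod _ bilin_eps_right])

lemma eps_right_tens: "module K V \<Longrightarrow> v \<in> carrier V \<Longrightarrow> h \<in> carrier H \<Longrightarrow>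
    eps_right V (tens K V H v h) = counit H h \<odot>\<^bsub>V\<^esub> v"
  by (rule tlift_tens[OF _ mod _ bilin_eps_right])

text \<open>By the counit axiom, \<open>h g\<^sub>1 \<epsilon>(g\<^sub>2) = h g\<close>. The product
  of \<open>x\<close>, and with it membership in the universal calculus, can thus be read off from
  \<open>theta x\<close>.\<close>

lemma eps_right_theta:
  assumes x: "x \<in> carrier HH" shows "eps_right H (theta x) = mu K H x"
proof (rule tensor_eqI[OF lin_map_comp[OF lin_map_eps_right[OF mod] lin_map_theta] lin_map_mu mod mod mod _ x])
  fix h g assume h: "h \<in> carrier H" and g: "g \<in> carrier H"
  have l: "lin_map K H H (\<lambda>a. h \<otimes>\<^bsub>H\<^esub> a)" using h by - (assumption | rule lin)+
  have "eps_right H (theta (tens K H H h g)) = tlift H (\<lambda>a b. eps_right H (tens K H H (h \<otimes>\<^bsub>H\<^esub> a) b)) (comult H g)"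
    unfolding theta_tens[OF h g] by (rule sw_apply[OF lin_map_eps_right[OF mod] g tmod mod]) (insert h, (assumption | rule lin)+)
  also have "\<dots> = tlift H (\<lambda>a b. counit H b \<odot>\<^bsub>H\<^esub> (h \<otimes>\<^bsub>H\<^esub> a)) (comult H g)"
    by (rule sw_cong[OF g mod], rule bilinI; (rule lin_map_comp[OF lin_map_eps_right[OF mod]] eps_right_tens[OF mod])?)
      (insert h, (assumption | rule lin)+)
  also have "\<dots> = h \<otimes>\<^bsub>H\<^esub> g" by (rule sw_counit_right[OF g mod l])
  finally show "eps_right H (theta (tens K H H h g)) = mu K H (tens K H H h g)" using h g by (simp add: mu_tens)
qed

section \<open>The adjoint coaction and its relation to the coaction on
  \<open>H \<otimes> H\<close>\<close>

lemma lin_map_Ad: "lin_map K H HH (Ad_coact K H)"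
  unfolding Ad_coact_def by (assumption | rule lin)+

text \<open>\<open>Ad_coact\<close> is defined through the tensor
  \<open>(\<Delta> \<otimes> id) (\<Delta> h)\<close>. As an iterated sum, with \<open>c\<close>,
  \<open>d\<close>, \<open>b\<close> the three legs of \<open>h\<close> in this order, it becomes
  accessible to the \<open>sw_\<close> rules.\<close>

lemma Ad_sweedler:
  assumes h: "h \<in> carrier H"
  shows "Ad_coact K H h = tlift HH (\<lambda>a b. tlift HH (\<lambda>c d. tens K H H d (antipode H c \<otimes>\<^bsub>H\<^esub> b)) (comult H a)) (comult H h)"
proof -
  let ?t = "tlift HH (\<lambda>x h3. tlift HH (\<lambda>h1 h2. tens K H H h2 (antipode H h1 \<otimes>\<^bsub>H\<^esub> h3)) x)"
  have b: "bilin K HH H HH (\<lambda>x h3. tlift HH (\<lambda>h1 h2. tens K H H h2 (antipode H h1 \<otimes>\<^bsub>H\<^esub> h3)) x)"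
    by (assumption | rule lin)+
  have lt: "lin_map K (tensor K HH H) HH ?t" by (rule lin_map_tlift'[OF tmod mod tmod b])
  have "Ad_coact K H h = tlift HH (\<lambda>a b. ?t (tens K HH H (comult H a) b)) (comult H h)"
    unfolding Ad_coact_def tmap_def
    by (rule sw_apply[OF lt h module_tensor[OF tmod mod] tmod]) (assumption | rule lin)+
  also have "\<dots> = tlift HH (\<lambda>a b. tlift HH (\<lambda>c d. tens K H H d (antipode H c \<otimes>\<^bsub>H\<^esub> b)) (comult H a)) (comult H h)"
  proof (rule sw_cong[OF h tmod])
    show "bilin K H H HH (\<lambda>a b. ?t (tens K HH H (comult H a) b))" by (assumption | rule lin)+
  qed (auto intro!: tlift_tens[OF tmod mod tmod b] comult_closed)
  finally show ?thesis .
qed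

end

context hopf_algebra
begin

abbreviation rho where "rho \<equiv> tensor_coact K H H (comult H) H (comult H)"
abbreviation sigma where "sigma \<equiv> tensor_coact K H H (comult H) H (Ad_coact K H)"

lemma module_HHH [lin]: "module K (tensor K HH H)"
  by (rule module_tensor[OF tmod mod])

lemma lin_map_rho: "lin_map K HH (tensor K HH H) rho"
  by (rule lin_map_tensor_coact[OF mod mod lin_map_comult lin_map_comult])

lemma lin_map_sigma: "lin_map K HH (tensor K HH H) sigma"
  by (rule lin_map_tensor_coact[OF mod mod lin_map_comult lin_map_Ad])

lemma sigma_tens:
  assumes x: "x \<in> carrier H" and y: "y \<in> carrier H"
  shows "sigma (tens K H H x y) = tlift (tensor K HH H) (\<lambda>a b. tlift (tensor K HH H) (\<lambda>p q. tlift (tensor K HH H)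
      (\<lambda>p1 p2. tens K HH H (tens K H H a p2) (b \<otimes>\<^bsub>H\<^esub> (antipode H p1 \<otimes>\<^bsub>H\<^esub> q))) (comult H p)) (comult H y)) (comult H x)"
  (is "_ = tlift ?T (\<lambda>a b. ?R a b) _")
  unfolding tensor_coact_tens[OF mod mod lin_map_comult lin_map_Ad x y]
proof (rule sw_cong[OF x module_HHH])
  note Ady = lin_map_closed[OF lin_map_Ad y]
  show "bilin K H H ?T (\<lambda>v0 v1. tlift ?T (\<lambda>w0 w1. tens K HH H (tens K H H v0 w0) (v1 \<otimes>\<^bsub>H\<^esub> w1)) (Ad_coact K H y))"
    by (rule bilin_coact2[OF mod mod lin_map_comult lin_map_Ad Ady])
  fix a b assume a: "a \<in> carrier H" and b: "b \<in> carrier H"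
  let ?\<beta> = "\<lambda>w0 w1. tens K HH H (tens K H H a w0) (b \<otimes>\<^bsub>H\<^esub> w1)"
  have bl: "bilin K H H ?T ?\<beta>" by (rule bilin_coact1[OF mod mod lin_map_comult lin_map_Ad a b])
  have lb: "lin_map K HH ?T (tlift ?T ?\<beta>)" by (rule lin_map_tlift'[OF mod mod module_HHH bl])
  have "tlift ?T ?\<beta> (Ad_coact K H y) = tlift ?T (\<lambda>p q. tlift ?T ?\<beta> (tlift HH (\<lambda>c d. tens K H H d (antipode H c \<otimes>\<^bsub>H\<^esub> q)) (comult H p))) (comult H y)"
    unfolding Ad_sweedler[OF y]
    by (rule sw_apply[OF lb y tmod module_HHH]) (assumption | rule lin)+
  also have "\<dots> = ?R a b"
  proof (rule sw_cong[OF y module_HHH])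
    show "bilin K H H ?T (\<lambda>p q. tlift ?T ?\<beta> (tlift HH (\<lambda>c d. tens K H H d (antipode H c \<otimes>\<^bsub>H\<^esub> q)) (comult H p)))"
      by (rule bilinI; rule lin_map_comp[OF lb]) (assumption | rule lin)+
    fix p q assume p: "p \<in> carrier H" and q: "q \<in> carrier H"
    have "tlift ?T ?\<beta> (tlift HH (\<lambda>c d. tens K H H d (antipode H c \<otimes>\<^bsub>H\<^esub> q)) (comult H p)) =
      tlift ?T (\<lambda>c d. tlift ?T ?\<beta> (tens K H H d (antipode H c \<otimes>\<^bsub>H\<^esub> q))) (comult H p)"
      by (rule sw_apply[OF lb p tmod module_HHH]) (insert q, (assumption | rule lin)+)
    also have "\<dots> = tlift ?T (\<lambda>p1 p2. ?\<beta> p2 (antipode H p1 \<otimes>\<^bsub>H\<^esub> q)) (comult H p)"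
    proof (rule sw_cong[OF p module_HHH])
      show "bilin K H H ?T (\<lambda>c d. tlift ?T ?\<beta> (tens K H H d (antipode H c \<otimes>\<^bsub>H\<^esub> q)))"
        by (rule bilinI; rule lin_map_comp[OF lb]) (insert q, (assumption | rule lin)+)
    qed (use q antipode_closed in \<open>auto intro!: tlift_tens[OF mod mod module_HHH bl]\<close>)
    finally show "tlift ?T ?\<beta> (tlift HH (\<lambda>c d. tens K H H d (antipode H c \<otimes>\<^bsub>H\<^esub> q)) (comult H p)) =
       tlift ?T (\<lambda>p1 p2. ?\<beta> p2 (antipode H p1 \<otimes>\<^bsub>H\<^esub> q)) (comult H p)" .
  qed
  finally show "tlift ?T ?\<beta> (Ad_coact K H y) = ?R a b" .
qed

text \<open>In Sweedler notation the left side is \<open>a \<otimes> y\<^sub>3 \<otimes> b y\<^sub>1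
  S(y\<^sub>2) y\<^sub>4\<close>. The adjacent legs \<open>y\<^sub>1 S(y\<^sub>2)\<close> collapse
  to a counit, and the remaining two are renumbered.\<close>

lemma sweedler_cancel:
  assumes a: "a \<in> carrier H" and b: "b \<in> carrier H" and y: "y \<in> carrier H"
  shows "tlift (tensor K HH H) (\<lambda>f d. tlift (tensor K HH H) (\<lambda>p q. tlift (tensor K HH H)
      (\<lambda>p1 p2. tens K HH H (tens K H H a p2) (b \<otimes>\<^bsub>H\<^esub> f \<otimes>\<^bsub>H\<^esub> (antipode H p1 \<otimes>\<^bsub>H\<^esub> q))) (comult H p)) (comult H d)) (comult H y) =
    tlift (tensor K HH H) (\<lambda>p q. tens K HH H (tens K H H a p) (b \<otimes>\<^bsub>H\<^esub> q)) (comult H y)"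
proof -
  let ?T = "tensor K HH H"
  let ?\<gamma> = "\<lambda>f p1 p2 q. tens K HH H (tens K H H a p2) (b \<otimes>\<^bsub>H\<^esub> f \<otimes>\<^bsub>H\<^esub> (antipode H p1 \<otimes>\<^bsub>H\<^esub> q))"
  \<comment> \<open>The argument \<open>w\<close> marks the place of
    \<open>y\<^sub>1 S(y\<^sub>2)\<close>; linearity in \<open>w\<close> lets the antipode axiom act
    there, and linearity in \<open>z\<close> the counit axiom afterwards.\<close>
  let ?F = "\<lambda>z w. tlift ?T (\<lambda>p2 q. tens K HH H (tens K H H a p2) (b \<otimes>\<^bsub>H\<^esub> (w \<otimes>\<^bsub>H\<^esub> q))) (comult H z)"
  have lF: "lin_map K H ?T (\<lambda>z. ?F z w)" if "w \<in> carrier H" for w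
    using a b that by - (assumption | rule lin)+
  have lF': "lin_map K H ?T (\<lambda>w. ?F z w)" if "z \<in> carrier H" for z
    using a b that by - (assumption | rule lin)+
  have "tlift ?T (\<lambda>f d. tlift ?T (\<lambda>p q. tlift ?T (\<lambda>p1 p2. ?\<gamma> f p1 p2 q) (comult H p)) (comult H d)) (comult H y)
    = tlift ?T (\<lambda>f d. tlift ?T (\<lambda>p1 z. ?F z (f \<otimes>\<^bsub>H\<^esub> antipode H p1)) (comult H d)) (comult H y)"
  proof (rule sw_cong[OF y module_HHH])
    show "bilin K H H ?T (\<lambda>f d. tlift ?T (\<lambda>p q. tlift ?T (\<lambda>p1 p2. ?\<gamma> f p1 p2 q) (comult H p)) (comult H d))"
      using a b by - (assumption | rule lin)+
    fix f d assume f: "f \<in> carrier H" and d: "d \<in> carrier H"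
    have "tlift ?T (\<lambda>p q. tlift ?T (\<lambda>p1 p2. ?\<gamma> f p1 p2 q) (comult H p)) (comult H d) =
       tlift ?T (\<lambda>p1 z. tlift ?T (\<lambda>p2 q. ?\<gamma> f p1 p2 q) (comult H z)) (comult H d)"
      by (rule sw_coassoc[OF d module_HHH]) (insert a b f, (assumption | rule lin)+)
    also have "\<dots> = tlift ?T (\<lambda>p1 z. ?F z (f \<otimes>\<^bsub>H\<^esub> antipode H p1)) (comult H d)"
    proof (rule sw_cong[OF d module_HHH])
      show "bilin K H H ?T (\<lambda>p1 z. tlift ?T (\<lambda>p2 q. ?\<gamma> f p1 p2 q) (comult H z))"
        using a b f by - (assumption | rule lin)+
      fix p1 z assume p1: "p1 \<in> carrier H" and z: "z \<in> carrier H"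
      show "tlift ?T (\<lambda>p2 q. ?\<gamma> f p1 p2 q) (comult H z) = ?F z (f \<otimes>\<^bsub>H\<^esub> antipode H p1)"
      proof (rule sw_cong[OF z module_HHH])
        show "bilin K H H ?T (\<lambda>p2 q. ?\<gamma> f p1 p2 q)" using a b f p1 by - (assumption | rule lin)+
      qed (use b f antipode_closed[OF p1] in \<open>simp add: m_assoc\<close>)
    qed
    finally show "tlift ?T (\<lambda>p q. tlift ?T (\<lambda>p1 p2. ?\<gamma> f p1 p2 q) (comult H p)) (comult H d) =
       tlift ?T (\<lambda>p1 z. ?F z (f \<otimes>\<^bsub>H\<^esub> antipode H p1)) (comult H d)" .
  qed
  also have "\<dots> = tlift ?T (\<lambda>u z. tlift ?T (\<lambda>f p1. ?F z (f \<otimes>\<^bsub>H\<^esub> antipode H p1)) (comult H u)) (comult H y)"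
    by (rule sw_coassoc[OF y module_HHH, symmetric]) (insert a b, (assumption | rule lin)+)
  also have "\<dots> = tlift ?T (\<lambda>u z. counit H u \<odot>\<^bsub>?T\<^esub> ?F z \<one>\<^bsub>H\<^esub>) (comult H y)"
  proof (rule sw_cong[OF y module_HHH])
    show "bilin K H H ?T (\<lambda>u z. tlift ?T (\<lambda>f p1. ?F z (f \<otimes>\<^bsub>H\<^esub> antipode H p1)) (comult H u))"
      using a b by - (assumption | rule lin)+
  qed (rule sw_antipode_right[OF _ module_HHH lF'], assumption+)
  also have "\<dots> = ?F y \<one>\<^bsub>H\<^esub>"
    by (rule sw_counit_left[OF y module_HHH lF]) simp
  also have "\<dots> = tlift ?T (\<lambda>p q. tens K HH H (tens K H H a p) (b \<otimes>\<^bsub>H\<^esub> q)) (comult H y)"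
  proof (rule sw_cong[OF y module_HHH])
    show "bilin K H H ?T (\<lambda>p2 q. tens K HH H (tens K H H a p2) (b \<otimes>\<^bsub>H\<^esub> (\<one>\<^bsub>H\<^esub> \<otimes>\<^bsub>H\<^esub> q)))"
      using a b by - (assumption | rule lin)+
  qed simp
  finally show ?thesis .
qed

text \<open>
  \<open>theta\<close> intertwines the tensor product coaction of \<open>H \<otimes> H\<close> with \<open>\<Delta> \<otimes> Ad\<close>. The calculation uses only
  \<open>a\<^sub>1 S(a\<^sub>2) = \<epsilon>(a)\<close>, and not that \<open>S\<close> reverses the coproduct.
\<close>

lemma sigma_theta:
  assumes x: "x \<in> carrier HH"
  shows "sigma (theta x) = tmap K HH H theta (\<lambda>h. h) (rho x)"
proof -
  let ?T = "tensor K HH H"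
  have lt: "lin_map K ?T ?T (tmap K HH H theta (\<lambda>h. h))"
    by (rule lin_map_tmap[OF lin_map_ident lin_map_theta lin_map_ident tmod mod tmod mod])
  show ?thesis
  proof (rule tensor_eqI[OF lin_map_comp[OF lin_map_sigma lin_map_theta] lin_map_comp[OF lt lin_map_rho] mod mod module_HHH _ x])
    fix h g assume h: "h \<in> carrier H" and g: "g \<in> carrier H"
    let ?\<gamma> = "\<lambda>a b p1 p2 q. tens K HH H (tens K H H a p2) (b \<otimes>\<^bsub>H\<^esub> (antipode H p1 \<otimes>\<^bsub>H\<^esub> q))"
    let ?S = "\<lambda>a b d. tlift ?T (\<lambda>p q. tlift ?T (\<lambda>p1 p2. ?\<gamma> a b p1 p2 q) (comult H p)) (comult H d)"
    let ?E = "\<lambda>a b e y. tlift ?T (\<lambda>p q. tens K HH H (tens K H H (a \<otimes>\<^bsub>H\<^esub> e) p) (b \<otimes>\<^bsub>H\<^esub> q)) (comult H y)"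
    have "sigma (theta (tens K H H h g)) = tlift ?T (\<lambda>c d. sigma (tens K H H (h \<otimes>\<^bsub>H\<^esub> c) d)) (comult H g)"
      unfolding theta_tens[OF h g] by (rule sw_apply[OF lin_map_sigma g tmod module_HHH]) (insert h, (assumption | rule lin)+)
    also have "\<dots> = tlift ?T (\<lambda>c d. tlift ?T (\<lambda>a b. tlift ?T (\<lambda>e f. ?S (a \<otimes>\<^bsub>H\<^esub> e) (b \<otimes>\<^bsub>H\<^esub> f) d) (comult H c)) (comult H h)) (comult H g)"
    proof (rule sw_cong[OF g module_HHH])
      show "bilin K H H ?T (\<lambda>c d. sigma (tens K H H (h \<otimes>\<^bsub>H\<^esub> c) d))"
        by (rule bilinI; rule lin_map_comp[OF lin_map_sigma]) (insert h, (assumption | rule lin)+)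
      fix c d assume c: "c \<in> carrier H" and d: "d \<in> carrier H"
      show "sigma (tens K H H (h \<otimes>\<^bsub>H\<^esub> c) d) = tlift ?T (\<lambda>a b. tlift ?T (\<lambda>e f. ?S (a \<otimes>\<^bsub>H\<^esub> e) (b \<otimes>\<^bsub>H\<^esub> f) d) (comult H c)) (comult H h)"
        unfolding sigma_tens[OF alg_mult_closed[OF alg h c] d]
        by (rule sw_mult[OF h c module_HHH]) (insert d, (assumption | rule lin)+)
    qed
    \<comment> \<open>The sums over the legs of \<open>h\<close> and of \<open>g\<close> are
      independent. Exchanging them brings all legs of \<open>g\<close> together, where
      coassociativity and \<open>sweedler_cancel\<close> apply for fixed legs \<open>a\<close>,
      \<open>b\<close> of \<open>h\<close>.\<close>
    also have "\<dots> = tlift ?T (\<lambda>a b. tlift ?T (\<lambda>c d. tlift ?T (\<lambda>e f. ?S (a \<otimes>\<^bsub>H\<^esub> e) (b \<otimes>\<^bsub>H\<^esub> f) d) (comult H c)) (comult H g)) (comult H h)"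
      by (rule sw_swap[OF g h module_HHH]) (assumption | rule lin)+
    also have "\<dots> = tlift ?T (\<lambda>a b. tlift ?T (\<lambda>e y. ?E a b e y) (comult H g)) (comult H h)"
    proof (rule sw_cong[OF h module_HHH])
      show "bilin K H H ?T (\<lambda>a b. tlift ?T (\<lambda>c d. tlift ?T (\<lambda>e f. ?S (a \<otimes>\<^bsub>H\<^esub> e) (b \<otimes>\<^bsub>H\<^esub> f) d) (comult H c)) (comult H g))"
        using g by - (assumption | rule lin)+
      fix a b assume a: "a \<in> carrier H" and b: "b \<in> carrier H"
      have "tlift ?T (\<lambda>c d. tlift ?T (\<lambda>e f. ?S (a \<otimes>\<^bsub>H\<^esub> e) (b \<otimes>\<^bsub>H\<^esub> f) d) (comult H c)) (comult H g) =
        tlift ?T (\<lambda>e y. tlift ?T (\<lambda>f d. ?S (a \<otimes>\<^bsub>H\<^esub> e) (b \<otimes>\<^bsub>H\<^esub> f) d) (comult H y)) (comult H g)"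
        by (rule sw_coassoc[OF g module_HHH]) (insert a b, (assumption | rule lin)+)
      also have "\<dots> = tlift ?T (\<lambda>e y. ?E a b e y) (comult H g)"
      proof (rule sw_cong[OF g module_HHH])
        show "bilin K H H ?T (\<lambda>e y. tlift ?T (\<lambda>f d. ?S (a \<otimes>\<^bsub>H\<^esub> e) (b \<otimes>\<^bsub>H\<^esub> f) d) (comult H y))"
          using a b by - (assumption | rule lin)+
      qed (rule sweedler_cancel[OF alg_mult_closed[OF alg a] b], assumption+)
      finally show "tlift ?T (\<lambda>c d. tlift ?T (\<lambda>e f. ?S (a \<otimes>\<^bsub>H\<^esub> e) (b \<otimes>\<^bsub>H\<^esub> f) d) (comult H c)) (comult H g) = \<dots>" .
    qed
    finally have L: "sigma (theta (tens K H H h g)) = tlift ?T (\<lambda>a b. tlift ?T (\<lambda>e y. ?E a b e y) (comult H g)) (comult H h)" .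
    have inner: "tmap K HH H theta (\<lambda>h. h) (tlift ?T (\<lambda>c d. tens K HH H (tens K H H a c) (b \<otimes>\<^bsub>H\<^esub> d)) (comult H g))
        = tlift ?T (\<lambda>e y. ?E a b e y) (comult H g)" if a: "a \<in> carrier H" and b: "b \<in> carrier H" for a b
    proof -
      have "tmap K HH H theta (\<lambda>h. h) (tlift ?T (\<lambda>c d. tens K HH H (tens K H H a c) (b \<otimes>\<^bsub>H\<^esub> d)) (comult H g)) =
        tlift ?T (\<lambda>c d. tmap K HH H theta (\<lambda>h. h) (tens K HH H (tens K H H a c) (b \<otimes>\<^bsub>H\<^esub> d))) (comult H g)"
        by (rule sw_apply[OF lt g module_HHH module_HHH]) (insert a b, (assumption | rule lin)+)
      also have "\<dots> = tlift ?T (\<lambda>c d. tlift ?T (\<lambda>e f. tens K HH H (tens K H H (a \<otimes>\<^bsub>H\<^esub> e) f) (b \<otimes>\<^bsub>H\<^esub> d)) (comult H c)) (comult H g)"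
      proof (rule sw_cong[OF g module_HHH])
        show "bilin K H H ?T (\<lambda>c d. tmap K HH H theta (\<lambda>h. h) (tens K HH H (tens K H H a c) (b \<otimes>\<^bsub>H\<^esub> d)))"
          by (rule bilinI; rule lin_map_comp[OF lt]) (insert a b, (assumption | rule lin)+)
        fix c d assume c: "c \<in> carrier H" and d: "d \<in> carrier H"
        have bd: "b \<otimes>\<^bsub>H\<^esub> d \<in> carrier H" using b d by simp
        have l: "lin_map K HH ?T (\<lambda>x. tens K HH H x (b \<otimes>\<^bsub>H\<^esub> d))" using bd by - (assumption | rule lin)+
        have "tmap K HH H theta (\<lambda>h. h) (tens K HH H (tens K H H a c) (b \<otimes>\<^bsub>H\<^esub> d)) = tens K HH H (theta (tens K H H a c)) (b \<otimes>\<^bsub>H\<^esub> d)"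
          by (rule tmap_tens[OF lin_map_theta lin_map_ident tmod mod tmod mod tens_closed[OF mod mod a c] bd])
        also have "\<dots> = tlift ?T (\<lambda>e f. tens K HH H (tens K H H (a \<otimes>\<^bsub>H\<^esub> e) f) (b \<otimes>\<^bsub>H\<^esub> d)) (comult H c)"
          unfolding theta_tens[OF a c] by (rule sw_apply[OF l c tmod module_HHH]) (insert a b, (assumption | rule lin)+)
        finally show "tmap K HH H theta (\<lambda>h. h) (tens K HH H (tens K H H a c) (b \<otimes>\<^bsub>H\<^esub> d)) = \<dots>" .
      qed
      also have "\<dots> = tlift ?T (\<lambda>e y. ?E a b e y) (comult H g)"
        by (rule sw_coassoc[OF g module_HHH]) (insert a b, (assumption | rule lin)+)
      finally show ?thesis .
    qed
    have cg: "comult H g \<in> carrier HH" by (rule comult_closed[OF g])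
    have "tmap K HH H theta (\<lambda>h. h) (rho (tens K H H h g)) =
      tlift ?T (\<lambda>a b. tmap K HH H theta (\<lambda>h. h) (tlift ?T (\<lambda>c d. tens K HH H (tens K H H a c) (b \<otimes>\<^bsub>H\<^esub> d)) (comult H g))) (comult H h)"
      unfolding tensor_coact_tens[OF mod mod lin_map_comult lin_map_comult h g]
      by (rule sw_apply[OF lt h module_HHH module_HHH bilin_coact2[OF mod mod lin_map_comult lin_map_comult cg]])
    also have "\<dots> = tlift ?T (\<lambda>a b. tlift ?T (\<lambda>e y. ?E a b e y) (comult H g)) (comult H h)"
    proof (rule sw_cong[OF h module_HHH])
      show "bilin K H H ?T (\<lambda>a b. tmap K HH H theta (\<lambda>h. h) (tlift ?T (\<lambda>c d. tens K HH H (tens K H H a c) (b \<otimes>\<^bsub>H\<^esub> d)) (comult H g)))"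
        by (rule bilinI; rule lin_map_comp[OF lt]) (insert g, (assumption | rule lin)+)
    qed (rule inner)
    finally show "sigma (theta (tens K H H h g)) = tmap K HH H theta (\<lambda>h. h) (rho (tens K H H h g))"
      using L by simp
  qed
qed


section \<open>Bicovariant calculi\<close>

lemma ker_counit_subset: "ker_counit K H \<subseteq> carrier H"
  by (auto simp: ker_counit_def)

lemma bicov_N_theta: "bicov_N K H Q = {x \<in> univ_calc K H. theta x \<in> tsub K H H (carrier H) Q}"
  by (simp add: bicov_N_def theta_def)

lemma eps_right_tsub_ker:
  assumes V: "module K V" and x: "x \<in> tsub K V H (carrier V) (ker_counit K H)"
  shows "eps_right V x = \<zero>\<^bsub>V\<^esub>"
proof -
  interpret V: module K V by fact
  have "submodule {\<zero>\<^bsub>V\<^esub>} K V" by (rule submoduleI'[OF V]) auto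
  from lin_map_tsub[OF x lin_map_eps_right[OF V] V mod V this subset_refl ker_counit_subset]
  have "eps_right V x \<in> {\<zero>\<^bsub>V\<^esub>}" by (simp add: eps_right_tens[OF V] ker_counit_def)
  then show ?thesis by simp
qed

context
  fixes Q assumes Q: "bicovariant K H Q"
begin

lemma Q_sub: "submodule Q K H" and Q_ker: "Q \<subseteq> ker_counit K H"
  and Q_ideal: "q \<in> Q \<Longrightarrow> h \<in> carrier H \<Longrightarrow> q \<otimes>\<^bsub>H\<^esub> h \<in> Q"
  and Q_Ad: "q \<in> Q \<Longrightarrow> Ad_coact K H q \<in> tsub K H H Q (carrier H)"
  using Q by (auto simp: bicovariant_def)

lemma Q_subset: "Q \<subseteq> carrier H" using Q_ker ker_counit_subset by blast

lemma HQ_submodule: "submodule (tsub K H H (carrier H) Q) K HH"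
  by (rule tsub_submodule[OF mod mod subset_refl Q_subset])

lemma HQ_subset: "tsub K H H (carrier H) Q \<subseteq> carrier HH"
  by (rule submodule_subset[OF tmod HQ_submodule])

text \<open>As \<open>Q\<close> lies in \<open>ker \<epsilon>\<close>, the map
  \<open>id \<otimes> \<epsilon>\<close> kills \<open>theta x\<close>. By
  \<open>eps_right_theta\<close> the value is the product of \<open>x\<close>, so \<open>x\<close>
  is a universal form.\<close>

lemma NH_eq: "bicov_N K H Q = {x \<in> carrier HH. theta x \<in> tsub K H H (carrier H) Q}"
proof -
  have "x \<in> univ_calc K H" if x: "x \<in> carrier HH" and t: "theta x \<in> tsub K H H (carrier H) Q" for x
  proof -
    have "theta x \<in> tsub K H H (carrier H) (ker_counit K H)"
      using t tsub_mono[OF mod mod subset_refl ker_counit_subset subset_refl Q_ker] by blast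
    from eps_right_tsub_ker[OF mod this] show ?thesis
      using x by (simp add: univ_calc_mu eps_right_theta[OF x])
  qed
  then show ?thesis unfolding bicov_N_theta using univ_subset by blast
qed

lemma NH_univ: "bicov_N K H Q \<subseteq> univ_calc K H" by (auto simp: bicov_N_def)

lemma NH_subset: "bicov_N K H Q \<subseteq> carrier HH" using NH_univ univ_subset by blast

lemma theta_NH: "theta ` bicov_N K H Q = tsub K H H (carrier H) Q"
proof
  show "theta ` bicov_N K H Q \<subseteq> tsub K H H (carrier H) Q" by (auto simp: NH_eq)
  show "tsub K H H (carrier H) Q \<subseteq> theta ` bicov_N K H Q"
  proof
    fix y assume y: "y \<in> tsub K H H (carrier H) Q"
    then have "y \<in> carrier HH" using HQ_subset by blast
    then show "y \<in> theta ` bicov_N K H Q"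
      using y by (intro image_eqI[of _ _ "theta_inv y"]) (auto simp: NH_eq theta_theta_inv intro: theta_inv_closed)
  qed
qed

text \<open>\<open>theta\<close> commutes with left multiplication by \<open>k\<close> on the first
  factor, and this multiplication preserves \<open>H \<otimes> Q\<close>.\<close>

lemma NH_lact:
  assumes k: "k \<in> carrier H" and x: "x \<in> bicov_N K H Q"
  shows "lact K H k x \<in> bicov_N K H Q"
proof -
  have x': "x \<in> carrier HH" using x NH_subset by blast
  have lk: "lin_map K H H (\<lambda>a. k \<otimes>\<^bsub>H\<^esub> a)" using k by - (assumption | rule lin)+
  have ll: "lin_map K HH HH (lact K H k)"
    unfolding lact_def by (rule lin_map_tmap[OF lin_map_ident lk lin_map_ident mod mod mod mod])
  have "theta (lact K H k x) = lact K H k (theta x)"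
  proof (rule tensor_eqI[OF lin_map_comp[OF lin_map_theta ll] lin_map_comp[OF ll lin_map_theta] mod mod tmod _ x'])
    fix a g assume a: "a \<in> carrier H" and g: "g \<in> carrier H"
    have t: "lact K H k (tens K H H c d) = tens K H H (k \<otimes>\<^bsub>H\<^esub> c) d" if "c \<in> carrier H" "d \<in> carrier H" for c d
      unfolding lact_def by (rule tmap_tens[OF lk lin_map_ident mod mod mod mod that])
    have b: "bilin K H H HH (\<lambda>c d. tens K H H (a \<otimes>\<^bsub>H\<^esub> c) d)" using a by - (assumption | rule lin)+
    have b': "bilin K H H HH (\<lambda>c d. lact K H k (tens K H H (a \<otimes>\<^bsub>H\<^esub> c) d))"
      by (rule bilinI; rule lin_map_comp[OF ll]) (insert a, (assumption | rule lin)+)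
    have "lact K H k (theta (tens K H H a g)) = tlift HH (\<lambda>c d. lact K H k (tens K H H (a \<otimes>\<^bsub>H\<^esub> c) d)) (comult H g)"
      unfolding theta_tens[OF a g] by (rule sw_apply[OF ll g tmod tmod b])
    also have "\<dots> = tlift HH (\<lambda>c d. tens K H H (k \<otimes>\<^bsub>H\<^esub> a \<otimes>\<^bsub>H\<^esub> c) d) (comult H g)"
      by (rule sw_cong[OF g tmod b']) (use a k in \<open>simp add: t m_assoc\<close>)
    also have "\<dots> = theta (lact K H k (tens K H H a g))"
      using a g k by (simp add: t theta_tens)
    finally show "theta (lact K H k (tens K H H a g)) = lact K H k (theta (tens K H H a g))" by simp
  qed
  moreover have "lact K H k (theta x) \<in> tsub K H H (carrier H) Q"
    unfolding lact_def
    by (rule tmap_tsub[OF _ subset_refl Q_subset lk lin_map_ident mod mod mod mod subset_refl Q_subset])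
      (use x k in \<open>auto simp: NH_eq\<close>)
  ultimately show ?thesis using lin_map_closed[OF ll x'] by (simp add: NH_eq)
qed

text \<open>Since \<open>\<Delta>\<close> is multiplicative, \<open>theta\<close> turns right
  multiplication by \<open>k\<close> on the second factor into right multiplication by
  \<open>\<Delta> k\<close> in the algebra \<open>H \<otimes> H\<close>. That preserves
  \<open>H \<otimes> Q\<close> because \<open>Q\<close> is a right ideal.\<close>

lemma NH_ract:
  assumes k: "k \<in> carrier H" and x: "x \<in> bicov_N K H Q"
  shows "ract K H x k \<in> bicov_N K H Q"
proof -
  have x': "x \<in> carrier HH" using x NH_subset by blast
  have lk: "lin_map K H H (\<lambda>a. a \<otimes>\<^bsub>H\<^esub> k)" using k by - (assumption | rule lin)+
  have lr: "lin_map K HH HH (\<lambda>x. ract K H x k)"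
    unfolding ract_def by (rule lin_map_tmap[OF lin_map_ident lin_map_ident lk mod mod mod mod])
  let ?m = "\<lambda>x. x \<otimes>\<^bsub>HH\<^esub> comult H k"
  have lm: "lin_map K HH HH ?m" by (rule lin_map_tensor_mult_left[OF alg alg comult_closed[OF k]])
  have mt: "?m (tens K H H c d) = tlift HH (\<lambda>e f. tens K H H (c \<otimes>\<^bsub>H\<^esub> e) (d \<otimes>\<^bsub>H\<^esub> f)) (comult H k)"
    if "c \<in> carrier H" "d \<in> carrier H" for c d
    unfolding tensor_mult_def by (rule tlift_tens[OF mod mod tmod bilin_tensor_mult2[OF alg alg comult_closed[OF k]] that])
  have "theta (ract K H x k) = ?m (theta x)"
  proof (rule tensor_eqI[OF lin_map_comp[OF lin_map_theta lr] lin_map_comp[OF lm lin_map_theta] mod mod tmod _ x'])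
    fix a g assume a: "a \<in> carrier H" and g: "g \<in> carrier H"
    have r: "ract K H (tens K H H a g) k = tens K H H a (g \<otimes>\<^bsub>H\<^esub> k)"
      unfolding ract_def by (rule tmap_tens[OF lin_map_ident lk mod mod mod mod a g])
    have b: "bilin K H H HH (\<lambda>c d. tens K H H (a \<otimes>\<^bsub>H\<^esub> c) d)" using a by - (assumption | rule lin)+
    have b': "bilin K H H HH (\<lambda>c d. ?m (tens K H H (a \<otimes>\<^bsub>H\<^esub> c) d))"
      by (rule bilinI; rule lin_map_comp[OF lm]) (insert a, (assumption | rule lin)+)
    have b3: "bilin K H H HH (\<lambda>e f. tens K H H (a \<otimes>\<^bsub>H\<^esub> c \<otimes>\<^bsub>H\<^esub> e) (d \<otimes>\<^bsub>H\<^esub> f))"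
      if "c \<in> carrier H" "d \<in> carrier H" for c d using a that by - (assumption | rule lin)+
    have "?m (theta (tens K H H a g)) = tlift HH (\<lambda>c d. ?m (tens K H H (a \<otimes>\<^bsub>H\<^esub> c) d)) (comult H g)"
      unfolding theta_tens[OF a g] by (rule sw_apply[OF lm g tmod tmod b])
    also have "\<dots> = tlift HH (\<lambda>c d. tlift HH (\<lambda>e f. tens K H H (a \<otimes>\<^bsub>H\<^esub> (c \<otimes>\<^bsub>H\<^esub> e)) (d \<otimes>\<^bsub>H\<^esub> f)) (comult H k)) (comult H g)"
    proof (rule sw_cong[OF g tmod b'])
      fix c d assume c: "c \<in> carrier H" and d: "d \<in> carrier H"
      show "?m (tens K H H (a \<otimes>\<^bsub>H\<^esub> c) d) = tlift HH (\<lambda>e f. tens K H H (a \<otimes>\<^bsub>H\<^esub> (c \<otimes>\<^bsub>H\<^esub> e)) (d \<otimes>\<^bsub>H\<^esub> f)) (comult H k)"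
        unfolding mt[OF alg_mult_closed[OF alg a c] d]
        by (rule sw_cong[OF k tmod b3[OF c d]]) (use a c d in \<open>simp add: m_assoc\<close>)
    qed
    also have "\<dots> = theta (tens K H H a (g \<otimes>\<^bsub>H\<^esub> k))"
      unfolding theta_tens[OF a alg_mult_closed[OF alg g k]]
      by (rule sw_mult[OF g k tmod b, symmetric])
    finally show "theta (ract K H (tens K H H a g) k) = ?m (theta (tens K H H a g))" by (simp add: r)
  qed
  moreover have "?m (theta x) \<in> tsub K H H (carrier H) Q"
  proof (rule lin_map_tsub[OF _ lm mod mod tmod HQ_submodule subset_refl Q_subset])
    show "theta x \<in> tsub K H H (carrier H) Q" using x by (simp add: NH_eq)
    fix a q assume a: "a \<in> carrier H" and q: "q \<in> Q"
    then have qH: "q \<in> carrier H" using Q_subset by blast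
    show "?m (tens K H H a q) \<in> tsub K H H (carrier H) Q"
      unfolding mt[OF a qH]
      by (rule tlift_mem[OF comult_closed[OF k] bilin_tensor_mult1[OF alg alg a qH] mod mod tmod HQ_submodule])
        (use a q in \<open>auto intro!: tsub_tens Q_ideal\<close>)
  qed
  ultimately show ?thesis using lin_map_closed[OF lr x'] by (simp add: NH_eq)
qed

text \<open>\<open>H \<otimes> Q\<close> is stable under \<open>\<Delta> \<otimes> Ad\<close>
  because \<open>Q\<close> is stable under \<open>Ad\<close>. By \<open>sigma_theta\<close>,
  applying \<open>theta_inv \<otimes> id\<close> carries this back to \<open>rho\<close>.\<close>

lemma rho_NH:
  assumes x: "x \<in> bicov_N K H Q"
  shows "rho x \<in> tsub K HH H (bicov_N K H Q) (carrier H)"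
proof -
  have x': "x \<in> carrier HH" using x NH_subset by blast
  have r: "rho x \<in> carrier (tensor K HH H)" by (rule lin_map_closed[OF lin_map_rho x'])
  have cm: "comult H a \<in> tsub K H H (carrier H) (carrier H)" if "a \<in> carrier H" for a
    using comult_closed[OF that] by (simp add: tsub_full[OF mod mod])
  have "sigma (theta x) \<in> tsub K HH H (tsub K H H (carrier H) Q) (carrier H)"
    by (rule tensor_coact_tsub[OF mod mod lin_map_comult lin_map_Ad _ subset_refl Q_subset cm Q_Ad])
      (use x in \<open>auto simp: NH_eq\<close>)
  then have "tmap K HH H theta_inv (\<lambda>h. h) (tmap K HH H theta (\<lambda>h. h) (rho x)) \<in> tsub K HH H (bicov_N K H Q) (carrier H)"
    unfolding sigma_theta[OF x', symmetric]
    by (rule tmap_tsub[OF _ HQ_subset subset_refl lin_map_theta_inv lin_map_ident tmod mod tmod mod NH_subset subset_refl])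
      (use HQ_subset in \<open>auto simp: NH_eq theta_theta_inv subset_iff intro: theta_inv_closed\<close>)
  also have "tmap K HH H theta_inv (\<lambda>h. h) (tmap K HH H theta (\<lambda>h. h) (rho x)) = tmap K HH H (\<lambda>x. theta_inv (theta x)) (\<lambda>h. h) (rho x)"
    by (rule tmap_tmap[OF r lin_map_theta lin_map_ident lin_map_theta_inv lin_map_ident tmod mod tmod mod tmod mod])
  also have "\<dots> = tmap K HH H (\<lambda>x. x) (\<lambda>h. h) (rho x)"
    by (rule tmap_cong[OF r lin_map_comp[OF lin_map_theta_inv lin_map_theta] lin_map_ident tmod mod tmod mod])
      (simp_all add: theta_inv_theta)
  also have "\<dots> = rho x" by (rule tmap_ident[OF r tmod mod])
  finally show ?thesis .
qed

end

end

section \<open>Free comodules\<close>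

lemma tensor_mem:
  assumes x: "x \<in> carrier (tensor K V W)" and f: "lin_map K (tensor K V W) X f"
    and m: "module K V" "module K W" "module K X" and U: "submodule U K X"
    and g: "\<And>a b. a \<in> carrier V \<Longrightarrow> b \<in> carrier W \<Longrightarrow> f (tens K V W a b) \<in> U"
  shows "f x \<in> U"
  by (rule lin_map_tsub[OF _ f m U subset_refl subset_refl g]) (use x m in \<open>simp_all add: tsub_full\<close>)

lemma tens_zero_left: "module K V \<Longrightarrow> module K W \<Longrightarrow> w \<in> carrier W \<Longrightarrow> tens K V W \<zero>\<^bsub>V\<^esub> w = \<zero>\<^bsub>tensor K V W\<^esub>"
  by (rule lin_map_zero[OF _ module_tensor lin_map_tens_left[OF _ _ _ lin_map_ident]])

lemma tens_zero_right: "module K V \<Longrightarrow> module K W \<Longrightarrow> v \<in> carrier V \<Longrightarrow> tens K V W v \<zero>\<^bsub>W\<^esub> = \<zero>\<^bsub>tensor K V W\<^esub>"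
  by (rule lin_map_zero[OF _ module_tensor lin_map_tens_right[OF _ _ _ lin_map_ident]])

context hopf_algebra
begin

context
  fixes V :: "('k, 'v, 'p) module_scheme"
  assumes V: "module K V"
begin

private abbreviation VH where "VH \<equiv> tensor K V H"

lemma mVH: "module K VH" and mVHH: "module K (tensor K VH H)" and mVHHH: "module K (tensor K (tensor K VH H) H)"
  and mV_HH: "module K (tensor K V HH)" and mVH_HH: "module K (tensor K VH HH)"
  by (intro module_tensor V mod)+

lemma bilin_tens3: "v \<in> carrier V \<Longrightarrow> bilin K H H (tensor K VH H) (\<lambda>a b. tens K VH H (tens K V H v a) b)"
  using V by - (assumption | rule lin)+

text \<open>The second argument is general because a coproduct supplies it, and a coproduct is
  usually not a pure tensor.\<close>

lemma assoc_iso_tens_right: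
  assumes v: "v \<in> carrier V" and Y: "Y \<in> carrier HH"
  shows "assoc_iso K V H H (tens K V HH v Y) = tlift (tensor K VH H) (\<lambda>a b. tens K VH H (tens K V H v a) b) Y"
proof (rule tensor_eqI[OF _ lin_map_tlift'[OF mod mod mVHH bilin_tens3[OF v]] mod mod mVHH _ Y])
  show "lin_map K HH (tensor K VH H) (\<lambda>Y. assoc_iso K V H H (tens K V HH v Y))"
    using V v by - (assumption | rule lin)+
qed (use v in \<open>simp add: assoc_iso_tens[OF V mod mod] tlift_tens[OF mod mod mVHH bilin_tens3]\<close>)

lemma lin_map_free_coact: "lin_map K VH (tensor K VH H) (free_coact K H V)"
  unfolding free_coact_def
  by (rule lin_map_comp[OF lin_map_assoc_iso[OF V mod mod] lin_map_tmap[OF lin_map_ident lin_map_ident lin_map_comult V mod V tmod]])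

lemma free_coact_tens:
  assumes v: "v \<in> carrier V" and h: "h \<in> carrier H"
  shows "free_coact K H V (tens K V H v h) = tlift (tensor K VH H) (\<lambda>a b. tens K VH H (tens K V H v a) b) (comult H h)"
  unfolding free_coact_def tmap_tens[OF lin_map_ident lin_map_comult V mod V tmod v h]
  by (rule assoc_iso_tens_right[OF v comult_closed[OF h]])

text \<open>Both axioms are those of \<open>\<Delta>\<close>, with \<open>v\<close> as a spectator
  in the first factor.\<close>

lemma free_comodule: "right_comodule K H VH (free_coact K H V)"
  unfolding right_comodule_def
proof (intro conjI ballI)
  note lf = lin_map_free_coact
  show "module K VH" by (rule mVH)
  show "lin_map K VH (tensor K VH H) (free_coact K H V)" by (rule lf)
  fix x assume x: "x \<in> carrier VH"
  have l1: "lin_map K (tensor K VH H) (tensor K (tensor K VH H) H) (tmap K (tensor K VH H) H (free_coact K H V) (\<lambda>h. h))"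
    by (rule lin_map_tmap[OF lin_map_ident lf lin_map_ident mVH mod mVHH mod])
  have l2: "lin_map K (tensor K VH H) (tensor K (tensor K VH H) H) (\<lambda>x. assoc_iso K VH H H (tmap K VH HH (\<lambda>v. v) (comult H) x))"
    by (rule lin_map_comp[OF lin_map_assoc_iso[OF mVH mod mod] lin_map_tmap[OF lin_map_ident lin_map_ident lin_map_comult mVH mod mVH tmod]])
  show "tmap K (tensor K VH H) H (free_coact K H V) (\<lambda>h. h) (free_coact K H V x) =
    assoc_iso K VH H H (tmap K VH HH (\<lambda>v. v) (comult H) (free_coact K H V x))"
  proof (rule tensor_eqI[OF lin_map_comp[OF l1 lf] lin_map_comp[OF l2 lf] V mod mVHHH _ x])
    fix v h assume v: "v \<in> carrier V" and h: "h \<in> carrier H"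
    let ?U = "tensor K (tensor K VH H) H"
    let ?\<gamma> = "\<lambda>a b c. tens K (tensor K VH H) H (tens K VH H (tens K V H v a) b) c"
    have va: "tens K V H v a \<in> carrier VH" if "a \<in> carrier H" for a by (rule tens_closed[OF V mod v that])
    have "tmap K (tensor K VH H) H (free_coact K H V) (\<lambda>h. h) (free_coact K H V (tens K V H v h)) =
       tlift ?U (\<lambda>a b. tmap K (tensor K VH H) H (free_coact K H V) (\<lambda>h. h) (tens K VH H (tens K V H v a) b)) (comult H h)"
      unfolding free_coact_tens[OF v h] by (rule sw_apply[OF l1 h mVHH mVHHH bilin_tens3[OF v]])
    also have "\<dots> = tlift ?U (\<lambda>a b. tlift ?U (\<lambda>c d. ?\<gamma> c d b) (comult H a)) (comult H h)"
    proof (rule sw_cong[OF h mVHHH])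
      show "bilin K H H ?U (\<lambda>a b. tmap K (tensor K VH H) H (free_coact K H V) (\<lambda>h. h) (tens K VH H (tens K V H v a) b))"
        by (rule bilin_comp[OF l1 bilin_tens3[OF v]])
      fix a b assume a: "a \<in> carrier H" and b: "b \<in> carrier H"
      have l: "lin_map K (tensor K VH H) ?U (\<lambda>x. tens K (tensor K VH H) H x b)"
        by (rule lin_map_tens_left[OF mVHH mod b lin_map_ident])
      show "tmap K (tensor K VH H) H (free_coact K H V) (\<lambda>h. h) (tens K VH H (tens K V H v a) b) = tlift ?U (\<lambda>c d. ?\<gamma> c d b) (comult H a)"
        unfolding tmap_tens[OF lf lin_map_ident mVH mod mVHH mod va[OF a] b] free_coact_tens[OF v a]
        by (rule sw_apply[OF l a mVHH mVHHH bilin_tens3[OF v]])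
    qed
    also have "\<dots> = tlift ?U (\<lambda>a b. tlift ?U (?\<gamma> a) (comult H b)) (comult H h)"
      by (rule sw_coassoc[OF h mVHHH]) (insert v V, (assumption | rule lin)+)
    finally have L: "tmap K (tensor K VH H) H (free_coact K H V) (\<lambda>h. h) (free_coact K H V (tens K V H v h)) = \<dots>" .
    have "assoc_iso K VH H H (tmap K VH HH (\<lambda>v. v) (comult H) (free_coact K H V (tens K V H v h))) =
       tlift ?U (\<lambda>a b. assoc_iso K VH H H (tmap K VH HH (\<lambda>v. v) (comult H) (tens K VH H (tens K V H v a) b))) (comult H h)"
      unfolding free_coact_tens[OF v h] by (rule sw_apply[OF l2 h mVHH mVHHH bilin_tens3[OF v]])
    also have "\<dots> = tlift ?U (\<lambda>a b. tlift ?U (?\<gamma> a) (comult H b)) (comult H h)"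
    proof (rule sw_cong[OF h mVHHH])
      show "bilin K H H ?U (\<lambda>a b. assoc_iso K VH H H (tmap K VH HH (\<lambda>v. v) (comult H) (tens K VH H (tens K V H v a) b)))"
        by (rule bilin_comp[OF l2 bilin_tens3[OF v]])
      fix a b assume a: "a \<in> carrier H" and b: "b \<in> carrier H"
      have bb: "bilin K H H ?U (?\<gamma> a)" using V v a by - (assumption | rule lin)+
      have la: "lin_map K HH ?U (\<lambda>Y. assoc_iso K VH H H (tens K VH HH (tens K V H v a) Y))"
        by (rule lin_map_comp[OF lin_map_assoc_iso[OF mVH mod mod] lin_map_tens_right[OF mVH tmod va[OF a] lin_map_ident]])
      show "assoc_iso K VH H H (tmap K VH HH (\<lambda>v. v) (comult H) (tens K VH H (tens K V H v a) b)) = tlift ?U (?\<gamma> a) (comult H b)"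
        unfolding tmap_tens[OF lin_map_ident lin_map_comult mVH mod mVH tmod va[OF a] b]
        by (rule tensor_eqI[OF la lin_map_tlift'[OF mod mod mVHHH bb] mod mod mVHHH _ comult_closed[OF b]])
          (simp add: assoc_iso_tens[OF mVH mod mod va[OF a]] tlift_tens[OF mod mod mVHHH bb])
    qed
    finally show "tmap K (tensor K VH H) H (free_coact K H V) (\<lambda>h. h) (free_coact K H V (tens K V H v h)) =
      assoc_iso K VH H H (tmap K VH HH (\<lambda>v. v) (comult H) (free_coact K H V (tens K V H v h)))" using L by simp
  qed
  show "tlift VH (\<lambda>x h. counit H h \<odot>\<^bsub>VH\<^esub> x) (free_coact K H V x) = x"
  proof (rule tensor_eqI[OF lin_map_comp[OF lin_map_eps_right[OF mVH] lf] lin_map_ident V mod mVH _ x])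
    fix v h assume v: "v \<in> carrier V" and h: "h \<in> carrier H"
    have l: "lin_map K H VH (\<lambda>a. tens K V H v a)" by (rule lin_map_tens_right[OF V mod v lin_map_ident])
    have b: "bilin K H H VH (\<lambda>a b. eps_right VH (tens K VH H (tens K V H v a) b))"
      by (rule bilin_comp[OF lin_map_eps_right[OF mVH] bilin_tens3[OF v]])
    have "eps_right VH (free_coact K H V (tens K V H v h)) =
        tlift VH (\<lambda>a b. eps_right VH (tens K VH H (tens K V H v a) b)) (comult H h)"
      unfolding free_coact_tens[OF v h] by (rule sw_apply[OF lin_map_eps_right[OF mVH] h mVHH mVH bilin_tens3[OF v]])
    also have "\<dots> = tlift VH (\<lambda>a b. counit H b \<odot>\<^bsub>VH\<^esub> tens K V H v a) (comult H h)"
      by (rule sw_cong[OF h mVH b]) (rule eps_right_tens[OF mVH tens_closed[OF V mod v]])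
    also have "\<dots> = tens K V H v h" by (rule sw_counit_right[OF h mVH l])
    finally show "eps_right VH (free_coact K H V (tens K V H v h)) = tens K V H v h" .
  qed
qed

text \<open>The counterpart of \<open>univ_tsub\<close> for the counit:
  \<open>h - \<epsilon>(h) 1\<close> always lies in \<open>ker \<epsilon>\<close>, and this
  projection applied to the second factor changes \<open>y\<close> by
  \<open>(id \<otimes> \<epsilon>)(y) \<otimes> 1\<close>, which is zero here.\<close>

lemma eps_right_zero_tsub:
  assumes y: "y \<in> carrier VH" and z: "eps_right V y = \<zero>\<^bsub>V\<^esub>"
  shows "y \<in> tsub K V H (carrier V) (ker_counit K H)"
proof -
  interpret T: module K VH by (rule mVH)
  let ?q = "\<lambda>h. h \<ominus>\<^bsub>H\<^esub> counit H h \<odot>\<^bsub>H\<^esub> \<one>\<^bsub>H\<^esub>"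
  have lq: "lin_map K H H ?q" by (assumption | rule lin)+
  have ls: "lin_map K VH VH (\<lambda>y. tens K V H (eps_right V y) \<one>\<^bsub>H\<^esub>)"
    by (rule lin_map_tens_left[OF V mod alg_one_closed[OF alg] lin_map_eps_right[OF V]])
  have "tmap K V H (\<lambda>v. v) ?q y = y \<ominus>\<^bsub>VH\<^esub> tens K V H (eps_right V y) \<one>\<^bsub>H\<^esub>"
  proof (rule tensor_eqI[OF lin_map_tmap[OF lin_map_ident lin_map_ident lq V mod V mod] lin_map_diff[OF mVH lin_map_ident ls] V mod mVH _ y])
    fix v h assume v: "v \<in> carrier V" and h: "h \<in> carrier H"
    have c: "counit H h \<in> carrier K" by (rule counit_closed[OF h])
    have lv: "lin_map K H VH (\<lambda>a. tens K V H v a)" by (rule lin_map_tens_right[OF V mod v lin_map_ident])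
    have lv': "lin_map K V VH (\<lambda>v. tens K V H v \<one>\<^bsub>H\<^esub>)"
      by (rule lin_map_tens_left[OF V mod alg_one_closed[OF alg] lin_map_ident])
    have "tens K V H v (?q h) = tens K V H v h \<ominus>\<^bsub>VH\<^esub> tens K V H v (counit H h \<odot>\<^bsub>H\<^esub> \<one>\<^bsub>H\<^esub>)"
      by (rule lin_map_minus[OF mod mVH lv h]) (simp add: c)
    also have "tens K V H v (counit H h \<odot>\<^bsub>H\<^esub> \<one>\<^bsub>H\<^esub>) = tens K V H (counit H h \<odot>\<^bsub>V\<^esub> v) \<one>\<^bsub>H\<^esub>"
      using lin_map_smult[OF lv c alg_one_closed[OF alg]] lin_map_smult[OF lv' c v] by simp
    finally show "tmap K V H (\<lambda>v. v) ?q (tens K V H v h) = tens K V H v h \<ominus>\<^bsub>VH\<^esub> tens K V H (eps_right V (tens K V H v h)) \<one>\<^bsub>H\<^esub>"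
      by (simp add: tmap_tens[OF lin_map_ident lq V mod V mod v h] eps_right_tens[OF V v h])
  qed
  also have "\<dots> = y" using y
    by (simp add: z tens_zero_left[OF V mod] a_minus_def module_neg_zero[OF mVH])
  finally have e: "tmap K V H (\<lambda>v. v) ?q y = y" .
  have "?q h \<in> ker_counit K H" if h: "h \<in> carrier H" for h
  proof -
    have c: "counit H h \<in> carrier K" by (rule counit_closed[OF h])
    have lc: "counit H (x \<oplus>\<^bsub>H\<^esub> y) = counit H x \<oplus>\<^bsub>K\<^esub> counit H y" if "x \<in> carrier H" "y \<in> carrier H" for x y
      using ring_hom_add[OF counit_hom that] .
    have "?q h = h \<oplus>\<^bsub>H\<^esub> (\<ominus>\<^bsub>K\<^esub> counit H h) \<odot>\<^bsub>H\<^esub> \<one>\<^bsub>H\<^esub>"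
      using c by (simp add: a_minus_def smult_l_minus)
    then have "counit H (?q h) = counit H h \<oplus>\<^bsub>K\<^esub> (\<ominus>\<^bsub>K\<^esub> counit H h) \<otimes>\<^bsub>K\<^esub> \<one>\<^bsub>K\<^esub>"
      using c h by (simp add: lc counit_smult counit_one)
    also have "\<dots> = \<zero>\<^bsub>K\<^esub>" using c abelian_group.r_neg[OF ring.is_abelian_group[OF cring.axioms(1)[OF module.axioms(1)[OF mod]]] c] by simp
    finally show ?thesis using lin_map_closed[OF lq h] by (simp add: ker_counit_def)
  qed
  then have "tmap K V H (\<lambda>v. v) ?q y \<in> tsub K V H (carrier V) (ker_counit K H)"
    by (intro tmap_in_tsub[OF y lin_map_ident lq V mod V mod subset_refl ker_counit_subset])
  then show ?thesis unfolding e .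
qed

end

text \<open>On pure tensors the products in \<open>M\<close> separate, and what remains is the
  multiplicativity of \<open>\<Delta>\<close> in the form \<open>sw_mult\<close>.\<close>

lemma free_coact_alg_hom:
  assumes M: "k_algebra K M"
  shows "alg_hom K (tensor K M H) (tensor K (tensor K M H) H) (free_coact K H M)"
proof -
  interpret M: k_algebra K M by fact
  note V = M.mod
  let ?P = "tensor K M H" let ?\<delta> = "free_coact K H M" let ?T = "tensor K ?P H"
  have P: "k_algebra K ?P" by (rule k_algebra_tensor[OF M alg])
  have T: "k_algebra K ?T" by (rule k_algebra_tensor[OF P alg])
  note lf = lin_map_free_coact[OF V] and mP = mVH[OF V] and mT = mVHH[OF V]
  have "?\<delta> \<in> ring_hom ?P ?T"
  proof (rule ring_hom_memI)
    show "?\<delta> x \<in> carrier ?T" if "x \<in> carrier ?P" for x using lf that by (rule lin_map_closed)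
    show "?\<delta> (x \<oplus>\<^bsub>?P\<^esub> y) = ?\<delta> x \<oplus>\<^bsub>?T\<^esub> ?\<delta> y" if "x \<in> carrier ?P" "y \<in> carrier ?P" for x y
      using lf that by (rule lin_map_add)
    show "?\<delta> \<one>\<^bsub>?P\<^esub> = \<one>\<^bsub>?T\<^esub>"
      unfolding one_tensor free_coact_tens[OF V alg_one_closed[OF M] alg_one_closed[OF alg]] comult_one
      by (rule tlift_tens[OF mod mod mT bilin_tens3[OF V]]) auto
    fix x y assume x: "x \<in> carrier ?P" and y: "y \<in> carrier ?P"
    show "?\<delta> (x \<otimes>\<^bsub>?P\<^esub> y) = ?\<delta> x \<otimes>\<^bsub>?T\<^esub> ?\<delta> y"
    proof (rule tensor_eqI[OF _ _ V mod mT _ x])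
      show "lin_map K ?P ?T (\<lambda>x. ?\<delta> (x \<otimes>\<^bsub>?P\<^esub> y))"
        by (rule lin_map_comp[OF lf lin_map_mult_left[OF P y lin_map_ident]])
      show "lin_map K ?P ?T (\<lambda>x. ?\<delta> x \<otimes>\<^bsub>?T\<^esub> ?\<delta> y)"
        by (rule lin_map_mult_left[OF T lin_map_closed[OF lf y] lf])
      fix m h assume m: "m \<in> carrier M" and h: "h \<in> carrier H"
      have mh: "tens K M H m h \<in> carrier ?P" by (rule tens_closed[OF V mod m h])
      show "?\<delta> (tens K M H m h \<otimes>\<^bsub>?P\<^esub> y) = ?\<delta> (tens K M H m h) \<otimes>\<^bsub>?T\<^esub> ?\<delta> y"
      proof (rule tensor_eqI[OF _ _ V mod mT _ y])
        show "lin_map K ?P ?T (\<lambda>y. ?\<delta> (tens K M H m h \<otimes>\<^bsub>?P\<^esub> y))"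
          by (rule lin_map_comp[OF lf lin_map_mult_right[OF P mh lin_map_ident]])
        show "lin_map K ?P ?T (\<lambda>y. ?\<delta> (tens K M H m h) \<otimes>\<^bsub>?T\<^esub> ?\<delta> y)"
          by (rule lin_map_mult_right[OF T lin_map_closed[OF lf mh] lf])
        fix n g assume n: "n \<in> carrier M" and g: "g \<in> carrier H"
        have mn: "m \<otimes>\<^bsub>M\<^esub> n \<in> carrier M" using m n by simp
        let ?Y = "?\<delta> (tens K M H n g)"
        have Y: "?Y \<in> carrier ?T" by (rule lin_map_closed[OF lf tens_closed[OF V mod n g]])
        have l1: "lin_map K ?T ?T (\<lambda>X. X \<otimes>\<^bsub>?T\<^esub> ?Y)" by (rule lin_map_mult_left[OF T Y lin_map_ident])
        have inner: "tens K ?P H (tens K M H m a) b \<otimes>\<^bsub>?T\<^esub> ?Y =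
           tlift ?T (\<lambda>c d. tens K ?P H (tens K M H (m \<otimes>\<^bsub>M\<^esub> n) (a \<otimes>\<^bsub>H\<^esub> c)) (b \<otimes>\<^bsub>H\<^esub> d)) (comult H g)"
          if a: "a \<in> carrier H" and b: "b \<in> carrier H" for a b
        proof -
          have ma: "tens K M H m a \<in> carrier ?P" by (rule tens_closed[OF V mod m a])
          have mab: "tens K ?P H (tens K M H m a) b \<in> carrier ?T" by (rule tens_closed[OF mP mod ma b])
          have l2: "lin_map K ?T ?T (\<lambda>X. tens K ?P H (tens K M H m a) b \<otimes>\<^bsub>?T\<^esub> X)"
            by (rule lin_map_mult_right[OF T mab lin_map_ident])
          have bb: "bilin K H H ?T (\<lambda>c d. tens K ?P H (tens K M H m a) b \<otimes>\<^bsub>?T\<^esub> tens K ?P H (tens K M H n c) d)"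
            by (rule bilin_comp[OF l2 bilin_tens3[OF V n]])
          have "tens K ?P H (tens K M H m a) b \<otimes>\<^bsub>?T\<^esub> ?Y =
             tlift ?T (\<lambda>c d. tens K ?P H (tens K M H m a) b \<otimes>\<^bsub>?T\<^esub> tens K ?P H (tens K M H n c) d) (comult H g)"
            unfolding free_coact_tens[OF V n g] by (rule sw_apply[OF l2 g mT mT bilin_tens3[OF V n]])
          also have "\<dots> = tlift ?T (\<lambda>c d. tens K ?P H (tens K M H (m \<otimes>\<^bsub>M\<^esub> n) (a \<otimes>\<^bsub>H\<^esub> c)) (b \<otimes>\<^bsub>H\<^esub> d)) (comult H g)"
          proof (rule sw_cong[OF g mT bb])
            fix c d assume c: "c \<in> carrier H" and d: "d \<in> carrier H"
            show "tens K ?P H (tens K M H m a) b \<otimes>\<^bsub>?T\<^esub> tens K ?P H (tens K M H n c) d =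
              tens K ?P H (tens K M H (m \<otimes>\<^bsub>M\<^esub> n) (a \<otimes>\<^bsub>H\<^esub> c)) (b \<otimes>\<^bsub>H\<^esub> d)"
              unfolding tensor_mult_tens[OF P alg ma b tens_closed[OF V mod n c] d] tensor_mult_tens[OF M alg m a n c] ..
          qed
          finally show ?thesis .
        qed
        have b1: "bilin K H H ?T (\<lambda>a b. tens K ?P H (tens K M H m a) b \<otimes>\<^bsub>?T\<^esub> ?Y)"
          by (rule bilin_comp[OF l1 bilin_tens3[OF V m]])
        have "?\<delta> (tens K M H m h) \<otimes>\<^bsub>?T\<^esub> ?Y = tlift ?T (\<lambda>a b. tens K ?P H (tens K M H m a) b \<otimes>\<^bsub>?T\<^esub> ?Y) (comult H h)"
          unfolding free_coact_tens[OF V m h] by (rule sw_apply[OF l1 h mT mT bilin_tens3[OF V m]])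
        also have "\<dots> = tlift ?T (\<lambda>a b. tlift ?T (\<lambda>c d. tens K ?P H (tens K M H (m \<otimes>\<^bsub>M\<^esub> n) (a \<otimes>\<^bsub>H\<^esub> c)) (b \<otimes>\<^bsub>H\<^esub> d)) (comult H g)) (comult H h)"
          by (rule sw_cong[OF h mT b1 inner])
        also have "\<dots> = ?\<delta> (tens K M H (m \<otimes>\<^bsub>M\<^esub> n) (h \<otimes>\<^bsub>H\<^esub> g))"
          unfolding free_coact_tens[OF V mn alg_mult_closed[OF alg h g]]
          by (rule sw_mult[OF h g mT bilin_tens3[OF V mn], symmetric])
        finally show "?\<delta> (tens K M H m h \<otimes>\<^bsub>?P\<^esub> tens K M H n g) = ?\<delta> (tens K M H m h) \<otimes>\<^bsub>?T\<^esub> ?\<delta> (tens K M H n g)"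
          by (simp add: tensor_mult_tens[OF M alg m h n g])
      qed
    qed
  qed
  then show ?thesis using lf by (simp add: alg_hom_def)
qed

end

section \<open>The trivial bundle with universal calculus\<close>

lemma submodule_set_add:
  assumes V: "module K V" and A: "submodule A K V" and B: "submodule B K V"
  shows "submodule (set_add V A B) K V"
proof (rule submoduleI'[OF V])
  interpret V: module K V by fact
  note a = submodule_subset[OF V A] and b = submodule_subset[OF V B]
  show "set_add V A B \<subseteq> carrier V" using a b by (auto simp: set_add_def')
  have "\<zero>\<^bsub>V\<^esub> = \<zero>\<^bsub>V\<^esub> \<oplus>\<^bsub>V\<^esub> \<zero>\<^bsub>V\<^esub>" by simp
  then show "\<zero>\<^bsub>V\<^esub> \<in> set_add V A B"
    using submodule_zero[OF V A] submodule_zero[OF V B] unfolding set_add_def' by blast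
  fix x y assume "x \<in> set_add V A B" "y \<in> set_add V A B"
  then obtain p q r s where *: "x = p \<oplus>\<^bsub>V\<^esub> q" "y = r \<oplus>\<^bsub>V\<^esub> s" "p \<in> A" "r \<in> A" "q \<in> B" "s \<in> B"
    by (auto simp: set_add_def')
  have "x \<oplus>\<^bsub>V\<^esub> y = (p \<oplus>\<^bsub>V\<^esub> r) \<oplus>\<^bsub>V\<^esub> (q \<oplus>\<^bsub>V\<^esub> s)"
    using * a b by (simp add: subset_iff V.a_ac)
  then show "x \<oplus>\<^bsub>V\<^esub> y \<in> set_add V A B"
    using submodule_add[OF V A *(3,4)] submodule_add[OF V B *(5,6)] unfolding set_add_def' by blast
next
  interpret V: module K V by fact
  note a = submodule_subset[OF V A] and b = submodule_subset[OF V B]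
  fix c x assume c: "c \<in> carrier K" and "x \<in> set_add V A B"
  then obtain p q where *: "x = p \<oplus>\<^bsub>V\<^esub> q" "p \<in> A" "q \<in> B" by (auto simp: set_add_def')
  then have "c \<odot>\<^bsub>V\<^esub> x = c \<odot>\<^bsub>V\<^esub> p \<oplus>\<^bsub>V\<^esub> c \<odot>\<^bsub>V\<^esub> q"
    using c a b by (simp add: subset_iff V.smult_r_distr)
  then show "c \<odot>\<^bsub>V\<^esub> x \<in> set_add V A B"
    using submodule_smult[OF A c *(2)] submodule_smult[OF B c *(3)] unfolding set_add_def' by blast
qed

text \<open>
  \<open>sh\<close> identifies \<open>(M \<otimes> M) \<otimes> (H \<otimes> H)\<close> with \<open>P \<otimes> P\<close>, and \<open>ush\<close> is its inverse; \<open>DR\<close> is the coaction of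
  \<open>P\<close>.
\<close>

locale trivial_bundle = hopf_algebra K H + M: k_algebra K M
  for K (structure) and H :: "('k, 'h, 'z) hopf_alg_scheme" (structure) and M :: "('k, 'm, 'y) module_scheme"
begin

abbreviation P where "P \<equiv> tensor K M H"
abbreviation MM where "MM \<equiv> tensor K M M"
abbreviation PP where "PP \<equiv> tensor K P P"
abbreviation PH where "PH \<equiv> tensor K P H"
abbreviation T4 where "T4 \<equiv> tensor K MM HH"
abbreviation sh where "sh \<equiv> interchange K M M H H"
abbreviation ush where "ush \<equiv> interchange K M H M H"
abbreviation DR where "DR \<equiv> free_coact K H M"
abbreviation iota where "iota \<equiv> \<lambda>m. tens K M H m \<one>\<^bsub>H\<^esub>"

sublocale P: k_algebra K P
  by (rule k_algebra_tensor[OF M.alg alg])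

lemma mT4: "module K T4" by (rule module_tensor[OF M.tmod tmod])
lemma mPH: "module K PH" by (rule module_tensor[OF P.mod mod])
lemma mPPH: "module K (tensor K PP H)" by (rule module_tensor[OF P.tmod mod])
lemma oneH: "\<one>\<^bsub>H\<^esub> \<in> carrier H" by (rule alg_one_closed[OF alg])
lemma oneM: "\<one>\<^bsub>M\<^esub> \<in> carrier M" by (rule alg_one_closed[OF M.alg])

section \<open>Products, actions and base forms in the coordinates
  \<open>(M \<otimes> M) \<otimes> (H \<otimes> H)\<close>\<close>

lemma lin_map_sh: "lin_map K T4 PP sh" by (rule lin_map_interchange[OF M.mod M.mod mod mod])
lemma lin_map_ush: "lin_map K PP T4 ush" by (rule lin_map_interchange[OF M.mod mod M.mod mod])
lemma sh_ush: "x \<in> carrier PP \<Longrightarrow> sh (ush x) = x" by (rule interchange_interchange[OF M.mod mod M.mod mod])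
lemma ush_sh: "x \<in> carrier T4 \<Longrightarrow> ush (sh x) = x" by (rule interchange_interchange[OF M.mod M.mod mod mod])
lemmas sh_closed = lin_map_closed[OF lin_map_sh]
lemmas ush_closed = lin_map_closed[OF lin_map_ush]

lemma sh_tens: "a \<in> carrier M \<Longrightarrow> b \<in> carrier M \<Longrightarrow> c \<in> carrier H \<Longrightarrow> d \<in> carrier H \<Longrightarrow>
    sh (tens K MM HH (tens K M M a b) (tens K H H c d)) = tens K P P (tens K M H a c) (tens K M H b d)"
  by (rule interchange_tens[OF M.mod M.mod mod mod])

lemma tT4: "x \<in> carrier MM \<Longrightarrow> y \<in> carrier HH \<Longrightarrow> tens K MM HH x y \<in> carrier T4"
  by (rule tens_closed[OF M.tmod tmod])

lemma tP: "m \<in> carrier M \<Longrightarrow> h \<in> carrier H \<Longrightarrow> tens K M H m h \<in> carrier P"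
  by (rule tens_closed[OF M.mod mod])

lemma tMM: "m \<in> carrier M \<Longrightarrow> n \<in> carrier M \<Longrightarrow> tens K M M m n \<in> carrier MM"
  by (rule tens_closed[OF M.mod M.mod])

lemma tHH: "m \<in> carrier H \<Longrightarrow> n \<in> carrier H \<Longrightarrow> tens K H H m n \<in> carrier HH"
  by (rule tens_closed[OF mod mod])

lemma T4_eqI:
  assumes "lin_map K T4 U f" "lin_map K T4 U g" "module K U"
    "\<And>a b c d. a \<in> carrier M \<Longrightarrow> b \<in> carrier M \<Longrightarrow> c \<in> carrier H \<Longrightarrow> d \<in> carrier H \<Longrightarrow>
      f (tens K MM HH (tens K M M a b) (tens K H H c d)) = g (tens K MM HH (tens K M M a b) (tens K H H c d))"
    "x \<in> carrier T4"
  shows "f x = g x"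
  by (rule tensor_eqI4[OF assms(1,2) M.mod M.mod mod mod assms(3,4,5)])

lemma lin_map_mm: "lin_map K T4 P (tmap K M H (mu K M) (mu K H))"
  by (rule lin_map_tmap[OF lin_map_ident M.lin_map_mu lin_map_mu M.tmod tmod M.mod mod])

lemma mu_sh: "x \<in> carrier T4 \<Longrightarrow> mu K P (sh x) = tmap K M H (mu K M) (mu K H) x"
  by (rule T4_eqI[OF lin_map_comp[OF P.lin_map_mu lin_map_sh] lin_map_mm P.mod])
    (simp_all add: sh_tens P.mu_tens tP tensor_mult_tens[OF M.alg alg] M.mu_tens mu_tens
      tmap_tens[OF M.lin_map_mu lin_map_mu M.tmod tmod M.mod mod] tMM tHH)

lemma mu_sh_tens: "x \<in> carrier MM \<Longrightarrow> y \<in> carrier HH \<Longrightarrow> mu K P (sh (tens K MM HH x y)) = tens K M H (mu K M x) (mu K H y)"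
  by (simp add: mu_sh tT4 tmap_tens[OF M.lin_map_mu lin_map_mu M.tmod tmod M.mod mod])

lemma sh_univ:
  assumes "x \<in> carrier MM" "y \<in> carrier HH" "x \<in> univ_calc K M \<or> y \<in> univ_calc K H"
  shows "sh (tens K MM HH x y) \<in> univ_calc K P"
proof -
  have "mu K P (sh (tens K MM HH x y)) = \<zero>\<^bsub>P\<^esub>"
    using assms(3) lin_map_closed[OF lin_map_mu assms(2)] lin_map_closed[OF M.lin_map_mu assms(1)]
    unfolding mu_sh_tens[OF assms(1,2)]
    by (auto simp: univ_calc_mu tens_zero_left[OF M.mod mod] tens_zero_right[OF M.mod mod])
  then show ?thesis using sh_closed[OF tT4[OF assms(1,2)]] by (simp add: univ_calc_mu)
qed

lemma lin_map_iota: "lin_map K M P iota"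
  by (rule lin_map_tens_left[OF M.mod mod oneH lin_map_ident])

lemma lin_map_iota2: "lin_map K MM PP (tmap K P P iota iota)"
  by (rule lin_map_tmap[OF lin_map_ident lin_map_iota lin_map_iota M.mod M.mod P.mod P.mod])

lemma lin_map_sh_one: "z \<in> carrier HH \<Longrightarrow> lin_map K MM PP (\<lambda>x. sh (tens K MM HH x z))"
  by (rule lin_map_comp[OF lin_map_sh lin_map_tens_left[OF M.tmod tmod _ lin_map_ident]])

text \<open>In these coordinates \<open>\<iota> \<otimes> \<iota>\<close> inserts
  \<open>1 \<otimes> 1\<close>. Base forms are recognised by this trivial second part.\<close>

lemma iota2: "x \<in> carrier MM \<Longrightarrow> tmap K P P iota iota x = sh (tens K MM HH x (tens K H H \<one>\<^bsub>H\<^esub> \<one>\<^bsub>H\<^esub>))"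
  by (rule tensor_eqI[OF lin_map_iota2 lin_map_sh_one[OF tHH[OF oneH oneH]] M.mod M.mod P.tmod])
    (simp_all add: sh_tens tmap_tens[OF lin_map_iota lin_map_iota M.mod M.mod P.mod P.mod])

lemma lin_map_lact: "k_algebra K A \<Longrightarrow> a \<in> carrier A \<Longrightarrow> lin_map K (tensor K A A) (tensor K A A) (lact K A a)"
  unfolding lact_def
  by (rule lin_map_tmap[OF lin_map_ident lin_map_mult_right[OF _ _ lin_map_ident] lin_map_ident])
    (simp_all add: k_algebra_module)

lemma lin_map_ract: "k_algebra K A \<Longrightarrow> a \<in> carrier A \<Longrightarrow> lin_map K (tensor K A A) (tensor K A A) (\<lambda>x. ract K A x a)"
  unfolding ract_def
  by (rule lin_map_tmap[OF lin_map_ident lin_map_ident lin_map_mult_left[OF _ _ lin_map_ident]])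
    (simp_all add: k_algebra_module)

lemma lact_tens: "k_algebra K A \<Longrightarrow> a \<in> carrier A \<Longrightarrow> x \<in> carrier A \<Longrightarrow> y \<in> carrier A \<Longrightarrow>
    lact K A a (tens K A A x y) = tens K A A (a \<otimes>\<^bsub>A\<^esub> x) y"
  unfolding lact_def
  by (rule tmap_tens[OF lin_map_mult_right[OF _ _ lin_map_ident] lin_map_ident]) (simp_all add: k_algebra_module)

lemma ract_tens: "k_algebra K A \<Longrightarrow> a \<in> carrier A \<Longrightarrow> x \<in> carrier A \<Longrightarrow> y \<in> carrier A \<Longrightarrow>
    ract K A (tens K A A x y) a = tens K A A x (y \<otimes>\<^bsub>A\<^esub> a)"
  unfolding ract_def
  by (rule tmap_tens[OF lin_map_ident lin_map_mult_left[OF _ _ lin_map_ident]]) (simp_all add: k_algebra_module)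

lemma lin_map_lact_param: "x \<in> carrier PP \<Longrightarrow> lin_map K P PP (\<lambda>p. lact K P p x)"
  unfolding lact_def
  by (rule lin_map_tmap_left[OF _ lin_map_ident P.mod P.mod P.mod P.mod P.mod])
    (auto intro!: lin_map_mult_left[OF P.alg] lin_map_mult_right[OF P.alg] lin_map_ident)

lemma lin_map_ract_param: "x \<in> carrier PP \<Longrightarrow> lin_map K P PP (\<lambda>p. ract K P x p)"
  unfolding ract_def
  by (rule lin_map_tmap_right[OF _ lin_map_ident P.mod P.mod P.mod P.mod P.mod])
    (auto intro!: lin_map_mult_left[OF P.alg] lin_map_mult_right[OF P.alg] lin_map_ident)

text \<open>A pure tensor of \<open>P\<close> acts factor by factor, so bimodule questions about
  \<open>P \<otimes> P\<close> split into one over \<open>M\<close> and one over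
  \<open>H\<close>.\<close>

lemma lact_sh:
  assumes m: "m \<in> carrier M" and h: "h \<in> carrier H" and x: "x \<in> carrier MM" and y: "y \<in> carrier HH"
  shows "lact K P (tens K M H m h) (sh (tens K MM HH x y)) = sh (tens K MM HH (lact K M m x) (lact K H h y))"
proof -
  note lm = lin_map_lact[OF M.alg m] and lh = lin_map_lact[OF alg h] and lp = lin_map_lact[OF P.alg tP[OF m h]]
  have l: "lin_map K T4 T4 (tmap K MM HH (lact K M m) (lact K H h))"
    by (rule lin_map_tmap[OF lin_map_ident lm lh M.tmod tmod M.tmod tmod])
  have "lact K P (tens K M H m h) (sh z) = sh (tmap K MM HH (lact K M m) (lact K H h) z)" if z: "z \<in> carrier T4" for z
    by (rule T4_eqI[OF lin_map_comp[OF lp lin_map_sh] lin_map_comp[OF lin_map_sh l] P.tmod _ z])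
      (simp add: sh_tens lact_tens[OF P.alg] lact_tens[OF M.alg m] lact_tens[OF alg h] tP m h tensor_mult_tens[OF M.alg alg]
        tmap_tens[OF lm lh M.tmod tmod M.tmod tmod] tMM tHH)
  from this[OF tT4[OF x y]] show ?thesis by (simp add: tmap_tens[OF lm lh M.tmod tmod M.tmod tmod x y])
qed

lemma ract_sh:
  assumes m: "m \<in> carrier M" and h: "h \<in> carrier H" and x: "x \<in> carrier MM" and y: "y \<in> carrier HH"
  shows "ract K P (sh (tens K MM HH x y)) (tens K M H m h) = sh (tens K MM HH (ract K M x m) (ract K H y h))"
proof -
  note lm = lin_map_ract[OF M.alg m] and lh = lin_map_ract[OF alg h] and lp = lin_map_ract[OF P.alg tP[OF m h]]
  have l: "lin_map K T4 T4 (tmap K MM HH (\<lambda>x. ract K M x m) (\<lambda>y. ract K H y h))"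
    by (rule lin_map_tmap[OF lin_map_ident lm lh M.tmod tmod M.tmod tmod])
  have "ract K P (sh z) (tens K M H m h) = sh (tmap K MM HH (\<lambda>x. ract K M x m) (\<lambda>y. ract K H y h) z)" if z: "z \<in> carrier T4" for z
    by (rule T4_eqI[OF lin_map_comp[OF lp lin_map_sh] lin_map_comp[OF lin_map_sh l] P.tmod _ z])
      (simp add: sh_tens ract_tens[OF P.alg] ract_tens[OF M.alg m] ract_tens[OF alg h] tP m h tensor_mult_tens[OF M.alg alg]
        tmap_tens[OF lm lh M.tmod tmod M.tmod tmod] tMM tHH)
  from this[OF tT4[OF x y]] show ?thesis by (simp add: tmap_tens[OF lm lh M.tmod tmod M.tmod tmod x y])
qed

lemma mu_lact: "k_algebra K A \<Longrightarrow> a \<in> carrier A \<Longrightarrow> x \<in> carrier (tensor K A A) \<Longrightarrow> mu K A (lact K A a x) = a \<otimes>\<^bsub>A\<^esub> mu K A x"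
proof -
  assume A: "k_algebra K A" and a: "a \<in> carrier A" and x: "x \<in> carrier (tensor K A A)"
  interpret A: k_algebra K A by fact
  show ?thesis
    by (rule tensor_eqI[OF lin_map_comp[OF A.lin_map_mu lin_map_lact[OF A a]] lin_map_mult_right[OF A a A.lin_map_mu] A.mod A.mod A.mod _ x])
      (simp add: lact_tens[OF A a] A.mu_tens a A.m_assoc)
qed

lemma mu_ract: "k_algebra K A \<Longrightarrow> a \<in> carrier A \<Longrightarrow> x \<in> carrier (tensor K A A) \<Longrightarrow> mu K A (ract K A x a) = mu K A x \<otimes>\<^bsub>A\<^esub> a"
proof -
  assume A: "k_algebra K A" and a: "a \<in> carrier A" and x: "x \<in> carrier (tensor K A A)"
  interpret A: k_algebra K A by fact
  show ?thesis
    by (rule tensor_eqI[OF lin_map_comp[OF A.lin_map_mu lin_map_ract[OF A a]] lin_map_mult_left[OF A a A.lin_map_mu] A.mod A.mod A.mod _ x])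
      (simp add: ract_tens[OF A a] A.mu_tens a A.m_assoc)
qed

lemma univ_lact: "k_algebra K A \<Longrightarrow> a \<in> carrier A \<Longrightarrow> x \<in> univ_calc K A \<Longrightarrow> lact K A a x \<in> univ_calc K A"
proof -
  assume A: "k_algebra K A" and a: "a \<in> carrier A" and x: "x \<in> univ_calc K A"
  interpret A: k_algebra K A by fact
  show ?thesis
    using x lin_map_closed[OF lin_map_lact[OF A a]] mu_lact[OF A a] a by (simp add: univ_calc_mu)
qed

lemma univ_ract: "k_algebra K A \<Longrightarrow> a \<in> carrier A \<Longrightarrow> x \<in> univ_calc K A \<Longrightarrow> ract K A x a \<in> univ_calc K A"
proof -
  assume A: "k_algebra K A" and a: "a \<in> carrier A" and x: "x \<in> univ_calc K A"
  interpret A: k_algebra K A by fact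
  show ?thesis
    using x lin_map_closed[OF lin_map_ract[OF A a]] mu_ract[OF A a] a by (simp add: univ_calc_mu)
qed

section \<open>The map \<open>ver\<close> and the universal exact sequence\<close>

lemma lin_map_DR: "lin_map K P PH DR" by (rule lin_map_free_coact[OF M.mod])

lemma DR_tens: "m \<in> carrier M \<Longrightarrow> h \<in> carrier H \<Longrightarrow>
    DR (tens K M H m h) = tlift PH (\<lambda>a b. tens K P H (tens K M H m a) b) (comult H h)"
  by (rule free_coact_tens[OF M.mod])

lemma lin_map_mulP: "p \<in> carrier P \<Longrightarrow> lin_map K P P (\<lambda>x. p \<otimes>\<^bsub>P\<^esub> x)"
  by (rule lin_map_mult_right[OF P.alg _ lin_map_ident])

lemma bilin_ver: "bilin K P P PH (\<lambda>p p'. tmap K P H (\<lambda>p0. p \<otimes>\<^bsub>P\<^esub> p0) (\<lambda>h. h) (DR p'))"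
proof (rule bilinI)
  fix p assume p: "p \<in> carrier P"
  show "lin_map K P PH (\<lambda>p'. tmap K P H (\<lambda>p0. p \<otimes>\<^bsub>P\<^esub> p0) (\<lambda>h. h) (DR p'))"
    by (rule lin_map_tmap[OF lin_map_DR lin_map_mulP[OF p] lin_map_ident P.mod mod P.mod mod])
next
  fix p assume p: "p \<in> carrier P"
  show "lin_map K P PH (\<lambda>p'. tmap K P H (\<lambda>p0. p' \<otimes>\<^bsub>P\<^esub> p0) (\<lambda>h. h) (DR p))"
    by (rule lin_map_tmap_left[OF lin_map_closed[OF lin_map_DR p] lin_map_ident P.mod mod P.mod mod P.mod])
      (auto intro!: lin_map_mult_left[OF P.alg] lin_map_mult_right[OF P.alg] lin_map_ident)
qed

lemma lin_map_ver: "lin_map K PP PH (ver K H P DR)"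
  unfolding ver_def by (rule lin_map_tlift'[OF P.mod P.mod mPH bilin_ver])

lemma ver_tens: "p \<in> carrier P \<Longrightarrow> p' \<in> carrier P \<Longrightarrow>
    ver K H P DR (tens K P P p p') = tmap K P H (\<lambda>p0. p \<otimes>\<^bsub>P\<^esub> p0) (\<lambda>h. h) (DR p')"
  unfolding ver_def by (rule tlift_tens[OF P.mod P.mod mPH bilin_ver])

text \<open>The counit law of the coaction gives
  \<open>(id \<otimes> \<epsilon>) (p \<Delta>\<^sub>R(p')) = p p'\<close>. Consequently
  \<open>x\<close> is a universal form exactly when \<open>id \<otimes> \<epsilon>\<close> kills
  \<open>ver x\<close>.\<close>

lemma eps_right_ver: "x \<in> carrier PP \<Longrightarrow> eps_right P (ver K H P DR x) = mu K P x"
proof (rule tensor_eqI[OF lin_map_comp[OF lin_map_eps_right[OF P.mod] lin_map_ver] P.lin_map_mu P.mod P.mod P.mod])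
  fix p q assume p: "p \<in> carrier P" and q: "q \<in> carrier P"
  have lt: "lin_map K PH PH (tmap K P H (\<lambda>p0. p \<otimes>\<^bsub>P\<^esub> p0) (\<lambda>h. h))"
    by (rule lin_map_tmap[OF lin_map_ident lin_map_mulP[OF p] lin_map_ident P.mod mod P.mod mod])
  have "eps_right P (tmap K P H (\<lambda>p0. p \<otimes>\<^bsub>P\<^esub> p0) (\<lambda>h. h) Y) = p \<otimes>\<^bsub>P\<^esub> eps_right P Y" if Y: "Y \<in> carrier PH" for Y
    by (rule tensor_eqI[OF lin_map_comp[OF lin_map_eps_right[OF P.mod] lt] lin_map_mult_right[OF P.alg p lin_map_eps_right[OF P.mod]] P.mod mod P.mod _ Y])
      (simp add: tmap_tens[OF lin_map_mulP[OF p] lin_map_ident P.mod mod P.mod mod] eps_right_tens[OF P.mod] p P.m_closed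
        P.smult_mult_right counit_closed)
  from this[OF lin_map_closed[OF lin_map_DR q]]
  show "eps_right P (ver K H P DR (tens K P P p q)) = mu K P (tens K P P p q)"
    using free_comodule[OF M.mod] p q by (simp add: ver_tens P.mu_tens right_comodule_def)
qed

abbreviation asc where "asc \<equiv> assoc_iso K M H H"

lemma lin_map_asc: "lin_map K (tensor K M HH) PH asc" by (rule lin_map_assoc_iso[OF M.mod mod mod])
lemma mM_HH: "module K (tensor K M HH)" by (rule module_tensor[OF M.mod tmod])

lemma lin_map_mu_theta: "lin_map K T4 (tensor K M HH) (tmap K M HH (mu K M) theta)"
  by (rule lin_map_tmap[OF lin_map_ident M.lin_map_mu lin_map_theta M.tmod tmod M.mod tmod])

text \<open>Both sides send \<open>(m \<otimes> n) \<otimes> (h \<otimes> g)\<close> to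
  \<open>m n \<otimes> h g\<^sub>1 \<otimes> g\<^sub>2\<close>; \<open>asc\<close> only moves the
  brackets from \<open>M \<otimes> (H \<otimes> H)\<close> to \<open>P \<otimes> H\<close>.\<close>

lemma ver_sh:
  assumes x: "x \<in> carrier T4"
  shows "ver K H P DR (sh x) = asc (tmap K M HH (mu K M) theta x)"
proof (rule T4_eqI[OF lin_map_comp[OF lin_map_ver lin_map_sh] lin_map_comp[OF lin_map_asc lin_map_mu_theta] mPH _ x])
  fix m n h g assume mn: "m \<in> carrier M" "n \<in> carrier M" and h: "h \<in> carrier H" and g: "g \<in> carrier H"
  have mm: "m \<otimes>\<^bsub>M\<^esub> n \<in> carrier M" using mn by simp
  note mh = tP[OF mn(1) h]
  have lt: "lin_map K PH PH (tmap K P H (\<lambda>p0. tens K M H m h \<otimes>\<^bsub>P\<^esub> p0) (\<lambda>h. h))"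
    by (rule lin_map_tmap[OF lin_map_ident lin_map_mulP[OF mh] lin_map_ident P.mod mod P.mod mod])
  have b: "bilin K H H PH (\<lambda>a b. tmap K P H (\<lambda>p0. tens K M H m h \<otimes>\<^bsub>P\<^esub> p0) (\<lambda>h. h) (tens K P H (tens K M H n a) b))"
    by (rule bilin_comp[OF lt bilin_tens3[OF M.mod mn(2)]])
  have b2: "bilin K H H HH (\<lambda>a b. tens K H H (h \<otimes>\<^bsub>H\<^esub> a) b)" using h by - (assumption | rule lin)+
  note b3 = bilin_tens3[OF M.mod mm]
  have l3: "lin_map K HH PH (tlift PH (\<lambda>a b. tens K P H (tens K M H (m \<otimes>\<^bsub>M\<^esub> n) a) b))"
    by (rule lin_map_tlift'[OF mod mod mPH b3])
  have b4: "bilin K H H PH (\<lambda>a b. tlift PH (\<lambda>a b. tens K P H (tens K M H (m \<otimes>\<^bsub>M\<^esub> n) a) b) (tens K H H (h \<otimes>\<^bsub>H\<^esub> a) b))"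
    by (rule bilin_comp[OF l3 b2])
  have "ver K H P DR (tens K P P (tens K M H m h) (tens K M H n g)) =
     tlift PH (\<lambda>a b. tmap K P H (\<lambda>p0. tens K M H m h \<otimes>\<^bsub>P\<^esub> p0) (\<lambda>h. h) (tens K P H (tens K M H n a) b)) (comult H g)"
    unfolding ver_tens[OF mh tP[OF mn(2) g]] DR_tens[OF mn(2) g]
    by (rule sw_apply[OF lt g mPH mPH bilin_tens3[OF M.mod mn(2)]])
  also have "\<dots> = tlift PH (\<lambda>a b. tens K P H (tens K M H (m \<otimes>\<^bsub>M\<^esub> n) (h \<otimes>\<^bsub>H\<^esub> a)) b) (comult H g)"
    by (rule sw_cong[OF g mPH b])
      (simp add: tmap_tens[OF lin_map_mulP[OF mh] lin_map_ident P.mod mod P.mod mod] tP mn h tensor_mult_tens[OF M.alg alg])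
  also have "\<dots> = tlift PH (\<lambda>a b. tlift PH (\<lambda>a b. tens K P H (tens K M H (m \<otimes>\<^bsub>M\<^esub> n) a) b) (tens K H H (h \<otimes>\<^bsub>H\<^esub> a) b)) (comult H g)"
    by (rule sw_cong[OF g mPH b4, symmetric]) (simp add: tlift_tens[OF mod mod mPH b3] h)
  also have "\<dots> = tlift PH (\<lambda>a b. tens K P H (tens K M H (m \<otimes>\<^bsub>M\<^esub> n) a) b) (theta (tens K H H h g))"
    unfolding theta_tens[OF h g] by (rule sw_apply[OF l3 g tmod mPH b2, symmetric])
  also have "\<dots> = asc (tens K M HH (m \<otimes>\<^bsub>M\<^esub> n) (theta (tens K H H h g)))"
    by (rule assoc_iso_tens_right[OF M.mod mm theta_closed[OF tHH[OF h g]], symmetric])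
  finally show "ver K H P DR (sh (tens K MM HH (tens K M M m n) (tens K H H h g))) =
      asc (tmap K M HH (mu K M) theta (tens K MM HH (tens K M M m n) (tens K H H h g)))"
    by (simp add: sh_tens mn h g tmap_tens[OF M.lin_map_mu lin_map_theta M.tmod tmod M.mod tmod] tMM tHH M.mu_tens)
qed

lemma ver_sh_tens: "x \<in> carrier MM \<Longrightarrow> y \<in> carrier HH \<Longrightarrow>
    ver K H P DR (sh (tens K MM HH x y)) = asc (tens K M HH (mu K M x) (theta y))"
  by (simp add: ver_sh tT4 tmap_tens[OF M.lin_map_mu lin_map_theta M.tmod tmod M.mod tmod])

text \<open>The universal horizontal forms. Exactness in the middle of the sequence is proved by
  identifying both the kernel of \<open>ver\<close> and the span of the products
  \<open>p \<omega> p'\<close> with this space.\<close>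

abbreviation horiz where "horiz \<equiv> sh ` tsub K MM HH (univ_calc K M) (carrier HH)"

lemma horiz_submodule: "submodule horiz K PP"
  by (rule submodule_image[OF mT4 P.tmod lin_map_sh tsub_submodule[OF M.tmod tmod M.univ_subset subset_refl]])

text \<open>Rebracketing and \<open>theta\<close> have left inverses, so the vanishing of
  \<open>ver\<close> means that \<open>mu \<otimes> id\<close> vanishes on the coordinates; the
  kernel of the latter is given by \<open>univ_tsub\<close>.\<close>

lemma ker_ver: "{x \<in> univ_calc K P. ver K H P DR x = \<zero>\<^bsub>PH\<^esub>} = horiz"
proof
  show "{x \<in> univ_calc K P. ver K H P DR x = \<zero>\<^bsub>PH\<^esub>} \<subseteq> horiz"
  proof
    fix x assume "x \<in> {x \<in> univ_calc K P. ver K H P DR x = \<zero>\<^bsub>PH\<^esub>}"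
    then have x: "x \<in> carrier PP" and v: "ver K H P DR x = \<zero>\<^bsub>PH\<^esub>" using P.univ_subset by auto
    define y where "y = ush x"
    have y: "y \<in> carrier T4" unfolding y_def by (rule ush_closed[OF x])
    have xy: "x = sh y" unfolding y_def by (simp add: sh_ush x)
    let ?w = "tmap K M HH (mu K M) theta y"
    have w: "?w \<in> carrier (tensor K M HH)" by (rule lin_map_closed[OF lin_map_mu_theta y])
    have "asc ?w = \<zero>\<^bsub>PH\<^esub>" using v by (simp add: xy ver_sh[OF y])
    then have "assoc_inv K M H H (asc ?w) = \<zero>\<^bsub>tensor K M HH\<^esub>"
      using lin_map_zero[OF mPH mM_HH lin_map_assoc_inv[OF M.mod mod mod]] by simp
    then have w0: "?w = \<zero>\<^bsub>tensor K M HH\<^esub>" by (simp add: assoc_inv_assoc_iso[OF M.mod mod mod w])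
    have lti: "lin_map K (tensor K M HH) (tensor K M HH) (tmap K M HH (\<lambda>m. m) theta_inv)"
      by (rule lin_map_tmap[OF lin_map_ident lin_map_ident lin_map_theta_inv M.mod tmod M.mod tmod])
    have "tmap K M HH (mu K M) (\<lambda>w. w) y = tmap K M HH (\<lambda>x. mu K M x) (\<lambda>y. theta_inv (theta y)) y"
      by (rule tmap_cong[OF y M.lin_map_mu lin_map_ident M.tmod tmod M.mod tmod]) (simp_all add: theta_inv_theta)
    also have "\<dots> = tmap K M HH (\<lambda>m. m) theta_inv ?w"
      by (rule tmap_tmap[OF y M.lin_map_mu lin_map_theta lin_map_ident lin_map_theta_inv M.tmod tmod M.mod tmod M.mod tmod, symmetric])
    also have "\<dots> = \<zero>\<^bsub>tensor K M HH\<^esub>" unfolding w0 by (rule lin_map_zero[OF mM_HH mM_HH lti])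
    finally have "y \<in> tsub K MM HH (univ_calc K M) (carrier HH)" by (rule M.univ_tsub[OF tmod y])
    then show "x \<in> horiz" unfolding xy by (rule imageI)
  qed
  show "horiz \<subseteq> {x \<in> univ_calc K P. ver K H P DR x = \<zero>\<^bsub>PH\<^esub>}"
  proof (rule image_subsetI)
    fix y assume y: "y \<in> tsub K MM HH (univ_calc K M) (carrier HH)"
    have "sh y \<in> univ_calc K P"
      by (rule lin_map_tsub[OF y lin_map_sh M.tmod tmod P.tmod P.univ_submodule M.univ_subset subset_refl])
        (use M.univ_subset in \<open>auto intro!: sh_univ\<close>)
    moreover have "sh y \<in> {x \<in> carrier PP. ver K H P DR x = \<zero>\<^bsub>PH\<^esub>}"
    proof (rule lin_map_tsub[OF y lin_map_sh M.tmod tmod P.tmod submodule_ker[OF P.tmod mPH lin_map_ver] M.univ_subset subset_refl])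
      fix a b assume a: "a \<in> univ_calc K M" and b: "b \<in> carrier HH"
      then have a': "a \<in> carrier MM" "mu K M a = \<zero>\<^bsub>M\<^esub>" by (auto simp: univ_calc_mu)
      have "ver K H P DR (sh (tens K MM HH a b)) = \<zero>\<^bsub>PH\<^esub>"
        unfolding ver_sh_tens[OF a'(1) b] a'(2) tens_zero_left[OF M.mod tmod theta_closed[OF b]]
        by (rule lin_map_zero[OF mM_HH mPH lin_map_asc])
      then show "sh (tens K MM HH a b) \<in> {x \<in> carrier PP. ver K H P DR x = \<zero>\<^bsub>PH\<^esub>}"
        using sh_closed[OF tT4[OF a'(1) b]] by simp
    qed
    ultimately show "sh y \<in> {x \<in> univ_calc K P. ver K H P DR x = \<zero>\<^bsub>PH\<^esub>}" by simp
  qed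
qed

lemma base_forms_mem: "\<omega> \<in> base_forms K P iota U \<Longrightarrow> U \<subseteq> carrier MM \<Longrightarrow>
    \<exists>a\<in>U. \<omega> = sh (tens K MM HH a (tens K H H \<one>\<^bsub>H\<^esub> \<one>\<^bsub>H\<^esub>))"
  unfolding base_forms_def using iota2 by blast

lemma sh_bimodule:
  assumes "m \<in> carrier M" "h \<in> carrier H" "a \<in> carrier MM" "n \<in> carrier M" "g \<in> carrier H"
  shows "ract K P (lact K P (tens K M H m h) (sh (tens K MM HH a (tens K H H \<one>\<^bsub>H\<^esub> \<one>\<^bsub>H\<^esub>)))) (tens K M H n g) =
    sh (tens K MM HH (ract K M (lact K M m a) n) (tens K H H h g))"
  using assms lin_map_closed[OF lin_map_lact[OF M.alg]]
  by (simp add: lact_sh ract_sh tHH oneH lact_tens[OF alg] ract_tens[OF alg])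

lemma lact_one: "k_algebra K A \<Longrightarrow> x \<in> carrier (tensor K A A) \<Longrightarrow> lact K A \<one>\<^bsub>A\<^esub> x = x"
proof -
  assume A: "k_algebra K A" and x: "x \<in> carrier (tensor K A A)"
  interpret A: k_algebra K A by fact
  show ?thesis
    by (rule tensor_eqI[OF lin_map_lact[OF A alg_one_closed[OF A]] lin_map_ident A.mod A.mod A.tmod _ x])
      (simp add: lact_tens[OF A])
qed

lemma ract_one: "k_algebra K A \<Longrightarrow> x \<in> carrier (tensor K A A) \<Longrightarrow> ract K A x \<one>\<^bsub>A\<^esub> = x"
proof -
  assume A: "k_algebra K A" and x: "x \<in> carrier (tensor K A A)"
  interpret A: k_algebra K A by fact
  show ?thesis
    by (rule tensor_eqI[OF lin_map_ract[OF A alg_one_closed[OF A]] lin_map_ident A.mod A.mod A.tmod _ x])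
      (simp add: ract_tens[OF A])
qed

text \<open>For pure \<open>p = m \<otimes> h\<close> and \<open>p' = n \<otimes> g\<close>, the
  product \<open>p \<omega> p'\<close> has coordinates \<open>m a n\<close>, again a universal form
  on \<open>M\<close>, and \<open>h \<otimes> g\<close>, which is arbitrary.\<close>

lemma horiz_span:
  "kspan K PP {ract K P (lact K P p \<omega>) p' | p \<omega> p'.
         p \<in> carrier P \<and> \<omega> \<in> base_forms K P iota (univ_calc K M) \<and> p' \<in> carrier P} = horiz"
  (is "kspan K PP ?S = _")
proof
  have mem: "ract K P (lact K P p \<omega>) p' \<in> horiz"
    if p: "p \<in> carrier P" and w: "\<omega> \<in> base_forms K P iota (univ_calc K M)" and p': "p' \<in> carrier P" for p \<omega> p'
  proof -
    obtain a where a: "a \<in> univ_calc K M" "\<omega> = sh (tens K MM HH a (tens K H H \<one>\<^bsub>H\<^esub> \<one>\<^bsub>H\<^esub>))"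
      using base_forms_mem[OF w M.univ_subset] by blast
    have a': "a \<in> carrier MM" using a(1) M.univ_subset by blast
    have wP: "\<omega> \<in> carrier PP" unfolding a(2) by (rule sh_closed[OF tT4[OF a' tHH[OF oneH oneH]]])
    have lp: "lact K P p \<omega> \<in> carrier PP" by (rule lin_map_closed[OF lin_map_lact[OF P.alg p] wP])
    show ?thesis
    proof (rule tensor_mem[OF p' lin_map_ract_param[OF lp] M.mod mod P.tmod horiz_submodule])
      fix n g assume n: "n \<in> carrier M" and g: "g \<in> carrier H"
      show "ract K P (lact K P p \<omega>) (tens K M H n g) \<in> horiz"
      proof (rule tensor_mem[OF p lin_map_comp[OF lin_map_ract[OF P.alg tP[OF n g]] lin_map_lact_param[OF wP]] M.mod mod P.tmod horiz_submodule])
        fix m h assume m: "m \<in> carrier M" and h: "h \<in> carrier H"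
        show "ract K P (lact K P (tens K M H m h) \<omega>) (tens K M H n g) \<in> horiz"
          unfolding a(2) sh_bimodule[OF m h a' n g]
          by (intro imageI tsub_tens univ_ract[OF M.alg n] univ_lact[OF M.alg m] a(1) tHH h g)
      qed
    qed
  qed
  show "kspan K PP ?S \<subseteq> horiz"
    by (rule kspan_least[OF horiz_submodule]) (use mem in blast)
  have "?S \<subseteq> carrier PP" using mem submodule_subset[OF P.tmod horiz_submodule] by blast
  then have sub: "submodule (kspan K PP ?S) K PP" by (rule kspan_submodule[OF P.tmod])
  show "horiz \<subseteq> kspan K PP ?S"
  proof (rule image_subsetI)
    fix y assume y: "y \<in> tsub K MM HH (univ_calc K M) (carrier HH)"
    show "sh y \<in> kspan K PP ?S"
    proof (rule lin_map_tsub[OF y lin_map_sh M.tmod tmod P.tmod sub M.univ_subset subset_refl])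
      fix a z assume a: "a \<in> univ_calc K M" and z: "z \<in> carrier HH"
      then have a': "a \<in> carrier MM" using M.univ_subset by blast
      show "sh (tens K MM HH a z) \<in> kspan K PP ?S"
      proof (rule tensor_mem[OF z lin_map_comp[OF lin_map_sh lin_map_tens_right[OF M.tmod tmod a' lin_map_ident]] mod mod P.tmod sub])
        fix h g assume h: "h \<in> carrier H" and g: "g \<in> carrier H"
        \<comment> \<open>Multiplying by \<open>1 \<otimes> h\<close> and
          \<open>1 \<otimes> g\<close> leaves \<open>a\<close> unchanged and fills in the two slots
          of \<open>1 \<otimes> 1\<close>.\<close>
        have "sh (tens K MM HH a (tens K H H h g)) = ract K P (lact K P (tens K M H \<one>\<^bsub>M\<^esub> h) (tmap K P P iota iota a)) (tens K M H \<one>\<^bsub>M\<^esub> g)"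
          by (simp add: iota2[OF a'] sh_bimodule[OF oneM h a' oneM g] lact_one[OF M.alg] ract_one[OF M.alg] a')
        also have "\<dots> \<in> ?S"
          using tP[OF oneM h] tP[OF oneM g] a unfolding base_forms_def by blast
        finally show "sh (tens K MM HH a (tens K H H h g)) \<in> kspan K PP ?S" by (rule kspan_incl)
      qed
    qed
  qed
qed

text \<open>\<open>eps_right_ver\<close> sends universal forms into the kernel of
  \<open>id \<otimes> \<epsilon>\<close>, which \<open>eps_right_zero_tsub\<close> identifies. The
  converse inclusion uses an explicit preimage.\<close>

lemma ver_univ: "ver K H P DR ` univ_calc K P = tsub K P H (carrier P) (ker_counit K H)"
proof
  show "ver K H P DR ` univ_calc K P \<subseteq> tsub K P H (carrier P) (ker_counit K H)"
  proof (rule image_subsetI)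
    fix x assume "x \<in> univ_calc K P"
    then have x: "x \<in> carrier PP" "mu K P x = \<zero>\<^bsub>P\<^esub>" by (auto simp: univ_calc_mu)
    show "ver K H P DR x \<in> tsub K P H (carrier P) (ker_counit K H)"
      by (rule eps_right_zero_tsub[OF P.mod lin_map_closed[OF lin_map_ver x(1)]]) (simp add: eps_right_ver x)
  qed
  show "tsub K P H (carrier P) (ker_counit K H) \<subseteq> ver K H P DR ` univ_calc K P"
  proof
    fix y assume y: "y \<in> tsub K P H (carrier P) (ker_counit K H)"
    have yc: "y \<in> carrier PH" using y tsub_subset[OF P.mod mod subset_refl ker_counit_subset] by blast
    \<comment> \<open>The preimage undoes the rebracketing and \<open>theta\<close>, and splits the
      multiplication of \<open>M\<close> by \<open>m \<mapsto> m \<otimes> 1\<close>.\<close>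
    let ?s = "\<lambda>m. tens K M M m \<one>\<^bsub>M\<^esub>"
    have ls: "lin_map K M MM ?s" by (rule lin_map_tens_left[OF M.mod M.mod oneM lin_map_ident])
    define w where "w = assoc_inv K M H H y"
    have w: "w \<in> carrier (tensor K M HH)" unfolding w_def by (rule lin_map_closed[OF lin_map_assoc_inv[OF M.mod mod mod] yc])
    define z where "z = tmap K MM HH ?s theta_inv w"
    have z: "z \<in> carrier T4" unfolding z_def by (rule tmap_closed[OF w ls lin_map_theta_inv M.mod tmod M.tmod tmod])
    have "tmap K M HH (mu K M) theta z = tmap K M HH (\<lambda>m. mu K M (?s m)) (\<lambda>y. theta (theta_inv y)) w"
      unfolding z_def by (rule tmap_tmap[OF w ls lin_map_theta_inv M.lin_map_mu lin_map_theta M.mod tmod M.tmod tmod M.mod tmod])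
    also have "\<dots> = tmap K M HH (\<lambda>m. m) (\<lambda>y. y) w"
      by (rule tmap_cong[OF w lin_map_comp[OF M.lin_map_mu ls] lin_map_comp[OF lin_map_theta lin_map_theta_inv] M.mod tmod M.mod tmod])
        (simp_all add: M.mu_tens theta_theta_inv)
    also have "\<dots> = w" by (rule tmap_ident[OF w M.mod tmod])
    finally have "ver K H P DR (sh z) = asc w" by (simp add: ver_sh[OF z])
    also have "asc w = y"
      unfolding w_def
      by (rule tensor_eqI3_left[OF lin_map_comp[OF lin_map_asc lin_map_assoc_inv[OF M.mod mod mod]] lin_map_ident M.mod mod mod mPH _ yc])
        (simp add: assoc_inv_tens[OF M.mod mod mod] assoc_iso_tens[OF M.mod mod mod])
    finally have v: "ver K H P DR (sh z) = y" .
    \<comment> \<open>The preimage is a universal form because its product can be computed from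
      \<open>y\<close>, whose second factor lies in \<open>ker \<epsilon>\<close>.\<close>
    have "mu K P (sh z) = eps_right P y" using eps_right_ver[OF sh_closed[OF z]] by (simp add: v)
    also have "\<dots> = \<zero>\<^bsub>P\<^esub>" by (rule eps_right_tsub_ker[OF P.mod y])
    finally have "sh z \<in> univ_calc K P" using sh_closed[OF z] by (simp add: univ_calc_mu)
    then show "y \<in> ver K H P DR ` univ_calc K P" using v by blast
  qed
qed

section \<open>The base algebra as the coinvariants\<close>

lemma iota_alg_hom: "alg_hom K M P iota"
proof -
  have "iota \<in> ring_hom M P"
    by (rule ring_hom_memI)
      (simp_all add: tP oneH one_tensor tensor_mult_tens[OF M.alg alg] lin_map_add[OF lin_map_iota])
  then show ?thesis by (simp add: alg_hom_def lin_map_iota)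
qed

text \<open>\<open>id \<otimes> \<epsilon>\<close> inverts \<open>\<iota>\<close>. Applying
  \<open>\<epsilon>\<close> to the middle factor of
  \<open>\<Delta>\<^sub>R p = p \<otimes> 1\<close> gives \<open>p\<close> on the left by the counit
  law and \<open>\<iota>((id \<otimes> \<epsilon>) p)\<close> on the right.\<close>

lemma iota_coinvariants: "bij_betw iota (carrier M) (coinvariants K H P DR)"
proof -
  have one: "DR (iota m) = tens K P H (iota m) \<one>\<^bsub>H\<^esub>" if m: "m \<in> carrier M" for m
    unfolding DR_tens[OF m oneH] comult_one
    by (rule tlift_tens[OF mod mod mPH bilin_tens3[OF M.mod m]]) (rule oneH)+
  have inj: "eps_right M (iota m) = m" if m: "m \<in> carrier M" for m
    using m by (simp add: eps_right_tens[OF M.mod m oneH] counit_one)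
  have surj: "p = iota (eps_right M p)" if p: "p \<in> carrier P" "DR p = tens K P H p \<one>\<^bsub>H\<^esub>" for p
  proof -
    let ?e = "tmap K M H (eps_right M) (\<lambda>h. h)"
    have le: "lin_map K PH P ?e" by (rule lin_map_tmap[OF lin_map_ident lin_map_eps_right[OF M.mod] lin_map_ident P.mod mod M.mod mod])
    have "?e (DR p) = p"
    proof (rule tensor_eqI[OF lin_map_comp[OF le lin_map_DR] lin_map_ident M.mod mod P.mod _ p(1)])
      fix m h assume m: "m \<in> carrier M" and h: "h \<in> carrier H"
      have l: "lin_map K H P (\<lambda>b. tens K M H m b)" by (rule lin_map_tens_right[OF M.mod mod m lin_map_ident])
      have b: "bilin K H H P (\<lambda>a b. ?e (tens K P H (tens K M H m a) b))"
        by (rule bilin_comp[OF le bilin_tens3[OF M.mod m]])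
      have "?e (DR (tens K M H m h)) = tlift P (\<lambda>a b. ?e (tens K P H (tens K M H m a) b)) (comult H h)"
        unfolding DR_tens[OF m h] by (rule sw_apply[OF le h mPH P.mod bilin_tens3[OF M.mod m]])
      also have "\<dots> = tlift P (\<lambda>a b. counit H a \<odot>\<^bsub>P\<^esub> tens K M H m b) (comult H h)"
      proof (rule sw_cong[OF h P.mod b])
        fix a b assume a: "a \<in> carrier H" and b: "b \<in> carrier H"
        show "?e (tens K P H (tens K M H m a) b) = counit H a \<odot>\<^bsub>P\<^esub> tens K M H m b"
          using lin_map_smult[OF lin_map_tens_left[OF M.mod mod b lin_map_ident] counit_closed[OF a] m]
          by (simp add: tmap_tens[OF lin_map_eps_right[OF M.mod] lin_map_ident P.mod mod M.mod mod tP[OF m a] b] eps_right_tens[OF M.mod m a])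
      qed
      also have "\<dots> = tens K M H m h" by (rule sw_counit_left[OF h P.mod l])
      finally show "?e (DR (tens K M H m h)) = tens K M H m h" .
    qed
    then show ?thesis
      by (simp add: p(2) tmap_tens[OF lin_map_eps_right[OF M.mod] lin_map_ident P.mod mod M.mod mod p(1) oneH])
  qed
  show ?thesis
    unfolding coinvariants_def
  proof (rule bij_betw_byWitness[where f'="eps_right M"])
    show "\<forall>a\<in>carrier M. eps_right M (iota a) = a" using inj by blast
    show "\<forall>a'\<in>{p \<in> carrier P. DR p = tens K P H p \<one>\<^bsub>H\<^esub>}. iota (eps_right M a') = a'" using surj by auto
    show "iota ` carrier M \<subseteq> {p \<in> carrier P. DR p = tens K P H p \<one>\<^bsub>H\<^esub>}" using one tP[OF _ oneH] by auto
    show "eps_right M ` {p \<in> carrier P. DR p = tens K P H p \<one>\<^bsub>H\<^esub>} \<subseteq> carrier M"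
      using lin_map_closed[OF lin_map_eps_right[OF M.mod]] by auto
  qed
qed

end

section \<open>The product calculus\<close>

context trivial_bundle
begin

abbreviation RP where "RP \<equiv> tensor_coact K H P DR P DR"

lemma lin_map_RP: "lin_map K PP (tensor K PP H) RP"
  by (rule lin_map_tensor_coact[OF P.mod P.mod lin_map_DR lin_map_DR])

lemma lin_map_sh_left: "x \<in> carrier MM \<Longrightarrow> lin_map K HH PP (\<lambda>z. sh (tens K MM HH x z))"
  by (rule lin_map_comp[OF lin_map_sh lin_map_tens_right[OF M.tmod tmod _ lin_map_ident]])

lemma lin_map_tmap_sh: "x \<in> carrier MM \<Longrightarrow> lin_map K (tensor K HH H) (tensor K PP H) (tmap K PP H (\<lambda>z. sh (tens K MM HH x z)) (\<lambda>h. h))"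
  by (rule lin_map_tmap[OF lin_map_ident lin_map_sh_left lin_map_ident tmod mod P.tmod mod])

text \<open>Elements of \<open>M\<close> are coinvariant, so the coaction on
  \<open>P \<otimes> P\<close> affects only the coordinate in \<open>H \<otimes> H\<close>, where it
  is \<open>rho\<close>.\<close>

lemma coact_sh:
  assumes x: "x \<in> carrier MM" and y: "y \<in> carrier HH"
  shows "RP (sh (tens K MM HH x y)) = tmap K PP H (\<lambda>z. sh (tens K MM HH x z)) (\<lambda>h. h) (rho y)"
proof (rule tensor_eqI[OF _ _ M.mod M.mod mPPH _ x])
  have ry: "rho y \<in> carrier (tensor K HH H)" by (rule lin_map_closed[OF lin_map_rho y])
  show "lin_map K MM (tensor K PP H) (\<lambda>x. RP (sh (tens K MM HH x y)))"
    by (rule lin_map_comp[OF lin_map_RP lin_map_sh_one[OF y]])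
  show "lin_map K MM (tensor K PP H) (\<lambda>x. tmap K PP H (\<lambda>z. sh (tens K MM HH x z)) (\<lambda>h. h) (rho y))"
    by (rule lin_map_tmap_left[OF ry lin_map_ident tmod mod P.tmod mod M.tmod lin_map_sh_one lin_map_sh_left])
  fix m n assume m: "m \<in> carrier M" and n: "n \<in> carrier M"
  note mn = tMM[OF m n]
  show "RP (sh (tens K MM HH (tens K M M m n) y)) = tmap K PP H (\<lambda>z. sh (tens K MM HH (tens K M M m n) z)) (\<lambda>h. h) (rho y)"
  proof (rule tensor_eqI[OF lin_map_comp[OF lin_map_RP lin_map_sh_left[OF mn]] lin_map_comp[OF lin_map_tmap_sh[OF mn] lin_map_rho] mod mod mPPH _ y])
    fix h g assume h: "h \<in> carrier H" and g: "g \<in> carrier H"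
    let ?T = "tensor K PP H"
    let ?R = "\<lambda>a b c d. tens K PP H (tens K P P (tens K M H m a) (tens K M H n c)) (b \<otimes>\<^bsub>H\<^esub> d)"
    let ?Y = "DR (tens K M H n g)"
    note Y = lin_map_closed[OF lin_map_DR tP[OF n g]]
    let ?\<beta> = "\<lambda>v0 v1 w0 w1. tens K PP H (tens K P P v0 w0) (v1 \<otimes>\<^bsub>H\<^esub> w1)"
    note b1 = bilin_coact1[OF P.mod P.mod lin_map_DR lin_map_DR]
    note b2 = bilin_coact2[OF P.mod P.mod lin_map_DR lin_map_DR Y]
    have l2: "lin_map K PH ?T (tlift ?T (\<lambda>v0 v1. tlift ?T (?\<beta> v0 v1) ?Y))"
      by (rule lin_map_tlift'[OF P.mod mod mPPH b2])
    have c1: "bilin K H H ?T (\<lambda>a b. tlift ?T (\<lambda>v0 v1. tlift ?T (?\<beta> v0 v1) ?Y) (tens K P H (tens K M H m a) b))"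
      by (rule bilin_comp[OF l2 bilin_tens3[OF M.mod m]])
    have inner: "tlift ?T (\<lambda>v0 v1. tlift ?T (?\<beta> v0 v1) ?Y) (tens K P H (tens K M H m a) b) = tlift ?T (?R a b) (comult H g)"
      if a: "a \<in> carrier H" and b: "b \<in> carrier H" for a b
    proof -
      note ma = tP[OF m a]
      have l1: "lin_map K PH ?T (tlift ?T (?\<beta> (tens K M H m a) b))"
        by (rule lin_map_tlift'[OF P.mod mod mPPH b1[OF ma b]])
      have c2: "bilin K H H ?T (\<lambda>c d. tlift ?T (?\<beta> (tens K M H m a) b) (tens K P H (tens K M H n c) d))"
        by (rule bilin_comp[OF l1 bilin_tens3[OF M.mod n]])
      have "tlift ?T (\<lambda>v0 v1. tlift ?T (?\<beta> v0 v1) ?Y) (tens K P H (tens K M H m a) b) = tlift ?T (?\<beta> (tens K M H m a) b) ?Y"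
        by (rule tlift_tens[OF P.mod mod mPPH b2 ma b])
      also have "\<dots> = tlift ?T (\<lambda>c d. tlift ?T (?\<beta> (tens K M H m a) b) (tens K P H (tens K M H n c) d)) (comult H g)"
        unfolding DR_tens[OF n g] by (rule sw_apply[OF l1 g mPH mPPH bilin_tens3[OF M.mod n]])
      also have "\<dots> = tlift ?T (?R a b) (comult H g)"
        by (rule sw_cong[OF g mPPH c2]) (rule tlift_tens[OF P.mod mod mPPH b1[OF ma b] tP[OF n]])
      finally show ?thesis .
    qed
    have "RP (tens K P P (tens K M H m h) (tens K M H n g)) =
       tlift ?T (\<lambda>a b. tlift ?T (\<lambda>v0 v1. tlift ?T (?\<beta> v0 v1) ?Y) (tens K P H (tens K M H m a) b)) (comult H h)"
      unfolding tensor_coact_tens[OF P.mod P.mod lin_map_DR lin_map_DR tP[OF m h] tP[OF n g]] DR_tens[OF m h]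
      by (rule sw_apply[OF l2 h mPH mPPH bilin_tens3[OF M.mod m]])
    also have "\<dots> = tlift ?T (\<lambda>a b. tlift ?T (?R a b) (comult H g)) (comult H h)"
      by (rule sw_cong[OF h mPPH c1 inner])
    finally have L: "RP (tens K P P (tens K M H m h) (tens K M H n g)) = \<dots>" .
    note lt = lin_map_tmap_sh[OF mn]
    let ?t = "tmap K PP H (\<lambda>z. sh (tens K MM HH (tens K M M m n) z)) (\<lambda>h. h)"
    note cg = comult_closed[OF g]
    note d1 = bilin_coact1[OF mod mod lin_map_comult lin_map_comult]
    note d2 = bilin_coact2[OF mod mod lin_map_comult lin_map_comult cg]
    have e1: "bilin K H H ?T (\<lambda>a b. ?t (tlift (tensor K HH H) (\<lambda>c d. tens K HH H (tens K H H a c) (b \<otimes>\<^bsub>H\<^esub> d)) (comult H g)))"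
      by (rule bilin_comp[OF lt d2])
    have inner2: "?t (tlift (tensor K HH H) (\<lambda>c d. tens K HH H (tens K H H a c) (b \<otimes>\<^bsub>H\<^esub> d)) (comult H g)) = tlift ?T (?R a b) (comult H g)"
      if a: "a \<in> carrier H" and b: "b \<in> carrier H" for a b
    proof -
      have e2: "bilin K H H ?T (\<lambda>c d. ?t (tens K HH H (tens K H H a c) (b \<otimes>\<^bsub>H\<^esub> d)))"
        by (rule bilin_comp[OF lt d1[OF a b]])
      have "?t (tlift (tensor K HH H) (\<lambda>c d. tens K HH H (tens K H H a c) (b \<otimes>\<^bsub>H\<^esub> d)) (comult H g)) =
         tlift ?T (\<lambda>c d. ?t (tens K HH H (tens K H H a c) (b \<otimes>\<^bsub>H\<^esub> d))) (comult H g)"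
        by (rule sw_apply[OF lt g module_HHH mPPH d1[OF a b]])
      also have "\<dots> = tlift ?T (?R a b) (comult H g)"
        by (rule sw_cong[OF g mPPH e2])
          (simp add: tmap_tens[OF lin_map_sh_left[OF mn] lin_map_ident tmod mod P.tmod mod] tHH a b sh_tens m n)
      finally show ?thesis .
    qed
    have "?t (rho (tens K H H h g)) = tlift ?T (\<lambda>a b. ?t (tlift (tensor K HH H) (\<lambda>c d. tens K HH H (tens K H H a c) (b \<otimes>\<^bsub>H\<^esub> d)) (comult H g))) (comult H h)"
      unfolding tensor_coact_tens[OF mod mod lin_map_comult lin_map_comult h g]
      by (rule sw_apply[OF lt h module_HHH mPPH d2])
    also have "\<dots> = tlift ?T (\<lambda>a b. tlift ?T (?R a b) (comult H g)) (comult H h)"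
      by (rule sw_cong[OF h mPPH e1 inner2])
    finally show "RP (sh (tens K MM HH (tens K M M m n) (tens K H H h g))) = ?t (rho (tens K H H h g))"
      using L by (simp add: sh_tens m n h g)
  qed
qed

context
  fixes NM Q
  assumes NM: "diff_calculus K M NM" and Q: "bicovariant K H Q"
begin

abbreviation NH where "NH \<equiv> bicov_N K H Q"
abbreviation NP where "NP \<equiv> product_N K M NM H NH"

lemma NM_univ: "NM \<subseteq> univ_calc K M" and NM_submodule: "submodule NM K MM"
  and NM_lact: "a \<in> carrier M \<Longrightarrow> x \<in> NM \<Longrightarrow> lact K M a x \<in> NM"
  and NM_ract: "a \<in> carrier M \<Longrightarrow> x \<in> NM \<Longrightarrow> ract K M x a \<in> NM"
  using NM by (auto simp: diff_calculus_def)

lemma NM_subset: "NM \<subseteq> carrier MM" using NM_univ M.univ_subset by blast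

lemma NH_sub: "NH \<subseteq> carrier HH" by (rule NH_subset[OF Q])

abbreviation A1 where "A1 \<equiv> tsub K MM HH NM (carrier HH)"
abbreviation A2 where "A2 \<equiv> tsub K MM HH (carrier MM) NH"
abbreviation A3 where "A3 \<equiv> tsub K MM HH (univ_calc K M) (univ_calc K H)"

lemma A1_sub: "submodule A1 K T4" by (rule tsub_submodule[OF M.tmod tmod NM_subset subset_refl])
lemma A2_sub: "submodule A2 K T4" by (rule tsub_submodule[OF M.tmod tmod subset_refl NH_sub])
lemma A3_sub: "submodule A3 K T4" by (rule tsub_submodule[OF M.tmod tmod M.univ_subset univ_subset])

lemma NP_unfold: "NP = sh ` set_add T4 (set_add T4 A1 A2) A3"
  by (simp add: product_N_def shuffle_interchange Let_def)

lemma NP_submodule: "submodule NP K PP"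
  unfolding NP_unfold
  by (intro submodule_image[OF mT4 P.tmod lin_map_sh] submodule_set_add[OF mT4] A1_sub A2_sub A3_sub)

lemma NP_subset: "NP \<subseteq> carrier PP" by (rule submodule_subset[OF P.tmod NP_submodule])

text \<open>The preimage of \<open>U\<close> is a subspace, so pure tensors from each of the three
  summands suffice. The later arguments about elements of \<open>N\<^sub>P\<close> are mostly
  instances of this case distinction.\<close>

lemma NP_mem:
  assumes x: "x \<in> NP" and f: "lin_map K PP X f" and X: "module K X" and U: "submodule U K X"
    and 1: "\<And>a y. a \<in> NM \<Longrightarrow> y \<in> carrier HH \<Longrightarrow> f (sh (tens K MM HH a y)) \<in> U"
    and 2: "\<And>a y. a \<in> carrier MM \<Longrightarrow> y \<in> NH \<Longrightarrow> f (sh (tens K MM HH a y)) \<in> U"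
    and 3: "\<And>a y. a \<in> univ_calc K M \<Longrightarrow> y \<in> univ_calc K H \<Longrightarrow> f (sh (tens K MM HH a y)) \<in> U"
  shows "f x \<in> U"
proof -
  obtain a b c where *: "x = sh (a \<oplus>\<^bsub>T4\<^esub> b \<oplus>\<^bsub>T4\<^esub> c)" "a \<in> A1" "b \<in> A2" "c \<in> A3"
    using x unfolding NP_unfold by (auto simp: set_add_def')
  note l = lin_map_comp[OF f lin_map_sh]
  have m: "f (sh a) \<in> U" "f (sh b) \<in> U" "f (sh c) \<in> U"
    using lin_map_tsub[OF *(2) l M.tmod tmod X U NM_subset subset_refl 1]
      lin_map_tsub[OF *(3) l M.tmod tmod X U subset_refl NH_sub 2]
      lin_map_tsub[OF *(4) l M.tmod tmod X U M.univ_subset univ_subset 3] by auto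
  have c: "a \<in> carrier T4" "b \<in> carrier T4" "c \<in> carrier T4"
    using * submodule_subset[OF mT4 A1_sub] submodule_subset[OF mT4 A2_sub] submodule_subset[OF mT4 A3_sub] by auto
  interpret T4: module K T4 by (rule mT4)
  have "f x = f (sh a) \<oplus>\<^bsub>X\<^esub> f (sh b) \<oplus>\<^bsub>X\<^esub> f (sh c)"
    using c by (simp add: *(1) lin_map_add[OF l])
  then show ?thesis using m submodule_add[OF X U] by simp
qed

lemma NP_I:
  "a \<in> NM \<Longrightarrow> y \<in> carrier HH \<Longrightarrow> sh (tens K MM HH a y) \<in> NP"
  "a \<in> carrier MM \<Longrightarrow> y \<in> NH \<Longrightarrow> sh (tens K MM HH a y) \<in> NP"
  "a \<in> univ_calc K M \<Longrightarrow> y \<in> univ_calc K H \<Longrightarrow> sh (tens K MM HH a y) \<in> NP"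
proof -
  interpret T4: module K T4 by (rule mT4)
  note z = submodule_zero[OF mT4 A1_sub] submodule_zero[OF mT4 A2_sub] submodule_zero[OF mT4 A3_sub]
  have i: "x \<in> A1 \<Longrightarrow> y \<in> A2 \<Longrightarrow> w \<in> A3 \<Longrightarrow> sh (x \<oplus>\<^bsub>T4\<^esub> y \<oplus>\<^bsub>T4\<^esub> w) \<in> NP" for x y w
    unfolding NP_unfold set_add_def' by blast
  show "sh (tens K MM HH a y) \<in> NP" if "a \<in> NM" "y \<in> carrier HH"
    using i[OF tsub_tens[OF that] z(2,3)] that NM_subset by (simp add: tT4 subset_iff)
  show "sh (tens K MM HH a y) \<in> NP" if "a \<in> carrier MM" "y \<in> NH"
    using i[OF z(1) tsub_tens[OF that] z(3)] that NH_sub by (simp add: tT4 subset_iff)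
  show "sh (tens K MM HH a y) \<in> NP" if "a \<in> univ_calc K M" "y \<in> univ_calc K H"
    using i[OF z(1,2) tsub_tens[OF that]] that M.univ_subset univ_subset by (simp add: tT4 subset_iff)
qed

section \<open>\<open>N\<^sub>P\<close> as a calculus compatible with coaction, base and
  \<open>ver\<close>\<close>

lemma NP_univ: "NP \<subseteq> univ_calc K P"
proof
  fix x assume "x \<in> NP"
  then show "x \<in> univ_calc K P"
    by (rule NP_mem[OF _ lin_map_ident P.tmod P.univ_submodule])
      (use NM_univ NM_subset NH_univ[OF Q] NH_sub M.univ_subset univ_subset in \<open>auto intro!: sh_univ\<close>)
qed

text \<open>Pure tensors act factor by factor, and \<open>N\<^sub>M\<close>,
  \<open>N\<^sub>H\<close>, the two universal calculi and the full tensor squares are all stable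
  under both actions.\<close>

lemma NP_diff_calculus: "diff_calculus K P NP"
  unfolding diff_calculus_def
proof (intro conjI ballI)
  show "NP \<subseteq> univ_calc K P" by (rule NP_univ)
  show "submodule NP K PP" by (rule NP_submodule)
  fix p x assume p: "p \<in> carrier P" and x: "x \<in> NP"
  have xP: "x \<in> carrier PP" using x NP_subset by blast
  note s = subsetD[OF NM_subset] subsetD[OF NH_sub] subsetD[OF M.univ_subset] subsetD[OF univ_subset]
  show "lact K P p x \<in> NP"
  proof (rule tensor_mem[OF p lin_map_lact_param[OF xP] M.mod mod P.tmod NP_submodule])
    fix m h assume m: "m \<in> carrier M" and h: "h \<in> carrier H"
    show "lact K P (tens K M H m h) x \<in> NP"
    proof (rule NP_mem[OF x lin_map_lact[OF P.alg tP[OF m h]] P.tmod NP_submodule])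
      fix a y assume a: "a \<in> NM" and y: "y \<in> carrier HH"
      show "lact K P (tens K M H m h) (sh (tens K MM HH a y)) \<in> NP"
        unfolding lact_sh[OF m h s(1)[OF a] y]
        by (rule NP_I(1)[OF NM_lact[OF m a] lin_map_closed[OF lin_map_lact[OF alg h] y]])
    next
      fix a y assume a: "a \<in> carrier MM" and y: "y \<in> NH"
      show "lact K P (tens K M H m h) (sh (tens K MM HH a y)) \<in> NP"
        unfolding lact_sh[OF m h a s(2)[OF y]]
        by (rule NP_I(2)[OF lin_map_closed[OF lin_map_lact[OF M.alg m] a] NH_lact[OF Q h y]])
    next
      fix a y assume a: "a \<in> univ_calc K M" and y: "y \<in> univ_calc K H"
      show "lact K P (tens K M H m h) (sh (tens K MM HH a y)) \<in> NP"
        unfolding lact_sh[OF m h s(3)[OF a] s(4)[OF y]]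
        by (rule NP_I(3)[OF univ_lact[OF M.alg m a] univ_lact[OF alg h y]])
    qed
  qed
  show "ract K P x p \<in> NP"
  proof (rule tensor_mem[OF p lin_map_ract_param[OF xP] M.mod mod P.tmod NP_submodule])
    fix m h assume m: "m \<in> carrier M" and h: "h \<in> carrier H"
    show "ract K P x (tens K M H m h) \<in> NP"
    proof (rule NP_mem[OF x lin_map_ract[OF P.alg tP[OF m h]] P.tmod NP_submodule])
      fix a y assume a: "a \<in> NM" and y: "y \<in> carrier HH"
      show "ract K P (sh (tens K MM HH a y)) (tens K M H m h) \<in> NP"
        unfolding ract_sh[OF m h s(1)[OF a] y]
        by (rule NP_I(1)[OF NM_ract[OF m a] lin_map_closed[OF lin_map_ract[OF alg h] y]])
    next
      fix a y assume a: "a \<in> carrier MM" and y: "y \<in> NH"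
      show "ract K P (sh (tens K MM HH a y)) (tens K M H m h) \<in> NP"
        unfolding ract_sh[OF m h a s(2)[OF y]]
        by (rule NP_I(2)[OF lin_map_closed[OF lin_map_ract[OF M.alg m] a] NH_ract[OF Q h y]])
    next
      fix a y assume a: "a \<in> univ_calc K M" and y: "y \<in> univ_calc K H"
      show "ract K P (sh (tens K MM HH a y)) (tens K M H m h) \<in> NP"
        unfolding ract_sh[OF m h s(3)[OF a] s(4)[OF y]]
        by (rule NP_I(3)[OF univ_ract[OF M.alg m a] univ_ract[OF alg h y]])
    qed
  qed
qed

text \<open>By \<open>coact_sh\<close> only the second coordinate is affected. It ranges over
  \<open>H \<otimes> H\<close>, over \<open>N\<^sub>H\<close> or over
  \<open>\<Omega>\<^sup>1H\<close>, and each of these is stable under \<open>rho\<close>.\<close>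

lemma NP_coact:
  assumes x: "x \<in> NP"
  shows "RP x \<in> tsub K PP H NP (carrier H)"
proof (rule NP_mem[OF x lin_map_RP mPPH tsub_submodule[OF P.tmod mod NP_subset subset_refl]])
  note s = subsetD[OF NM_subset] subsetD[OF NH_sub] subsetD[OF M.univ_subset] subsetD[OF univ_subset]
  fix a y assume a: "a \<in> NM" and y: "y \<in> carrier HH"
  show "RP (sh (tens K MM HH a y)) \<in> tsub K PP H NP (carrier H)"
    unfolding coact_sh[OF s(1)[OF a] y]
    by (rule tmap_in_tsub[OF lin_map_closed[OF lin_map_rho y] lin_map_sh_left[OF s(1)[OF a]] lin_map_ident tmod mod P.tmod mod NP_subset subset_refl NP_I(1)[OF a]])
next
  note s = subsetD[OF NM_subset] subsetD[OF NH_sub] subsetD[OF M.univ_subset] subsetD[OF univ_subset]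
  fix a y assume a: "a \<in> carrier MM" and y: "y \<in> NH"
  show "RP (sh (tens K MM HH a y)) \<in> tsub K PP H NP (carrier H)"
    unfolding coact_sh[OF a s(2)[OF y]]
    by (rule tmap_tsub[OF rho_NH[OF Q y] NH_sub subset_refl lin_map_sh_left[OF a] lin_map_ident tmod mod P.tmod mod NP_subset subset_refl NP_I(2)[OF a]])
next
  note s = subsetD[OF NM_subset] subsetD[OF NH_sub] subsetD[OF M.univ_subset] subsetD[OF univ_subset]
  fix a y assume a: "a \<in> univ_calc K M" and y: "y \<in> univ_calc K H"
  show "RP (sh (tens K MM HH a y)) \<in> tsub K PP H NP (carrier H)"
    unfolding coact_sh[OF s(3)[OF a] s(4)[OF y]]
    by (rule tmap_tsub[OF tensor_coact_univ[OF alg comult_hom y] univ_subset subset_refl lin_map_sh_left[OF s(3)[OF a]] lin_map_ident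
          tmod mod P.tmod mod NP_subset subset_refl NP_I(3)[OF a]])
qed

text \<open>The functional \<open>\<epsilon> \<mu>\<close> on \<open>H \<otimes> H\<close> has the
  value 1 at \<open>1 \<otimes> 1\<close> and vanishes on \<open>\<Omega>\<^sup>1H\<close>, hence on
  \<open>N\<^sub>H\<close>. Contracting the second coordinate with it maps \<open>N\<^sub>P\<close>
  into \<open>N\<^sub>M\<close> and recovers a form on \<open>M\<close> from its image in
  \<open>P \<otimes> P\<close>.\<close>

lemma NP_base: "base_forms K P iota NM = NP \<inter> base_forms K P iota (univ_calc K M)"
proof
  let ?o = "tens K H H \<one>\<^bsub>H\<^esub> \<one>\<^bsub>H\<^esub>"
  note o = tHH[OF oneH oneH]
  show "base_forms K P iota NM \<subseteq> NP \<inter> base_forms K P iota (univ_calc K M)"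
  proof
    fix w assume w: "w \<in> base_forms K P iota NM"
    then obtain a where "a \<in> NM" "w = sh (tens K MM HH a ?o)" using base_forms_mem[OF w NM_subset] by blast
    then show "w \<in> NP \<inter> base_forms K P iota (univ_calc K M)"
      using NP_I(1)[OF _ o] w NM_univ by (auto simp: base_forms_def)
  qed
  show "NP \<inter> base_forms K P iota (univ_calc K M) \<subseteq> base_forms K P iota NM"
  proof
    fix w assume "w \<in> NP \<inter> base_forms K P iota (univ_calc K M)"
    then have wN: "w \<in> NP" and w: "w \<in> base_forms K P iota (univ_calc K M)" by auto
    obtain a where a: "a \<in> univ_calc K M" "w = sh (tens K MM HH a ?o)"
      using base_forms_mem[OF w M.univ_subset] by blast
    have a': "a \<in> carrier MM" using a M.univ_subset by blast
    let ?f = "\<lambda>x. tlift MM (\<lambda>x y. counit H (mu K H y) \<odot>\<^bsub>MM\<^esub> x) (ush x)"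
    have b: "bilin K MM HH MM (\<lambda>x y. counit H (mu K H y) \<odot>\<^bsub>MM\<^esub> x)"
      by (assumption | rule lin)+
    have lf: "lin_map K PP MM ?f" by (rule lin_map_comp[OF lin_map_tlift'[OF M.tmod tmod M.tmod b] lin_map_ush])
    have ft: "?f (sh (tens K MM HH x y)) = counit H (mu K H y) \<odot>\<^bsub>MM\<^esub> x" if "x \<in> carrier MM" "y \<in> carrier HH" for x y
      by (simp add: ush_sh[OF tT4[OF that]] tlift_tens[OF M.tmod tmod M.tmod b that])
    interpret MM: module K MM by (rule M.tmod)
    have c0: "counit H \<zero>\<^bsub>H\<^esub> \<odot>\<^bsub>MM\<^esub> x = \<zero>\<^bsub>MM\<^esub>" if "x \<in> carrier MM" for x
      by (rule lin_map_zero[OF mod M.tmod lin_map_counit_smult[OF M.tmod that lin_map_ident]])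
    have "?f w \<in> NM"
    proof (rule NP_mem[OF wN lf M.tmod NM_submodule])
      fix x y assume x: "x \<in> NM" and y: "y \<in> carrier HH"
      then have x': "x \<in> carrier MM" using NM_subset by blast
      show "?f (sh (tens K MM HH x y)) \<in> NM"
        unfolding ft[OF x' y] by (rule submodule_smult[OF NM_submodule counit_closed[OF mu_closed[OF y]] x])
    next
      fix x y assume x: "x \<in> carrier MM" and y: "y \<in> NH"
      then have y': "y \<in> carrier HH" "mu K H y = \<zero>\<^bsub>H\<^esub>" using NH_univ[OF Q] by (auto simp: univ_calc_mu)
      show "?f (sh (tens K MM HH x y)) \<in> NM"
        unfolding ft[OF x y'(1)] y'(2) c0[OF x] by (rule submodule_zero[OF M.tmod NM_submodule])
    next
      fix x y assume x: "x \<in> univ_calc K M" and y: "y \<in> univ_calc K H"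
      then have y': "y \<in> carrier HH" "mu K H y = \<zero>\<^bsub>H\<^esub>" "x \<in> carrier MM" by (auto simp: univ_calc_mu)
      show "?f (sh (tens K MM HH x y)) \<in> NM"
        unfolding ft[OF y'(3,1)] y'(2) c0[OF y'(3)] by (rule submodule_zero[OF M.tmod NM_submodule])
    qed
    moreover have "?f w = a" unfolding a(2) ft[OF a' o] using a' by (simp add: mu_tens counit_one)
    ultimately show "w \<in> base_forms K P iota NM" unfolding base_forms_def a(2) using iota2[OF a'] by force
  qed
qed

text \<open>The first and third summands have a universal form on \<open>M\<close> as first
  coordinate, which \<open>mu K M\<close> kills. Only the second summand contributes to the
  image.\<close>

lemma NP_ver: "ver K H P DR ` NP = tsub K P H (carrier P) Q"
proof
  note QH = Q_subset[OF Q]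
  have sQ: "submodule (tsub K P H (carrier P) Q) K PH" by (rule tsub_submodule[OF P.mod mod subset_refl QH])
  show "ver K H P DR ` NP \<subseteq> tsub K P H (carrier P) Q"
  proof (rule image_subsetI, rule NP_mem[OF _ lin_map_ver mPH sQ])
    have z: "ver K H P DR (sh (tens K MM HH a y)) \<in> tsub K P H (carrier P) Q" if a: "a \<in> univ_calc K M" and y: "y \<in> carrier HH" for a y
    proof -
      have a': "a \<in> carrier MM" "mu K M a = \<zero>\<^bsub>M\<^esub>" using a by (auto simp: univ_calc_mu)
      show ?thesis
        unfolding ver_sh_tens[OF a'(1) y] a'(2) tens_zero_left[OF M.mod tmod theta_closed[OF y]]
          lin_map_zero[OF mM_HH mPH lin_map_asc]
        by (rule submodule_zero[OF mPH sQ])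
    qed
    show "ver K H P DR (sh (tens K MM HH a y)) \<in> tsub K P H (carrier P) Q" if "a \<in> NM" "y \<in> carrier HH" for a y
      using z that NM_univ by blast
    show "ver K H P DR (sh (tens K MM HH a y)) \<in> tsub K P H (carrier P) Q" if "a \<in> univ_calc K M" "y \<in> univ_calc K H" for a y
      using z that univ_subset by blast
    fix a y assume a: "a \<in> carrier MM" and y: "y \<in> NH"
    have y': "y \<in> carrier HH" using y NH_sub by blast
    have ma: "mu K M a \<in> carrier M" by (rule lin_map_closed[OF M.lin_map_mu a])
    have ty: "theta y \<in> tsub K H H (carrier H) Q" using y by (simp add: NH_eq[OF Q])
    show "ver K H P DR (sh (tens K MM HH a y)) \<in> tsub K P H (carrier P) Q"
      unfolding ver_sh_tens[OF a y']
    proof (rule lin_map_tsub[OF ty lin_map_comp[OF lin_map_asc lin_map_tens_right[OF M.mod tmod ma lin_map_ident]] mod mod mPH sQ subset_refl QH])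
      fix h q assume h: "h \<in> carrier H" and q: "q \<in> Q"
      then have "q \<in> carrier H" using QH by blast
      then show "asc (tens K M HH (mu K M a) (tens K H H h q)) \<in> tsub K P H (carrier P) Q"
        using tsub_tens[OF tP[OF ma h] q] by (simp add: assoc_iso_tens[OF M.mod mod mod ma h])
    qed
  qed
  have sN: "submodule (ver K H P DR ` NP) K PH" by (rule submodule_image[OF P.tmod mPH lin_map_ver NP_submodule])
  show "tsub K P H (carrier P) Q \<subseteq> ver K H P DR ` NP"
  proof (rule tsub_least[OF sN])
    fix p q assume p: "p \<in> carrier P" and q: "q \<in> Q"
    have qH: "q \<in> carrier H" using q QH by blast
    show "tens K P H p q \<in> ver K H P DR ` NP"
    proof (rule tensor_mem[OF p lin_map_tens_left[OF P.mod mod qH lin_map_ident] M.mod mod mPH sN])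
      fix m h assume m: "m \<in> carrier M" and h: "h \<in> carrier H"
      \<comment> \<open>\<open>theta_NH\<close> supplies the second coordinate of a preimage; the
        first is \<open>m \<otimes> 1\<close>, whose product in \<open>M\<close> is
        \<open>m\<close>.\<close>
      obtain y where y: "y \<in> NH" "theta y = tens K H H h q"
        using theta_NH[OF Q] tsub_tens[OF h q, of K H H] by (metis imageE)
      have y': "y \<in> carrier HH" using y NH_sub by blast
      have "tens K P H (tens K M H m h) q = ver K H P DR (sh (tens K MM HH (tens K M M m \<one>\<^bsub>M\<^esub>) y))"
        unfolding ver_sh_tens[OF tMM[OF m oneM] y'] y(2)
        using m by (simp add: M.mu_tens oneM assoc_iso_tens[OF M.mod mod mod m h qH])
      then show "tens K P H (tens K M H m h) q \<in> ver K H P DR ` NP"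
        using NP_I(2)[OF tMM[OF m oneM] y(1)] by blast
    qed
  qed
qed

end

end

section \<open>Flatness\<close>

context tensor_pair
begin

text \<open>\<open>tlift\<close> takes its target as a ring record, whereas
  \<open>tensor_group\<close> is a monoid record written multiplicatively. The group is repackaged
  so that it can be a target.\<close>

definition G_ring where
  "G_ring = \<lparr>carrier = carrier G, mult = (\<lambda>_ _. undefined), one = undefined,
     ring.zero = \<one>\<^bsub>G\<^esub>, ring.add = (\<lambda>x y. x \<otimes>\<^bsub>G\<^esub> y)\<rparr>"

lemma G_ring_sel:
  "carrier G_ring = carrier G" "\<zero>\<^bsub>G_ring\<^esub> = \<one>\<^bsub>G\<^esub>" "x \<oplus>\<^bsub>G_ring\<^esub> y = x \<otimes>\<^bsub>G\<^esub> y"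
  by (simp_all add: G_ring_def)

lemma G_ring_abelian_group: "abelian_group G_ring"
proof (rule abelian_groupI)
  fix x assume "x \<in> carrier G_ring"
  then show "\<exists>y\<in>carrier G_ring. y \<oplus>\<^bsub>G_ring\<^esub> x = \<zero>\<^bsub>G_ring\<^esub>"
    using G.l_inv_ex by (auto simp: G_ring_sel)
qed (simp_all add: G_ring_sel G.m_ac)

lemma tlift_mult: "abelian_group U \<Longrightarrow> balanced U \<beta> \<Longrightarrow> x \<in> carrier G \<Longrightarrow> y \<in> carrier G \<Longrightarrow>
    tlift U \<beta> (x \<otimes>\<^bsub>G\<^esub> y) = tlift U \<beta> x \<oplus>\<^bsub>U\<^esub> tlift U \<beta> y"
  using hom_mult[OF tlift_hom] by fastforce

lemma tlift_in: "abelian_group U \<Longrightarrow> balanced U \<beta> \<Longrightarrow> x \<in> carrier G \<Longrightarrow> tlift U \<beta> x \<in> carrier U"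
  using hom_in_carrier[OF tlift_hom] by fastforce

lemma tlift_one: "abelian_group U \<Longrightarrow> balanced U \<beta> \<Longrightarrow> tlift U \<beta> \<one>\<^bsub>G\<^esub> = \<zero>\<^bsub>U\<^esub>"
proof -
  assume U: "abelian_group U" and b: "balanced U \<beta>"
  interpret U: abelian_group U by fact
  have "tlift U \<beta> \<one>\<^bsub>G\<^esub> \<oplus>\<^bsub>U\<^esub> tlift U \<beta> \<one>\<^bsub>G\<^esub> = tlift U \<beta> \<one>\<^bsub>G\<^esub>"
    using tlift_mult[OF U b G.one_closed G.one_closed] by simp
  then show ?thesis
    using U.add.l_cancel_one[OF tlift_in[OF U b G.one_closed] tlift_in[OF U b G.one_closed]] by simp
qed

end

text \<open>Flatness is stated through images of cosets under \<open>frag_extend\<close>. That map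
  and the lift are both additive on the free group and agree on generators, so flatness can be
  treated by the universal property. Allowing maps on both factors covers the left and the right
  version.\<close>

lemma induced_map_tlift:
  assumes X: "tensor_pair R A ra B lb" and X': "tensor_pair R' A' ra' B' lb'"
    and f: "f \<in> carrier A \<rightarrow> carrier A'" and g: "g \<in> carrier B \<rightarrow> carrier B'"
    and b: "tensor_pair.balanced R A ra B lb (tensor_pair.G_ring R' A' ra' B' lb') (\<lambda>a b. tensor_pair.pure R' A' ra' B' lb' (f a) (g b))"
    and x: "x \<in> carrier (tensor_group R A ra B lb)"
  shows "tensor_rel R' A' ra' B' lb' <#>\<^bsub>free_Abelian_group (carrier A' \<times> carrier B')\<^esub>
      (frag_extend (\<lambda>(a, b). frag_of (f a, g b)) ` x) =
    tlift (tensor_pair.G_ring R' A' ra' B' lb') (\<lambda>a b. tensor_pair.pure R' A' ra' B' lb' (f a) (g b)) x"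
proof -
  interpret X: tensor_pair R A ra B lb by fact
  interpret X': tensor_pair R' A' ra' B' lb' by fact
  let ?U = "X'.G_ring" let ?\<beta> = "\<lambda>a b. X'.pure (f a) (g b)"
  let ?\<phi> = "frag_extend (\<lambda>(a, b). frag_of (f a, g b))"
  have \<phi>F: "?\<phi> y \<in> carrier X'.F" if "y \<in> carrier X.F" for y
  proof -
    have "Poly_Mapping.keys (?\<phi> y) \<subseteq> (\<Union>p\<in>Poly_Mapping.keys y. Poly_Mapping.keys ((\<lambda>(a, b). frag_of (f a, g b)) p))"
      by (rule keys_frag_extend)
    also have "\<dots> \<subseteq> carrier A' \<times> carrier B'" using that f g by (auto simp: subset_iff Pi_iff)
    finally show ?thesis by simp
  qed
  have key: "X'.N #>\<^bsub>X'.F\<^esub> ?\<phi> y = tlift ?U ?\<beta> (X.N #>\<^bsub>X.F\<^esub> y)" if y: "y \<in> carrier X.F" for y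
  proof -
    have "Poly_Mapping.keys y \<subseteq> carrier A \<times> carrier B" using y by simp
    then show ?thesis
    proof (induction y rule: free_Abelian_group_induct[consumes 1, case_names zero diff one])
      case zero
      have "X.N #>\<^bsub>X.F\<^esub> 0 = \<one>\<^bsub>X.G\<^esub>" "X'.N #>\<^bsub>X'.F\<^esub> 0 = \<one>\<^bsub>X'.G\<^esub>"
        using X.F.coset_mult_one[of X.N] subgroup.subset[OF X.rel_subgroup]
          X'.F.coset_mult_one[of X'.N] subgroup.subset[OF X'.rel_subgroup] by (simp_all add: X.G_one X'.G_one)
      then show ?case using X.tlift_one[OF X'.G_ring_abelian_group b] by (simp add: X'.G_ring_sel)
    next
      case (diff u v)
      have uv: "u \<in> carrier X.F" "v \<in> carrier X.F" "u - v \<in> carrier X.F"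
        using diff keys_diff[of u v] by auto
      note \<phi> = uv[THEN \<phi>F]
      have c: "X.N #>\<^bsub>X.F\<^esub> (u - v) \<in> carrier X.G" "X.N #>\<^bsub>X.F\<^esub> v \<in> carrier X.G"
        using uv by (auto simp only: X.G_carrier intro: imageI)
      have "(X.N #>\<^bsub>X.F\<^esub> (u - v)) \<otimes>\<^bsub>X.G\<^esub> (X.N #>\<^bsub>X.F\<^esub> v) = X.N #>\<^bsub>X.F\<^esub> u"
        using X.G_mult[OF uv(3,2)] by simp
      then have 1: "tlift ?U ?\<beta> (X.N #>\<^bsub>X.F\<^esub> u) = tlift ?U ?\<beta> (X.N #>\<^bsub>X.F\<^esub> (u - v)) \<otimes>\<^bsub>X'.G\<^esub> tlift ?U ?\<beta> (X.N #>\<^bsub>X.F\<^esub> v)"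
        using X.tlift_mult[OF X'.G_ring_abelian_group b c] by (simp add: X'.G_ring_sel)
      have "(X'.N #>\<^bsub>X'.F\<^esub> ?\<phi> (u - v)) \<otimes>\<^bsub>X'.G\<^esub> (X'.N #>\<^bsub>X'.F\<^esub> ?\<phi> v) = X'.N #>\<^bsub>X'.F\<^esub> ?\<phi> u"
        using X'.G_mult[OF \<phi>(3,2)] by (simp add: frag_extend_diff)
      then have 2: "(X'.N #>\<^bsub>X'.F\<^esub> ?\<phi> (u - v)) \<otimes>\<^bsub>X'.G\<^esub> (X'.N #>\<^bsub>X'.F\<^esub> ?\<phi> v) = tlift ?U ?\<beta> (X.N #>\<^bsub>X.F\<^esub> (u - v)) \<otimes>\<^bsub>X'.G\<^esub> (X'.N #>\<^bsub>X'.F\<^esub> ?\<phi> v)"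
        using 1 diff.IH by simp
      have "X'.N #>\<^bsub>X'.F\<^esub> ?\<phi> (u - v) \<in> carrier X'.G" "X'.N #>\<^bsub>X'.F\<^esub> ?\<phi> v \<in> carrier X'.G"
        using \<phi> by (auto simp only: X'.G_carrier intro: imageI)
      moreover have "tlift ?U ?\<beta> (X.N #>\<^bsub>X.F\<^esub> (u - v)) \<in> carrier X'.G"
        using X.tlift_in[OF X'.G_ring_abelian_group b c(1)] by (simp add: X'.G_ring_sel)
      ultimately show ?case using 2 X'.G.right_cancel by blast
    next
      case (one p)
      then obtain a c where p: "p = (a, c)" "a \<in> carrier A" "c \<in> carrier B" by auto
      show ?case
        using X.tlift_pure[OF X'.G_ring_abelian_group b p(2,3)] by (simp add: p(1) X.pure_def X'.pure_def)
    qed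
  qed
  obtain y where y: "y \<in> carrier X.F" "x = X.N #>\<^bsub>X.F\<^esub> y" using x by (auto simp only: X.G_carrier)
  have sub: "z \<in> carrier X.F \<and> X.N #>\<^bsub>X.F\<^esub> z = x" if "z \<in> x" for z
    using that unfolding y(2) using X.F.repr_independence[OF _ y(1) X.rel_subgroup]
      X.F.r_coset_subset_G[OF subgroup.subset[OF X.rel_subgroup] y(1)] by blast
  have ex: "y \<in> x" unfolding y(2) by (rule X.F.rcos_self[OF y(1) X.rel_subgroup])
  \<comment> \<open>The union runs over all representatives of \<open>x\<close>; by
    \<open>key\<close> they all yield the same coset.\<close>
  have "X'.N <#>\<^bsub>X'.F\<^esub> (?\<phi> ` x) = (\<Union>z\<in>x. X'.N #>\<^bsub>X'.F\<^esub> ?\<phi> z)"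
    by (auto simp: set_mult_def r_coset_def)
  also have "\<dots> = (\<Union>z\<in>x. tlift ?U ?\<beta> x)"
    by (rule SUP_cong[OF refl]) (use key sub in metis)
  also have "\<dots> = tlift ?U ?\<beta> x" using ex by auto
  finally show ?thesis .
qed

text \<open>
  The base change of \<open>M \<otimes> H\<close> along an \<open>M\<close>-module \<open>A\<close> is \<open>A \<otimes> H\<close> over the field, where every
  injective linear map has a retraction, although it need not have one over \<open>M\<close>.
\<close>

definition restrict_scalars :: "('k, _) ring_scheme \<Rightarrow> ('k, 'm, _) module_scheme \<Rightarrow> 'x ring \<Rightarrow> ('m \<Rightarrow> 'x \<Rightarrow> 'x) \<Rightarrow> ('k, 'x) module" where
  "restrict_scalars K M A act = \<lparr>carrier = carrier A, mult = (\<lambda>_ _. undefined), one = undefined,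
     ring.zero = \<zero>\<^bsub>A\<^esub>, ring.add = (\<lambda>x y. x \<oplus>\<^bsub>A\<^esub> y), smult = (\<lambda>c a. act (c \<odot>\<^bsub>M\<^esub> \<one>\<^bsub>M\<^esub>) a)\<rparr>"

lemma restrict_scalars_sel:
  "carrier (restrict_scalars K M A act) = carrier A" "\<zero>\<^bsub>restrict_scalars K M A act\<^esub> = \<zero>\<^bsub>A\<^esub>"
  "x \<oplus>\<^bsub>restrict_scalars K M A act\<^esub> y = x \<oplus>\<^bsub>A\<^esub> y" "c \<odot>\<^bsub>restrict_scalars K M A act\<^esub> x = act (c \<odot>\<^bsub>M\<^esub> \<one>\<^bsub>M\<^esub>) x"
  by (simp_all add: restrict_scalars_def)

text \<open>Multiplicativity \<open>mu\<close> concerns scalars only. There left and right actions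
  obey the same law because \<open>K\<close> is commutative, and one lemma serves both kinds of
  module.\<close>

lemma restrict_scalars_module:
  assumes M: "k_algebra K M" and A: "abelian_group A"
    and cl: "\<And>r a. r \<in> carrier M \<Longrightarrow> a \<in> carrier A \<Longrightarrow> act r a \<in> carrier A"
    and ad: "\<And>r a b. r \<in> carrier M \<Longrightarrow> a \<in> carrier A \<Longrightarrow> b \<in> carrier A \<Longrightarrow> act r (a \<oplus>\<^bsub>A\<^esub> b) = act r a \<oplus>\<^bsub>A\<^esub> act r b"
    and da: "\<And>r s a. r \<in> carrier M \<Longrightarrow> s \<in> carrier M \<Longrightarrow> a \<in> carrier A \<Longrightarrow> act (r \<oplus>\<^bsub>M\<^esub> s) a = act r a \<oplus>\<^bsub>A\<^esub> act s a"
    and mu: "\<And>c d a. c \<in> carrier K \<Longrightarrow> d \<in> carrier K \<Longrightarrow> a \<in> carrier A \<Longrightarrow>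
       act ((c \<otimes>\<^bsub>K\<^esub> d) \<odot>\<^bsub>M\<^esub> \<one>\<^bsub>M\<^esub>) a = act (c \<odot>\<^bsub>M\<^esub> \<one>\<^bsub>M\<^esub>) (act (d \<odot>\<^bsub>M\<^esub> \<one>\<^bsub>M\<^esub>) a)"
    and one: "\<And>a. a \<in> carrier A \<Longrightarrow> act \<one>\<^bsub>M\<^esub> a = a"
  shows "module K (restrict_scalars K M A act)"
proof (rule moduleI)
  interpret M: k_algebra K M by fact
  interpret A: abelian_group A by fact
  show "cring K" by (rule module.axioms(1)[OF M.mod])
  show "abelian_group (restrict_scalars K M A act)"
    by (rule abelian_groupI) (auto simp: restrict_scalars_sel A.a_ac intro: A.l_neg A.a_inv_closed bexI[of _ "\<ominus>\<^bsub>A\<^esub> x" for x])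
qed (use k_algebra_module[OF M] k_algebra_ring[OF M] cl ad da mu one in
  \<open>simp_all add: restrict_scalars_sel module.smult_closed module.smult_l_distr module.smult_one ring.ring_simprules\<close>)

lemma injective_linear_retraction:
  assumes K: "field K" and V: "module K V" and W: "module K W" and f: "lin_map K V W f" and inj: "inj_on f (carrier V)"
  obtains g where "lin_map K W V g" "\<And>v. v \<in> carrier V \<Longrightarrow> g (f v) = v"
proof -
  interpret V: module K V by fact
  have s: "submodule (f ` carrier V) K W" by (rule submodule_image[OF V W f submodule_carrier[OF V]])
  obtain r where r: "lin_map K W (W\<lparr>carrier := f ` carrier V\<rparr>) r" "\<And>u. u \<in> f ` carrier V \<Longrightarrow> r u = u"
    by (rule exists_retraction[OF K W s]) blast
  let ?h = "inv_into (carrier V) f"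
  have h: "?h (f v) = v" if "v \<in> carrier V" for v using inj that by simp
  have lh: "lin_map K (W\<lparr>carrier := f ` carrier V\<rparr>) V ?h"
    by (rule lin_mapI) (auto simp: h lin_map_add[OF f, symmetric] lin_map_smult[OF f, symmetric] simp del: inv_into_f_f)
  show ?thesis
    by (rule that[OF lin_map_comp[OF lh r(1)]]) (simp add: r(2) h)
qed

context trivial_bundle
begin

section \<open>The bundle algebra as a left and right module over the base\<close>

lemma iota_mult: "r \<in> carrier M \<Longrightarrow> s \<in> carrier M \<Longrightarrow> iota (r \<otimes>\<^bsub>M\<^esub> s) = iota r \<otimes>\<^bsub>P\<^esub> iota s"
  by (simp add: tensor_mult_tens[OF M.alg alg] oneH)

lemma left_module_P: "left_module M P (\<lambda>m p. iota m \<otimes>\<^bsub>P\<^esub> p)"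
  unfolding left_module_def
  by (intro conjI ballI k_algebra_ring[OF M.alg] module_abelian_group[OF P.mod])
    (simp_all add: P.l_distr P.r_distr P.m_assoc tP oneH lin_map_add[OF lin_map_iota] iota_mult flip: one_tensor)

lemma right_module_P: "right_module M P (\<lambda>p m. p \<otimes>\<^bsub>P\<^esub> iota m)"
  unfolding right_module_def
  by (intro conjI ballI k_algebra_ring[OF M.alg] module_abelian_group[OF P.mod])
    (simp_all add: P.l_distr P.r_distr P.m_assoc tP oneH lin_map_add[OF lin_map_iota] iota_mult flip: one_tensor)

lemma iota_mult_left: "m \<in> carrier M \<Longrightarrow> n \<in> carrier M \<Longrightarrow> h \<in> carrier H \<Longrightarrow>
    iota m \<otimes>\<^bsub>P\<^esub> tens K M H n h = tens K M H (m \<otimes>\<^bsub>M\<^esub> n) h"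
  by (simp add: tensor_mult_tens[OF M.alg alg] oneH)

lemma iota_mult_right: "m \<in> carrier M \<Longrightarrow> n \<in> carrier M \<Longrightarrow> h \<in> carrier H \<Longrightarrow>
    tens K M H n h \<otimes>\<^bsub>P\<^esub> iota m = tens K M H (n \<otimes>\<^bsub>M\<^esub> m) h"
  by (simp add: tensor_mult_tens[OF M.alg alg] oneH)

lemma smult_one_closed: "c \<in> carrier K \<Longrightarrow> c \<odot>\<^bsub>M\<^esub> \<one>\<^bsub>M\<^esub> \<in> carrier M"
  using oneM by simp

lemma smult_one_mult: "c \<in> carrier K \<Longrightarrow> m \<in> carrier M \<Longrightarrow> (c \<odot>\<^bsub>M\<^esub> \<one>\<^bsub>M\<^esub>) \<otimes>\<^bsub>M\<^esub> m = c \<odot>\<^bsub>M\<^esub> m"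
    "c \<in> carrier K \<Longrightarrow> m \<in> carrier M \<Longrightarrow> m \<otimes>\<^bsub>M\<^esub> (c \<odot>\<^bsub>M\<^esub> \<one>\<^bsub>M\<^esub>) = c \<odot>\<^bsub>M\<^esub> m"
  using oneM by (simp_all add: M.smult_mult_left M.smult_mult_right)

lemma scalar_mult: "c \<in> carrier K \<Longrightarrow> d \<in> carrier K \<Longrightarrow> (c \<otimes>\<^bsub>K\<^esub> d) \<odot>\<^bsub>M\<^esub> \<one>\<^bsub>M\<^esub> = (c \<odot>\<^bsub>M\<^esub> \<one>\<^bsub>M\<^esub>) \<otimes>\<^bsub>M\<^esub> (d \<odot>\<^bsub>M\<^esub> \<one>\<^bsub>M\<^esub>)"
  by (simp only: smult_one_mult(1) smult_one_closed module.smult_assoc1[OF M.mod] oneM)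

text \<open>In a right module a product acts in the opposite order. This form supplies the order
  demanded by \<open>restrict_scalars_module\<close>.\<close>

lemma scalar_commute: "c \<in> carrier K \<Longrightarrow> d \<in> carrier K \<Longrightarrow> (c \<otimes>\<^bsub>K\<^esub> d) \<odot>\<^bsub>M\<^esub> \<one>\<^bsub>M\<^esub> = (d \<odot>\<^bsub>M\<^esub> \<one>\<^bsub>M\<^esub>) \<otimes>\<^bsub>M\<^esub> (c \<odot>\<^bsub>M\<^esub> \<one>\<^bsub>M\<^esub>)"
proof -
  assume c: "c \<in> carrier K" and d: "d \<in> carrier K"
  show ?thesis
    unfolding comm_monoid.m_comm[OF cring.axioms(2)[OF module.axioms(1)[OF M.mod]] c d] by (rule scalar_mult[OF d c])
qed

lemma right_restrict_module:
  fixes A :: "'x ring"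
  assumes A: "right_module M A ra"
  shows "module K (restrict_scalars K M A (\<lambda>r a. ra a r))"
    and "\<And>a. a \<in> carrier A \<Longrightarrow> lin_map K M (restrict_scalars K M A (\<lambda>r a. ra a r)) (ra a)"
    and "\<And>m. m \<in> carrier M \<Longrightarrow> a \<in> carrier A \<Longrightarrow> a' \<in> carrier A \<Longrightarrow> ra (a \<oplus>\<^bsub>A\<^esub> a') m = ra a m \<oplus>\<^bsub>A\<^esub> ra a' m"
proof -
  have *: "abelian_group A" "\<And>a r. a \<in> carrier A \<Longrightarrow> r \<in> carrier M \<Longrightarrow> ra a r \<in> carrier A"
    "\<And>a a' r. a \<in> carrier A \<Longrightarrow> a' \<in> carrier A \<Longrightarrow> r \<in> carrier M \<Longrightarrow> ra (a \<oplus>\<^bsub>A\<^esub> a') r = ra a r \<oplus>\<^bsub>A\<^esub> ra a' r"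
    "\<And>a r s. a \<in> carrier A \<Longrightarrow> r \<in> carrier M \<Longrightarrow> s \<in> carrier M \<Longrightarrow> ra a (r \<oplus>\<^bsub>M\<^esub> s) = ra a r \<oplus>\<^bsub>A\<^esub> ra a s"
    "\<And>a r s. a \<in> carrier A \<Longrightarrow> r \<in> carrier M \<Longrightarrow> s \<in> carrier M \<Longrightarrow> ra a (r \<otimes>\<^bsub>M\<^esub> s) = ra (ra a r) s"
    "\<And>a. a \<in> carrier A \<Longrightarrow> ra a \<one>\<^bsub>M\<^esub> = a"
    using A by (auto simp: right_module_def)
  show "module K (restrict_scalars K M A (\<lambda>r a. ra a r))"
    by (rule restrict_scalars_module[OF M.alg *(1)]) (simp_all add: * scalar_commute smult_one_closed)
  show "lin_map K M (restrict_scalars K M A (\<lambda>r a. ra a r)) (ra a)" if a: "a \<in> carrier A" for a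
  proof (rule lin_mapI)
    fix c x assume c: "c \<in> carrier K" and x: "x \<in> carrier M"
    have "ra a (x \<otimes>\<^bsub>M\<^esub> (c \<odot>\<^bsub>M\<^esub> \<one>\<^bsub>M\<^esub>)) = ra (ra a x) (c \<odot>\<^bsub>M\<^esub> \<one>\<^bsub>M\<^esub>)" by (rule *(5)[OF a x smult_one_closed[OF c]])
    then show "ra a (c \<odot>\<^bsub>M\<^esub> x) = c \<odot>\<^bsub>restrict_scalars K M A (\<lambda>r a. ra a r)\<^esub> ra a x"
      using c x by (simp add: smult_one_mult restrict_scalars_sel)
  qed (simp_all add: restrict_scalars_sel * a)
  show "\<And>m. m \<in> carrier M \<Longrightarrow> a \<in> carrier A \<Longrightarrow> a' \<in> carrier A \<Longrightarrow> ra (a \<oplus>\<^bsub>A\<^esub> a') m = ra a m \<oplus>\<^bsub>A\<^esub> ra a' m"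
    by (rule *(3))
qed

lemma left_restrict_module:
  fixes A :: "'x ring"
  assumes A: "left_module M A la"
  shows "module K (restrict_scalars K M A la)"
    and "\<And>a. a \<in> carrier A \<Longrightarrow> lin_map K M (restrict_scalars K M A la) (\<lambda>m. la m a)"
    and "\<And>m. m \<in> carrier M \<Longrightarrow> a \<in> carrier A \<Longrightarrow> a' \<in> carrier A \<Longrightarrow> la m (a \<oplus>\<^bsub>A\<^esub> a') = la m a \<oplus>\<^bsub>A\<^esub> la m a'"
proof -
  have *: "abelian_group A" "\<And>a r. a \<in> carrier A \<Longrightarrow> r \<in> carrier M \<Longrightarrow> la r a \<in> carrier A"
    "\<And>a a' r. a \<in> carrier A \<Longrightarrow> a' \<in> carrier A \<Longrightarrow> r \<in> carrier M \<Longrightarrow> la r (a \<oplus>\<^bsub>A\<^esub> a') = la r a \<oplus>\<^bsub>A\<^esub> la r a'"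
    "\<And>a r s. a \<in> carrier A \<Longrightarrow> r \<in> carrier M \<Longrightarrow> s \<in> carrier M \<Longrightarrow> la (r \<oplus>\<^bsub>M\<^esub> s) a = la r a \<oplus>\<^bsub>A\<^esub> la s a"
    "\<And>a r s. a \<in> carrier A \<Longrightarrow> r \<in> carrier M \<Longrightarrow> s \<in> carrier M \<Longrightarrow> la (r \<otimes>\<^bsub>M\<^esub> s) a = la r (la s a)"
    "\<And>a. a \<in> carrier A \<Longrightarrow> la \<one>\<^bsub>M\<^esub> a = a"
    using A by (auto simp: left_module_def)
  show "module K (restrict_scalars K M A la)"
    by (rule restrict_scalars_module[OF M.alg *(1)]) (simp_all add: * scalar_mult smult_one_closed)
  show "lin_map K M (restrict_scalars K M A la) (\<lambda>m. la m a)" if a: "a \<in> carrier A" for a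
  proof (rule lin_mapI)
    fix c x assume c: "c \<in> carrier K" and x: "x \<in> carrier M"
    have "la ((c \<odot>\<^bsub>M\<^esub> \<one>\<^bsub>M\<^esub>) \<otimes>\<^bsub>M\<^esub> x) a = la (c \<odot>\<^bsub>M\<^esub> \<one>\<^bsub>M\<^esub>) (la x a)" by (rule *(5)[OF a smult_one_closed[OF c] x])
    then show "la (c \<odot>\<^bsub>M\<^esub> x) a = c \<odot>\<^bsub>restrict_scalars K M A la\<^esub> la x a"
      using c x by (simp add: smult_one_mult restrict_scalars_sel)
  qed (simp_all add: restrict_scalars_sel * a)
  show "\<And>m. m \<in> carrier M \<Longrightarrow> a \<in> carrier A \<Longrightarrow> a' \<in> carrier A \<Longrightarrow> la m (a \<oplus>\<^bsub>A\<^esub> a') = la m a \<oplus>\<^bsub>A\<^esub> la m a'"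
    by (rule *(3))
qed

lemma flat_left_P: "flat_left (t :: ('x \<times> 'w) itself) M P (\<lambda>m p. iota m \<otimes>\<^bsub>P\<^esub> p)"
  unfolding flat_left_def
proof (intro conjI allI impI left_module_P)
  fix A :: "'x ring" and ra and A' :: "'w ring" and ra' f
  assume "right_module M A ra \<and> right_module M A' ra' \<and> f \<in> hom (add_monoid A) (add_monoid A') \<and>
      (\<forall>a\<in>carrier A. \<forall>r\<in>carrier M. f (ra a r) = ra' (f a) r) \<and> inj_on f (carrier A)"
  then have A: "right_module M A ra" and A': "right_module M A' ra'"
    and f: "f \<in> hom (add_monoid A) (add_monoid A')" and fr: "\<And>a r. a \<in> carrier A \<Longrightarrow> r \<in> carrier M \<Longrightarrow> f (ra a r) = ra' (f a) r"
    and inj: "inj_on f (carrier A)" by auto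
  have fcl: "f a \<in> carrier A'" if "a \<in> carrier A" for a using f that by (auto simp: hom_def)
  have fadd: "f (a \<oplus>\<^bsub>A\<^esub> b) = f a \<oplus>\<^bsub>A'\<^esub> f b" if "a \<in> carrier A" "b \<in> carrier A" for a b using f that by (auto simp: hom_def)
  let ?lP = "\<lambda>m p. iota m \<otimes>\<^bsub>P\<^esub> p"
  have iP: "iota r \<otimes>\<^bsub>P\<^esub> p \<in> carrier P" if "r \<in> carrier M" "p \<in> carrier P" for r p
    using that by (intro P.m_closed tP oneH)
  interpret X: tensor_pair M A ra P ?lP
    using A P.abelian_group_axioms iP by (auto simp: tensor_pair_def tensor_pair_axioms_def right_module_def module_abelian_group[OF P.mod])
  interpret X': tensor_pair M A' ra' P ?lP
    using A' P.abelian_group_axioms iP by (auto simp: tensor_pair_def tensor_pair_axioms_def right_module_def module_abelian_group[OF P.mod])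
  let ?K = "restrict_scalars K M A (\<lambda>r a. ra a r)" let ?K' = "restrict_scalars K M A' (\<lambda>r a. ra' a r)"
  note r1 = right_restrict_module[OF A] and r2 = right_restrict_module[OF A']
  have lf: "lin_map K ?K ?K' f"
    by (rule lin_mapI) (simp_all add: restrict_scalars_sel fcl fadd fr smult_one_closed)
  obtain g where g: "lin_map K ?K' ?K g" "\<And>a. a \<in> carrier A \<Longrightarrow> g (f a) = a"
    by (rule injective_linear_retraction[OF field_axioms r1(1) r2(1) lf]) (use inj in \<open>auto simp: restrict_scalars_sel\<close>)
  let ?E = "tensor K ?K H" let ?E' = "tensor K ?K' H"
  have mE: "module K ?E" and mE': "module K ?E'" by (rule module_tensor[OF r1(1) mod], rule module_tensor[OF r2(1) mod])
  have cA': "a \<in> carrier A' \<Longrightarrow> lin_map K P ?E' (tmap K ?K' H (ra' a) (\<lambda>h. h))" for a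
    by (rule lin_map_tmap[OF lin_map_ident r2(2) lin_map_ident M.mod mod r2(1) mod])
  \<comment> \<open>On pure tensors \<open>?\<Phi> a (m \<otimes> h) = a m \<otimes> h\<close>,
    which passes from the tensor product over \<open>M\<close> to the one over the field.\<close>
  let ?\<Phi> = "\<lambda>a p. tmap K ?K' H (ra' a) (\<lambda>h. h) p"
  have b\<Phi>: "X'.balanced ?E' ?\<Phi>"
    unfolding X'.balanced_def
  proof (intro conjI ballI)
    fix a p assume a: "a \<in> carrier A'" and p: "p \<in> carrier P"
    show "?\<Phi> a p \<in> carrier ?E'" by (rule lin_map_closed[OF cA'[OF a] p])
  next
    fix a a' p assume a: "a \<in> carrier A'" "a' \<in> carrier A'" and p: "p \<in> carrier P"
    have aa: "a \<oplus>\<^bsub>A'\<^esub> a' \<in> carrier A'" using a by simp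
    show "?\<Phi> (a \<oplus>\<^bsub>A'\<^esub> a') p = ?\<Phi> a p \<oplus>\<^bsub>?E'\<^esub> ?\<Phi> a' p"
    proof (rule tensor_eqI[OF cA'[OF aa] lin_map_sum[OF mE' cA'[OF a(1)] cA'[OF a(2)]] M.mod mod mE' _ p])
      fix m h assume m: "m \<in> carrier M" and h: "h \<in> carrier H"
      show "?\<Phi> (a \<oplus>\<^bsub>A'\<^esub> a') (tens K M H m h) = ?\<Phi> a (tens K M H m h) \<oplus>\<^bsub>?E'\<^esub> ?\<Phi> a' (tens K M H m h)"
        using lin_map_add[OF lin_map_tens_left[OF r2(1) mod h lin_map_ident], of "ra' a m" "ra' a' m"]
          lin_map_closed[OF r2(2)[OF a(1)] m] lin_map_closed[OF r2(2)[OF a(2)] m]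
        by (simp add: tmap_tens[OF r2(2) lin_map_ident M.mod mod r2(1) mod] aa a m h r2(3) restrict_scalars_sel)
    qed
  next
    fix a p p' assume a: "a \<in> carrier A'" and p: "p \<in> carrier P" "p' \<in> carrier P"
    show "?\<Phi> a (p \<oplus>\<^bsub>P\<^esub> p') = ?\<Phi> a p \<oplus>\<^bsub>?E'\<^esub> ?\<Phi> a p'" by (rule lin_map_add[OF cA'[OF a] p])
  next
    fix a r p assume a: "a \<in> carrier A'" and r: "r \<in> carrier M" and p: "p \<in> carrier P"
    have ar: "ra' a r \<in> carrier A'" by (rule X'.ra_closed[OF a r])
    show "?\<Phi> (ra' a r) p = ?\<Phi> a (iota r \<otimes>\<^bsub>P\<^esub> p)"
    proof (rule tensor_eqI[OF cA'[OF ar] lin_map_comp[OF cA'[OF a] lin_map_mulP[OF tP[OF r oneH]]] M.mod mod mE' _ p])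
      fix m h assume m: "m \<in> carrier M" and h: "h \<in> carrier H"
      have "ra' a (r \<otimes>\<^bsub>M\<^esub> m) = ra' (ra' a r) m" using A' a r m by (simp add: right_module_def)
      then show "?\<Phi> (ra' a r) (tens K M H m h) = ?\<Phi> a (iota r \<otimes>\<^bsub>P\<^esub> tens K M H m h)"
        by (simp add: iota_mult_left r m h tmap_tens[OF r2(2) lin_map_ident M.mod mod r2(1) mod] a ar)
    qed
  qed
  interpret Y: two_modules K ?K H using r1(1) mod by (simp add: two_modules_def)
  \<comment> \<open>The way back: \<open>a \<otimes> h\<close> goes to the class of
    \<open>a \<otimes> (1 \<otimes> h)\<close> over \<open>M\<close>.\<close>
  let ?\<Psi> = "\<lambda>a h. X.pure a (tens K M H \<one>\<^bsub>M\<^esub> h)"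
  have raA: "ra a \<one>\<^bsub>M\<^esub> = a" if "a \<in> carrier A" for a using A that by (simp add: right_module_def)
  have b\<Psi>: "Y.balanced X.G_ring ?\<Psi>"
    unfolding Y.balanced_def
  proof (intro conjI ballI)
    fix a h assume a: "a \<in> carrier ?K" and h: "h \<in> carrier H"
    show "?\<Psi> a h \<in> carrier X.G_ring" using a by (simp add: restrict_scalars_sel X.G_ring_sel X.pure_closed tP oneM h)
  next
    fix a a' h assume a: "a \<in> carrier ?K" "a' \<in> carrier ?K" and h: "h \<in> carrier H"
    show "?\<Psi> (a \<oplus>\<^bsub>?K\<^esub> a') h = ?\<Psi> a h \<oplus>\<^bsub>X.G_ring\<^esub> ?\<Psi> a' h"
      using a by (simp add: restrict_scalars_sel X.G_ring_sel X.pure_add_left tP oneM h)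
  next
    fix a h h' assume a: "a \<in> carrier ?K" and h: "h \<in> carrier H" "h' \<in> carrier H"
    show "?\<Psi> a (h \<oplus>\<^bsub>H\<^esub> h') = ?\<Psi> a h \<oplus>\<^bsub>X.G_ring\<^esub> ?\<Psi> a h'"
      using a by (simp add: restrict_scalars_sel X.G_ring_sel X.pure_add_right tP oneM h
        lin_map_add[OF lin_map_tens_right[OF M.mod mod oneM lin_map_ident]])
  next
    fix a c h assume a: "a \<in> carrier ?K" and c: "c \<in> carrier K" and h: "h \<in> carrier H"
    have "tens K M H \<one>\<^bsub>M\<^esub> (c \<odot>\<^bsub>H\<^esub> h) = iota (c \<odot>\<^bsub>M\<^esub> \<one>\<^bsub>M\<^esub>) \<otimes>\<^bsub>P\<^esub> tens K M H \<one>\<^bsub>M\<^esub> h"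
      using lin_map_smult[OF lin_map_tens_right[OF M.mod mod oneM lin_map_ident] c h]
        lin_map_smult[OF lin_map_tens_left[OF M.mod mod h lin_map_ident] c oneM]
      by (simp add: iota_mult_left[OF smult_one_closed[OF c] oneM h] smult_one_mult c oneM)
    then show "?\<Psi> (c \<odot>\<^bsub>?K\<^esub> a) h = ?\<Psi> a (c \<odot>\<^bsub>H\<^esub> h)"
      using a by (simp add: restrict_scalars_sel X.pure_balanced smult_one_closed c tP oneM h)
  qed
  have carY: "carrier Y.G = carrier ?E" by (simp add: tensor_sel)
  have \<Psi>a: "tlift X.G_ring ?\<Psi> (x \<oplus>\<^bsub>?E\<^esub> y) = tlift X.G_ring ?\<Psi> x \<otimes>\<^bsub>X.G\<^esub> tlift X.G_ring ?\<Psi> y" if "x \<in> carrier ?E" "y \<in> carrier ?E" for x y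
    using Y.tlift_mult[OF X.G_ring_abelian_group b\<Psi>, of x y] that by (simp add: tensor_sel X.G_ring_sel)
  have \<Psi>t: "tlift X.G_ring ?\<Psi> (tens K ?K H a h) = ?\<Psi> a h" if "a \<in> carrier A" "h \<in> carrier H" for a h
    using Y.tlift_pure[OF X.G_ring_abelian_group b\<Psi>, of a h] that by (simp add: Y.tens_eq_pure restrict_scalars_sel)
  have \<Psi>0: "tlift X.G_ring ?\<Psi> \<zero>\<^bsub>?E\<^esub> = \<one>\<^bsub>X.G\<^esub>"
    using Y.tlift_one[OF X.G_ring_abelian_group b\<Psi>] by (simp add: tensor_sel X.G_ring_sel)
  let ?J = "\<lambda>a p. X'.pure (f a) p"
  have bJ: "X.balanced X'.G_ring ?J"
    unfolding X.balanced_def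
    by (auto simp: X'.G_ring_sel fcl fadd fr X'.pure_closed X'.pure_add_left X'.pure_add_right X'.pure_balanced)
  have lgE: "lin_map K ?E' ?E (tmap K ?K H g (\<lambda>h. h))"
    by (rule lin_map_tmap[OF lin_map_ident g(1) lin_map_ident r2(1) mod r1(1) mod])
  \<comment> \<open>A left inverse of the induced map: pass to \<open>A' \<otimes> H\<close> over
    the field, apply \<open>g\<close> there, and return to the tensor product over \<open>M\<close>.
    Since \<open>g\<close> is known to be linear over \<open>K\<close> only, it could not be applied
    before the passage.\<close>
  let ?L = "\<lambda>X. tlift X.G_ring ?\<Psi> (tmap K ?K H g (\<lambda>h. h) (tlift ?E' ?\<Phi> X))"
  have E'g: "abelian_group ?E'" by (rule module_abelian_group[OF mE'])
  have inv: "?L (tlift X'.G_ring ?J X) = X" if "X \<in> carrier X.G" for X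
    using that
  proof (induction X rule: X.G_induct)
    case one
    show ?case
      by (simp add: X.tlift_one[OF X'.G_ring_abelian_group bJ] X'.G_ring_sel X'.tlift_one[OF E'g b\<Phi>] lin_map_zero[OF mE' mE lgE] \<Psi>0)
  next
    case (pure a p)
    have "?L (tlift X'.G_ring ?J (X.pure a p)) = tlift X.G_ring ?\<Psi> (tmap K ?K H g (\<lambda>h. h) (?\<Phi> (f a) p))"
      using pure by (simp add: X.tlift_pure[OF X'.G_ring_abelian_group bJ] X'.tlift_pure[OF E'g b\<Phi>] fcl)
    also have "tmap K ?K H g (\<lambda>h. h) (?\<Phi> (f a) p) = tmap K ?K H (\<lambda>m. g (ra' (f a) m)) (\<lambda>h. h) p"
      by (rule tmap_tmap[OF pure(2) r2(2)[OF fcl[OF pure(1)]] lin_map_ident g(1) lin_map_ident M.mod mod r2(1) mod r1(1) mod])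
    \<comment> \<open>Because \<open>f\<close> is \<open>M\<close>-linear,
      \<open>(f a) m = f (a m)\<close>, and \<open>g\<close> undoes \<open>f\<close>.\<close>
    also have "\<dots> = tmap K ?K H (ra a) (\<lambda>h. h) p"
      by (rule tmap_cong[OF pure(2) lin_map_comp[OF g(1) r2(2)[OF fcl[OF pure(1)]]] lin_map_ident M.mod mod r1(1) mod])
        (simp_all add: fr[symmetric] pure(1) g(2) X.ra_closed)
    also have "tlift X.G_ring ?\<Psi> (tmap K ?K H (ra a) (\<lambda>h. h) p) = X.pure a p"
      using M.mod mod pure(2)
    proof (induction p rule: tensor_induct)
      case zero
      have l: "lin_map K P ?E (tmap K ?K H (ra a) (\<lambda>h. h))"
        by (rule lin_map_tmap[OF lin_map_ident r1(2)[OF pure(1)] lin_map_ident M.mod mod r1(1) mod])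
      have "X.pure a \<zero>\<^bsub>P\<^esub> \<otimes>\<^bsub>X.G\<^esub> X.pure a \<zero>\<^bsub>P\<^esub> = X.pure a \<zero>\<^bsub>P\<^esub>"
        using X.pure_add_right[OF pure(1) P.zero_closed P.zero_closed] by simp
      then have "X.pure a \<zero>\<^bsub>P\<^esub> = \<one>\<^bsub>X.G\<^esub>"
        using X.G.l_cancel_one[OF X.pure_closed[OF pure(1) P.zero_closed] X.pure_closed[OF pure(1) P.zero_closed]] by simp
      then show ?case by (simp add: lin_map_zero[OF P.mod mE l] \<Psi>0)
    next
      case (tens m h)
      then show ?case
        using X.pure_balanced[OF pure(1) tens(1) tP[OF oneM tens(2)]]
        by (simp add: tmap_tens[OF r1(2)[OF pure(1)] lin_map_ident M.mod mod r1(1) mod] \<Psi>t X.ra_closed pure(1) iota_mult_left oneM)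
    next
      case (add x y)
      have l: "lin_map K P ?E (tmap K ?K H (ra a) (\<lambda>h. h))"
        by (rule lin_map_tmap[OF lin_map_ident r1(2)[OF pure(1)] lin_map_ident M.mod mod r1(1) mod])
      show ?case using add pure(1)
        by (simp add: lin_map_add[OF l] \<Psi>a lin_map_closed[OF l] X.pure_add_right)
    qed
    finally show ?case .
  next
    case (mult x y)
    have c: "tlift X'.G_ring ?J x \<in> carrier X'.G" "tlift X'.G_ring ?J y \<in> carrier X'.G"
      using X.tlift_in[OF X'.G_ring_abelian_group bJ] mult by (auto simp: X'.G_ring_sel)
    note d = c[THEN X'.tlift_in[OF E'g b\<Phi>]]
    show ?case
      using mult X.tlift_mult[OF X'.G_ring_abelian_group bJ mult(1,2)]
      by (simp add: X'.G_ring_sel X'.tlift_mult[OF E'g b\<Phi> c] lin_map_add[OF lgE d] \<Psi>a lin_map_closed[OF lgE] d)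
  qed
  have ind: "X'.N <#>\<^bsub>X'.F\<^esub> (frag_extend (\<lambda>(a, b). frag_of (f a, b)) ` X) = tlift X'.G_ring ?J X" if "X \<in> carrier X.G" for X
    by (rule induced_map_tlift[OF X.tensor_pair_axioms X'.tensor_pair_axioms _ _ bJ that]) (use fcl in auto)
  show "inj_on (\<lambda>X. X'.N <#>\<^bsub>X'.F\<^esub> (frag_extend (\<lambda>(a, b). frag_of (f a, b)) ` X)) (carrier X.G)"
    by (rule inj_on_inverseI[of _ ?L]) (simp only: ind inv)
qed

text \<open>The mirror image of \<open>flat_left_P\<close>. The maps \<open>?\<Phi>\<close> and
  \<open>?\<Psi>\<close> also reorder the factors, so that the retraction again acts on the first
  factor of \<open>A' \<otimes> H\<close>.\<close>

lemma flat_right_P: "flat_right (t :: ('x \<times> 'w) itself) M P (\<lambda>p m. p \<otimes>\<^bsub>P\<^esub> iota m)"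
  unfolding flat_right_def
proof (intro conjI allI impI right_module_P)
  fix A :: "'x ring" and la and A' :: "'w ring" and la' f
  assume "left_module M A la \<and> left_module M A' la' \<and> f \<in> hom (add_monoid A) (add_monoid A') \<and>
      (\<forall>a\<in>carrier A. \<forall>r\<in>carrier M. f (la r a) = la' r (f a)) \<and> inj_on f (carrier A)"
  then have A: "left_module M A la" and A': "left_module M A' la'"
    and f: "f \<in> hom (add_monoid A) (add_monoid A')" and fr: "\<And>a r. a \<in> carrier A \<Longrightarrow> r \<in> carrier M \<Longrightarrow> f (la r a) = la' r (f a)"
    and inj: "inj_on f (carrier A)" by auto
  have fcl: "f a \<in> carrier A'" if "a \<in> carrier A" for a using f that by (auto simp: hom_def)
  have fadd: "f (a \<oplus>\<^bsub>A\<^esub> b) = f a \<oplus>\<^bsub>A'\<^esub> f b" if "a \<in> carrier A" "b \<in> carrier A" for a b using f that by (auto simp: hom_def)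
  let ?rP = "\<lambda>p m. p \<otimes>\<^bsub>P\<^esub> iota m"
  have iP: "p \<otimes>\<^bsub>P\<^esub> iota r \<in> carrier P" if "r \<in> carrier M" "p \<in> carrier P" for r p
    using that by (intro P.m_closed tP oneH)
  interpret X: tensor_pair M P ?rP A la
    using A P.abelian_group_axioms iP by (auto simp: tensor_pair_def tensor_pair_axioms_def left_module_def module_abelian_group[OF P.mod])
  interpret X': tensor_pair M P ?rP A' la'
    using A' P.abelian_group_axioms iP by (auto simp: tensor_pair_def tensor_pair_axioms_def left_module_def module_abelian_group[OF P.mod])
  let ?K = "restrict_scalars K M A la" let ?K' = "restrict_scalars K M A' la'"
  note r1 = left_restrict_module[OF A] and r2 = left_restrict_module[OF A']
  have lf: "lin_map K ?K ?K' f"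
    by (rule lin_mapI) (simp_all add: restrict_scalars_sel fcl fadd fr smult_one_closed)
  obtain g where g: "lin_map K ?K' ?K g" "\<And>a. a \<in> carrier A \<Longrightarrow> g (f a) = a"
    by (rule injective_linear_retraction[OF field_axioms r1(1) r2(1) lf]) (use inj in \<open>auto simp: restrict_scalars_sel\<close>)
  let ?E = "tensor K ?K H" let ?E' = "tensor K ?K' H"
  have mE: "module K ?E" and mE': "module K ?E'" by (rule module_tensor[OF r1(1) mod], rule module_tensor[OF r2(1) mod])
  have cA': "a \<in> carrier A' \<Longrightarrow> lin_map K P ?E' (tmap K ?K' H (\<lambda>m. la' m a) (\<lambda>h. h))" for a
    by (rule lin_map_tmap[OF lin_map_ident r2(2) lin_map_ident M.mod mod r2(1) mod])
  let ?\<Phi> = "\<lambda>p a. tmap K ?K' H (\<lambda>m. la' m a) (\<lambda>h. h) p"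
  have b\<Phi>: "X'.balanced ?E' ?\<Phi>"
    unfolding X'.balanced_def
  proof (intro conjI ballI)
    fix p a assume a: "a \<in> carrier A'" and p: "p \<in> carrier P"
    show "?\<Phi> p a \<in> carrier ?E'" by (rule lin_map_closed[OF cA'[OF a] p])
  next
    fix p p' a assume a: "a \<in> carrier A'" and p: "p \<in> carrier P" "p' \<in> carrier P"
    show "?\<Phi> (p \<oplus>\<^bsub>P\<^esub> p') a = ?\<Phi> p a \<oplus>\<^bsub>?E'\<^esub> ?\<Phi> p' a" by (rule lin_map_add[OF cA'[OF a] p])
  next
    fix p a a' assume a: "a \<in> carrier A'" "a' \<in> carrier A'" and p: "p \<in> carrier P"
    have aa: "a \<oplus>\<^bsub>A'\<^esub> a' \<in> carrier A'" using a by simp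
    show "?\<Phi> p (a \<oplus>\<^bsub>A'\<^esub> a') = ?\<Phi> p a \<oplus>\<^bsub>?E'\<^esub> ?\<Phi> p a'"
    proof (rule tensor_eqI[OF cA'[OF aa] lin_map_sum[OF mE' cA'[OF a(1)] cA'[OF a(2)]] M.mod mod mE' _ p])
      fix m h assume m: "m \<in> carrier M" and h: "h \<in> carrier H"
      show "?\<Phi> (tens K M H m h) (a \<oplus>\<^bsub>A'\<^esub> a') = ?\<Phi> (tens K M H m h) a \<oplus>\<^bsub>?E'\<^esub> ?\<Phi> (tens K M H m h) a'"
        using lin_map_add[OF lin_map_tens_left[OF r2(1) mod h lin_map_ident], of "la' m a" "la' m a'"]
          lin_map_closed[OF r2(2)[OF a(1)] m] lin_map_closed[OF r2(2)[OF a(2)] m]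
        by (simp add: tmap_tens[OF r2(2) lin_map_ident M.mod mod r2(1) mod] aa a m h r2(3) restrict_scalars_sel)
    qed
  next
    fix p r a assume a: "a \<in> carrier A'" and r: "r \<in> carrier M" and p: "p \<in> carrier P"
    have ar: "la' r a \<in> carrier A'" by (rule X'.lb_closed[OF a r])
    show "?\<Phi> (p \<otimes>\<^bsub>P\<^esub> iota r) a = ?\<Phi> p (la' r a)"
    proof (rule tensor_eqI[OF lin_map_comp[OF cA'[OF a] lin_map_mult_left[OF P.alg tP[OF r oneH] lin_map_ident]] cA'[OF ar] M.mod mod mE' _ p])
      fix m h assume m: "m \<in> carrier M" and h: "h \<in> carrier H"
      have "la' (m \<otimes>\<^bsub>M\<^esub> r) a = la' m (la' r a)" using A' a r m by (simp add: left_module_def)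
      then show "?\<Phi> (tens K M H m h \<otimes>\<^bsub>P\<^esub> iota r) a = ?\<Phi> (tens K M H m h) (la' r a)"
        by (simp add: iota_mult_right r m h tmap_tens[OF r2(2) lin_map_ident M.mod mod r2(1) mod] a ar)
    qed
  qed
  interpret Y: two_modules K ?K H using r1(1) mod by (simp add: two_modules_def)
  let ?\<Psi> = "\<lambda>a h. X.pure (tens K M H \<one>\<^bsub>M\<^esub> h) a"
  have b\<Psi>: "Y.balanced X.G_ring ?\<Psi>"
    unfolding Y.balanced_def
  proof (intro conjI ballI)
    fix a h assume a: "a \<in> carrier ?K" and h: "h \<in> carrier H"
    show "?\<Psi> a h \<in> carrier X.G_ring" using a by (simp add: restrict_scalars_sel X.G_ring_sel X.pure_closed tP oneM h)
  next
    fix a a' h assume a: "a \<in> carrier ?K" "a' \<in> carrier ?K" and h: "h \<in> carrier H"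
    show "?\<Psi> (a \<oplus>\<^bsub>?K\<^esub> a') h = ?\<Psi> a h \<oplus>\<^bsub>X.G_ring\<^esub> ?\<Psi> a' h"
      using a by (simp add: restrict_scalars_sel X.G_ring_sel X.pure_add_right tP oneM h)
  next
    fix a h h' assume a: "a \<in> carrier ?K" and h: "h \<in> carrier H" "h' \<in> carrier H"
    show "?\<Psi> a (h \<oplus>\<^bsub>H\<^esub> h') = ?\<Psi> a h \<oplus>\<^bsub>X.G_ring\<^esub> ?\<Psi> a h'"
      using a by (simp add: restrict_scalars_sel X.G_ring_sel X.pure_add_left tP oneM h
        lin_map_add[OF lin_map_tens_right[OF M.mod mod oneM lin_map_ident]])
  next
    fix a c h assume a: "a \<in> carrier ?K" and c: "c \<in> carrier K" and h: "h \<in> carrier H"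
    have "tens K M H \<one>\<^bsub>M\<^esub> (c \<odot>\<^bsub>H\<^esub> h) = tens K M H \<one>\<^bsub>M\<^esub> h \<otimes>\<^bsub>P\<^esub> iota (c \<odot>\<^bsub>M\<^esub> \<one>\<^bsub>M\<^esub>)"
      using lin_map_smult[OF lin_map_tens_right[OF M.mod mod oneM lin_map_ident] c h]
        lin_map_smult[OF lin_map_tens_left[OF M.mod mod h lin_map_ident] c oneM]
      by (simp add: iota_mult_right[OF smult_one_closed[OF c] oneM h] smult_one_mult c oneM)
    then show "?\<Psi> (c \<odot>\<^bsub>?K\<^esub> a) h = ?\<Psi> a (c \<odot>\<^bsub>H\<^esub> h)"
      using a X.pure_balanced[OF tP[OF oneM h] smult_one_closed[OF c], of a] by (simp add: restrict_scalars_sel)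
  qed
  have \<Psi>a: "tlift X.G_ring ?\<Psi> (x \<oplus>\<^bsub>?E\<^esub> y) = tlift X.G_ring ?\<Psi> x \<otimes>\<^bsub>X.G\<^esub> tlift X.G_ring ?\<Psi> y" if "x \<in> carrier ?E" "y \<in> carrier ?E" for x y
    using Y.tlift_mult[OF X.G_ring_abelian_group b\<Psi>, of x y] that by (simp add: tensor_sel X.G_ring_sel)
  have \<Psi>t: "tlift X.G_ring ?\<Psi> (tens K ?K H a h) = ?\<Psi> a h" if "a \<in> carrier A" "h \<in> carrier H" for a h
    using Y.tlift_pure[OF X.G_ring_abelian_group b\<Psi>, of a h] that by (simp add: Y.tens_eq_pure restrict_scalars_sel)
  have \<Psi>0: "tlift X.G_ring ?\<Psi> \<zero>\<^bsub>?E\<^esub> = \<one>\<^bsub>X.G\<^esub>"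
    using Y.tlift_one[OF X.G_ring_abelian_group b\<Psi>] by (simp add: tensor_sel X.G_ring_sel)
  let ?J = "\<lambda>p a. X'.pure p (f a)"
  have bJ: "X.balanced X'.G_ring ?J"
    unfolding X.balanced_def
    by (auto simp: X'.G_ring_sel fcl fadd fr X'.pure_closed X'.pure_add_left X'.pure_add_right X'.pure_balanced)
  have lgE: "lin_map K ?E' ?E (tmap K ?K H g (\<lambda>h. h))"
    by (rule lin_map_tmap[OF lin_map_ident g(1) lin_map_ident r2(1) mod r1(1) mod])
  let ?L = "\<lambda>X. tlift X.G_ring ?\<Psi> (tmap K ?K H g (\<lambda>h. h) (tlift ?E' ?\<Phi> X))"
  have E'g: "abelian_group ?E'" by (rule module_abelian_group[OF mE'])
  have inv: "?L (tlift X'.G_ring ?J X) = X" if "X \<in> carrier X.G" for X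
    using that
  proof (induction X rule: X.G_induct)
    case one
    show ?case
      by (simp add: X.tlift_one[OF X'.G_ring_abelian_group bJ] X'.G_ring_sel X'.tlift_one[OF E'g b\<Phi>] lin_map_zero[OF mE' mE lgE] \<Psi>0)
  next
    case (pure p a)
    have "?L (tlift X'.G_ring ?J (X.pure p a)) = tlift X.G_ring ?\<Psi> (tmap K ?K H g (\<lambda>h. h) (?\<Phi> p (f a)))"
      using pure by (simp add: X.tlift_pure[OF X'.G_ring_abelian_group bJ] X'.tlift_pure[OF E'g b\<Phi>] fcl)
    also have "tmap K ?K H g (\<lambda>h. h) (?\<Phi> p (f a)) = tmap K ?K H (\<lambda>m. g (la' m (f a))) (\<lambda>h. h) p"
      by (rule tmap_tmap[OF pure(1) r2(2)[OF fcl[OF pure(2)]] lin_map_ident g(1) lin_map_ident M.mod mod r2(1) mod r1(1) mod])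
    also have "\<dots> = tmap K ?K H (\<lambda>m. la m a) (\<lambda>h. h) p"
      by (rule tmap_cong[OF pure(1) lin_map_comp[OF g(1) r2(2)[OF fcl[OF pure(2)]]] lin_map_ident M.mod mod r1(1) mod])
        (simp_all add: fr[symmetric] pure(2) g(2) X.lb_closed)
    also have "tlift X.G_ring ?\<Psi> (tmap K ?K H (\<lambda>m. la m a) (\<lambda>h. h) p) = X.pure p a"
    proof -
      have l: "lin_map K P ?E (tmap K ?K H (\<lambda>m. la m a) (\<lambda>h. h))"
        by (rule lin_map_tmap[OF lin_map_ident r1(2)[OF pure(2)] lin_map_ident M.mod mod r1(1) mod])
      show ?thesis
        using M.mod mod pure(1)
      proof (induction p rule: tensor_induct)
        case zero
        have "X.pure \<zero>\<^bsub>P\<^esub> a \<otimes>\<^bsub>X.G\<^esub> X.pure \<zero>\<^bsub>P\<^esub> a = X.pure \<zero>\<^bsub>P\<^esub> a"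
          using X.pure_add_left[OF P.zero_closed P.zero_closed pure(2)] by simp
        then have "X.pure \<zero>\<^bsub>P\<^esub> a = \<one>\<^bsub>X.G\<^esub>"
          using X.G.l_cancel_one[OF X.pure_closed[OF P.zero_closed pure(2)] X.pure_closed[OF P.zero_closed pure(2)]] by simp
        then show ?case by (simp add: lin_map_zero[OF P.mod mE l] \<Psi>0)
      next
        case (tens m h)
        then show ?case
          using X.pure_balanced[OF tP[OF oneM tens(2)] tens(1) pure(2)]
          by (simp add: tmap_tens[OF r1(2)[OF pure(2)] lin_map_ident M.mod mod r1(1) mod] \<Psi>t X.lb_closed pure(2) iota_mult_right oneM)
      next
        case (add x y)
        then show ?case using pure(2)
          by (simp add: lin_map_add[OF l] \<Psi>a lin_map_closed[OF l] X.pure_add_left)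
      qed
    qed
    finally show ?case .
  next
    case (mult x y)
    have c: "tlift X'.G_ring ?J x \<in> carrier X'.G" "tlift X'.G_ring ?J y \<in> carrier X'.G"
      using X.tlift_in[OF X'.G_ring_abelian_group bJ] mult by (auto simp: X'.G_ring_sel)
    note d = c[THEN X'.tlift_in[OF E'g b\<Phi>]]
    show ?case
      using mult X.tlift_mult[OF X'.G_ring_abelian_group bJ mult(1,2)]
      by (simp add: X'.G_ring_sel X'.tlift_mult[OF E'g b\<Phi> c] lin_map_add[OF lgE d] \<Psi>a lin_map_closed[OF lgE] d)
  qed
  have ind: "X'.N <#>\<^bsub>X'.F\<^esub> (frag_extend (\<lambda>(b, a). frag_of (b, f a)) ` X) = tlift X'.G_ring ?J X" if "X \<in> carrier X.G" for X
    by (rule induced_map_tlift[OF X.tensor_pair_axioms X'.tensor_pair_axioms _ _ bJ that]) (use fcl in auto)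
  show "inj_on (\<lambda>X. X'.N <#>\<^bsub>X'.F\<^esub> (frag_extend (\<lambda>(b, a). frag_of (b, f a)) ` X)) (carrier X.G)"
    by (rule inj_on_inverseI[of _ ?L]) (simp only: ind inv)
qed

section \<open>The trivial bundle as a quantum principal bundle\<close>

lemma qpb_universal_trivial: "qpb_universal (t :: ('x \<times> 'w) itself) K M iota P H DR"
  unfolding qpb_universal_def
  using hopf_algebra_axioms P.alg free_comodule[OF M.mod] free_coact_alg_hom[OF M.alg] M.alg iota_alg_hom iota_coinvariants
    flat_left_P[of t] flat_right_P[of t] ver_univ
  by (simp only: horiz_span ker_ver simp_thms)

lemma qpb_nonuniversal_trivial:
  assumes NM: "diff_calculus K M NM" and Q: "bicovariant K H Q"
  shows "qpb_nonuniversal (t :: ('x \<times> 'w) itself) K M NM iota P (product_N K M NM H (bicov_N K H Q)) H Q DR"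
  unfolding qpb_nonuniversal_def
  using qpb_universal_trivial assms NP_diff_calculus[OF assms] NP_base[OF assms] NP_ver[OF assms] NP_coact[OF assms]
  by blast

end

section \<open>The horizontal forms of the trivial bundle\<close>

lemma submodule_of_sub:
  assumes V: "module K V" and U: "submodule U K V" and N: "submodule N K V" and s: "N \<subseteq> U"
  shows "submodule N K (V\<lparr>carrier := U\<rparr>)"
  by (rule submoduleI'[OF module_sub[OF V U]])
    (use assms in \<open>auto simp: submodule_zero submodule_add submodule_smult\<close>)

lemma lin_map_tsub_eq:
  assumes x: "x \<in> tsub K V W A B" and f: "lin_map K (tensor K V W) X f" and g: "lin_map K (tensor K V W) X g"
    and m: "module K V" "module K W" "module K X" and s: "A \<subseteq> carrier V" "B \<subseteq> carrier W"
    and e: "\<And>a b. a \<in> A \<Longrightarrow> b \<in> B \<Longrightarrow> f (tens K V W a b) = g (tens K V W a b)"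
  shows "f x = g x"
proof -
  note T = module_tensor[OF m(1,2)]
  have "submodule {x \<in> carrier (tensor K V W). f x = g x} K (tensor K V W)"
  proof (rule submoduleI'[OF T])
    interpret T: module K "tensor K V W" by (rule T)
    show "\<zero>\<^bsub>tensor K V W\<^esub> \<in> {x \<in> carrier (tensor K V W). f x = g x}"
      using lin_map_zero[OF T m(3) f] lin_map_zero[OF T m(3) g] by simp
  qed (use module.smult_closed[OF T] abelian_monoid.a_closed[OF abelian_group.axioms(1)[OF module_abelian_group[OF T]]]
     lin_map_add[OF f] lin_map_add[OF g] lin_map_smult[OF f] lin_map_smult[OF g] in auto)
  from tsub_least[OF this, of A B] have "tsub K V W A B \<subseteq> {x \<in> carrier (tensor K V W). f x = g x}"
    using e s tens_closed[OF m(1,2)] by blast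
  then show ?thesis using x by blast
qed

context hopf_algebra
begin

text \<open>Any solution is the one selected by \<open>THE\<close>: with a retraction
  \<open>r\<close> of \<open>V\<close> onto \<open>U\<close>, the map \<open>r \<otimes> id\<close>
  is a left inverse of the map induced by the inclusion, so solutions are unique.\<close>

lemma sub_coact_eqI:
  assumes V: "module K V" and U: "submodule U K V" and y: "y \<in> carrier (tensor K (V\<lparr>carrier := U\<rparr>) H)"
    and e: "tmap K V H (\<lambda>v. v) (\<lambda>h. h) y = \<delta> u"
  shows "sub_coact K H V \<delta> U u = y"
  unfolding sub_coact_def
proof (rule the_equality)
  let ?U = "V\<lparr>carrier := U\<rparr>"
  have mU: "module K ?U" by (rule module_sub[OF V U])
  obtain r where r: "lin_map K V ?U r" "\<And>u. u \<in> U \<Longrightarrow> r u = u" using exists_retraction[OF field_axioms V U] by metis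
  have i: "lin_map K ?U V (\<lambda>v. v)"
    by (rule lin_map_restrict_dom[OF submodule_subset[OF V U] lin_map_ident])
  have inv: "tmap K ?U H r (\<lambda>h. h) (tmap K V H (\<lambda>v. v) (\<lambda>h. h) z) = z" if z: "z \<in> carrier (tensor K ?U H)" for z
  proof -
    have "tmap K ?U H r (\<lambda>h. h) (tmap K V H (\<lambda>v. v) (\<lambda>h. h) z) = tmap K ?U H (\<lambda>v. r v) (\<lambda>h. h) z"
      by (rule tmap_tmap[OF z i lin_map_ident r(1) lin_map_ident mU mod V mod mU mod])
    also have "\<dots> = tmap K ?U H (\<lambda>v. v) (\<lambda>h. h) z"
      by (rule tmap_cong[OF z lin_map_comp[OF r(1) i] lin_map_ident mU mod mU mod]) (simp_all add: r(2))
    also have "\<dots> = z" by (rule tmap_ident[OF z mU mod])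
    finally show ?thesis .
  qed
  show "y \<in> carrier (tensor K ?U H) \<and> tmap K V H (\<lambda>v. v) (\<lambda>h. h) y = \<delta> u" using y e by simp
  fix z assume z: "z \<in> carrier (tensor K ?U H) \<and> tmap K V H (\<lambda>v. v) (\<lambda>h. h) z = \<delta> u"
  then have "tmap K V H (\<lambda>v. v) (\<lambda>h. h) z = tmap K V H (\<lambda>v. v) (\<lambda>h. h) y" using e by simp
  then show "z = y" using inv z y by metis
qed

text \<open>The axioms for \<open>\<delta>'\<close> follow from those for \<open>\<delta>\<close> by
  naturality. For the coaction restricted to the horizontal forms, which is defined by
  \<open>THE\<close>, this replaces a direct proof of coassociativity.\<close>

lemma comodule_transport:
  assumes c: "right_comodule K H V \<delta>" and W: "module K W" and f: "lin_map K V W f"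
    and bij: "bij_betw f (carrier V) (carrier W)"
    and e: "\<And>v. v \<in> carrier V \<Longrightarrow> \<delta>' (f v) = tmap K W H f (\<lambda>h. h) (\<delta> v)"
  shows "right_comodule K H W \<delta>'"
proof -
  have V: "module K V" and d: "lin_map K V (tensor K V H) \<delta>"
    and ca: "\<And>v. v \<in> carrier V \<Longrightarrow> tmap K (tensor K V H) H \<delta> (\<lambda>h. h) (\<delta> v) =
      assoc_iso K V H H (tmap K V HH (\<lambda>v. v) (comult H) (\<delta> v))"
    and cu: "\<And>v. v \<in> carrier V \<Longrightarrow> eps_right V (\<delta> v) = v"
    using c by (auto simp: right_comodule_def)
  interpret V: module K V by (rule V)
  have im: "f ` carrier V = carrier W" and inj: "inj_on f (carrier V)" using bij by (auto simp: bij_betw_def)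
  let ?g = "inv_into (carrier V) f"
  have gf: "?g (f v) = v" if "v \<in> carrier V" for v using inj that by simp
  have wf: "\<exists>v\<in>carrier V. w = f v" if "w \<in> carrier W" for w using that im by blast
  have g: "lin_map K W V ?g"
  proof (rule lin_mapI)
    fix x y assume "x \<in> carrier W" "y \<in> carrier W"
    then obtain a b where *: "x = f a" "y = f b" "a \<in> carrier V" "b \<in> carrier V" using wf by metis
    have "f (a \<oplus>\<^bsub>V\<^esub> b) = f a \<oplus>\<^bsub>W\<^esub> f b" by (rule lin_map_add[OF f *(3,4)])
    then show "?g (x \<oplus>\<^bsub>W\<^esub> y) = ?g x \<oplus>\<^bsub>V\<^esub> ?g y" using * gf[of "a \<oplus>\<^bsub>V\<^esub> b"] by (simp add: gf)
  next
    fix c x assume k: "c \<in> carrier K" and "x \<in> carrier W"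
    then obtain a where *: "x = f a" "a \<in> carrier V" using wf by metis
    have "f (c \<odot>\<^bsub>V\<^esub> a) = c \<odot>\<^bsub>W\<^esub> f a" by (rule lin_map_smult[OF f k *(2)])
    then show "?g (c \<odot>\<^bsub>W\<^esub> x) = c \<odot>\<^bsub>V\<^esub> ?g x" using * k gf[of "c \<odot>\<^bsub>V\<^esub> a"] by (simp add: gf)
  next
    fix x assume "x \<in> carrier W"
    then obtain a where "x = f a" "a \<in> carrier V" using wf by metis
    then show "?g x \<in> carrier V" by (simp add: gf)
  qed
  let ?ff = "tmap K W H f (\<lambda>h. h)"
  have lff: "lin_map K (tensor K V H) (tensor K W H) ?ff"
    by (rule lin_map_tmap[OF lin_map_ident f lin_map_ident V mod W mod])
  have d': "lin_map K W (tensor K W H) \<delta>'"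
  proof (rule lin_map_cong[OF W lin_map_comp[OF lff lin_map_comp[OF d g]]])
    fix w assume "w \<in> carrier W"
    then obtain v where "w = f v" "v \<in> carrier V" using wf by metis
    then show "?ff (\<delta> (?g w)) = \<delta>' w" by (simp add: e gf)
  qed
  note mVH = module_tensor[OF V mod] and mWH = module_tensor[OF W mod]
  \<comment> \<open>Naturality of the rebracketing, which carries the right side of coassociativity
    across \<open>f\<close>.\<close>
  have nat: "assoc_iso K W H H (tmap K W HH f (\<lambda>y. y) Z) = tmap K (tensor K W H) H ?ff (\<lambda>h. h) (assoc_iso K V H H Z)"
    if Z: "Z \<in> carrier (tensor K V HH)" for Z
  proof (rule tensor_eqI3_right[OF _ _ V mod mod module_tensor[OF mWH mod] _ Z])
    show "lin_map K (tensor K V HH) (tensor K (tensor K W H) H) (\<lambda>Z. assoc_iso K W H H (tmap K W HH f (\<lambda>y. y) Z))"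
      by (rule lin_map_comp[OF lin_map_assoc_iso[OF W mod mod] lin_map_tmap[OF lin_map_ident f lin_map_ident V tmod W tmod]])
    show "lin_map K (tensor K V HH) (tensor K (tensor K W H) H) (\<lambda>Z. tmap K (tensor K W H) H ?ff (\<lambda>h. h) (assoc_iso K V H H Z))"
      by (rule lin_map_tmap[OF lin_map_assoc_iso[OF V mod mod] lff lin_map_ident mVH mod mWH mod])
    fix v a b assume v: "v \<in> carrier V" and a: "a \<in> carrier H" and b: "b \<in> carrier H"
    show "assoc_iso K W H H (tmap K W HH f (\<lambda>y. y) (tens K V HH v (tens K H H a b))) =
        tmap K (tensor K W H) H ?ff (\<lambda>h. h) (assoc_iso K V H H (tens K V HH v (tens K H H a b)))"
      unfolding tmap_tens[OF f lin_map_ident V tmod W tmod v tens_closed[OF mod mod a b]]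
        assoc_iso_tens[OF W mod mod lin_map_closed[OF f v] a b] assoc_iso_tens[OF V mod mod v a b]
        tmap_tens[OF lff lin_map_ident mVH mod mWH mod tens_closed[OF V mod v a] b]
        tmap_tens[OF f lin_map_ident V mod W mod v a] ..
  qed
  show ?thesis
    unfolding right_comodule_def
  proof (intro conjI ballI W d')
    fix w assume "w \<in> carrier W"
    then obtain v where w: "w = f v" and v: "v \<in> carrier V" using wf by metis
    note dv = lin_map_closed[OF d v]
    have "tmap K (tensor K W H) H \<delta>' (\<lambda>h. h) (\<delta>' w) = tmap K (tensor K W H) H (\<lambda>v. \<delta>' (f v)) (\<lambda>h. h) (\<delta> v)"
      unfolding w e[OF v] by (rule tmap_tmap[OF dv f lin_map_ident d' lin_map_ident V mod W mod mWH mod])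
    also have "\<dots> = tmap K (tensor K W H) H (\<lambda>v. ?ff (\<delta> v)) (\<lambda>h. h) (\<delta> v)"
      by (rule tmap_cong[OF dv lin_map_comp[OF d' f] lin_map_ident V mod mWH mod]) (simp_all add: e)
    also have "\<dots> = tmap K (tensor K W H) H ?ff (\<lambda>h. h) (tmap K (tensor K V H) H \<delta> (\<lambda>h. h) (\<delta> v))"
      by (rule tmap_tmap[OF dv d lin_map_ident lff lin_map_ident V mod mVH mod mWH mod, symmetric])
    also have "\<dots> = assoc_iso K W H H (tmap K W HH f (\<lambda>y. y) (tmap K V HH (\<lambda>v. v) (comult H) (\<delta> v)))"
      unfolding ca[OF v] by (rule nat[OF tmap_closed[OF dv lin_map_ident lin_map_comult V mod V tmod], symmetric])
    also have "tmap K W HH f (\<lambda>y. y) (tmap K V HH (\<lambda>v. v) (comult H) (\<delta> v)) = tmap K W HH (\<lambda>v. f v) (\<lambda>h. comult H h) (\<delta> v)"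
      by (rule tmap_tmap[OF dv lin_map_ident lin_map_comult f lin_map_ident V mod V tmod W tmod])
    also have "\<dots> = tmap K W HH (\<lambda>w. w) (comult H) (\<delta>' w)"
      unfolding w e[OF v] by (rule tmap_tmap[OF dv f lin_map_ident lin_map_ident lin_map_comult V mod W mod W tmod, symmetric])
    finally show "tmap K (tensor K W H) H \<delta>' (\<lambda>h. h) (\<delta>' w) = assoc_iso K W H H (tmap K W HH (\<lambda>w. w) (comult H) (\<delta>' w))" .
    have "eps_right W (?ff X) = f (eps_right V X)" if X: "X \<in> carrier (tensor K V H)" for X
      by (rule tensor_eqI[OF lin_map_comp[OF lin_map_eps_right[OF W] lff] lin_map_comp[OF f lin_map_eps_right[OF V]] V mod W _ X])
        (simp add: tmap_tens[OF f lin_map_ident V mod W mod] eps_right_tens[OF W] eps_right_tens[OF V] lin_map_closed[OF f]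
          lin_map_smult[OF f] counit_closed)
    from this[OF dv] show "eps_right W (\<delta>' w) = w" unfolding w e[OF v] cu[OF v] .
  qed
qed

end

context trivial_bundle
begin

context
  fixes NM Q
  assumes NM: "diff_calculus K M NM" and Q: "bicovariant K H Q"
begin

private abbreviation N where "N \<equiv> product_N K M NM H (bicov_N K H Q)"
private abbreviation UM where "UM \<equiv> univ_forms K M"
private abbreviation UP where "UP \<equiv> univ_forms K P"
private abbreviation FM where "FM \<equiv> forms K M NM"
private abbreviation FP where "FP \<equiv> forms K P N"
private abbreviation piM where "piM \<omega> \<equiv> NM +>\<^bsub>UM\<^esub> \<omega>"
private abbreviation piP where "piP \<omega> \<equiv> N +>\<^bsub>UP\<^esub> \<omega>"
text \<open>\<open>psi \<omega> h\<close> represents the form \<open>\<omega> h\<close>.\<close>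

private abbreviation psi where "psi \<omega> h \<equiv> sh (tens K MM HH \<omega> (tens K H H \<one>\<^bsub>H\<^esub> h))"

section \<open>Forms on the base and on the bundle as quotients\<close>

lemma univ_forms_sel:
  "carrier (univ_forms K A) = univ_calc K A" "\<zero>\<^bsub>univ_forms K A\<^esub> = \<zero>\<^bsub>tensor K A A\<^esub>"
  "x \<oplus>\<^bsub>univ_forms K A\<^esub> y = x \<oplus>\<^bsub>tensor K A A\<^esub> y" "c \<odot>\<^bsub>univ_forms K A\<^esub> x = c \<odot>\<^bsub>tensor K A A\<^esub> x"
  by (simp_all add: univ_forms_def)

lemma mUM: "module K UM" unfolding univ_forms_def by (rule module_sub[OF M.tmod M.univ_submodule])
lemma mUP: "module K UP" unfolding univ_forms_def by (rule module_sub[OF P.tmod P.univ_submodule])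

lemma quot_UM: "quotient K UM NM"
  unfolding quotient_def quotient_axioms_def
  by (intro conjI mUM) (unfold univ_forms_def, rule submodule_of_sub[OF M.tmod M.univ_submodule NM_submodule[OF NM Q] NM_univ[OF NM Q]])

lemma quot_UP: "quotient K UP N"
  unfolding quotient_def quotient_axioms_def
  by (intro conjI mUP) (unfold univ_forms_def, rule submodule_of_sub[OF P.tmod P.univ_submodule NP_submodule[OF NM Q] NP_univ[OF NM Q]])

lemma mFM: "module K FM" unfolding forms_def by (rule quotient.quot_module[OF quot_UM])
lemma mFP: "module K FP" unfolding forms_def by (rule quotient.quot_module[OF quot_UP])
lemma mFH: "module K (tensor K FM H)" by (rule module_tensor[OF mFM mod])
lemma mFPH: "module K (tensor K FP H)" by (rule module_tensor[OF mFP mod])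

lemma lin_map_FP_lift: "module K W \<Longrightarrow> lin_map K UP W f \<Longrightarrow> (\<And>n. n \<in> N \<Longrightarrow> f n = \<zero>\<^bsub>W\<^esub>) \<Longrightarrow> lin_map K FP W (\<lambda>X. f (SOME x. x \<in> X))"
  unfolding forms_def by (rule quotient.lin_map_some_lift[OF quot_UP])

lemma carrier_FM: "carrier FM = piM ` univ_calc K M"
  unfolding forms_def quotient.quot_carrier[OF quot_UM] univ_forms_sel ..

lemma carrier_FP: "carrier FP = piP ` univ_calc K P"
  unfolding forms_def quotient.quot_carrier[OF quot_UP] univ_forms_sel ..

lemma lin_map_piM: "lin_map K UM FM piM" unfolding forms_def by (rule quotient.lin_map_proj[OF quot_UM])
lemma lin_map_piP: "lin_map K UP FP piP" unfolding forms_def by (rule quotient.lin_map_proj[OF quot_UP])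

lemma piP_eq: "x \<in> univ_calc K P \<Longrightarrow> y \<in> univ_calc K P \<Longrightarrow> x \<ominus>\<^bsub>PP\<^esub> y \<in> N \<Longrightarrow> piP x = piP y"
proof -
  assume x: "x \<in> univ_calc K P" and y: "y \<in> univ_calc K P" and d: "x \<ominus>\<^bsub>PP\<^esub> y \<in> N"
  \<comment> \<open>Negation is defined through the carrier, which differs between the two records.
    Expressing it as scaling by minus one makes the two comparable.\<close>
  have "\<ominus>\<^bsub>UP\<^esub> y = \<ominus>\<^bsub>PP\<^esub> y"
    using module_neg[OF mUP, of y] module_neg[OF P.tmod, of y] y P.univ_subset by (auto simp: univ_forms_sel)
  then have "x \<ominus>\<^bsub>UP\<^esub> y \<in> N" using d by (simp add: a_minus_def univ_forms_sel)
  then show ?thesis using quotient.coset_eq_iff[OF quot_UP] x y by (simp add: univ_forms_sel)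
qed

lemma lin_map_univ:
  assumes "lin_map K (tensor K A A) (tensor K B B) f" "\<And>x. x \<in> univ_calc K A \<Longrightarrow> f x \<in> univ_calc K B"
  shows "lin_map K (univ_forms K A) (univ_forms K B) f"
  using assms by (auto simp: lin_map_def univ_forms_sel univ_calc_def Pi_iff)

lemma lin_map_UP_dom: "lin_map K PP W f \<Longrightarrow> lin_map K UP W f"
  unfolding univ_forms_def by (rule lin_map_restrict_dom[OF P.univ_subset])

lemma psi_univ: "\<omega> \<in> univ_calc K M \<Longrightarrow> h \<in> carrier H \<Longrightarrow> psi \<omega> h \<in> univ_calc K P"
  using M.univ_subset by (auto intro!: sh_univ tHH oneH)

lemma lin_map_psi_left: "h \<in> carrier H \<Longrightarrow> lin_map K UM UP (\<lambda>\<omega>. psi \<omega> h)"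
  by (rule lin_map_univ[OF lin_map_sh_one[OF tHH[OF oneH]] psi_univ])

lemma lin_map_psi_right: "\<omega> \<in> univ_calc K M \<Longrightarrow> lin_map K H UP (psi \<omega>)"
  unfolding univ_forms_def
  by (rule lin_map_restrict_cod[OF lin_map_comp[OF lin_map_sh_left lin_map_tens_right[OF mod mod oneH lin_map_ident]] psi_univ])
    (use M.univ_subset in auto)

lemma iota2_univ: "\<omega> \<in> univ_calc K M \<Longrightarrow> tmap K P P iota iota \<omega> \<in> univ_calc K P"
  using psi_univ[OF _ oneH] M.univ_subset by (auto simp: iota2)

lemma forms_incl_piM: "\<omega> \<in> univ_calc K M \<Longrightarrow> forms_incl K P N iota (piM \<omega>) = piP (psi \<omega> \<one>\<^bsub>H\<^esub>)"
proof -
  assume w: "\<omega> \<in> univ_calc K M"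
  have "set_add UP N (tmap K P P iota iota ` (piM \<omega>)) = piP (tmap K P P iota iota \<omega>)"
  proof (rule set_add_image_coset[OF quot_UP quot_UM lin_map_univ[OF lin_map_iota2 iota2_univ]])
    show "tmap K P P iota iota n \<in> N" if "n \<in> NM" for n
      using NP_I(1)[OF NM Q that tHH[OF oneH oneH]] that NM_subset[OF NM Q] by (auto simp: iota2)
  qed (use w in \<open>simp_all add: univ_forms_sel\<close>)
  then show ?thesis using w M.univ_subset by (auto simp: forms_incl_def base_forms_def iota2)
qed

lemma forms_ract_piP: "x \<in> univ_calc K P \<Longrightarrow> p \<in> carrier P \<Longrightarrow> forms_ract K P N (piP x) p = piP (ract K P x p)"
  unfolding forms_ract_def
  by (rule set_add_image_coset[OF quot_UP quot_UP lin_map_univ[OF lin_map_ract[OF P.alg] univ_ract[OF P.alg]]])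
    (use NP_diff_calculus[OF NM Q] in \<open>auto simp: diff_calculus_def univ_forms_sel\<close>)

lemma forms_lact_piP: "x \<in> univ_calc K P \<Longrightarrow> p \<in> carrier P \<Longrightarrow> forms_lact K P N p (piP x) = piP (lact K P p x)"
  unfolding forms_lact_def
  by (rule set_add_image_coset[OF quot_UP quot_UP lin_map_univ[OF lin_map_lact[OF P.alg] univ_lact[OF P.alg]]])
    (use NP_diff_calculus[OF NM Q] in \<open>auto simp: diff_calculus_def univ_forms_sel\<close>)

text \<open>The bilinear map \<open>(\<alpha>, h) \<mapsto> \<alpha> h\<close> whose lift is the
  isomorphism of the theorem; \<open>h\<close> enters as the element \<open>1 \<otimes> h\<close> of
  \<open>P\<close>.\<close>

private abbreviation be where
  "be \<equiv> \<lambda>\<alpha> h. forms_ract K P N (forms_incl K P N iota \<alpha>) (tens K M H \<one>\<^bsub>M\<^esub> h)"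

lemma ract_psi: "\<omega> \<in> univ_calc K M \<Longrightarrow> m \<in> carrier M \<Longrightarrow> h \<in> carrier H \<Longrightarrow> ract K P (psi \<omega> \<one>\<^bsub>H\<^esub>) (tens K M H m h) = psi (ract K M \<omega> m) h"
  using M.univ_subset by (auto simp: ract_sh tHH oneH ract_tens[OF alg])

lemma be_piM: "\<omega> \<in> univ_calc K M \<Longrightarrow> h \<in> carrier H \<Longrightarrow> be (piM \<omega>) h = piP (psi \<omega> h)"
  using M.univ_subset
  by (auto simp: forms_incl_piM forms_ract_piP psi_univ oneH tP oneM ract_psi ract_one[OF M.alg] subset_iff)

lemma bilin_be: "bilin K FM H FP be"
proof (rule bilinI)
  fix h assume h: "h \<in> carrier H"
  note l = lin_map_comp[OF lin_map_piP lin_map_psi_left[OF h]]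
  interpret UM: module K UM by (rule mUM)
  show "lin_map K FM FP (\<lambda>\<alpha>. be \<alpha> h)"
  proof (rule lin_mapI)
    show "be x h \<in> carrier FP" if x: "x \<in> carrier FM" for x
    proof -
      obtain a where a: "x = piM a" "a \<in> univ_calc K M" using x by (auto simp: carrier_FM)
      show ?thesis unfolding a(1) be_piM[OF a(2) h] using lin_map_closed[OF l] a(2) by (simp add: univ_forms_sel)
    qed
    show "be (x \<oplus>\<^bsub>FM\<^esub> y) h = be x h \<oplus>\<^bsub>FP\<^esub> be y h" if x: "x \<in> carrier FM" and y: "y \<in> carrier FM" for x y
    proof -
      obtain a b where a: "x = piM a" "a \<in> univ_calc K M" and b: "y = piM b" "b \<in> univ_calc K M"
        using x y by (auto simp: carrier_FM)
      have ab: "a \<in> carrier UM" "b \<in> carrier UM" "a \<oplus>\<^bsub>UM\<^esub> b \<in> univ_calc K M"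
        using a b UM.a_closed[of a b] by (simp_all add: univ_forms_sel(1))
      show ?thesis
        unfolding a(1) b(1) lin_map_add[OF lin_map_piM ab(1,2), symmetric] be_piM[OF ab(3) h] be_piM[OF a(2) h] be_piM[OF b(2) h]
        by (rule lin_map_add[OF l ab(1,2)])
    qed
    show "be (c \<odot>\<^bsub>FM\<^esub> x) h = c \<odot>\<^bsub>FP\<^esub> be x h" if c: "c \<in> carrier K" and x: "x \<in> carrier FM" for c x
    proof -
      obtain a where a: "x = piM a" "a \<in> univ_calc K M" using x by (auto simp: carrier_FM)
      have ab: "a \<in> carrier UM" "c \<odot>\<^bsub>UM\<^esub> a \<in> univ_calc K M"
        using a c UM.smult_closed[of c a] by (simp_all add: univ_forms_sel(1))
      show ?thesis
        unfolding a(1) lin_map_smult[OF lin_map_piM c ab(1), symmetric] be_piM[OF ab(2) h] be_piM[OF a(2) h]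
        by (rule lin_map_smult[OF l c ab(1)])
    qed
  qed
next
  fix \<alpha> assume "\<alpha> \<in> carrier FM"
  then obtain a where a: "\<alpha> = piM a" "a \<in> univ_calc K M" by (auto simp: carrier_FM)
  show "lin_map K H FP (be \<alpha>)"
    by (rule lin_map_cong[OF mod lin_map_comp[OF lin_map_piP lin_map_psi_right[OF a(2)]]]) (simp add: a(1) be_piM[OF a(2)])
qed

section \<open>The map \<open>\<alpha> \<otimes> h \<mapsto> \<alpha> h\<close> and its
  injectivity\<close>

private abbreviation ff where "ff \<equiv> tlift FP be"

lemma lin_map_ff: "lin_map K (tensor K FM H) FP ff"
  by (rule lin_map_tlift'[OF mFM mod mFP bilin_be])

lemma ff_tens: "\<omega> \<in> univ_calc K M \<Longrightarrow> h \<in> carrier H \<Longrightarrow> ff (tens K FM H (piM \<omega>) h) = piP (psi \<omega> h)"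
  by (subst tlift_tens[OF mFM mod mFP bilin_be]) (simp_all add: be_piM carrier_FM)

text \<open>The left inverse \<open>?g\<close> is induced by \<open>?r\<close>, which kills
  \<open>N\<^sub>P\<close> summand by summand: elements of \<open>N\<^sub>M\<close> have class zero,
  while \<open>mu K H\<close> annihilates both \<open>N\<^sub>H\<close> and
  \<open>\<Omega>\<^sup>1H\<close>.\<close>

lemma ff_inj: "inj_on ff (carrier (tensor K FM H))"
proof -
  let ?q = "\<lambda>x. piM (univ_proj K M x)"
  have lup: "lin_map K MM UM (univ_proj K M)"
    unfolding univ_forms_def by (rule lin_map_restrict_cod[OF M.lin_map_univ_proj M.univ_proj_univ])
  have lq: "lin_map K MM FM ?q" by (rule lin_map_comp[OF lin_map_piM lup])
  let ?r = "\<lambda>x. tmap K FM H ?q (mu K H) (ush x)"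
  have lr: "lin_map K PP (tensor K FM H) ?r"
    by (rule lin_map_tmap[OF lin_map_ush lq lin_map_mu M.tmod tmod mFM mod])
  have rt: "?r (sh (tens K MM HH x y)) = tens K FM H (?q x) (mu K H y)" if "x \<in> carrier MM" "y \<in> carrier HH" for x y
    by (simp add: ush_sh[OF tT4[OF that]] tmap_tens[OF lq lin_map_mu M.tmod tmod mFM mod that])
  have z: "submodule {\<zero>\<^bsub>tensor K FM H\<^esub>} K (tensor K FM H)"
  proof -
    interpret T: module K "tensor K FM H" by (rule mFH)
    show ?thesis by (rule submoduleI'[OF mFH]) auto
  qed
  have rN: "?r n = \<zero>\<^bsub>tensor K FM H\<^esub>" if n: "n \<in> N" for n
  proof -
    have "?r n \<in> {\<zero>\<^bsub>tensor K FM H\<^esub>}"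
    proof (rule NP_mem[OF NM Q n lr mFH z])
      fix a y assume a: "a \<in> NM" and y: "y \<in> carrier HH"
      have a': "a \<in> univ_calc K M" "a \<in> carrier MM" using a NM_univ[OF NM Q] NM_subset[OF NM Q] by auto
      have "piM a = \<zero>\<^bsub>FM\<^esub>" unfolding forms_def using quotient.proj_zero_iff[OF quot_UM, of a] a a' by (simp add: univ_forms_sel)
      then show "?r (sh (tens K MM HH a y)) \<in> {\<zero>\<^bsub>tensor K FM H\<^esub>}"
        by (simp add: rt a' y M.univ_proj_ident tens_zero_left[OF mFM mod] mu_closed)
    next
      fix a y assume a: "a \<in> carrier MM" and y: "y \<in> bicov_N K H Q"
      then have "y \<in> carrier HH" "mu K H y = \<zero>\<^bsub>H\<^esub>" using NH_univ[OF Q] by (auto simp: univ_calc_mu)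
      then show "?r (sh (tens K MM HH a y)) \<in> {\<zero>\<^bsub>tensor K FM H\<^esub>}"
        using lin_map_closed[OF lq a] by (simp add: rt a tens_zero_right[OF mFM mod])
    next
      fix a y assume a: "a \<in> univ_calc K M" and y: "y \<in> univ_calc K H"
      then have "a \<in> carrier MM" "y \<in> carrier HH" "mu K H y = \<zero>\<^bsub>H\<^esub>" by (auto simp: univ_calc_mu)
      then show "?r (sh (tens K MM HH a y)) \<in> {\<zero>\<^bsub>tensor K FM H\<^esub>}"
        using lin_map_closed[OF lq] by (simp add: rt tens_zero_right[OF mFM mod])
    qed
    then show ?thesis by simp
  qed
  have lrU: "lin_map K UP (tensor K FM H) ?r"
    by (rule lin_map_UP_dom[OF lr])
  let ?g = "\<lambda>X. ?r (SOME x. x \<in> X)"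
  have lg: "lin_map K FP (tensor K FM H) ?g"
    by (rule lin_map_FP_lift[OF mFH lrU rN])
  have gf: "?g (ff X) = X" if X: "X \<in> carrier (tensor K FM H)" for X
  proof (rule tensor_eqI[OF lin_map_comp[OF lg lin_map_ff] lin_map_ident mFM mod mFH _ X])
    fix \<alpha> h assume "\<alpha> \<in> carrier FM" and h: "h \<in> carrier H"
    then obtain a where a: "\<alpha> = piM a" "a \<in> univ_calc K M" by (auto simp: carrier_FM)
    have a': "a \<in> carrier MM" using a(2) M.univ_subset by blast
    \<comment> \<open>On the representative \<open>a \<otimes> (1 \<otimes> h)\<close> of a
      generator, \<open>univ_proj\<close> fixes \<open>a\<close> and the product in \<open>H\<close>
      returns \<open>h\<close>.\<close>
    have "?g (piP (psi a h)) = ?r (psi a h)"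
      by (rule quotient.some_lift[OF quot_UP mFH lrU rN]) (simp_all add: univ_forms_sel psi_univ[OF a(2) h])
    also have "\<dots> = tens K FM H \<alpha> h"
      by (simp add: rt a' tHH oneH h M.univ_proj_ident[OF a(2)] a(1) mu_tens)
    finally show "?g (ff (tens K FM H \<alpha> h)) = tens K FM H \<alpha> h" by (simp add: a(1) ff_tens[OF a(2) h])
  qed
  then show ?thesis by (rule inj_on_inverseI)
qed

section \<open>The three subspaces of horizontal forms\<close>

private abbreviation im where "im \<equiv> ff ` carrier (tensor K FM H)"

lemma im_submodule: "submodule im K FP"
  by (rule submodule_image[OF mFH mFP lin_map_ff submodule_carrier[OF mFH]])

lemma im_psi: "\<omega> \<in> univ_calc K M \<Longrightarrow> h \<in> carrier H \<Longrightarrow> piP (psi \<omega> h) \<in> im"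
  using tens_closed[OF mFM mod] by (force simp: carrier_FM ff_tens[symmetric])

lemma im_least:
  assumes U: "submodule U K FP" and g: "\<And>\<omega> h. \<omega> \<in> univ_calc K M \<Longrightarrow> h \<in> carrier H \<Longrightarrow> piP (psi \<omega> h) \<in> U"
  shows "im \<subseteq> U"
proof (rule image_subsetI)
  fix X assume X: "X \<in> carrier (tensor K FM H)"
  show "ff X \<in> U"
    by (rule tensor_mem[OF X lin_map_ff mFM mod mFP U]) (use g in \<open>auto simp: carrier_FM ff_tens\<close>)
qed

text \<open>Modulo \<open>\<Omega>\<^sup>1M \<otimes> \<Omega>\<^sup>1H\<close> the two tensor factors in \<open>H\<close> may be multiplied together on either side.\<close>

lemma piP_merge:
  assumes w: "\<omega> \<in> univ_calc K M" and y: "y \<in> carrier HH" and z: "z \<in> carrier HH" and e: "mu K H y = mu K H z"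
  shows "piP (sh (tens K MM HH \<omega> y)) = piP (sh (tens K MM HH \<omega> z))"
proof (rule piP_eq)
  have w': "\<omega> \<in> carrier MM" using w M.univ_subset by blast
  show "sh (tens K MM HH \<omega> y) \<in> univ_calc K P" "sh (tens K MM HH \<omega> z) \<in> univ_calc K P"
    using w w' y z by (auto intro!: sh_univ)
  interpret HH: module K HH by (rule tmod)
  have "mu K H (y \<ominus>\<^bsub>HH\<^esub> z) = \<zero>\<^bsub>H\<^esub>"
    unfolding lin_map_minus[OF tmod mod lin_map_mu y z] e by (rule module_diff_self[OF mod mu_closed[OF z]])
  then have "y \<ominus>\<^bsub>HH\<^esub> z \<in> univ_calc K H" using y z by (simp add: univ_calc_mu)
  from NP_I(3)[OF NM Q w this]
  show "sh (tens K MM HH \<omega> y) \<ominus>\<^bsub>PP\<^esub> sh (tens K MM HH \<omega> z) \<in> N"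
    by (simp add: lin_map_minus[OF tmod P.tmod lin_map_sh_left[OF w'] y z])
qed

text \<open>For pure \<open>p = m \<otimes> h\<close> and \<open>p' = n \<otimes> g\<close> the form
  has coordinates \<open>m \<omega> n\<close> and \<open>h \<otimes> g\<close>, and
  \<open>piP_merge\<close> replaces the latter by \<open>1 \<otimes> h g\<close>.\<close>

lemma PMP_gen:
  assumes p: "p \<in> carrier P" and a: "\<alpha> \<in> carrier FM" and p': "p' \<in> carrier P"
  shows "forms_ract K P N (forms_lact K P N p (forms_incl K P N iota \<alpha>)) p' \<in> im"
proof -
  obtain \<omega> where w: "\<alpha> = piM \<omega>" "\<omega> \<in> univ_calc K M" using a by (auto simp: carrier_FM)
  have w': "\<omega> \<in> carrier MM" using w(2) M.univ_subset by blast
  note u = psi_univ[OF w(2) oneH]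
  have uP: "psi \<omega> \<one>\<^bsub>H\<^esub> \<in> carrier PP" using u P.univ_subset by blast
  have e: "forms_ract K P N (forms_lact K P N p (forms_incl K P N iota \<alpha>)) p' = piP (ract K P (lact K P p (psi \<omega> \<one>\<^bsub>H\<^esub>)) p')"
    unfolding w(1) forms_incl_piM[OF w(2)] forms_lact_piP[OF u p] by (rule forms_ract_piP[OF univ_lact[OF P.alg p u] p'])
  have lp: "lact K P p (psi \<omega> \<one>\<^bsub>H\<^esub>) \<in> univ_calc K P" by (rule univ_lact[OF P.alg p u])
  have lpP: "lact K P p (psi \<omega> \<one>\<^bsub>H\<^esub>) \<in> carrier PP" using lp P.univ_subset by blast
  have l1: "lin_map K P FP (\<lambda>p'. piP (ract K P (lact K P p (psi \<omega> \<one>\<^bsub>H\<^esub>)) p'))"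
    by (rule lin_map_comp[OF lin_map_piP], unfold univ_forms_def, rule lin_map_restrict_cod[OF lin_map_ract_param[OF lpP] univ_ract[OF P.alg _ lp]])
  show ?thesis
    unfolding e
  proof (rule tensor_mem[OF p' l1 M.mod mod mFP im_submodule])
    fix n g assume n: "n \<in> carrier M" and g: "g \<in> carrier H"
    have l2: "lin_map K P FP (\<lambda>p. piP (ract K P (lact K P p (psi \<omega> \<one>\<^bsub>H\<^esub>)) (tens K M H n g)))"
      by (rule lin_map_comp[OF lin_map_piP], unfold univ_forms_def,
          rule lin_map_restrict_cod[OF lin_map_comp[OF lin_map_ract[OF P.alg tP[OF n g]] lin_map_lact_param[OF uP]]
            univ_ract[OF P.alg tP[OF n g] univ_lact[OF P.alg _ u]]])
    show "piP (ract K P (lact K P p (psi \<omega> \<one>\<^bsub>H\<^esub>)) (tens K M H n g)) \<in> im"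
    proof (rule tensor_mem[OF p l2 M.mod mod mFP im_submodule])
      fix m h assume m: "m \<in> carrier M" and h: "h \<in> carrier H"
      let ?w = "ract K M (lact K M m \<omega>) n"
      have wu: "?w \<in> univ_calc K M" by (rule univ_ract[OF M.alg n univ_lact[OF M.alg m w(2)]])
      have "piP (ract K P (lact K P (tens K M H m h) (psi \<omega> \<one>\<^bsub>H\<^esub>)) (tens K M H n g)) = piP (psi ?w (h \<otimes>\<^bsub>H\<^esub> g))"
        unfolding sh_bimodule[OF m h w' n g]
        by (rule piP_merge[OF wu]) (simp_all add: tHH oneH h g mu_tens)
      then show "piP (ract K P (lact K P (tens K M H m h) (psi \<omega> \<one>\<^bsub>H\<^esub>)) (tens K M H n g)) \<in> im"
        using im_psi[OF wu alg_mult_closed[OF alg h g]] by simp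
    qed
  qed
qed

lemma oneP: "\<one>\<^bsub>P\<^esub> \<in> carrier P" by simp

lemma incl_closed:
  assumes a: "\<alpha> \<in> carrier FM"
  shows "\<exists>x\<in>univ_calc K P. forms_incl K P N iota \<alpha> = piP x"
  using a psi_univ[OF _ oneH] by (force simp: carrier_FM forms_incl_piM)

lemma lact_oneP: "\<alpha> \<in> carrier FM \<Longrightarrow> forms_lact K P N \<one>\<^bsub>P\<^esub> (forms_incl K P N iota \<alpha>) = forms_incl K P N iota \<alpha>"
proof -
  assume "\<alpha> \<in> carrier FM"
  then obtain x where x: "x \<in> univ_calc K P" "forms_incl K P N iota \<alpha> = piP x" using incl_closed by blast
  then have "x \<in> carrier PP" using P.univ_subset by blast
  then show ?thesis by (simp only: x forms_lact_piP[OF x(1) oneP] lact_one[OF P.alg])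
qed

lemma ract_oneP: "\<alpha> \<in> carrier FM \<Longrightarrow> p \<in> carrier P \<Longrightarrow>
    forms_ract K P N (forms_lact K P N p (forms_incl K P N iota \<alpha>)) \<one>\<^bsub>P\<^esub> = forms_lact K P N p (forms_incl K P N iota \<alpha>)"
proof -
  assume "\<alpha> \<in> carrier FM" and p: "p \<in> carrier P"
  then obtain x where x: "x \<in> univ_calc K P" "forms_incl K P N iota \<alpha> = piP x" using incl_closed by blast
  have lx: "lact K P p x \<in> univ_calc K P" by (rule univ_lact[OF P.alg p x(1)])
  then have "lact K P p x \<in> carrier PP" using P.univ_subset by blast
  then show ?thesis by (simp only: x(2) forms_lact_piP[OF x(1) p] forms_ract_piP[OF lx oneP] ract_one[OF P.alg])
qed

text \<open>All three subspaces are compared with the image of \<open>ff\<close>.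
  \<open>PMP_gen\<close> bounds each of them from above, with the unit of \<open>P\<close> inserted
  where a factor is absent, and the generators of the image are recovered with factors
  \<open>1 \<otimes> h\<close>.\<close>

lemma forms_PMP_im: "forms_PMP K M NM iota P N = im"
proof
  show "forms_PMP K M NM iota P N \<subseteq> im"
    unfolding forms_PMP_def by (rule kspan_least[OF im_submodule]) (use PMP_gen in blast)
  have s: "{forms_ract K P N (forms_lact K P N p (forms_incl K P N iota \<alpha>)) p' | p \<alpha> p'.
         p \<in> carrier P \<and> \<alpha> \<in> carrier FM \<and> p' \<in> carrier P} \<subseteq> carrier FP"
    using PMP_gen submodule_subset[OF mFP im_submodule] by blast
  show "im \<subseteq> forms_PMP K M NM iota P N"
    unfolding forms_PMP_def
  proof (rule im_least[OF kspan_submodule[OF mFP s] kspan_incl])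
    fix \<omega> h assume w: "\<omega> \<in> univ_calc K M" and h: "h \<in> carrier H"
    have a: "piM \<omega> \<in> carrier FM" using w by (simp add: carrier_FM)
    have "piP (psi \<omega> h) = forms_ract K P N (forms_lact K P N \<one>\<^bsub>P\<^esub> (forms_incl K P N iota (piM \<omega>))) (tens K M H \<one>\<^bsub>M\<^esub> h)"
      unfolding lact_oneP[OF a] be_piM[OF w h] ..
    then show "piP (psi \<omega> h) \<in> {forms_ract K P N (forms_lact K P N p (forms_incl K P N iota \<alpha>)) p' | p \<alpha> p'.
         p \<in> carrier P \<and> \<alpha> \<in> carrier FM \<and> p' \<in> carrier P}"
      using a oneP tP[OF oneM h] by blast
  qed
qed

lemma forms_MP_im: "forms_MP K M NM iota P N = im"
proof
  have g: "forms_ract K P N (forms_incl K P N iota \<alpha>) p \<in> im" if a: "\<alpha> \<in> carrier FM" and p: "p \<in> carrier P" for \<alpha> p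
    using PMP_gen[OF oneP a p] by (simp only: lact_oneP[OF a])
  show "forms_MP K M NM iota P N \<subseteq> im"
    unfolding forms_MP_def by (rule kspan_least[OF im_submodule]) (use g in blast)
  have s: "{forms_ract K P N (forms_incl K P N iota \<alpha>) p | \<alpha> p. \<alpha> \<in> carrier FM \<and> p \<in> carrier P} \<subseteq> carrier FP"
    using g submodule_subset[OF mFP im_submodule] by blast
  show "im \<subseteq> forms_MP K M NM iota P N"
    unfolding forms_MP_def
  proof (rule im_least[OF kspan_submodule[OF mFP s] kspan_incl])
    fix \<omega> h assume w: "\<omega> \<in> univ_calc K M" and h: "h \<in> carrier H"
    have a: "piM \<omega> \<in> carrier FM" using w by (simp add: carrier_FM)
    show "piP (psi \<omega> h) \<in> {forms_ract K P N (forms_incl K P N iota \<alpha>) p | \<alpha> p. \<alpha> \<in> carrier FM \<and> p \<in> carrier P}"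
      unfolding be_piM[OF w h, symmetric] using a tP[OF oneM h] by blast
  qed
qed

lemma forms_PM_im: "forms_PM K M NM iota P N = im"
proof
  have g: "forms_lact K P N p (forms_incl K P N iota \<alpha>) \<in> im" if a: "\<alpha> \<in> carrier FM" and p: "p \<in> carrier P" for \<alpha> p
    using PMP_gen[OF p a oneP] by (simp only: ract_oneP[OF a p])
  show "forms_PM K M NM iota P N \<subseteq> im"
    unfolding forms_PM_def by (rule kspan_least[OF im_submodule]) (use g in blast)
  have s: "{forms_lact K P N p (forms_incl K P N iota \<alpha>) | p \<alpha>. p \<in> carrier P \<and> \<alpha> \<in> carrier FM} \<subseteq> carrier FP"
    using g submodule_subset[OF mFP im_submodule] by blast
  show "im \<subseteq> forms_PM K M NM iota P N"
    unfolding forms_PM_def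
  proof (rule im_least[OF kspan_submodule[OF mFP s] kspan_incl])
    fix \<omega> h assume w: "\<omega> \<in> univ_calc K M" and h: "h \<in> carrier H"
    have a: "piM \<omega> \<in> carrier FM" using w by (simp add: carrier_FM)
    have w': "\<omega> \<in> carrier MM" using w M.univ_subset by blast
    \<comment> \<open>The elements \<open>1 \<otimes> h\<close> and \<open>h \<otimes> 1\<close>
      have the same product, so \<open>\<omega> h = h \<omega>\<close> in the quotient, and a right
      multiple of a base form is also a left multiple.\<close>
    have "piP (psi \<omega> h) = piP (sh (tens K MM HH \<omega> (tens K H H h \<one>\<^bsub>H\<^esub>)))"
      by (rule piP_merge[OF w]) (simp_all add: tHH oneH h mu_tens)
    also have "\<dots> = forms_lact K P N (tens K M H \<one>\<^bsub>M\<^esub> h) (forms_incl K P N iota (piM \<omega>))"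
      unfolding forms_incl_piM[OF w] forms_lact_piP[OF psi_univ[OF w oneH] tP[OF oneM h]]
      by (simp add: lact_sh oneM h w' tHH oneH lact_one[OF M.alg] lact_tens[OF alg])
    finally show "piP (psi \<omega> h) \<in> {forms_lact K P N p (forms_incl K P N iota \<alpha>) | p \<alpha>. p \<in> carrier P \<and> \<alpha> \<in> carrier FM}"
      using a tP[OF oneM h] by blast
  qed
qed

text \<open>The coaction on \<open>\<Omega>\<^sup>1(P)\<close> written without \<open>THE\<close>
  and without a choice of representative. Inserting \<open>univ_proj\<close>, which is the identity
  on universal forms, makes the formula linear on all of \<open>P \<otimes> P\<close>.\<close>

private abbreviation cP where "cP x \<equiv> tmap K FP H (\<lambda>x. piP (univ_proj K P x)) (\<lambda>h. h) (RP x)"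

lemma lin_map_proj_univ: "lin_map K PP FP (\<lambda>x. piP (univ_proj K P x))"
  by (rule lin_map_comp[OF lin_map_piP], unfold univ_forms_def, rule lin_map_restrict_cod[OF P.lin_map_univ_proj P.univ_proj_univ])

lemma lin_map_proj_univ_tensor: "lin_map K (tensor K PP H) (tensor K FP H) (tmap K FP H (\<lambda>x. piP (univ_proj K P x)) (\<lambda>h. h))"
  by (rule lin_map_tmap[OF lin_map_ident lin_map_proj_univ lin_map_ident P.tmod mod mFP mod])

lemma lin_map_cP: "lin_map K UP (tensor K FP H) cP"
  by (rule lin_map_UP_dom[OF lin_map_comp[OF lin_map_proj_univ_tensor lin_map_RP]])

lemma cP_N: "n \<in> N \<Longrightarrow> cP n = \<zero>\<^bsub>tensor K FP H\<^esub>"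
proof -
  assume n: "n \<in> N"
  interpret T: module K "tensor K FP H" by (rule mFPH)
  have z: "submodule {\<zero>\<^bsub>tensor K FP H\<^esub>} K (tensor K FP H)" by (rule submoduleI'[OF mFPH]) auto
  have "cP n \<in> {\<zero>\<^bsub>tensor K FP H\<^esub>}"
  proof (rule lin_map_tsub[OF NP_coact[OF NM Q n] lin_map_proj_univ_tensor P.tmod mod mFPH z NP_subset[OF NM Q] subset_refl])
    fix a b assume a: "a \<in> N" and b: "b \<in> carrier H"
    have a': "a \<in> univ_calc K P" "a \<in> carrier PP" using a NP_univ[OF NM Q] NP_subset[OF NM Q] by auto
    have "piP a = \<zero>\<^bsub>FP\<^esub>" unfolding forms_def using quotient.proj_zero_iff[OF quot_UP, of a] a a' by (simp add: univ_forms_sel)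
    then show "tmap K FP H (\<lambda>x. piP (univ_proj K P x)) (\<lambda>h. h) (tens K PP H a b) \<in> {\<zero>\<^bsub>tensor K FP H\<^esub>}"
      by (simp add: tmap_tens[OF lin_map_proj_univ lin_map_ident P.tmod mod mFP mod a'(2) b] P.univ_proj_ident[OF a'(1)] tens_zero_left[OF mFP mod b])
  qed
  then show ?thesis by simp
qed

text \<open>For a universal form \<open>y\<close> the value \<open>RP y\<close> already lies in the
  span of \<open>\<Omega>\<^sup>1P \<otimes> H\<close>, so applying \<open>univ_proj\<close> to its
  first factor gives the lift that \<open>sub_coact\<close> asks for. By \<open>cP_N\<close> the
  result does not depend on the representative picked in \<open>quot_coact\<close>.\<close>

lemma forms_coact_piP:
  assumes x: "x \<in> univ_calc K P"
  shows "forms_coact K H P N DR (piP x) = cP x"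
proof -
  have xU: "x \<in> carrier UP" using x by (simp add: univ_forms_sel)
  obtain n where n: "n \<in> N" "(SOME y. y \<in> piP x) = n \<oplus>\<^bsub>UP\<^esub> x" by (rule quotient.some_coset[OF quot_UP xU])
  define y where "y = (SOME y. y \<in> piP x)"
  interpret UP: module K UP by (rule mUP)
  have "n \<in> carrier UP" using n(1) quotient.N_subset[OF quot_UP] by blast
  then have yU: "y \<in> carrier UP" unfolding y_def n(2) using xU by (rule UP.a_closed)
  then have y: "y \<in> univ_calc K P" by (simp add: univ_forms_sel)
  have yP: "y \<in> carrier PP" using y P.univ_subset by blast
  let ?U = "PP\<lparr>carrier := univ_calc K P\<rparr>"
  have mU: "module K ?U" by (rule module_sub[OF P.tmod P.univ_submodule])
  have lU: "lin_map K PP ?U (univ_proj K P)" by (rule lin_map_restrict_cod[OF P.lin_map_univ_proj P.univ_proj_univ])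
  have i: "lin_map K ?U PP (\<lambda>v. v)" by (rule lin_map_restrict_dom[OF P.univ_subset lin_map_ident])
  note Ry = lin_map_closed[OF lin_map_RP yP]
  have "tmap K PP H (\<lambda>v. v) (\<lambda>h. h) (tmap K ?U H (univ_proj K P) (\<lambda>h. h) (RP y)) = tmap K PP H (\<lambda>v. univ_proj K P v) (\<lambda>h. h) (RP y)"
    by (rule tmap_tmap[OF Ry lU lin_map_ident i lin_map_ident P.tmod mod mU mod P.tmod mod])
  also have "\<dots> = RP y"
    by (rule lin_map_tsub_eq[OF tensor_coact_univ[OF P.alg free_coact_alg_hom[OF M.alg] y]
          lin_map_tmap[OF lin_map_ident P.lin_map_univ_proj lin_map_ident P.tmod mod P.tmod mod] lin_map_ident P.tmod mod mPPH P.univ_subset subset_refl])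
      (use P.univ_subset in \<open>auto simp: tmap_tens[OF P.lin_map_univ_proj lin_map_ident P.tmod mod P.tmod mod] P.univ_proj_ident subset_iff\<close>)
  finally have s: "sub_coact K H PP RP (univ_calc K P) y = tmap K ?U H (univ_proj K P) (\<lambda>h. h) (RP y)"
    by (intro sub_coact_eqI[OF P.tmod P.univ_submodule] tmap_closed[OF Ry lU lin_map_ident P.tmod mod mU mod])
  have lpi: "lin_map K ?U FP piP" using lin_map_piP by (simp add: univ_forms_def)
  have "forms_coact K H P N DR (piP x) = tmap K FP H piP (\<lambda>h. h) (tmap K ?U H (univ_proj K P) (\<lambda>h. h) (RP y))"
    unfolding forms_coact_def quot_coact_def y_def[symmetric] s by (simp only: forms_def)
  also have "\<dots> = cP y"
    by (rule tmap_tmap[OF Ry lU lin_map_ident lpi lin_map_ident P.tmod mod mU mod mFP mod])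
  also have "\<dots> = cP x" unfolding y_def by (rule quotient.some_lift[OF quot_UP mFPH lin_map_cP cP_N xU])
  finally show ?thesis .
qed

lemma lin_map_forms_coact: "lin_map K FP (tensor K FP H) (forms_coact K H P N DR)"
proof -
  have "lin_map K FP (tensor K FP H) (\<lambda>X. cP (SOME x. x \<in> X))"
    by (rule lin_map_FP_lift[OF mFPH lin_map_cP cP_N])
  then show ?thesis
  proof (rule lin_map_cong[OF mFP])
    fix X assume "X \<in> carrier FP"
    then obtain x where x: "X = piP x" "x \<in> univ_calc K P" by (auto simp: carrier_FP)
    show "cP (SOME x. x \<in> X) = forms_coact K H P N DR X"
      unfolding x(1) forms_coact_piP[OF x(2)]
      by (rule quotient.some_lift[OF quot_UP mFPH lin_map_cP cP_N]) (simp_all add: univ_forms_sel x(2))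
  qed
qed

lemma rho_one: "h \<in> carrier H \<Longrightarrow> rho (tens K H H \<one>\<^bsub>H\<^esub> h) = tlift (tensor K HH H) (\<lambda>c d. tens K HH H (tens K H H \<one>\<^bsub>H\<^esub> c) d) (comult H h)"
proof -
  assume h: "h \<in> carrier H"
  note ch = comult_closed[OF h]
  have "rho (tens K H H \<one>\<^bsub>H\<^esub> h) = tlift (tensor K HH H) (\<lambda>c d. tens K HH H (tens K H H \<one>\<^bsub>H\<^esub> c) (\<one>\<^bsub>H\<^esub> \<otimes>\<^bsub>H\<^esub> d)) (comult H h)"
    unfolding tensor_coact_tens[OF mod mod lin_map_comult lin_map_comult oneH h] comult_one
    by (rule tlift_tens[OF mod mod module_HHH bilin_coact2[OF mod mod lin_map_comult lin_map_comult ch] oneH oneH])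
  also have "\<dots> = tlift (tensor K HH H) (\<lambda>c d. tens K HH H (tens K H H \<one>\<^bsub>H\<^esub> c) d) (comult H h)"
    by (rule sw_cong[OF h module_HHH bilin_coact1[OF mod mod lin_map_comult lin_map_comult oneH oneH]]) simp
  finally show ?thesis .
qed

text \<open>Since the base is coinvariant, both sides send \<open>[\<omega>] \<otimes> h\<close> to
  \<open>[\<omega> h\<^sub>1] \<otimes> h\<^sub>2\<close>.\<close>

lemma forms_coact_ff:
  assumes X: "X \<in> carrier (tensor K FM H)"
  shows "forms_coact K H P N DR (ff X) = tmap K FP H ff (\<lambda>h. h) (free_coact K H FM X)"
proof -
  have lt: "lin_map K (tensor K (tensor K FM H) H) (tensor K FP H) (tmap K FP H ff (\<lambda>h. h))"
    by (rule lin_map_tmap[OF lin_map_ident lin_map_ff lin_map_ident mFH mod mFP mod])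
  show ?thesis
  proof (rule tensor_eqI[OF lin_map_comp[OF lin_map_forms_coact lin_map_ff] lin_map_comp[OF lt lin_map_free_coact[OF mFM]] mFM mod mFPH _ X])
    fix \<alpha> h assume a: "\<alpha> \<in> carrier FM" and h: "h \<in> carrier H"
    then obtain \<omega> where w: "\<alpha> = piM \<omega>" "\<omega> \<in> univ_calc K M" by (auto simp: carrier_FM)
    have w': "\<omega> \<in> carrier MM" using w(2) M.univ_subset by blast
    let ?t1 = "tmap K FP H (\<lambda>x. piP (univ_proj K P x)) (\<lambda>h. h)"
    let ?t2 = "tmap K PP H (\<lambda>z. sh (tens K MM HH \<omega> z)) (\<lambda>h. h)"
    note l12 = lin_map_comp[OF lin_map_proj_univ_tensor lin_map_tmap_sh[OF w']]
    let ?b = "\<lambda>c d. tens K HH H (tens K H H \<one>\<^bsub>H\<^esub> c) d"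
    have b: "bilin K H H (tensor K HH H) ?b" by (rule bilin_tens3[OF mod oneH])
    have b1: "bilin K H H (tensor K FP H) (\<lambda>c d. ?t1 (?t2 (?b c d)))"
      by (rule bilin_comp[OF l12 b])
    have "forms_coact K H P N DR (ff (tens K FM H \<alpha> h)) = ?t1 (?t2 (rho (tens K H H \<one>\<^bsub>H\<^esub> h)))"
      unfolding w(1) ff_tens[OF w(2) h] forms_coact_piP[OF psi_univ[OF w(2) h]] coact_sh[OF w' tHH[OF oneH h]] ..
    also have "\<dots> = tlift (tensor K FP H) (\<lambda>c d. ?t1 (?t2 (?b c d))) (comult H h)"
      unfolding rho_one[OF h] by (rule sw_apply[OF l12 h module_HHH mFPH b])
    also have "\<dots> = tlift (tensor K FP H) (\<lambda>c d. tens K FP H (piP (psi \<omega> c)) d) (comult H h)"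
    proof (rule sw_cong[OF h mFPH b1])
      fix c d assume c: "c \<in> carrier H" and d: "d \<in> carrier H"
      note u = psi_univ[OF w(2) c]
      have uP: "psi \<omega> c \<in> carrier PP" using u P.univ_subset by blast
      show "?t1 (?t2 (?b c d)) = tens K FP H (piP (psi \<omega> c)) d"
        unfolding tmap_tens[OF lin_map_sh_left[OF w'] lin_map_ident tmod mod P.tmod mod tHH[OF oneH c] d]
          tmap_tens[OF lin_map_proj_univ lin_map_ident P.tmod mod mFP mod uP d] P.univ_proj_ident[OF u] ..
    qed
    finally have L: "forms_coact K H P N DR (ff (tens K FM H \<alpha> h)) = \<dots>" .
    note b3 = bilin_tens3[OF mFM a]
    have b4: "bilin K H H (tensor K FP H) (\<lambda>c d. tmap K FP H ff (\<lambda>h. h) (tens K (tensor K FM H) H (tens K FM H \<alpha> c) d))"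
      by (rule bilin_comp[OF lt b3])
    have "tmap K FP H ff (\<lambda>h. h) (free_coact K H FM (tens K FM H \<alpha> h)) =
       tlift (tensor K FP H) (\<lambda>c d. tmap K FP H ff (\<lambda>h. h) (tens K (tensor K FM H) H (tens K FM H \<alpha> c) d)) (comult H h)"
      unfolding free_coact_tens[OF mFM a h] by (rule sw_apply[OF lt h module_tensor[OF mFH mod] mFPH b3])
    also have "\<dots> = tlift (tensor K FP H) (\<lambda>c d. tens K FP H (piP (psi \<omega> c)) d) (comult H h)"
    proof (rule sw_cong[OF h mFPH b4])
      fix c d assume c: "c \<in> carrier H" and d: "d \<in> carrier H"
      show "tmap K FP H ff (\<lambda>h. h) (tens K (tensor K FM H) H (tens K FM H \<alpha> c) d) = tens K FP H (piP (psi \<omega> c)) d"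
        unfolding tmap_tens[OF lin_map_ff lin_map_ident mFH mod mFP mod tens_closed[OF mFM mod a c] d]
        unfolding w(1) ff_tens[OF w(2) c] ..
    qed
    finally show "forms_coact K H P N DR (ff (tens K FM H \<alpha> h)) = tmap K FP H ff (\<lambda>h. h) (free_coact K H FM (tens K FM H \<alpha> h))"
      using L by simp
  qed
qed

lemma horizontal_forms_iso:
  "comodule_iso K H (tensor K FM H) (free_coact K H FM) (FP\<lparr>carrier := forms_MP K M NM iota P N\<rparr>)
     (sub_coact K H FP (forms_coact K H P N DR) (forms_MP K M NM iota P N)) ff"
  unfolding forms_MP_im
proof -
  let ?W = "FP\<lparr>carrier := im\<rparr>" let ?s = "sub_coact K H FP (forms_coact K H P N DR) im"
  have W: "module K ?W" by (rule module_sub[OF mFP im_submodule])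
  have f: "lin_map K (tensor K FM H) ?W ff" by (rule lin_map_restrict_cod[OF lin_map_ff]) simp
  have bij: "bij_betw ff (carrier (tensor K FM H)) (carrier ?W)" using ff_inj by (simp add: bij_betw_def)
  have i: "lin_map K ?W FP (\<lambda>v. v)"
    by (rule lin_map_restrict_dom[OF submodule_subset[OF mFP im_submodule] lin_map_ident])
  \<comment> \<open>The candidate has values in \<open>im \<otimes> H\<close> by construction, and
    its image in \<open>\<Omega>\<^sup>1(P) \<otimes> H\<close> is the coaction by
    \<open>forms_coact_ff\<close>; hence it is the value of \<open>sub_coact\<close>.\<close>
  have e: "?s (ff v) = tmap K ?W H ff (\<lambda>h. h) (free_coact K H FM v)" if v: "v \<in> carrier (tensor K FM H)" for v
  proof (rule sub_coact_eqI[OF mFP im_submodule])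
    note fv = lin_map_closed[OF lin_map_free_coact[OF mFM] v]
    show "tmap K ?W H ff (\<lambda>h. h) (free_coact K H FM v) \<in> carrier (tensor K ?W H)"
      by (rule tmap_closed[OF fv f lin_map_ident mFH mod W mod])
    have "tmap K FP H (\<lambda>v. v) (\<lambda>h. h) (tmap K ?W H ff (\<lambda>h. h) (free_coact K H FM v)) = tmap K FP H (\<lambda>v. ff v) (\<lambda>h. h) (free_coact K H FM v)"
      by (rule tmap_tmap[OF fv f lin_map_ident i lin_map_ident mFH mod W mod mFP mod])
    then show "tmap K FP H (\<lambda>v. v) (\<lambda>h. h) (tmap K ?W H ff (\<lambda>h. h) (free_coact K H FM v)) = forms_coact K H P N DR (ff v)"
      by (simp only: forms_coact_ff[OF v])
  qed
  show "comodule_iso K H (tensor K FM H) (free_coact K H FM) ?W ?s ff"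
    unfolding comodule_iso_def
    using free_comodule[OF mFM] comodule_transport[OF free_comodule[OF mFM] W f bij e] f bij e by blast
qed

end

end

theorem proposition3p1:
  fixes K :: "'k ring"
    and M :: "('k, 'm) module" and N\<^sub>M :: "('m, 'm) tens set"
    and H :: "('k, 'h) hopf_alg" and Q\<^sub>H :: "'h set"
  defines "P \<equiv> tensor K M H"
    and "\<Delta>\<^sub>R \<equiv> free_coact K H M"
    and "\<iota> \<equiv> (\<lambda>m. tens K M H m \<one>\<^bsub>H\<^esub>)"
    and "N\<^sub>P \<equiv> product_N K M N\<^sub>M H (bicov_N K H Q\<^sub>H)"
  assumes "field K"
    and "k_algebra K M" and "diff_calculus K M N\<^sub>M"
    and "hopf_algebra K H" and "bicovariant K H Q\<^sub>H"
  shows "qpb_nonuniversal TYPE('x \<times> 'y) K M N\<^sub>M \<iota> P N\<^sub>P H Q\<^sub>H \<Delta>\<^sub>R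
    \<and> forms_MP K M N\<^sub>M \<iota> P N\<^sub>P = forms_PMP K M N\<^sub>M \<iota> P N\<^sub>P
    \<and> forms_PMP K M N\<^sub>M \<iota> P N\<^sub>P = forms_PM K M N\<^sub>M \<iota> P N\<^sub>P
    \<and> comodule_iso K H
        (tensor K (forms K M N\<^sub>M) H) (free_coact K H (forms K M N\<^sub>M))
        ((forms K P N\<^sub>P)\<lparr>carrier := forms_MP K M N\<^sub>M \<iota> P N\<^sub>P\<rparr>)
        (sub_coact K H (forms K P N\<^sub>P) (forms_coact K H P N\<^sub>P \<Delta>\<^sub>R) (forms_MP K M N\<^sub>M \<iota> P N\<^sub>P))
        (tlift (forms K P N\<^sub>P)
          (\<lambda>\<alpha> h. forms_ract K P N\<^sub>P (forms_incl K P N\<^sub>P \<iota> \<alpha>) (tens K M H \<one>\<^bsub>M\<^esub> h)))"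
proof -
  interpret trivial_bundle K H M
    using assms(6,8) by (simp add: trivial_bundle_def)
  note calc = assms(7,9)
  show ?thesis
    unfolding P_def \<Delta>\<^sub>R_def \<iota>_def N\<^sub>P_def
    using qpb_nonuniversal_trivial[OF calc] horizontal_forms_iso[OF calc]
      forms_MP_im[OF calc] forms_PMP_im[OF calc] forms_PM_im[OF calc]
    by simp
qed

end
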